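(* Let $A_1,\dots,A_m\subset\mathbb R^q$ be Borel sets such that for every $k$, $p_{A_k}:=\mathbb P(\mathbf Z\in A_k)>0$ and Condition (C) holds for $A=A_k$; assume Condition (W) holds. Then for every $M\ge2$, as $n\to\infty$, the process $$\vec{\mathcal C}^*_{n,M,\mathcal A}(\vec{\mathbf u}_0,\dots,\vec{\mathbf u}_M):=\big(\vec{\mathbb C}_n(\vec{\mathbf u}_0|\mathcal A),\vec{\mathbb C}^*_{n,1}(\vec{\mathbf u}_1|\mathcal A),\dots,\vec{\mathbb C}^*_{n,M}(\vec{\mathbf u}_M|\mathcal A)\big)$$ converges weakly in $\ell^\infty([0,1]^{mp(M+1)},\mathbb R^{m(M+1)})$ to a process that concatenates $M+1$ independent copies of $\vec{\mathbb C}_\infty(\cdot|\mathcal A)$.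
   Context: Let $(\mathbf X,\mathbf Z)$ be a random vector in $\mathbb R^p\times\mathbb R^q$ with i.i.d. copies $(\mathbf X_i,\mathbf Z_i)_{i\le n}$; $\mathcal A:=\{A_1,\dots,A_m\}$; vector inequalities componentwise. For Borel $A$ with $p_A>0$: conditional margins $F_k(t|A):=\mathbb P(X_k\le t\mid\mathbf Z\in A)$ are continuous (standing assumption); $C(\cdot|A)$ is the conditional copula of $\mathbf X$ given $\mathbf Z\in A$; $\mathbf U^A:=(F_1(X_1|A),\dots,F_p(X_p|A))$; $D(\mathbf u,A):=\mathbb P(\mathbf U^A\le\mathbf u,\mathbf Z\in A)$; $\hat p_A:=n^{-1}\sum_i\mathbf 1(\mathbf Z_i\in A)$; $F_{n,k}(t|A):=\frac1{n\hat p_A}\sum_i\mathbf 1(X_{i,k}\le t,\mathbf Z_i\in A)$; $F^{-1}(u):=\inf\{t:F(t)\ge u\}$; $\overline D_n(\mathbf u,A):=n^{-1}\sum_i\mathbf 1(X_{i,k}\le F^{-1}_{n,k}(u_k|A)\,\forall k,\mathbf Z_i\in A)$; $\overline{\mathbb C}_n(\mathbf u|A):=\sqrt n(\overline D_n(\mathbf u,A)/\hat p_A-C(\mathbf u|A))$. Condition (C) for $A$: for each $k$, $\partial_kD(\mathbf u,A)$ (w.r.t. $u_k$) exists and is continuous on $\{\mathbf u:0<u_k<1\}$. Bootstrap: $\mathbf W_n$ exchangeable nonnegative, independent of the sample, $\overline W_n$ its average; Condition (W): $\sup_n\int_0^\infty\sqrt{\mathbb P(|W_{n,1}-\overline W_n|>t)}dt<\infty$,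 $n^{-1/2}\mathbb E[\max_i|W_{n,i}-\overline W_n|]\to0$ and $n^{-1}\sum_i(W_{n,i}-\overline W_n)^2\to1$ in probability. $\mathbb D^*_n(\mathbf u,A):=n^{-1/2}\sum_iW_{n,i}\mathbf 1(X_{i,k}\le F^{-1}_{n,k}(u_k|A)\,\forall k,\mathbf Z_i\in A)-\sqrt n\overline W_n\overline D_n(\mathbf u,A)$; $\widehat{\partial_kD}(\mathbf u,A):=\big(\overline D_n(\mathbf u_{-k},u^+_{k,n},A)-\overline D_n(\mathbf u_{-k},u^-_{k,n},A)\big)/(u^+_{k,n}-u^-_{k,n})$ with $u^+_{k,n}=\min(u_k+n^{-1/2},1)$, $u^-_{k,n}=\max(u_k-n^{-1/2},0)$; $\widetilde{\mathbb D}^*_n(\mathbf u,A):=\mathbb D^*_n(\mathbf u,A)-\hat p_A^{-1}\sum_k\widehat{\partial_kD}(\mathbf u,A)(\mathbb D^*_n((u_k,\mathbf 1_{-k}),A)-u_k\mathbb D^*_n(\mathbf 1,A))$, where $(u_k,\mathbf 1_{-k})$ has $k$-th coordinate $u_k$ and others $1$; $\widetilde{\mathbb C}^*_n(\mathbf u|A):=\widetilde{\mathbb D}^*_n(\mathbf u,A)/\hat p_A-\overline D_n(\mathbf u,A)\widetilde{\mathbb D}^*_n(\mathbf 1,A)/\hat p_A^2$. For $\vec{\mathbf u}=(\mathbf u_1,\dots,\mathbf u_m)\in[0,1]^{mp}$: $\vec{\mathbb C}_n(\vec{\mathbf u}|\mathcal A):=(\overline{\mathbb C}_n(\mathbf u_1|A_1),\dots,\overline{\mathbb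 C}_n(\mathbf u_m|A_m))$ and $\vec{\mathbb C}^*_{n,j}(\vec{\mathbf u}|\mathcal A):=(\widetilde{\mathbb C}^*_{n}(\mathbf u_1|A_1),\dots,\widetilde{\mathbb C}^*_{n}(\mathbf u_m|A_m))$ computed with the $j$-th of $M$ mutually independent realizations of $\mathbf W_n$ (independent of the sample). The limit: $\vec{\mathbb C}_\infty(\vec{\mathbf u}|\mathcal A):=(\mathbb C_\infty(\mathbf u_1|A_1),\dots,\mathbb C_\infty(\mathbf u_m|A_m))$ with $\mathbb C_\infty(\mathbf u|A_j):=\frac{\mathbb B(\mathbf u,A_j)}{p_{A_j}}-\sum_{i=1}^p\frac{\partial_iD(\mathbf u,A_j)}{p_{A_j}^2}\big(\mathbb B((u_i,\mathbf 1_{-i}),A_j)-u_i\mathbb B(\mathbf 1,A_j)\big)-\frac{D(\mathbf u,A_j)}{p_{A_j}^2}\mathbb B(\mathbf 1,A_j)$, where $(\mathbb B(\cdot,A_1),\dots,\mathbb B(\cdot,A_m))$ is jointly centered Gaussian with $\mathbb E[\mathbb B(\mathbf u,A_j)\mathbb B(\mathbf v,A_k)]=\mathbb P(\mathbf U^{A_j}\le\mathbf u,\mathbf U^{A_k}\le\mathbf v,\mathbf Z\in A_j\cap A_k)-D(\mathbf u,A_j)D(\mathbf v,A_k)$. *)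

theory Defs
  imports "HOL-Probability.Probability"
begin

definition pA :: "'a measure \<Rightarrow> ('a \<Rightarrow> 'z) \<Rightarrow> 'z set \<Rightarrow> real" where
  "pA M Z A = measure M {\<omega> \<in> space M. Z \<omega> \<in> A}"

definition condF :: "'a measure \<Rightarrow> ('a \<Rightarrow> real^'p) \<Rightarrow> ('a \<Rightarrow> 'z) \<Rightarrow> 'p \<Rightarrow> real \<Rightarrow> 'z set \<Rightarrow> real" where
  "condF M X Z k t A = measure M {\<omega> \<in> space M. X \<omega> $ k \<le> t \<and> Z \<omega> \<in> A} / pA M Z A"

definition UA :: "'a measure \<Rightarrow> ('a \<Rightarrow> real^'p) \<Rightarrow> ('a \<Rightarrow> 'z) \<Rightarrow> 'z set \<Rightarrow> 'a \<Rightarrow> real^'p" where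
  "UA M X Z A \<omega> = (\<chi> k. condF M X Z k (X \<omega> $ k) A)"

definition Dfun :: "'a measure \<Rightarrow> ('a \<Rightarrow> real^'p) \<Rightarrow> ('a \<Rightarrow> 'z) \<Rightarrow> real^'p \<Rightarrow> 'z set \<Rightarrow> real" where
  "Dfun M X Z u A = measure M {\<omega> \<in> space M. (\<forall>k. UA M X Z A \<omega> $ k \<le> u $ k) \<and> Z \<omega> \<in> A}"

text \<open>conditional copula C(u|A): the joint distribution function of U^A given Z in A
  (the copula of X given Z in A, margins being continuous)\<close>
definition copulaC :: "'a measure \<Rightarrow> ('a \<Rightarrow> real^'p) \<Rightarrow> ('a \<Rightarrow> 'z) \<Rightarrow> real^'p \<Rightarrow> 'z set \<Rightarrow> real" where
  "copulaC M X Z u A = Dfun M X Z u A / pA M Z A"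

definition upd :: "real^'p \<Rightarrow> 'p \<Rightarrow> real \<Rightarrow> real^'p" where
  "upd u k s = (\<chi> l. if l = k then s else u $ l)"

definition onek :: "real^'p \<Rightarrow> 'p \<Rightarrow> real^'p" where
  "onek u k = (\<chi> l. if l = k then u $ k else 1)"

definition ones :: "real^'p" where
  "ones = (\<chi> l. 1)"

definition dD :: "'a measure \<Rightarrow> ('a \<Rightarrow> real^'p) \<Rightarrow> ('a \<Rightarrow> 'z) \<Rightarrow> real^'p \<Rightarrow> 'z set \<Rightarrow> 'p \<Rightarrow> real" where
  "dD M X Z u A k = deriv (\<lambda>s. Dfun M X Z (upd u k s) A) (u $ k)"

definition condC :: "'a measure \<Rightarrow> ('a \<Rightarrow> real^'p) \<Rightarrow> ('a \<Rightarrow> 'z) \<Rightarrow> 'z set \<Rightarrow> bool" where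
  "condC M X Z A \<longleftrightarrow> (\<forall>k.
     (\<forall>u\<in>cbox 0 1. 0 < u $ k \<and> u $ k < 1 \<longrightarrow>
        (\<lambda>s. Dfun M X Z (upd u k s) A) differentiable (at (u $ k))) \<and>
     continuous_on {u \<in> cbox 0 1. 0 < u $ k \<and> u $ k < 1} (\<lambda>u. dD M X Z u A k))"

text \<open>covariance of the limiting Brownian-bridge type process B\<close>
definition covB :: "'a measure \<Rightarrow> ('a \<Rightarrow> real^'p) \<Rightarrow> ('a \<Rightarrow> 'z) \<Rightarrow> 'z set \<Rightarrow> real^'p \<Rightarrow> 'z set \<Rightarrow> real^'p \<Rightarrow> real" where
  "covB M X Z A u A' v =
     measure M {\<omega> \<in> space M. (\<forall>k. UA M X Z A \<omega> $ k \<le> u $ k) \<and> (\<forall>k. UA M X Z A' \<omega> $ k \<le> v $ k)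
                                \<and> Z \<omega> \<in> A \<inter> A'} - Dfun M X Z u A * Dfun M X Z v A'"

text \<open>C_infinity(u|A) as a functional of a path B(.,A)\<close>
definition Cinf :: "'a measure \<Rightarrow> ('a \<Rightarrow> real^'p) \<Rightarrow> ('a \<Rightarrow> 'z) \<Rightarrow> (real^'p \<Rightarrow> real) \<Rightarrow> real^'p \<Rightarrow> 'z set \<Rightarrow> real" where
  "Cinf M X Z B u A =
     B u / pA M Z A
     - (\<Sum>i\<in>UNIV. dD M X Z u A i / (pA M Z A)\<^sup>2 * (B (onek u i) - u $ i * B ones))
     - Dfun M X Z u A / (pA M Z A)\<^sup>2 * B ones"

section \<open>Empirical quantities (for realized sample values xs i, zs i, i < n)\<close>

definition phat :: "nat \<Rightarrow> (nat \<Rightarrow> 'z) \<Rightarrow> 'z set \<Rightarrow> real" where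
  "phat n zs A = (\<Sum>i<n. indicator A (zs i)) / real n"

definition Fn :: "nat \<Rightarrow> (nat \<Rightarrow> real^'p) \<Rightarrow> (nat \<Rightarrow> 'z) \<Rightarrow> 'p \<Rightarrow> 'z set \<Rightarrow> real \<Rightarrow> real" where
  "Fn n xs zs k A t = (\<Sum>i<n. if xs i $ k \<le> t \<and> zs i \<in> A then 1 else 0) / (real n * phat n zs A)"

definition qinv :: "(real \<Rightarrow> real) \<Rightarrow> real \<Rightarrow> ereal" where
  "qinv F u = Inf {ereal t | t. u \<le> F t}"

definition sel :: "nat \<Rightarrow> (nat \<Rightarrow> real^'p) \<Rightarrow> (nat \<Rightarrow> 'z) \<Rightarrow> real^'p \<Rightarrow> 'z set \<Rightarrow> nat \<Rightarrow> bool" where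
  "sel n xs zs u A i \<longleftrightarrow> (\<forall>k. ereal (xs i $ k) \<le> qinv (Fn n xs zs k A) (u $ k)) \<and> zs i \<in> A"

definition Dbar :: "nat \<Rightarrow> (nat \<Rightarrow> real^'p) \<Rightarrow> (nat \<Rightarrow> 'z) \<Rightarrow> real^'p \<Rightarrow> 'z set \<Rightarrow> real" where
  "Dbar n xs zs u A = (\<Sum>i<n. if sel n xs zs u A i then 1 else 0) / real n"

definition Cbar :: "'a measure \<Rightarrow> ('a \<Rightarrow> real^'p) \<Rightarrow> ('a \<Rightarrow> 'z) \<Rightarrow> nat \<Rightarrow> (nat \<Rightarrow> real^'p) \<Rightarrow> (nat \<Rightarrow> 'z) \<Rightarrow> real^'p \<Rightarrow> 'z set \<Rightarrow> real" where
  "Cbar M X Z n xs zs u A = sqrt (real n) * (Dbar n xs zs u A / phat n zs A - copulaC M X Z u A)"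

definition wbar :: "nat \<Rightarrow> (nat \<Rightarrow> real) \<Rightarrow> real" where
  "wbar n w = (\<Sum>i<n. w i) / real n"

definition Dstar :: "nat \<Rightarrow> (nat \<Rightarrow> real^'p) \<Rightarrow> (nat \<Rightarrow> 'z) \<Rightarrow> (nat \<Rightarrow> real) \<Rightarrow> real^'p \<Rightarrow> 'z set \<Rightarrow> real" where
  "Dstar n xs zs w u A =
     (\<Sum>i<n. w i * (if sel n xs zs u A i then 1 else 0)) / sqrt (real n)
     - sqrt (real n) * wbar n w * Dbar n xs zs u A"

definition dhat :: "nat \<Rightarrow> (nat \<Rightarrow> real^'p) \<Rightarrow> (nat \<Rightarrow> 'z) \<Rightarrow> real^'p \<Rightarrow> 'z set \<Rightarrow> 'p \<Rightarrow> real" where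
  "dhat n xs zs u A k =
     (let up = min (u $ k + 1 / sqrt (real n)) 1; um = max (u $ k - 1 / sqrt (real n)) 0 in
      (Dbar n xs zs (upd u k up) A - Dbar n xs zs (upd u k um) A) / (up - um))"

definition Dtilde :: "nat \<Rightarrow> (nat \<Rightarrow> real^'p) \<Rightarrow> (nat \<Rightarrow> 'z) \<Rightarrow> (nat \<Rightarrow> real) \<Rightarrow> real^'p \<Rightarrow> 'z set \<Rightarrow> real" where
  "Dtilde n xs zs w u A =
     Dstar n xs zs w u A
     - (1 / phat n zs A) * (\<Sum>k\<in>UNIV. dhat n xs zs u A k *
          (Dstar n xs zs w (onek u k) A - u $ k * Dstar n xs zs w ones A))"

definition Ctilde :: "nat \<Rightarrow> (nat \<Rightarrow> real^'p) \<Rightarrow> (nat \<Rightarrow> 'z) \<Rightarrow> (nat \<Rightarrow> real) \<Rightarrow> real^'p \<Rightarrow> 'z set \<Rightarrow> real" where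
  "Ctilde n xs zs w u A =
     Dtilde n xs zs w u A / phat n zs A - Dbar n xs zs u A * Dtilde n xs zs w ones A / (phat n zs A)\<^sup>2"

text \<open>Wn n i \<omega> = W_{n,i} (i < n, 0-based)\<close>
definition condW :: "'a measure \<Rightarrow> (nat \<Rightarrow> nat \<Rightarrow> 'a \<Rightarrow> real) \<Rightarrow> bool" where
  "condW M Wn \<longleftrightarrow>
     (\<exists>B::real. \<forall>n\<ge>1.
        (\<integral>\<^sup>+ t. indicator {0..} t *
            ennreal (sqrt (measure M {\<omega> \<in> space M. \<bar>Wn n 0 \<omega> - wbar n (\<lambda>i. Wn n i \<omega>)\<bar> > t})) \<partial>lborel)
        \<le> ennreal B) \<and>
     (\<lambda>n. ennreal (1 / sqrt (real n)) *
            (\<integral>\<^sup>+ \<omega>. ennreal (Max ((\<lambda>i. \<bar>Wn n i \<omega> - wbar n (\<lambda>i. Wn n i \<omega>)\<bar>) ` {..<n})) \<partial>M))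
       \<longlonglongrightarrow> 0 \<and>
     (\<forall>e>0. (\<lambda>n. measure M {\<omega> \<in> space M.
          \<bar>(\<Sum>i<n. (Wn n i \<omega> - wbar n (\<lambda>i. Wn n i \<omega>))\<^sup>2) / real n - 1\<bar> > e}) \<longlonglongrightarrow> 0)"

definition exch_weights :: "'a measure \<Rightarrow> (nat \<Rightarrow> nat \<Rightarrow> 'a \<Rightarrow> real) \<Rightarrow> bool" where
  "exch_weights M Wn \<longleftrightarrow> (\<forall>n.
     (\<forall>i<n. \<forall>\<omega>\<in>space M. 0 \<le> Wn n i \<omega>) \<and>
     (\<forall>\<pi>. \<pi> permutes {..<n} \<longrightarrow>
        distr M (PiM {..<n} (\<lambda>_. borel)) (\<lambda>\<omega>. restrict (\<lambda>i. Wn n (\<pi> i) \<omega>) {..<n})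
        = distr M (PiM {..<n} (\<lambda>_. borel)) (\<lambda>\<omega>. restrict (\<lambda>i. Wn n i \<omega>) {..<n})))"

definition linf :: "'t set \<Rightarrow> 'i set \<Rightarrow> ('t \<Rightarrow> 'i \<Rightarrow> real) \<Rightarrow> bool" where
  "linf T I f \<longleftrightarrow> (\<exists>B. \<forall>t\<in>T. \<forall>c\<in>I. \<bar>f t c\<bar> \<le> B)"

definition ldist :: "'t set \<Rightarrow> 'i set \<Rightarrow> ('t \<Rightarrow> 'i \<Rightarrow> real) \<Rightarrow> ('t \<Rightarrow> 'i \<Rightarrow> real) \<Rightarrow> real" where
  "ldist T I f g = Sup {\<bar>f t c - g t c\<bar> | t c. t \<in> T \<and> c \<in> I}"

definition linf_open :: "'t set \<Rightarrow> 'i set \<Rightarrow> ('t \<Rightarrow> 'i \<Rightarrow> real) set \<Rightarrow> bool" where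
  "linf_open T I U \<longleftrightarrow> U \<subseteq> {f. linf T I f} \<and>
     (\<forall>f\<in>U. \<exists>r>0. \<forall>g. linf T I g \<and> ldist T I f g < r \<longrightarrow> g \<in> U)"

definition linf_bcont :: "'t set \<Rightarrow> 'i set \<Rightarrow> (('t \<Rightarrow> 'i \<Rightarrow> real) \<Rightarrow> real) \<Rightarrow> bool" where
  "linf_bcont T I h \<longleftrightarrow> (\<exists>B. \<forall>f. linf T I f \<longrightarrow> \<bar>h f\<bar> \<le> B) \<and>
     (\<forall>f. linf T I f \<longrightarrow> (\<forall>e>0. \<exists>d>0. \<forall>g. linf T I g \<and> ldist T I f g < d \<longrightarrow> \<bar>h g - h f\<bar> < e))"

definition outer_exp :: "'a measure \<Rightarrow> ('a \<Rightarrow> real) \<Rightarrow> real" where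
  "outer_exp M Y = Inf {integral\<^sup>L M g | g. g \<in> borel_measurable M \<and> integrable M g \<and>
                                             (\<forall>\<omega>\<in>space M. Y \<omega> \<le> g \<omega>)}"

text \<open>X_n (maps on M, possibly non-measurable) converge weakly in l^infinity(T,R^I) to
  the Borel measurable map G on N: E^* h(X_n) -> E h(G) for all bounded continuous h\<close>
definition weak_conv_linf :: "'t set \<Rightarrow> 'i set \<Rightarrow> 'a measure \<Rightarrow> (nat \<Rightarrow> 'a \<Rightarrow> 't \<Rightarrow> 'i \<Rightarrow> real)
     \<Rightarrow> 'b measure \<Rightarrow> ('b \<Rightarrow> 't \<Rightarrow> 'i \<Rightarrow> real) \<Rightarrow> bool" where
  "weak_conv_linf T I M Xs N G \<longleftrightarrow>
     (\<forall>n. \<forall>\<omega>\<in>space M. linf T I (Xs n \<omega>)) \<and>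
     (\<forall>\<omega>\<in>space N. linf T I (G \<omega>)) \<and>
     (\<forall>U. linf_open T I U \<longrightarrow> {\<omega> \<in> space N. G \<omega> \<in> U} \<in> sets N) \<and>
     (\<forall>h. linf_bcont T I h \<longrightarrow>
        (\<lambda>n. outer_exp M (\<lambda>\<omega>. h (Xs n \<omega>))) \<longlonglongrightarrow> integral\<^sup>L N (\<lambda>\<omega>. h (G \<omega>)))"

text \<open>Y is a centered Gaussian family with covariance K: every finite linear combination
  is (possibly degenerate) centered normal with the induced variance\<close>
definition gaussian_family :: "'b measure \<Rightarrow> 's set \<Rightarrow> ('s \<Rightarrow> 'b \<Rightarrow> real) \<Rightarrow> ('s \<Rightarrow> 's \<Rightarrow> real) \<Rightarrow> bool" where
  "gaussian_family N S Y K \<longleftrightarrow> (\<forall>F c. finite F \<and> F \<subseteq> S \<longrightarrow>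
     (\<lambda>\<omega>. \<Sum>s\<in>F. c s * Y s \<omega>) \<in> borel_measurable N \<and>
     (\<forall>\<theta>. char (distr N borel (\<lambda>\<omega>. \<Sum>s\<in>F. c s * Y s \<omega>)) \<theta> =
            complex_of_real (exp (- (\<theta>\<^sup>2 * (\<Sum>s\<in>F. \<Sum>s'\<in>F. c s * c s' * K s s')) / 2))))"

end

theory Submission imports Defs begin

text \<open>
  Write f_k(u) for the indicator of the event that U^{A_k} is at most u and Z lies in A_k. All
  statistics are functionals of the multiplier empirical processes
  alpha^j_n(k,u) = n^{-1/2} sum_i v^j_i (f_k(u)(X_i,Z_i) - D(u,A_k)), where v^0 = 1 and v^j is the
  centred j-th weight vector. Because sample quantiles only depend on ranks, the empirical and the
  bootstrap copula processes are exact transforms of alpha^0_n and alpha^j_n evaluated at random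
  arguments; a deterministic linearisation (mean value theorem, with the boundary treated by the
  smallness of the bridge-type terms there) shows that they are uniformly close to the linear
  functional C_inf of alpha^j_n as soon as the paths are bounded and have a small modulus of continuity.
  The modulus is controlled by dyadic chaining with exponential moments for i.i.d. sums; the
  weights enter through the layer-cake formula for v^j, which is where the integral of
  sqrt P(|W - Wbar| > t) comes from. Finite-dimensional limits follow by conditioning on the weights,
  whose cross products average to the identity by exchangeability and independence. Weak convergence
  in l^infinity is tested on bounded Lipschitz functionals of the paths projected to dyadic grids.
\<close>

section \<open>Weak convergence from bounded Lipschitz functionals\<close>

text \<open>Condition (C) is silent on the faces of the cube where a coordinate is 0 or 1, so the
  derivatives have no uniform modulus. They are nevertheless bounded, since D is Lipschitz; as
  \<open>deriv\<close> returns an arbitrary value where no derivative exists, the bound is chosen to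
  cover that value too. The processes are not treated as measurable maps into the function space.
  Suprema of increments are never integrated: measurable majorants of them are. Functionals of the
  processes are compared with functionals of finitely many grid values outside a small measurable
  event, and outer expectation absorbs the rest. The limit must be carried by a measure on the type
  \<open>real\<close>, while it is built from a sequence of independent Gaussian sequences. An
  injection of that sequence space into the reals transports it; no topology of the reals is
  involved.\<close>

lemma ldist_bdd:
  assumes "linf T I f" "linf T I g"
  shows "bdd_above {\<bar>f t c - g t c\<bar> | t c. t \<in> T & c \<in> I}"
proof -
  obtain B C where "\<forall>t\<in>T. \<forall>c\<in>I. \<bar>f t c\<bar> <= B" "\<forall>t\<in>T. \<forall>c\<in>I. \<bar>g t c\<bar> <= C"
    using assms unfolding linf_def by auto
  then show ?thesis
    by (intro bdd_aboveI[of _ "B + C"]) (force intro: order_trans[OF abs_triangle_ineq4])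
qed

lemma ldist_ge:
  assumes "linf T I f" "linf T I g" "t \<in> T" "c \<in> I"
  shows "\<bar>f t c - g t c\<bar> <= ldist T I f g"
  unfolding ldist_def using assms by (intro cSup_upper ldist_bdd) auto

lemma ldist_le:
  assumes "T ~= {}" "I ~= {}" "!!t c. t \<in> T ==> c \<in> I ==> \<bar>f t c - g t c\<bar> <= e"
  shows "ldist T I f g <= e"
  unfolding ldist_def using assms by (intro cSup_least) auto

lemma ldist_commute: "ldist T I f g = ldist T I g f"
  unfolding ldist_def by (simp add: abs_minus_commute)

lemma ldist_self:
  assumes "T ~= {}" "I ~= {}" shows "ldist T I f f = 0"
proof -
  have "{\<bar>f t c - f t c\<bar> | t c. t \<in> T & c \<in> I} = {0}" using assms by auto
  then show ?thesis unfolding ldist_def by simp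
qed

lemma ldist_nonneg:
  assumes "T ~= {}" "I ~= {}" "linf T I f" "linf T I g"
  shows "0 <= ldist T I f g"
proof -
  obtain t c where "t \<in> T" "c \<in> I" using assms by auto
  from ldist_ge[OF assms(3,4) this] show ?thesis by linarith
qed

lemma ldist_triangle:
  assumes "T ~= {}" "I ~= {}" "linf T I f" "linf T I g" "linf T I k"
  shows "ldist T I f k <= ldist T I f g + ldist T I g k"
proof (rule ldist_le[OF assms(1,2)])
  fix t c assume tc: "t \<in> T" "c \<in> I"
  show "\<bar>f t c - k t c\<bar> <= ldist T I f g + ldist T I g k"
    using ldist_ge[OF assms(3,4) tc] ldist_ge[OF assms(4,5) tc] by linarith
qed

definition linf_BL :: "'t set => 'i set => real => real => (('t => 'i => real) => real) => bool" where
  "linf_BL T I B K h \<longleftrightarrow> 0 <= B & 0 <= K & (\<forall>f. linf T I f --> \<bar>h f\<bar> <= B) &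
     (\<forall>f g. linf T I f --> linf T I g --> \<bar>h f - h g\<bar> <= K * ldist T I f g)"

text \<open>The Lipschitz (Pasch-Hausdorff) envelope of \<open>h\<close>: for \<open>h\<close>
  bounded below, the largest \<open>K\<close>-Lipschitz functional below it. It replaces a merely
  continuous test functional, whose continuity need not be uniform on this nonseparable space, by
  Lipschitz ones.\<close>

definition linf_infconv :: "'t set => 'i set => real => (('t => 'i => real) => real) => ('t => 'i => real) => real" where
  "linf_infconv T I K h f = (INF g\<in>{g. linf T I g}. h g + K * ldist T I f g)"

context
  fixes T :: "'t set" and I :: "'i set" and h :: "('t => 'i => real) => real" and B :: real
  assumes TI: "T ~= {}" "I ~= {}" and hB: "!!f. linf T I f ==> \<bar>h f\<bar> <= B"
begin

lemma infconv_bdd_below: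
  assumes "0 <= K" "linf T I f"
  shows "bdd_below ((%g. h g + K * ldist T I f g) ` {g. linf T I g})"
proof (rule bdd_belowI2[of _ "-B"])
  fix g assume "g \<in> {g. linf T I g}"
  then have "\<bar>h g\<bar> <= B" "0 <= K * ldist T I f g"
    using hB assms ldist_nonneg[OF TI] by auto
  then show "- B <= h g + K * ldist T I f g" by linarith
qed

lemma infconv_le:
  assumes "0 <= K" "linf T I f" shows "linf_infconv T I K h f <= h f"
  unfolding linf_infconv_def using assms
  by (intro cINF_lower2[OF infconv_bdd_below]) (auto simp: ldist_self[OF TI])

lemma infconv_ge:
  assumes "!!g. linf T I g ==> c <= h g + K * ldist T I f g" "linf T I f"
  shows "c <= linf_infconv T I K h f"
  unfolding linf_infconv_def using assms by (intro cINF_greatest) auto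

lemma infconv_BL:
  assumes "0 <= K" shows "linf_BL T I B K (linf_infconv T I K h)"
proof -
  have l: "linf T I (%_ _. 0)" by (auto simp: linf_def)
  have B0: "0 <= B" using hB[OF l] by linarith
  have bd: "\<bar>linf_infconv T I K h f\<bar> <= B" if f: "linf T I f" for f
  proof -
    have "- B <= linf_infconv T I K h f"
    proof (rule infconv_ge[OF _ f])
      fix g assume "linf T I g"
      then have "\<bar>h g\<bar> <= B" "0 <= K * ldist T I f g" using hB assms f ldist_nonneg[OF TI] by auto
      then show "- B <= h g + K * ldist T I f g" by linarith
    qed
    then show ?thesis using infconv_le[OF assms f] hB[OF f] by linarith
  qed
  have lip: "linf_infconv T I K h f - linf_infconv T I K h g <= K * ldist T I f g"
    if f: "linf T I f" and g: "linf T I g" for f g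
  proof -
    have "linf_infconv T I K h f - K * ldist T I f g <= linf_infconv T I K h g"
    proof (rule infconv_ge[OF _ g])
      fix k assume k: "linf T I k"
      have "linf_infconv T I K h f <= h k + K * ldist T I f k"
        unfolding linf_infconv_def using k by (intro cINF_lower[OF infconv_bdd_below[OF assms f]]) auto
      also have "ldist T I f k <= ldist T I f g + ldist T I g k" by (rule ldist_triangle[OF TI f g k])
      finally show "linf_infconv T I K h f - K * ldist T I f g <= h k + K * ldist T I g k"
        using assms by (simp add: mult_left_mono distrib_left)
    qed
    then show ?thesis by linarith
  qed
  have "\<bar>linf_infconv T I K h f - linf_infconv T I K h g\<bar> <= K * ldist T I f g"
    if "linf T I f" "linf T I g" for f g
    using lip[OF that] lip[OF that(2,1)] by (simp add: abs_le_iff ldist_commute[of T I g f])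
  then show ?thesis unfolding linf_BL_def using assms B0 bd by blast
qed

text \<open>A competitor \<open>g\<close> within distance \<open>d\<close> of \<open>f\<close>
  cannot lower the value by more than \<open>e/2\<close>, by continuity; one farther away pays at
  least \<open>m * d\<close>, which eventually exceeds the oscillation \<open>2 * B\<close>.\<close>

lemma infconv_tendsto:
  assumes f: "linf T I f"
    and c: "!!e. 0 < e ==> \<exists>d>0. \<forall>g. linf T I g & ldist T I f g < d --> \<bar>h g - h f\<bar> < e"
  shows "(%m. linf_infconv T I (real m) h f) \<longlonglongrightarrow> h f"
proof (rule LIMSEQ_I)
  fix e :: real assume e: "0 < e"
  obtain d where d: "d > 0" "!!g. linf T I g ==> ldist T I f g < d ==> \<bar>h g - h f\<bar> < e/2"
    using c[of "e/2"] e by auto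
  obtain m0 :: nat where m0: "2 * B / d < real m0" using reals_Archimedean2 by blast
  show "\<exists>no. \<forall>n\<ge>no. norm (linf_infconv T I (real n) h f - h f) < e"
  proof (intro exI allI impI)
    fix n assume n: "m0 <= n"
    have "h f - e/2 <= linf_infconv T I (real n) h f"
    proof (rule infconv_ge[OF _ f])
      fix g assume g: "linf T I g"
      have nn: "0 <= ldist T I f g" by (rule ldist_nonneg[OF TI f g])
      show "h f - e / 2 <= h g + real n * ldist T I f g"
      proof (cases "ldist T I f g < d")
        case True
        have "0 <= real n * ldist T I f g" using nn by simp
        then show ?thesis using d(2)[OF g True] by linarith
      next
        case False
        have "2 * B < real m0 * d" using m0 d(1) by (simp add: field_simps)
        also have "... <= real n * ldist T I f g" using n False d(1) by (intro mult_mono) auto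
        finally show ?thesis using hB[OF f] hB[OF g] e by linarith
      qed
    qed
    then show "norm (linf_infconv T I (real n) h f - h f) < e"
      using infconv_le[of "real n", OF _ f] e by simp
  qed
qed

end

section \<open>Outer expectations and reduction to bounded Lipschitz functionals\<close>

lemma outer_exp_mono:
  assumes "prob_space M" "!!om. om \<in> space M ==> Y om <= Y' om" "!!om. om \<in> space M ==> \<bar>Y om\<bar> <= B"
    "!!om. om \<in> space M ==> \<bar>Y' om\<bar> <= B"
  shows "outer_exp M Y <= outer_exp M Y'"
proof -
  interpret prob_space M by fact
  let ?S = "%Y. {integral\<^sup>L M g | g. g \<in> borel_measurable M & integrable M g & (\<forall>om\<in>space M. Y om <= g om)}"
  show ?thesis unfolding outer_exp_def
  proof (rule cInf_superset_mono)
    have "integral\<^sup>L M (%_. B) \<in> ?S Y'" using assms(4) by (force simp: abs_le_iff)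
    then show "?S Y' ~= {}" by blast
    show "bdd_below (?S Y)"
    proof (rule bdd_belowI[of _ "-B"], clarify)
      fix g assume "integrable M g" "\<forall>om\<in>space M. Y om <= g om"
      then have "integral\<^sup>L M (%_. -B) <= integral\<^sup>L M g"
        using assms(3) by (intro integral_mono) (auto simp: abs_le_iff, force)
      then show "- B <= integral\<^sup>L M g" by (simp add: prob_space)
    qed
    show "?S Y' \<subseteq> ?S Y" using order_trans[OF assms(2)] by blast
  qed
qed

text \<open>\<open>g\<close> plus the error is itself an admissible measurable majorant of
  \<open>Y\<close>, and every majorant of \<open>Y\<close> dominates \<open>g\<close> minus the
  error. This is where a non-measurable functional is exchanged for a measurable one that agrees
  with it up to \<open>e\<close> off a small event.\<close>

lemma outer_exp_approx:
  assumes "prob_space M" and g[measurable]: "g \<in> borel_measurable M" and "integrable M g"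
    and E[measurable]: "E \<in> sets M" and "0 <= c"
    and Y: "!!om. om \<in> space M ==> \<bar>Y om - g om\<bar> <= e + c * indicator E om"
  shows "\<bar>outer_exp M Y - integral\<^sup>L M g\<bar> <= e + c * measure M E"
proof -
  interpret prob_space M by fact
  let ?S = "{integral\<^sup>L M g | g. g \<in> borel_measurable M & integrable M g & (\<forall>om\<in>space M. Y om <= g om)}"
  have [simp]: "integrable M (%om. e + c * indicator E om)"
    by (intro Bochner_Integration.integrable_add integrable_const integrable_mult_right)
      (auto simp: integrable_indicator_iff emeasure_eq_measure)
  have int: "integral\<^sup>L M (%om. e + c * indicator E om) = e + c * measure M E"
    by (subst Bochner_Integration.integral_add)
       (auto simp: prob_space emeasure_eq_measure)
  have up: "integral\<^sup>L M g + (e + c * measure M E) \<in> ?S"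
  proof (intro CollectI exI conjI)
    show "integral\<^sup>L M g + (e + c * measure M E) = integral\<^sup>L M (%om. g om + (e + c * indicator E om))"
      by (subst Bochner_Integration.integral_add) (auto simp: int assms)
    show "integrable M (%om. g om + (e + c * indicator E om))" using assms by simp
    show "\<forall>om\<in>space M. Y om <= g om + (e + c * indicator E om)" using Y by (fastforce simp: abs_le_iff)
  qed simp
  have lo: "integral\<^sup>L M g - (e + c * measure M E) <= x" if "x \<in> ?S" for x
  proof -
    obtain f where f: "x = integral\<^sup>L M f" "integrable M f" "\<forall>om\<in>space M. Y om <= f om" using \<open>x \<in> ?S\<close> by auto
    have "integral\<^sup>L M (%om. g om - (e + c * indicator E om)) <= integral\<^sup>L M f"
      using f assms(3) Y by (intro integral_mono) (fastforce simp: abs_le_iff)+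
    then show ?thesis using f by (simp add: int assms)
  qed
  have "outer_exp M Y <= integral\<^sup>L M g + (e + c * measure M E)"
    unfolding outer_exp_def by (rule cInf_lower[OF up], rule bdd_belowI) (rule lo)
  moreover have "integral\<^sup>L M g - (e + c * measure M E) <= outer_exp M Y"
    unfolding outer_exp_def by (rule cInf_greatest) (use up lo in blast)+
  ultimately show ?thesis by linarith
qed

text \<open>The envelopes of \<open>h\<close> and of \<open>- h\<close> bracket a bounded continuous
  \<open>h\<close> between Lipschitz functionals whose integrals under the limit differ arbitrarily
  little, so monotonicity of outer expectation transfers the limit. The Borel measurability of
  \<open>G\<close> is obtained from the same envelopes.\<close>

lemma weak_conv_linf_of_BL:
  fixes T :: "'t set" and I :: "'i set"
  assumes P: "prob_space M" "prob_space N" and TI: "T ~= {}" "I ~= {}"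
    and Xs: "!!n om. om \<in> space M ==> linf T I (Xs n om)"
    and G: "!!om. om \<in> space N ==> linf T I (G om)"
    and meas: "!!B K h. linf_BL T I B K h ==> (%om. h (G om)) \<in> borel_measurable N"
    and conv: "!!B K h. linf_BL T I B K h ==>
       (%n. outer_exp M (%om. h (Xs n om))) \<longlonglongrightarrow> integral\<^sup>L N (%om. h (G om))"
  shows "weak_conv_linf T I M Xs N G"
proof -
  interpret N: prob_space N by fact
  have op: "{om \<in> space N. G om \<in> U} \<in> sets N" if U: "linf_open T I U" for U
  proof -
    define h :: "('t => 'i => real) => real" where "h f = (if f \<in> U then 1 else 0)" for f
    have hB: "\<bar>h f\<bar> <= 1" if "linf T I f" for f by (simp add: h_def)
    \<comment> \<open>For the indicator of an open set the envelope with constant 1 is the distance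
      to the complement cut off at 1, hence positive exactly on the set.\<close>
    have eq: "G om \<in> U \<longleftrightarrow> linf_infconv T I 1 h (G om) > 0" if w: "om \<in> space N" for om
    proof
      assume GU: "G om \<in> U"
      then obtain r where r: "r > 0" "!!g. linf T I g ==> ldist T I (G om) g < r ==> g \<in> U"
        using U unfolding linf_open_def by blast
      have "min r 1 <= linf_infconv T I 1 h (G om)"
      proof (rule infconv_ge[OF TI hB _ G[OF w]])
        fix g assume g: "linf T I g"
        show "min r 1 <= h g + 1 * ldist T I (G om) g"
          using r(2)[OF g] ldist_nonneg[OF TI G[OF w] g] by (cases "ldist T I (G om) g < r") (auto simp: h_def)
      qed
      then show "linf_infconv T I 1 h (G om) > 0" using r(1) by (auto simp: min_def split: if_splits)
    next
      assume "linf_infconv T I 1 h (G om) > 0"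
      moreover have "linf_infconv T I 1 h (G om) <= h (G om)"
        by (rule infconv_le[OF TI hB _ G[OF w]]) simp_all
      ultimately have "h (G om) > 0" by linarith
      then show "G om \<in> U" by (simp add: h_def split: if_splits)
    qed
    have [measurable]: "(%om. linf_infconv T I 1 h (G om)) \<in> borel_measurable N"
      by (rule meas[OF infconv_BL[OF TI hB zero_le_one]])
    have "{om \<in> space N. G om \<in> U} = {om \<in> space N. linf_infconv T I 1 h (G om) > 0}" using eq by auto
    also have "... \<in> sets N" by measurable
    finally show ?thesis .
  qed
  have lower: "(%om. h (G om)) \<in> borel_measurable N &
      (\<forall>e>0. \<exists>h' B K. linf_BL T I B K h' & (\<forall>f. linf T I f --> \<bar>h' f\<bar> <= B & \<bar>h f\<bar> <= B & h' f <= h f) &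
         integral\<^sup>L N (%om. h (G om)) - e < integral\<^sup>L N (%om. h' (G om)))"
    if h: "linf_bcont T I h" for h
  proof -
    obtain B where B: "!!f. linf T I f ==> \<bar>h f\<bar> <= B"
      and c: "!!f e. linf T I f ==> 0 < e ==> \<exists>d>0. \<forall>g. linf T I g & ldist T I f g < d --> \<bar>h g - h f\<bar> < e"
      using h unfolding linf_bcont_def by blast
    let ?h = "%m f. linf_infconv T I (real m) h f"
    have BL: "linf_BL T I B (real m) (?h m)" for m by (rule infconv_BL[OF TI B]) auto
    have m1: "(%om. ?h m (G om)) \<in> borel_measurable N" for m by (rule meas[OF BL])
    have lim: "(%m. ?h m (G om)) \<longlonglongrightarrow> h (G om)" if "om \<in> space N" for om
      by (rule infconv_tendsto[OF TI B G[OF that] c[OF G[OF that]]])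
    have m2: "(%om. h (G om)) \<in> borel_measurable N"
      by (rule borel_measurable_LIMSEQ_real[OF lim m1])
    have bd: "\<bar>?h m f\<bar> <= B" if "linf T I f" for m f
      using BL[of m] that unfolding linf_BL_def by blast
    have "(%m. integral\<^sup>L N (%om. ?h m (G om))) \<longlonglongrightarrow> integral\<^sup>L N (%om. h (G om))"
      by (rule integral_dominated_convergence[where w="%_. B"])
         (use m1 m2 lim bd G in \<open>auto intro!: AE_I2\<close>)
    then have ex: "\<exists>m. integral\<^sup>L N (%om. h (G om)) - e < integral\<^sup>L N (%om. ?h m (G om))" if "e > 0" for e
      using order_tendstoD(1)[of _ "integral\<^sup>L N (%om. h (G om))" sequentially "integral\<^sup>L N (%om. h (G om)) - e"] that
      by (auto simp: eventually_sequentially)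
    have hle: "?h m f <= h f" if "linf T I f" for m f
      by (rule infconv_le[OF TI B _ that]) auto
    have "\<exists>h' B K. linf_BL T I B K h' & (\<forall>f. linf T I f --> \<bar>h' f\<bar> <= B & \<bar>h f\<bar> <= B & h' f <= h f) &
         integral\<^sup>L N (%om. h (G om)) - e < integral\<^sup>L N (%om. h' (G om))" if e: "e > 0" for e
    proof -
      obtain m where m: "integral\<^sup>L N (%om. h (G om)) - e < integral\<^sup>L N (%om. ?h m (G om))"
        using ex[OF e] by blast
      show ?thesis
        by (rule exI[of _ "?h m"], rule exI[of _ B], rule exI[of _ "real m"])
           (use m BL bd B hle in simp)
    qed
    then show ?thesis using m2 by simp
  qed
  have lim: "(%n. outer_exp M (%om. h (Xs n om))) \<longlonglongrightarrow> integral\<^sup>L N (%om. h (G om))"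
    if h: "linf_bcont T I h" for h
  proof (rule LIMSEQ_I)
    fix e :: real assume e: "e > 0"
    \<comment> \<open>The lower approximation of \<open>- h\<close> supplies the upper one of
      \<open>h\<close>.\<close>
    have h': "linf_bcont T I (%f. - h f)"
      using h unfolding linf_bcont_def by (simp add: abs_minus_commute)
    obtain h1 B1 K1 where 1: "linf_BL T I B1 K1 h1" "!!f. linf T I f ==> \<bar>h1 f\<bar> <= B1 & \<bar>h f\<bar> <= B1 & h1 f <= h f"
         "integral\<^sup>L N (%om. h (G om)) - e < integral\<^sup>L N (%om. h1 (G om))"
      using lower[OF h] e by blast
    obtain h2 B2 K2 where 2: "linf_BL T I B2 K2 h2" "!!f. linf T I f ==> \<bar>h2 f\<bar> <= B2 & \<bar>- h f\<bar> <= B2 & h2 f <= - h f"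
         "integral\<^sup>L N (%om. - h (G om)) - e < integral\<^sup>L N (%om. h2 (G om))"
      using lower[OF h'] e by blast
    have 3: "linf_BL T I B2 K2 (%f. - h2 f)" using 2(1) unfolding linf_BL_def by (auto simp: abs_minus_commute)
    have "eventually (%n. outer_exp M (%om. h1 (Xs n om)) > integral\<^sup>L N (%om. h (G om)) - e) sequentially"
      using order_tendstoD(1)[OF conv[OF 1(1)] 1(3)] .
    moreover have "eventually (%n. outer_exp M (%om. - h2 (Xs n om)) < integral\<^sup>L N (%om. h (G om)) + e) sequentially"
      by (rule order_tendstoD(2)[OF conv[OF 3]]) (use 2(3) in simp)
    ultimately have "eventually (%n. norm (outer_exp M (%om. h (Xs n om)) - integral\<^sup>L N (%om. h (G om))) < e) sequentially"
    proof eventually_elim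
      case (elim n)
      have h2: "\<bar>h2 (Xs n om)\<bar> <= B2 & \<bar>h (Xs n om)\<bar> <= B2 & h (Xs n om) <= - h2 (Xs n om)"
        if "om \<in> space M" for om using 2(2)[OF Xs[OF that, of n]] by auto
      have "outer_exp M (%om. h1 (Xs n om)) <= outer_exp M (%om. h (Xs n om))"
        by (rule outer_exp_mono[OF P(1), where B=B1]) (use 1(2) Xs in blast)+
      moreover have "outer_exp M (%om. h (Xs n om)) <= outer_exp M (%om. - h2 (Xs n om))"
        by (rule outer_exp_mono[OF P(1), where B=B2]) (use h2 in simp_all)
      ultimately show ?case using elim by (simp add: abs_less_iff)
    qed
    then show "\<exists>no. \<forall>n\<ge>no. norm (outer_exp M (%om. h (Xs n om)) - integral\<^sup>L N (%om. h (G om))) < e"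
      by (simp add: eventually_sequentially)
  qed
  show ?thesis unfolding weak_conv_linf_def using Xs G op lim by blast
qed

section \<open>Finite-dimensional convergence\<close>

text \<open>Finite sums of shifted cosines of linear forms. They form an algebra, the shift makes
  sines available, and their expectations are determined by characteristic functions; this makes
  them the link between characteristic functions and Stone-Weierstrass.\<close>

inductive_set trig_sums :: "nat => ((nat => real) => real) set" for d where
  base: "(%x. a * cos ((\<Sum>r<d. c r * x r) + b)) \<in> trig_sums d"
| add: "g \<in> trig_sums d ==> g' \<in> trig_sums d ==> (%x. g x + g' x) \<in> trig_sums d"

lemma trig_sums_mult:
  assumes "g \<in> trig_sums d" "g' \<in> trig_sums d"
  shows "(%x. g x * g' x) \<in> trig_sums d"
  using assms
proof (induction g)
  case (base a c b)
  show ?case using base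
  proof (induction g')
    case (base a' c' b')
    have "(%x. (a*a'/2) * cos ((\<Sum>r<d. (c r - c' r) * x r) + (b - b')) + (a*a'/2) * cos ((\<Sum>r<d. (c r + c' r) * x r) + (b + b')))
        \<in> trig_sums d"
      by (intro trig_sums.intros)
    also have "(%x. (a*a'/2) * cos ((\<Sum>r<d. (c r - c' r) * x r) + (b - b')) + (a*a'/2) * cos ((\<Sum>r<d. (c r + c' r) * x r) + (b + b')))
       = (%x. a * cos ((\<Sum>r<d. c r * x r) + b) * (a' * cos ((\<Sum>r<d. c' r * x r) + b')))"
    proof
      fix x
      have 1: "(\<Sum>r<d. (c r - c' r) * x r) + (b - b') = ((\<Sum>r<d. c r * x r) + b) - ((\<Sum>r<d. c' r * x r) + b')"
        by (simp add: left_diff_distrib sum_subtractf)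
      have 2: "(\<Sum>r<d. (c r + c' r) * x r) + (b + b') = ((\<Sum>r<d. c r * x r) + b) + ((\<Sum>r<d. c' r * x r) + b')"
        by (simp add: distrib_right sum.distrib)
      show "(a*a'/2) * cos ((\<Sum>r<d. (c r - c' r) * x r) + (b - b')) + (a*a'/2) * cos ((\<Sum>r<d. (c r + c' r) * x r) + (b + b'))
        = a * cos ((\<Sum>r<d. c r * x r) + b) * (a' * cos ((\<Sum>r<d. c' r * x r) + b'))"
        unfolding 1 2 cos_add[of "_ + b"] cos_diff[of "_ + b"] by (simp add: algebra_simps)
    qed
    finally show ?case .
  next
    case (add g g') then show ?case by (simp add: distrib_left trig_sums.add)
  qed
next
  case (add g g'') then show ?case by (simp add: distrib_right trig_sums.add)
qed

lemma trig_sums_sin: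
  assumes "r < d" shows "(%x. sin (\<theta> * x r)) \<in> trig_sums d"
proof -
  have "(%x. 1 * cos ((\<Sum>i<d. (if i = r then \<theta> else 0) * x i) + (- pi/2))) \<in> trig_sums d"
    by (rule trig_sums.base)
  also have "(%x. 1 * cos ((\<Sum>i<d. (if i = r then \<theta> else 0) * x i) + (- pi/2))) = (%x. sin (\<theta> * x r))"
    using assms by (simp add: if_distribR cos_diff sum.delta if_distrib[where f="%y. y * _"] cong: if_cong)
  finally show ?thesis .
qed

lemma trig_sums_bounded: "g \<in> trig_sums d ==> \<exists>B. \<forall>x. \<bar>g x\<bar> <= B"
proof (induction rule: trig_sums.induct)
  case (base a c b)
  have "\<bar>a * cos y\<bar> <= \<bar>a\<bar>" for y by (simp add: abs_mult mult_left_le)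
  then show ?case by blast
next
  case (add g g')
  then show ?case by (meson abs_triangle_ineq add_mono order_trans)
qed

lemma trig_sums_measurable:
  assumes "g \<in> trig_sums d" "!!r. r < d ==> (%om. V om r) \<in> borel_measurable M"
  shows "(%om. g (V om)) \<in> borel_measurable M"
  using assms(1)
proof (induction rule: trig_sums.induct)
  case (base a c b)
  have "(%om. \<Sum>r<d. c r * V om r) \<in> borel_measurable M"
    using assms(2) by (intro borel_measurable_sum borel_measurable_times) auto
  then show ?case by measurable
qed measurable

lemma trig_sums_expectation_tendsto:
  assumes "prob_space M" "prob_space N" "g \<in> trig_sums d"
    and V: "!!n r. r < d ==> (%om. V n om r) \<in> borel_measurable M"
    and V': "!!r. r < d ==> (%om. V' om r) \<in> borel_measurable N"
    and chf: "!!c. (%n. \<integral>om. iexp (\<Sum>r<d. c r * V n om r) \<partial>M) \<longlonglongrightarrow> (\<integral>om. iexp (\<Sum>r<d. c r * V' om r) \<partial>N)"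
  shows "(%n. \<integral>om. g (V n om) \<partial>M) \<longlonglongrightarrow> (\<integral>om. g (V' om) \<partial>N)"
  using assms(3)
proof (induction rule: trig_sums.induct)
  case (base a c b)
  interpret M: prob_space M by fact
  interpret N: prob_space N by fact
  \<comment> \<open>A shifted cosine is the real part of the exponential rotated by
    \<open>iexp b\<close>, so its integral is read off the characteristic function.\<close>
  have *: "(\<integral>om. a * cos ((\<Sum>r<d. c r * W om r) + b) \<partial>P) = a * Re (iexp b * (\<integral>om. iexp (\<Sum>r<d. c r * W om r) \<partial>P))"
    if "prob_space P" "!!r. r < d ==> (%om. W om r) \<in> borel_measurable P" for P :: "'c measure" and W
  proof -
    interpret P: prob_space P by fact
    have [measurable]: "(%om. \<Sum>r<d. c r * W om r) \<in> borel_measurable P"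
      using that(2) by (intro borel_measurable_sum borel_measurable_times) auto
    have int: "integrable P (%om. iexp (\<Sum>r<d. c r * W om r))"
      by (intro P.integrable_const_bound[of _ 1]) (auto simp del: of_real_sum)
    have "a * Re (iexp b * (\<integral>om. iexp (\<Sum>r<d. c r * W om r) \<partial>P)) = a * Re (\<integral>om. iexp b * iexp (\<Sum>r<d. c r * W om r) \<partial>P)"
      by simp
    also have "... = a * (\<integral>om. Re (iexp b * iexp (\<Sum>r<d. c r * W om r)) \<partial>P)"
      by (subst integral_Re) (use int in auto)
    also have "... = (\<integral>om. a * Re (iexp b * iexp (\<Sum>r<d. c r * W om r)) \<partial>P)" by simp
    also have "... = (\<integral>om. a * cos ((\<Sum>r<d. c r * W om r) + b) \<partial>P)"
      by (rule arg_cong[where f="integral\<^sup>L P"]) (simp add: fun_eq_iff exp_add[symmetric] Re_exp add.commute)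
    finally show ?thesis ..
  qed
  have "(%n. a * Re (iexp b * (\<integral>om. iexp (\<Sum>r<d. c r * V n om r) \<partial>M))) \<longlonglongrightarrow> a * Re (iexp b * (\<integral>om. iexp (\<Sum>r<d. c r * V' om r) \<partial>N))"
    by (intro tendsto_intros chf)
  moreover have "(\<integral>om. a * cos ((\<Sum>r<d. c r * V n om r) + b) \<partial>M) = a * Re (iexp b * (\<integral>om. iexp (\<Sum>r<d. c r * V n om r) \<partial>M))" for n
    by (rule *[OF assms(1) V])
  moreover have "(\<integral>om. a * cos ((\<Sum>r<d. c r * V' om r) + b) \<partial>N) = a * Re (iexp b * (\<integral>om. iexp (\<Sum>r<d. c r * V' om r) \<partial>N))"
    by (rule *[OF assms(2) V'])
  ultimately show ?case by (simp only:)
next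
  case (add g g')
  interpret M: prob_space M by fact
  interpret N: prob_space N by fact
  have i1: "integrable M (%om. g (V n om))" if g: "g \<in> trig_sums d" for n g
  proof -
    obtain B where "\<forall>x. \<bar>g x\<bar> <= B" using trig_sums_bounded[OF g] by blast
    then show ?thesis using trig_sums_measurable[of g d "V n" M, OF g V]
      by (intro M.integrable_const_bound[of _ B]) auto
  qed
  have i2: "integrable N (%om. g (V' om))" if g: "g \<in> trig_sums d" for g
  proof -
    obtain B where "\<forall>x. \<bar>g x\<bar> <= B" using trig_sums_bounded[OF g] by blast
    then show ?thesis using trig_sums_measurable[of g d V' N, OF g V']
      by (intro N.integrable_const_bound[of _ B]) auto
  qed
  show ?case using add by (simp add: i1 i2 tendsto_add)
qed

section \<open>Convergence of Lipschitz functions of finitely many coordinates\<close>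

lemma continuous_on_finite_coords:
  fixes \<Phi> :: "(nat => real) => real"
  assumes "0 <= K" "!!x y e. (!!r. r < d ==> \<bar>x r - y r\<bar> <= e) ==> 0 <= e ==> \<bar>\<Phi> x - \<Phi> y\<bar> <= K * e"
  shows "continuous_on UNIV \<Phi>"
  unfolding continuous_on_eq_continuous_at[OF open_UNIV] isCont_def
proof (intro ballI, unfold tendsto_iff, intro allI impI)
  fix x :: "nat => real" and e :: real assume e: "e > 0"
  let ?e = "e / (K + 1) / 2"
  have e': "?e > 0" using e assms(1) by simp
  have "\<forall>\<^sub>F y in at x. \<forall>r\<in>{..<d}. dist (y r) (x r) < ?e"
  proof (rule eventually_ball_finite)
    show "\<forall>r\<in>{..<d}. \<forall>\<^sub>F y in at x. dist (y r) (x r) < ?e"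
    proof
      fix r
      have "isCont (%y::nat => real. y r) x"
        using continuous_on_product_coordinates[of r, where ?'b=real] unfolding continuous_on_eq_continuous_at[OF open_UNIV] by blast
      then show "\<forall>\<^sub>F y in at x. dist (y r) (x r) < ?e"
        unfolding isCont_def tendsto_iff using e' by blast
    qed
  qed simp
  then show "\<forall>\<^sub>F y in at x. dist (\<Phi> y) (\<Phi> x) < e"
  proof eventually_elim
    case (elim y)
    have "\<bar>\<Phi> y - \<Phi> x\<bar> <= K * ?e"
      using elim e' by (intro assms(2)) (auto simp: dist_real_def less_imp_le)
    also have "... <= (K + 1) * ?e" using e' by (intro mult_right_mono) auto
    also have "... = e / 2" using assms(1) nonzero_mult_div_cancel_left[of "K+1" "e/2"] by (simp add: field_simps)
    also have "... < e" using e by simp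
    finally show ?case by (simp add: dist_real_def)
  qed
qed

lemma finite_coords_measurable:
  fixes \<Phi> :: "(nat => real) => real"
  assumes "0 <= K" "!!x y e. (!!r. r < d ==> \<bar>x r - y r\<bar> <= e) ==> 0 <= e ==> \<bar>\<Phi> x - \<Phi> y\<bar> <= K * e"
    and V: "!!r. r < d ==> (%om. V om r) \<in> borel_measurable M"
  shows "(%om. \<Phi> (V om)) \<in> borel_measurable M"
proof -
  have "(%om r. if r < d then V om r else 0) \<in> measurable M (PiM UNIV (%_::nat. borel))"
  proof (rule measurable_PiM_single')
    fix r show "(%om. if r < d then V om r else 0) \<in> borel_measurable M"
      using V[of r] by (cases "r < d") auto
  qed (auto simp: space_PiM)
  then have m: "(%om r. if r < d then V om r else 0) \<in> borel_measurable M"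
    by (simp add: measurable_cong_sets[OF refl sets_PiM_equal_borel])
  have "\<Phi> \<in> borel_measurable borel"
    by (intro borel_measurable_continuous_onI continuous_on_finite_coords[of K d]) (use assms in auto)
  from measurable_compose[OF m this]
  have "(%om. \<Phi> (%r. if r < d then V om r else 0)) \<in> borel_measurable M" .
  \<comment> \<open>The Lipschitz hypothesis with \<open>e = 0\<close> says that
    \<open>\<Phi>\<close> ignores every coordinate from \<open>d\<close> on.\<close>
  moreover have "\<Phi> (%r. if r < d then V om r else 0) = \<Phi> (V om)" for om
    using assms(2)[of "%r. if r < d then V om r else 0" "V om" 0] by simp
  ultimately show ?thesis by simp
qed

lemma (in prob_space) tight_single:
  fixes Y :: "'a => real" and e :: real
  assumes [measurable]: "Y \<in> borel_measurable M" and "0 < e"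
  shows "\<exists>R0. \<forall>R\<ge>R0. prob {om\<in>space M. \<bar>Y om\<bar> > R} <= e"
proof -
  have "(%n. prob {om\<in>space M. \<bar>Y om\<bar> > real n}) \<longlonglongrightarrow> prob (\<Inter>n. {om\<in>space M. \<bar>Y om\<bar> > real n})"
    by (rule finite_Lim_measure_decseq) (auto simp: decseq_def)
  also have "(\<Inter>n. {om\<in>space M. \<bar>Y om\<bar> > real n}) = {}"
  proof -
    have "\<exists>n. \<not> \<bar>Y om\<bar> > real n" for om using real_arch_simple[of "\<bar>Y om\<bar>"] by (simp add: not_less)
    then show ?thesis by auto
  qed
  finally have "\<forall>\<^sub>F n in sequentially. prob {om\<in>space M. \<bar>Y om\<bar> > real n} < e"
    using assms(2) by (intro order_tendstoD) auto
  then obtain n where n: "prob {om\<in>space M. \<bar>Y om\<bar> > real n} < e" by (auto simp: eventually_sequentially)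
  have "prob {om\<in>space M. \<bar>Y om\<bar> > R} <= prob {om\<in>space M. \<bar>Y om\<bar> > real n}" if "R >= real n" for R
    using that by (intro finite_measure_mono) auto
  then show ?thesis using n by (intro exI[of _ "real n"] allI impI) (rule order_trans[OF _ less_imp_le[OF n]])
qed

text \<open>A self-contained form of Levy's continuity theorem. Composition with sines maps the
  coordinates into a compact cube, where Stone-Weierstrass approximates \<open>\<Phi>\<close> by an
  element of \<open>trig_sums\<close>; tightness pays for the region where the sine cannot be
  inverted.\<close>

lemma fidi_conv_nat:
  fixes \<Phi> :: "(nat => real) => real"
  assumes "prob_space M" "prob_space N"
    and V: "!!n r. r < d ==> (%om. V n om r) \<in> borel_measurable M"
    and V': "!!r. r < d ==> (%om. V' om r) \<in> borel_measurable N"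
    and chf: "!!c. (%n. \<integral>om. iexp (\<Sum>r<d. c r * V n om r) \<partial>M) \<longlonglongrightarrow> (\<integral>om. iexp (\<Sum>r<d. c r * V' om r) \<partial>N)"
    and tight: "!!e. e > 0 ==> \<exists>R0. \<forall>R\<ge>R0. \<forall>\<^sub>F n in sequentially. \<forall>r<d. measure M {om\<in>space M. \<bar>V n om r\<bar> > R} <= e"
    and K: "0 <= K" "!!x y e. (!!r. r < d ==> \<bar>x r - y r\<bar> <= e) ==> 0 <= e ==> \<bar>\<Phi> x - \<Phi> y\<bar> <= K * e"
    and B: "!!x. \<bar>\<Phi> x\<bar> <= B"
  shows "(%n. \<integral>om. \<Phi> (V n om) \<partial>M) \<longlonglongrightarrow> (\<integral>om. \<Phi> (V' om) \<partial>N)"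
proof (rule LIMSEQ_I)
  fix e0 :: real assume e0: "e0 > 0"
  interpret M: prob_space M by fact
  interpret N: prob_space N by fact
  have B0: "0 <= B" using B[of undefined] by linarith
  define e where "e = e0 / 5"
  have e: "e > 0" using e0 by (simp add: e_def)
  \<comment> \<open>The tail allowance per coordinate: \<open>d\<close> coordinates, each weighted
    by \<open>2 * B\<close>, cost at most \<open>e\<close> together. The added ones keep the
    denominator positive.\<close>
  define e' where "e' = e / ((2 * B + 1) * (real d + 1))"
  have "(2 * B + 1) * (real d + 1) > 0" using B0 by (intro mult_pos_pos) auto
  then have e': "e' > 0" using e by (simp add: e'_def)
  have e'': "2 * B * (real d * e') <= e"
  proof -
    have "2 * B * (real d * e') <= (2 * B + 1) * ((real d + 1) * e')"
      using B0 e' by (intro mult_mono) auto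
    also have "... = e" unfolding e'_def using \<open>(2 * B + 1) * (real d + 1) > 0\<close> B0 by (auto simp: add_nonneg_eq_0_iff)
    finally show ?thesis .
  qed
  obtain R0 where R0: "!!R. R >= R0 ==> \<forall>\<^sub>F n in sequentially. \<forall>r<d. measure M {om\<in>space M. \<bar>V n om r\<bar> > R} <= e'"
    using tight[OF e'] by auto
  have "\<forall>r\<in>{..<d}. \<exists>R0. \<forall>R\<ge>R0. measure N {om\<in>space N. \<bar>V' om r\<bar> > R} <= e'"
    using N.tight_single[OF V' e'] by simp
  then obtain R1 where R1: "!!r R. r < d ==> R >= R1 r ==> measure N {om\<in>space N. \<bar>V' om r\<bar> > R} <= e'"
    by (metis lessThan_iff)
  define R where "R = Max (insert 1 (insert R0 (R1 ` {..<d})))"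
  have Rge: "R >= 1" "R >= R0" "!!r. r < d ==> R >= R1 r" unfolding R_def by (intro Max_ge; simp)+
  \<comment> \<open>With this frequency the sine is injective on the interval from
    \<open>- R\<close> to \<open>R\<close>, so \<open>arcsin\<close> undoes it there.\<close>
  define \<theta> where "\<theta> = pi / (2 * R)"
  have \<theta>: "\<theta> > 0" using Rge(1) by (simp add: \<theta>_def)
  \<comment> \<open>The coordinates from \<open>d\<close> on are pinned to 0, so that distinct
    points of \<open>S\<close> differ in a coordinate below \<open>d\<close>. That coordinate
    function, a sine after composition with \<open>s\<close>, separates them.\<close>
  define S where "S = (\<Pi>\<^sub>E r\<in>UNIV. if r < d then {-1..1::real} else {0})"
  have compS: "compact S"
  proof -
    have "compactin (product_topology (%_::nat. euclidean) UNIV) S"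
      unfolding S_def by (subst compactin_PiE) (auto simp: compactin_euclidean_iff)
    then show ?thesis by (simp add: euclidean_product_topology compactin_euclidean_iff)
  qed
  have Sb: "-1 <= y r & y r <= 1" if "y \<in> S" "r < d" for y r
    using PiE_mem[OF that(1)[unfolded S_def], of r] that(2) by simp
  define s where "s x = (%r. if r < d then sin (\<theta> * x r) else 0)" for x :: "nat => real"
  have sS: "s x \<in> S" for x by (auto simp: S_def s_def)
  define R' where "R' = {p :: (nat => real) => real. continuous_on UNIV p & (%x. p (s x)) \<in> trig_sums d}"
  define g where "g y = \<Phi> (%r. if r < d then arcsin (y r) / \<theta> else 0)" for y
  interpret function_ring_on R' S
  proof
    show "compact S" by fact
    fix c :: real
    have "(%x. c * cos ((\<Sum>r<d. 0 * x r) + 0)) \<in> trig_sums d" by (rule trig_sums.base)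
    then show "(%_. c) \<in> R'" by (simp add: R'_def)
  next
    fix x y assume xy: "x \<in> S" "y \<in> S" "x ~= y"
    then obtain r where r: "x r ~= y r" by auto
    have rd: "r < d" using xy r unfolding S_def PiE_iff by (metis UNIV_I singletonD)
    have "(%x. x r) \<in> R'" unfolding R'_def s_def
      using trig_sums_sin[OF rd, of \<theta>] rd by (simp add: continuous_on_product_coordinates)
    then show "\<exists>f\<in>R'. f x ~= f y" by (rule rev_bexI) (rule r)
  next
    fix f assume "f \<in> R'" then show "continuous_on S f" unfolding R'_def by (auto intro: continuous_on_subset[of UNIV])
  next
    fix f g assume "f \<in> R'" "g \<in> R'"
    then show "(%x. f x + g x) \<in> R'" "(%x. f x * g x) \<in> R'"
      unfolding R'_def
      by (simp_all add: continuous_on_add continuous_on_mult trig_sums.add[of "%x. f (s x)"] trig_sums_mult[of "%x. f (s x)"])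
  qed
  have "continuous_on S (\<Phi> \<circ> (%y r. if r < d then arcsin (y r) / \<theta> else 0))"
  proof (rule continuous_on_compose)
    show "continuous_on S (%y r. if r < d then arcsin (y r) / \<theta> else 0)"
    proof (rule continuous_on_coordinatewise_then_product)
      fix r
      show "continuous_on S (%y. if r < d then arcsin (y r) / \<theta> else 0)"
      proof (cases "r < d")
        case True
        have "continuous_on S (%y. arcsin (y r))"
          by (rule continuous_on_arcsin)
             (use True Sb in \<open>auto intro: continuous_on_subset[OF continuous_on_product_coordinates]\<close>)
        then show ?thesis using True \<theta> by (auto intro!: continuous_intros)
      qed simp
    qed
  qed (rule continuous_on_subset[OF continuous_on_finite_coords[OF K]], auto)
  then have "continuous_on S g" by (simp add: g_def[abs_def] comp_def)
  from Stone_Weierstrass_basic[OF this e] obtain p where p: "p \<in> R'" "!!y. y \<in> S ==> \<bar>g y - p y\<bar> < e"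
    by auto
  define G where "G x = p (s x)" for x
  have G: "G \<in> trig_sums d" using p(1) by (simp add: R'_def G_def[abs_def])
  have bnd: "\<bar>\<Phi> x - G x\<bar> <= e + 2 * B * (\<Sum>r<d. indicator {y. \<bar>y\<bar> > R} (x r))" for x
  proof (cases "\<forall>r<d. \<bar>x r\<bar> <= R")
    case True
    have "\<bar>\<Phi> x - g (s x)\<bar> <= K * 0" unfolding g_def
    proof (rule K(2))
      fix r assume r: "r < d"
      have "\<bar>\<theta> * x r\<bar> <= pi / 2"
      proof -
        have "\<bar>\<theta> * x r\<bar> <= \<theta> * R" using True r \<theta> by (simp add: abs_mult)
        then show ?thesis using Rge(1) by (simp add: \<theta>_def)
      qed
      then have "arcsin (sin (\<theta> * x r)) = \<theta> * x r" by (intro arcsin_sin) (auto simp: abs_le_iff)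
      then show "\<bar>x r - (if r < d then arcsin (s x r) / \<theta> else 0)\<bar> <= 0"
        using r \<theta> by (simp add: s_def)
    qed simp
    moreover have "(\<Sum>r<d. indicator {y. \<bar>y\<bar> > R} (x r)) = (0::real)"
      using True by (intro sum.neutral) (auto simp: indicator_def)
    ultimately show ?thesis using p(2)[OF sS[of x]] by (simp add: G_def)
  next
    case False
    then obtain r where r: "r < d" "\<bar>x r\<bar> > R" by auto
    have "(1::real) <= (\<Sum>r<d. indicator {y. \<bar>y\<bar> > R} (x r))"
      using r member_le_sum[of r "{..<d}" "%r. indicator {y. \<bar>y\<bar> > R} (x r) :: real"] by auto
    then have "2 * B * 1 <= 2 * B * (\<Sum>r<d. indicator {y. \<bar>y\<bar> > R} (x r))"
      using B0 by (intro mult_left_mono) auto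
    moreover have "\<bar>g (s x)\<bar> <= B" unfolding g_def by (rule B)
    ultimately show ?thesis using p(2)[OF sS[of x]] B[of x] by (simp add: G_def)
  qed
  have key: "\<bar>(\<integral>om. \<Phi> (W om) \<partial>P) - (\<integral>om. G (W om) \<partial>P)\<bar> <= 2 * e"
    if "prob_space P" and W: "!!r. r < d ==> (%om. W om r) \<in> borel_measurable P"
      and t: "!!r. r < d ==> measure P {om\<in>space P. \<bar>W om r\<bar> > R} <= e'" for P :: "'c measure" and W
  proof -
    interpret P: prob_space P by fact
    have m1[measurable]: "(%om. \<Phi> (W om)) \<in> borel_measurable P"
      by (rule finite_coords_measurable[OF K W])
    have m2[measurable]: "(%om. G (W om)) \<in> borel_measurable P"
      by (rule trig_sums_measurable[OF G W])
    obtain BG where BG: "!!x. \<bar>G x\<bar> <= BG" using trig_sums_bounded[OF G] by auto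
    have i1: "integrable P (%om. \<Phi> (W om))" using B by (intro P.integrable_const_bound[of _ B]) auto
    have i2: "integrable P (%om. G (W om))" using BG by (intro P.integrable_const_bound[of _ BG]) auto
    have ind: "(%om. indicator {y. \<bar>y\<bar> > R} (W om r)) = (indicator {om. \<bar>W om r\<bar> > R} :: _ => real)" for r
      by (auto simp: indicator_def)
    have ms: "{om\<in>space P. \<bar>W om r\<bar> > R} \<in> sets P" if "r < d" for r
      using W[OF that] by measurable
    have ii: "integrable P (%om. indicator {y. \<bar>y\<bar> > R} (W om r) :: real)" if "r < d" for r
      using W[OF that] by (intro P.integrable_const_bound[of _ 1]) (auto simp: indicator_def)
    have im: "(\<integral>om. indicator {y. \<bar>y\<bar> > R} (W om r) \<partial>P) = measure P {om\<in>space P. \<bar>W om r\<bar> > R}" if "r < d" for r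
    proof -
      have "(\<integral>om. indicator {y. \<bar>y\<bar> > R} (W om r) \<partial>P) = (\<integral>om. (indicator {om\<in>space P. \<bar>W om r\<bar> > R} om :: real) \<partial>P)"
        by (intro Bochner_Integration.integral_cong) (auto simp: indicator_def)
      then show ?thesis using ms[OF that] by simp
    qed
    have "\<bar>(\<integral>om. \<Phi> (W om) \<partial>P) - (\<integral>om. G (W om) \<partial>P)\<bar> = \<bar>\<integral>om. \<Phi> (W om) - G (W om) \<partial>P\<bar>"
      using i1 i2 by simp
    also have "... <= (\<integral>om. \<bar>\<Phi> (W om) - G (W om)\<bar> \<partial>P)" by (rule integral_abs_bound)
    also have "... <= (\<integral>om. e + 2 * B * (\<Sum>r<d. indicator {y. \<bar>y\<bar> > R} (W om r)) \<partial>P)"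
      using i1 i2 ii bnd
      by (intro integral_mono Bochner_Integration.integrable_add integrable_mult_right Bochner_Integration.integrable_sum) auto
    also have "... = e + 2 * B * (\<Sum>r<d. measure P {om\<in>space P. \<bar>W om r\<bar> > R})"
      using ii im by (subst Bochner_Integration.integral_add) (auto simp: P.prob_space intro!: integrable_mult_right Bochner_Integration.integrable_sum)
    also have "... <= e + 2 * B * (\<Sum>r<d. e')"
      using B0 t by (intro add_left_mono mult_left_mono sum_mono) auto
    also have "... <= 2 * e" using e'' by simp
    finally show ?thesis .
  qed
  have "\<forall>\<^sub>F n in sequentially. dist (\<integral>om. G (V n om) \<partial>M) (\<integral>om. G (V' om) \<partial>N) < e"
    using trig_sums_expectation_tendsto[OF assms(1,2) G V V' chf] e by (auto simp: tendsto_iff)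
  moreover have "\<forall>\<^sub>F n in sequentially. \<forall>r<d. measure M {om\<in>space M. \<bar>V n om r\<bar> > R} <= e'"
    using R0[OF Rge(2)] .
  ultimately have "\<forall>\<^sub>F n in sequentially. norm ((\<integral>om. \<Phi> (V n om) \<partial>M) - (\<integral>om. \<Phi> (V' om) \<partial>N)) < e0"
  proof eventually_elim
    case (elim n)
    have "\<bar>(\<integral>om. \<Phi> (V n om) \<partial>M) - (\<integral>om. G (V n om) \<partial>M)\<bar> <= 2 * e"
      by (rule key[OF assms(1) V]) (use elim in auto)
    moreover have "\<bar>(\<integral>om. \<Phi> (V' om) \<partial>N) - (\<integral>om. G (V' om) \<partial>N)\<bar> <= 2 * e"
      by (rule key[OF assms(2) V']) (use R1 Rge in auto)
    ultimately show ?case using elim(1) unfolding dist_real_def e_def real_norm_def by linarith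
  qed
  then show "\<exists>no. \<forall>n\<ge>no. norm ((\<integral>om. \<Phi> (V n om) \<partial>M) - (\<integral>om. \<Phi> (V' om) \<partial>N)) < e0"
    by (simp add: eventually_sequentially)
qed

lemma fidi_conv:
  fixes \<Phi> :: "('i => real) => real"
  assumes "prob_space M" "prob_space N" and F: "finite F"
    and V: "!!n r. r \<in> F ==> (%om. V n om r) \<in> borel_measurable M"
    and V': "!!r. r \<in> F ==> (%om. V' om r) \<in> borel_measurable N"
    and chf: "!!c. (%n. \<integral>om. iexp (\<Sum>r\<in>F. c r * V n om r) \<partial>M) \<longlonglongrightarrow> (\<integral>om. iexp (\<Sum>r\<in>F. c r * V' om r) \<partial>N)"
    and tight: "!!e. e > 0 ==> \<exists>R0. \<forall>R\<ge>R0. \<forall>\<^sub>F n in sequentially. \<forall>r\<in>F. measure M {om\<in>space M. \<bar>V n om r\<bar> > R} <= e"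
    and K: "0 <= K" "!!x y e. (!!r. r \<in> F ==> \<bar>x r - y r\<bar> <= e) ==> 0 <= e ==> \<bar>\<Phi> x - \<Phi> y\<bar> <= K * e"
    and B: "!!x. \<bar>\<Phi> x\<bar> <= B"
  shows "(%n. \<integral>om. \<Phi> (V n om) \<partial>M) \<longlonglongrightarrow> (\<integral>om. \<Phi> (V' om) \<partial>N)"
    and "(%om. \<Phi> (V n om)) \<in> borel_measurable M" and "(%om. \<Phi> (V' om)) \<in> borel_measurable N"
proof -
  define d where "d = card F"
  obtain b where b: "bij_betw b {..<d} F"
    using ex_bij_betw_nat_finite[OF F] by (auto simp: d_def atLeast0LessThan)
  define i where "i = the_inv_into {..<d} b"
  have ib: "i (b r) = r" if "r < d" for r
    unfolding i_def using b that by (intro the_inv_into_f_f) (auto simp: bij_betw_def)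
  have iF: "i x < d" "b (i x) = x" if "x \<in> F" for x
    using b that ib by (auto simp: bij_betw_def)
  have bF: "b r \<in> F" if "r < d" for r using b that by (auto simp: bij_betw_def)
  define \<Psi> where "\<Psi> y = \<Phi> (%x. y (i x))" for y
  have eq: "\<Psi> (%r. x (b r)) = \<Phi> x" for x
    using K(2)[of "%r. x (b (i r))" x 0] iF by (simp add: \<Psi>_def)
  have L: "\<bar>\<Psi> x - \<Psi> y\<bar> <= K * e" if "!!r. r < d ==> \<bar>x r - y r\<bar> <= e" "0 <= e" for x y e
    unfolding \<Psi>_def by (rule K(2)) (use that iF in auto)
  have sm: "(\<Sum>r\<in>F. c (i r) * g r) = (\<Sum>r<d. c r * g (b r))" for c g
    using sum.reindex_bij_betw[OF b, of "%r. c (i r) * g r"] ib by simp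
  have "(%n. \<integral>om. \<Psi> (%r. V n om (b r)) \<partial>M) \<longlonglongrightarrow> (\<integral>om. \<Psi> (%r. V' om (b r)) \<partial>N)"
  proof (rule fidi_conv_nat[OF assms(1,2), where d=d and K=K and B=B and \<Phi>=\<Psi> and V="%n om r. V n om (b r)" and V'="%om r. V' om (b r)"])
    fix c show "(%n. \<integral>om. iexp (\<Sum>r<d. c r * V n om (b r)) \<partial>M) \<longlonglongrightarrow> (\<integral>om. iexp (\<Sum>r<d. c r * V' om (b r)) \<partial>N)"
      using chf[of "%r. c (i r)"] unfolding sm .
  next
    fix e :: real assume "e > 0"
    from tight[OF this] obtain R0 where R0: "!!R. R\<ge>R0 ==> \<forall>\<^sub>F n in sequentially. \<forall>r\<in>F. measure M {om\<in>space M. \<bar>V n om r\<bar> > R} <= e"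
      by auto
    show "\<exists>R0. \<forall>R\<ge>R0. \<forall>\<^sub>F n in sequentially. \<forall>r<d. measure M {om\<in>space M. \<bar>V n om (b r)\<bar> > R} <= e"
      by (intro exI[of _ R0] allI impI) (rule eventually_mono[OF R0], use bF in auto)
  next
    fix x y :: "nat => real" and e :: real assume "!!r. r < d ==> \<bar>x r - y r\<bar> <= e" "0 <= e"
    then show "\<bar>\<Psi> x - \<Psi> y\<bar> <= K * e" by (rule L)
  qed (simp_all add: V V' bF K(1) B \<Psi>_def)
  then show "(%n. \<integral>om. \<Phi> (V n om) \<partial>M) \<longlonglongrightarrow> (\<integral>om. \<Phi> (V' om) \<partial>N)" by (simp add: eq)
  show "(%om. \<Phi> (V n om)) \<in> borel_measurable M"
    using finite_coords_measurable[where \<Phi>=\<Psi> and K=K and d=d, OF K(1) L, of "%om r. V n om (b r)" M] V bF by (simp add: eq)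
  show "(%om. \<Phi> (V' om)) \<in> borel_measurable N"
    using finite_coords_measurable[where \<Phi>=\<Psi> and K=K and d=d, OF K(1) L, of "%om r. V' om (b r)" N] V' bF by (simp add: eq)
qed

section \<open>Chaining for empirical processes\<close>

definition dproj :: "nat => real^'p => real^'p" where
  "dproj l u = (\<chi> i. real_of_int \<lfloor>2^l * u $ i\<rfloor> / 2^l)"

definition dceil :: "nat => real^'p => real^'p" where
  "dceil l u = (\<chi> i. min 1 ((real_of_int \<lfloor>2^l * u $ i\<rfloor> + 1) / 2^l))"

definition dgrid :: "nat => (real^'p) set" where
  "dgrid l = (%g. \<chi> i. real (g i) / 2^l) ` {g. \<forall>i. g i <= 2^l}"

text \<open>The links of the chaining. Rounding one point at two consecutive levels, or two points
  within one mesh, always produces such a pair. Their number is exponential in \<open>l\<close>, so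
  its logarithm is only linear.\<close>

definition dpairs :: "nat => ((real^'p) \<times> (real^'p)) set" where
  "dpairs l = {(a, b). a \<in> dgrid l & b \<in> dgrid l & (\<forall>i. \<bar>a $ i - b $ i\<bar> <= 1 / 2^l)}"

lemma dgrid_iff: "a \<in> dgrid l \<longleftrightarrow> (\<forall>i. \<exists>c::nat. c <= 2^l & a $ i = real c / 2^l)"
proof
  assume "\<forall>i. \<exists>c::nat. c <= 2^l & a $ i = real c / 2^l"
  then obtain g where "!!i. g i <= (2::nat)^l & a $ i = real (g i) / 2^l" by metis
  then show "a \<in> dgrid l" unfolding dgrid_def by (intro image_eqI[of _ _ g]) (auto simp: vec_eq_iff)
qed (auto simp: dgrid_def)

lemma finite_dgrid: "finite (dgrid l :: (real^'p) set)"
  and card_dgrid: "card (dgrid l :: (real^'p) set) <= (2^l + 1) ^ CARD('p)"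
proof -
  have *: "{g :: 'p => nat. \<forall>i. g i <= 2^l} = (\<Pi>\<^sub>E i\<in>UNIV. {..2^l})" by (auto simp: PiE_iff)
  have "finite {g :: 'p => nat. \<forall>i. g i <= 2^l}" unfolding * by (intro finite_PiE) auto
  then show "finite (dgrid l :: (real^'p) set)" "card (dgrid l :: (real^'p) set) <= (2^l + 1) ^ CARD('p)"
    unfolding dgrid_def using card_image_le[of "{g :: 'p => nat. \<forall>i. g i <= 2^l}" "%g. \<chi> i. real (g i) / 2^l"]
    by (auto simp: * card_PiE)
qed

lemma finite_dpairs: "finite (dpairs l :: ((real^'p) \<times> (real^'p)) set)"
  by (rule finite_subset[of _ "dgrid l \<times> dgrid l"]) (auto simp: dpairs_def finite_dgrid)

lemma card_dpairs: "card (dpairs l :: ((real^'p) \<times> (real^'p)) set) <= 2 ^ (2 * CARD('p) * (l + 1))"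
proof -
  have "card (dpairs l :: ((real^'p) \<times> (real^'p)) set) <= card ((dgrid l \<times> dgrid l) :: ((real^'p) \<times> (real^'p)) set)"
    by (rule card_mono) (auto simp: dpairs_def finite_dgrid)
  also have "... <= ((2^l + 1) ^ CARD('p)) * ((2^l + 1) ^ CARD('p))"
    by (simp only: card_cartesian_product) (intro mult_mono card_dgrid; simp)
  also have "... <= ((2^(l+1)) ^ CARD('p)) * ((2^(l+1)) ^ CARD('p))"
    by (intro mult_mono power_mono) auto
  also have "... = 2 ^ (2 * CARD('p) * (l + 1))"
    by (simp only: power_mult[symmetric] power_add[symmetric]) (simp add: algebra_simps)
  finally show ?thesis .
qed

lemma dgrid_cube: "a \<in> dgrid l ==> a \<in> cbox 0 1"
proof -
  assume a: "a \<in> dgrid l"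
  have "0 <= a $ i & a $ i <= 1" for i
  proof -
    obtain c :: nat where c: "c <= 2^l" "a $ i = real c / 2^l" using a by (auto simp: dgrid_iff)
    have "real c <= 2^l" using of_nat_mono[OF c(1), where ?'a=real] by simp
    then show ?thesis using c(2) by simp
  qed
  then show ?thesis by (simp add: mem_box_cart)
qed

lemma dgrid_Suc: "a \<in> dgrid l ==> a \<in> dgrid (Suc l)"
  unfolding dgrid_iff
proof
  fix i assume "\<forall>i. \<exists>c::nat. c <= 2^l & a $ i = real c / 2^l"
  then obtain c :: nat where "c <= 2^l" "a $ i = real c / 2^l" by blast
  then show "\<exists>c::nat. c <= 2 ^ Suc l & a $ i = real c / 2 ^ Suc l"
    by (intro exI[of _ "2 * c"]) auto
qed

lemma dproj_grid: "u \<in> cbox 0 1 ==> dproj l u \<in> dgrid l"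
  unfolding dgrid_iff
proof
  fix i assume "u \<in> cbox 0 1"
  then have u: "0 <= u $ i" "u $ i <= 1" by (auto simp: mem_box_cart)
  have "2^l * u $ i <= 2^l * 1" using u by (intro mult_left_mono) auto
  then have "\<lfloor>2^l * u $ i\<rfloor> <= 2^l" by (metis floor_mono floor_numeral_power mult.right_neutral)
  moreover have "0 <= \<lfloor>2^l * u $ i\<rfloor>" using u by simp
  ultimately show "\<exists>c::nat. c <= 2^l & dproj l u $ i = real c / 2^l"
    by (intro exI[of _ "nat \<lfloor>2^l * u $ i\<rfloor>"]) (auto simp: dproj_def nat_le_iff)
qed

lemma dproj_Suc_pair:
  assumes "u \<in> cbox 0 1" shows "(dproj (Suc l) u, dproj l u) \<in> dpairs (Suc l)"
proof -
  have "\<bar>dproj (Suc l) u $ i - dproj l u $ i\<bar> <= 1 / 2 ^ Suc l" for i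
  proof -
    let ?x = "2^l * u $ i"
    have "\<lfloor>2 * ?x\<rfloor> = 2 * \<lfloor>?x\<rfloor> \<or> \<lfloor>2 * ?x\<rfloor> = 2 * \<lfloor>?x\<rfloor> + 1" by linarith
    then have "\<bar>real_of_int \<lfloor>2 * ?x\<rfloor> - 2 * real_of_int \<lfloor>?x\<rfloor>\<bar> <= 1" by linarith
    moreover have "dproj (Suc l) u $ i - dproj l u $ i = (real_of_int \<lfloor>2 * ?x\<rfloor> - 2 * real_of_int \<lfloor>?x\<rfloor>) / 2 ^ Suc l"
      by (simp add: dproj_def mult.assoc field_simps)
    ultimately show ?thesis by (simp add: abs_divide divide_right_mono del: power_Suc)
  qed
  then show ?thesis using dproj_grid[OF assms] dgrid_Suc by (auto simp: dpairs_def)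
qed

lemma dproj_near_pair:
  assumes "u \<in> cbox 0 1" "v \<in> cbox 0 1" "!!i. \<bar>u $ i - v $ i\<bar> <= 1 / 2^l"
  shows "(dproj l u, dproj l v) \<in> dpairs l"
proof -
  have "\<bar>dproj l u $ i - dproj l v $ i\<bar> <= 1 / 2 ^ l" for i
  proof -
    have "\<bar>2^l * u $ i - 2^l * v $ i\<bar> = 2^l * \<bar>u $ i - v $ i\<bar>"
      by (metis abs_mult abs_numeral power_abs right_diff_distrib)
    also have "... <= 1" using assms(3)[of i] by (simp add: field_simps)
    finally have "2^l * u $ i <= 2^l * v $ i + 1" "2^l * v $ i <= 2^l * u $ i + 1" by (simp_all add: abs_le_iff)
    from this[THEN floor_mono]
    have "\<bar>real_of_int \<lfloor>2^l * u $ i\<rfloor> - real_of_int \<lfloor>2^l * v $ i\<rfloor>\<bar> <= 1" by simp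
    then show ?thesis by (simp add: dproj_def diff_divide_distrib[symmetric] abs_divide divide_right_mono)
  qed
  then show ?thesis using dproj_grid assms by (auto simp: dpairs_def)
qed

lemma dproj_dist: "0 <= u $ i - dproj l u $ i" "u $ i - dproj l u $ i <= 1 / 2^l"
proof -
  have "u $ i - dproj l u $ i = (2^l * u $ i - real_of_int \<lfloor>2^l * u $ i\<rfloor>) / 2^l"
    by (simp add: dproj_def field_simps)
  moreover have "0 <= 2^l * u $ i - real_of_int \<lfloor>2^l * u $ i\<rfloor>" "2^l * u $ i - real_of_int \<lfloor>2^l * u $ i\<rfloor> <= 1" by linarith+
  ultimately show "0 <= u $ i - dproj l u $ i" "u $ i - dproj l u $ i <= 1 / 2^l"
    by (simp_all add: divide_right_mono)
qed

lemma dproj_dceil: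
  assumes u: "u \<in> cbox 0 1"
  shows "(dceil l u, dproj l u) \<in> dpairs l" "dproj l u $ i <= u $ i" "u $ i <= dceil l u $ i"
proof -
  have u1: "0 <= u $ i" "u $ i <= 1" for i using u by (auto simp: mem_box_cart)
  have "\<exists>c::nat. c <= 2^l & dceil l u $ i = real c / 2^l & \<bar>dceil l u $ i - dproj l u $ i\<bar> <= 1 / 2^l" for i
  proof (cases "\<lfloor>2^l * u $ i\<rfloor> < 2^l")
    case True
    have nn: "0 <= \<lfloor>2^l * u $ i\<rfloor>" using u1 by simp
    have "real_of_int (\<lfloor>2^l * u $ i\<rfloor> + 1) <= real_of_int (2^l)" using True by linarith
    then have "(real_of_int \<lfloor>2^l * u $ i\<rfloor> + 1) / 2^l <= 1" by simp
    then have "dceil l u $ i = (real_of_int \<lfloor>2^l * u $ i\<rfloor> + 1) / 2^l" by (simp add: dceil_def)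
    then show ?thesis using True nn
      by (intro exI[of _ "nat (\<lfloor>2^l * u $ i\<rfloor> + 1)"]) (auto simp: dproj_def diff_divide_distrib[symmetric] nat_le_iff)
  next
    \<comment> \<open>Only the coordinate value 1 has this floor; the cap in \<open>dceil\<close>
      keeps the upper neighbour on the grid, and both roundings equal 1.\<close>
    case False
    obtain c :: nat where c: "c <= 2^l" "dproj l u $ i = real c / 2^l" using dproj_grid[OF u, of l] by (auto simp: dgrid_iff)
    then have "real_of_int \<lfloor>2^l * u $ i\<rfloor> = real c" by (simp add: dproj_def)
    then have "\<lfloor>2^l * u $ i\<rfloor> = int c" by linarith
    then have "int (2^l) <= int c" using False by simp
    then have "c = 2^l" using c(1) by (simp only: of_nat_le_iff)
    then have "dproj l u $ i = 1" "dceil l u $ i = 1" using c(2) \<open>real_of_int \<lfloor>2^l * u $ i\<rfloor> = real c\<close>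
      by (auto simp: dceil_def field_simps)
    then show ?thesis by (intro exI[of _ "2^l"]) auto
  qed
  then show "(dceil l u, dproj l u) \<in> dpairs l" using dproj_grid[OF u, of l] unfolding dpairs_def dgrid_iff
    by blast
  show "dproj l u $ i <= u $ i" using dproj_dist(1)[of u i l] by simp
  have "2^l * u $ i <= real_of_int \<lfloor>2^l * u $ i\<rfloor> + 1" by linarith
  then have "u $ i <= (real_of_int \<lfloor>2^l * u $ i\<rfloor> + 1) / 2^l" by (simp add: field_simps)
  then show "u $ i <= dceil l u $ i" using u1 by (simp add: dceil_def)
qed

lemma chain_proj:
  assumes M: "!!m a b. l < m ==> m <= L ==> (a, b) \<in> dpairs m ==> \<bar>g a - g b\<bar> <= Mm m"
    and u: "u \<in> cbox 0 1" and "l <= L"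
  shows "\<bar>g (dproj L u) - g (dproj l u)\<bar> <= (\<Sum>m\<in>{l<..L}. Mm m :: real)"
  using \<open>l <= L\<close> M
proof (induction L rule: dec_induct)
  case base then show ?case by simp
next
  case (step L)
  have "\<bar>g (dproj L u) - g (dproj l u)\<bar> <= (\<Sum>m\<in>{l<..L}. Mm m)" using step by simp
  moreover have "\<bar>g (dproj (Suc L) u) - g (dproj L u)\<bar> <= Mm (Suc L)"
    using step(1) by (intro step(4) dproj_Suc_pair[OF u]) auto
  moreover have "{l<..Suc L} = insert (Suc L) {l<..L}" using step(1) by auto
  ultimately show ?case by simp
qed

text \<open>Both points are followed from level \<open>L\<close> down to level \<open>l\<close>,
  where their roundings are neighbours. The link at level \<open>l\<close> occurs once; counting it
  twice merely gives the bound the shape of a single sum.\<close>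

lemma chain_pair:
  assumes M: "!!m a b. l <= m ==> m <= L ==> (a, b) \<in> dpairs m ==> \<bar>g a - g b\<bar> <= Mm m"
    and u: "u \<in> cbox 0 1" "v \<in> cbox 0 1" "!!i. \<bar>u $ i - v $ i\<bar> <= 1 / 2^l" and l: "l <= L"
  shows "\<bar>g (dproj L u) - g (dproj L v)\<bar> <= 2 * (\<Sum>m\<in>{l..L}. Mm m :: real)"
proof -
  have 0: "0 <= Mm l" using M[OF order_refl l dproj_near_pair[OF u]] by linarith
  have "\<bar>g (dproj L w) - g (dproj l w)\<bar> <= (\<Sum>m\<in>{l<..L}. Mm m)" if "w \<in> cbox 0 1" for w
    by (rule chain_proj[OF M that l]) auto
  moreover have "\<bar>g (dproj L u) - g (dproj L v)\<bar> <= \<bar>g (dproj L u) - g (dproj l u)\<bar> + \<bar>g (dproj l u) - g (dproj l v)\<bar> + \<bar>g (dproj L v) - g (dproj l v)\<bar>"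
    by linarith
  ultimately have "\<bar>g (dproj L u) - g (dproj L v)\<bar> <= (\<Sum>m\<in>{l<..L}. Mm m) + \<bar>g (dproj l u) - g (dproj l v)\<bar> + (\<Sum>m\<in>{l<..L}. Mm m)"
    using u(1,2) by (meson add_mono order_refl order_trans)
  with M[OF order_refl l dproj_near_pair[OF u]] 0
  have "\<bar>g (dproj L u) - g (dproj L v)\<bar> <= 2 * (Mm l + (\<Sum>m\<in>{l<..L}. Mm m))" by (simp add: algebra_simps)
  also have "Mm l + (\<Sum>m\<in>{l<..L}. Mm m) = (\<Sum>m\<in>{l..L}. Mm m)"
    using l by (simp add: sum.head)
  finally show ?thesis .
qed

section \<open>Maximal inequality and constants of the chaining\<close>

lemma (in prob_space) max_via_mgf:
  fixes d :: "'i => 'a => real"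
  assumes S: "finite S" "S ~= {}" and lam: "lam > 0"
    and d[measurable]: "!!i. i \<in> S ==> d i \<in> borel_measurable M"
    and int: "!!i. i \<in> S ==> integrable M (%x. exp (lam * d i x))" "!!i. i \<in> S ==> integrable M (%x. exp (- lam * d i x))"
    and b: "!!i. i \<in> S ==> expectation (%x. exp (lam * d i x)) <= exp b" "!!i. i \<in> S ==> expectation (%x. exp (- lam * d i x)) <= exp b"
  shows "\<exists>Mx. Mx \<in> borel_measurable M & integrable M Mx & (\<forall>i\<in>S. \<forall>x. \<bar>d i x\<bar> <= Mx x) &
    expectation Mx <= (ln (2 * real (card S)) + b) / lam"
proof -
  define Y where "Y x = (\<Sum>i\<in>S. exp (lam * d i x) + exp (- lam * d i x))" for x
  define c where "c = 2 * real (card S) * exp b"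
  have card: "card S > 0" using S by (simp add: card_gt_0_iff)
  have c: "c > 0" using card by (simp add: c_def)
  have Yint: "integrable M Y" unfolding Y_def using int by (intro Bochner_Integration.integrable_sum Bochner_Integration.integrable_add)
  have "expectation Y = (\<Sum>i\<in>S. expectation (%x. exp (lam * d i x)) + expectation (%x. exp (- lam * d i x)))"
    unfolding Y_def using int by simp
  also have "... <= (\<Sum>i\<in>S. exp b + exp b)" by (intro sum_mono add_mono b)
  also have "... = c" by (simp add: c_def)
  finally have EY: "expectation Y <= c" .
  \<comment> \<open>The tangent line of the logarithm at \<open>c\<close>: it bounds
    \<open>ln (Y x) / lam\<close> and is integrable because \<open>Y\<close> is. Jensen's inequality
    is avoided, and a single variable dominates all \<open>d i\<close> pointwise.\<close>
  let ?M = "%x. (Y x / c + (ln c - 1)) / lam"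
  have bound: "\<bar>d i x\<bar> <= ?M x" if i: "i \<in> S" for i x
  proof -
    have "exp (lam * \<bar>d i x\<bar>) <= exp (lam * d i x) + exp (- lam * d i x)"
      by (cases "d i x >= 0") auto
    also have "... <= Y x" unfolding Y_def by (rule member_le_sum[OF i]) (auto simp: S)
    finally have 1: "exp (lam * \<bar>d i x\<bar>) <= Y x" .
    then have Y0: "Y x > 0" by (rule less_le_trans[OF exp_gt_zero])
    have "lam * \<bar>d i x\<bar> <= ln (Y x)" using 1 Y0 by (simp add: ln_ge_iff)
    also have "ln (Y x) = ln (Y x / c) + ln c" using Y0 c by (simp add: ln_div)
    also have "ln (Y x / c) <= Y x / c - 1" using Y0 c by (intro ln_le_minus_one) simp
    finally show ?thesis using lam by (simp add: field_simps)
  qed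
  have "integrable M ?M" using Yint by auto
  moreover have "expectation ?M <= (ln (2 * real (card S)) + b) / lam"
  proof -
    have "expectation ?M = (expectation Y / c + (ln c - 1)) / lam"
      using Yint by (simp add: prob_space)
    also have "... <= (1 + (ln c - 1)) / lam"
      using EY c lam by (intro divide_right_mono add_right_mono) auto
    also have "1 + (ln c - 1) = ln (2 * real (card S)) + b" using card by (simp add: c_def ln_mult)
    finally show ?thesis .
  qed
  moreover have "?M \<in> borel_measurable M" using Yint by auto
  ultimately show ?thesis using bound by blast
qed

text \<open>Expectation bound for the largest increment over \<open>dpairs m\<close>, per square
  root of the sample size: the logarithm of the number of pairs plus the exponent of the moment
  generating function, divided by the slope \<open>sqrt (2^m) / 2\<close>. The argument
  \<open>p\<close> is the dimension. The numerator grows linearly in \<open>m\<close>, which makes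
  the series summable.\<close>

definition chain_const :: "real => real => nat => real" where
  "chain_const p C m = 2 * (1 + 2 * p * (real m + 1) + C * p) / sqrt (2^m)"

lemma chain_const_nonneg: "0 <= p ==> 0 <= C ==> 0 <= chain_const p C m"
  by (simp add: chain_const_def)

lemma summable_chain_const: "summable (chain_const p C)"
proof -
  let ?z = "1 / sqrt 2 :: real"
  have z: "norm ?z < 1" by simp
  have "summable (%m. (2 + 2 * C * p) * ?z^m + 4 * p * (of_nat (Suc m) * ?z^m))"
    using geometric_deriv_sums[OF z] z
    by (intro summable_add summable_mult summable_geometric) (auto simp: sums_iff)
  also have "(%m. (2 + 2 * C * p) * ?z^m + 4 * p * (of_nat (Suc m) * ?z^m)) = chain_const p C"
    by (rule ext) (simp add: chain_const_def real_sqrt_power power_divide add_divide_distrib ring_distribs)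
  finally show ?thesis .
qed

definition chain_tail :: "real => real => nat => real" where
  "chain_tail p C l = (\<Sum>m. chain_const p C (m + l))"

lemma chain_tail_tendsto: "chain_tail p C \<longlonglongrightarrow> 0"
  unfolding chain_tail_def using suminf_exist_split2[OF summable_chain_const] .

lemma chain_sum_le_tail:
  assumes "0 <= p" "0 <= C" shows "(\<Sum>m\<in>{l..L}. chain_const p C m) <= chain_tail p C l"
proof (cases "l <= L")
  case True
  have "(\<Sum>m\<in>{l..L}. chain_const p C m) = (\<Sum>m\<in>{0..L-l}. chain_const p C (m + l))"
    using sum.shift_bounds_cl_nat_ivl[of "chain_const p C" 0 l "L - l"] True by simp
  also have "... <= chain_tail p C l" unfolding chain_tail_def
    using assms by (intro sum_le_suminf summable_ignore_initial_segment summable_chain_const) (auto intro: chain_const_nonneg)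
  finally show ?thesis .
next
  case False
  then show ?thesis unfolding chain_tail_def using assms
    by (auto intro!: suminf_nonneg summable_ignore_initial_segment summable_chain_const chain_const_nonneg)
qed

lemma ln_card_dpairs:
  "ln (2 * real (card (dpairs m :: ((real^'p) \<times> (real^'p)) set))) <= 1 + 2 * real CARD('p) * (real m + 1)"
proof -
  have ne: "(0, 0) \<in> (dpairs m :: ((real^'p) \<times> (real^'p)) set)" by (auto simp: dpairs_def dgrid_iff intro: exI[of _ 0])
  then have c: "card (dpairs m :: ((real^'p) \<times> (real^'p)) set) > 0" using finite_dpairs card_gt_0_iff by blast
  have "2 * real (card (dpairs m :: ((real^'p) \<times> (real^'p)) set)) <= 2 * 2 ^ (2 * CARD('p) * (m + 1))"
    using of_nat_mono[OF card_dpairs[where 'p='p], where ?'a=real, of m] by simp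
  also have "... = 2 ^ (1 + 2 * CARD('p) * (m + 1))" by simp
  finally have "ln (2 * real (card (dpairs m :: ((real^'p) \<times> (real^'p)) set))) <= ln (2 ^ (1 + 2 * CARD('p) * (m + 1)))"
    using c by (subst ln_le_cancel_iff) auto
  also have "... = real (1 + 2 * CARD('p) * (m + 1)) * ln 2" by (rule ln_realpow)
  also have "... <= real (1 + 2 * CARD('p) * (m + 1)) * 1" using ln_2_less_1 by (intro mult_left_mono) auto
  finally show ?thesis by (simp add: algebra_simps)
qed

lemma exp_le_quadratic: "exp y <= 1 + y + y\<^sup>2" if "y <= 1" for y :: real
proof (cases "0 <= y")
  case True then show ?thesis using exp_bound[OF True that] by simp
next
  case False
  have 1: "1 - y <= exp (- y)" using exp_ge_add_one_self[of "-y"] by simp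
  have "exp y = 1 / exp (- y)" by (simp add: exp_minus field_simps)
  also have "... <= 1 / (1 - y)" using False 1 by (intro divide_left_mono) (auto intro: mult_pos_pos)
  also have "... <= 1 + y + y\<^sup>2"
  proof -
    have "(1 + y + y\<^sup>2) * (1 - y) = 1 - y * y\<^sup>2" by (simp add: algebra_simps power2_eq_square)
    moreover have "y * y\<^sup>2 <= 0" using False by (intro mult_nonpos_nonneg) auto
    ultimately show ?thesis using False by (simp add: divide_le_eq)
  qed
  finally show ?thesis .
qed

lemma PiM_indep_coords:
  assumes "!!i. prob_space (Q i)"
  shows "prob_space.indep_vars (PiM UNIV Q) Q (%i x. x i) UNIV"
proof -
  interpret prob_space "PiM UNIV Q" by (intro prob_space_PiM assms)
  have 1: "distr (PiM UNIV Q) (Q i) (%x. x i) = Q i" for i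
    by (rule distr_PiM_component) (auto simp: assms)
  have "distr (PiM UNIV Q) (PiM UNIV Q) (%x. \<lambda>i\<in>UNIV. x i) = PiM UNIV Q"
    by (simp add: restrict_UNIV distr_id2)
  then show ?thesis by (subst indep_vars_iff_distr_eq_PiM') (auto simp: 1)
qed

lemma integral_PiM_component:
  fixes g :: "'s => 'b::{banach, second_countable_topology}"
  assumes "!!i. prob_space (Q i)" "g \<in> borel_measurable (Q i)"
  shows "(\<integral>x. g (x i) \<partial>PiM UNIV Q) = (\<integral>y. g y \<partial>Q i)"
    and "integrable (PiM UNIV Q) (%x. g (x i)) \<longleftrightarrow> integrable (Q i) g"
proof -
  have 1: "distr (PiM UNIV Q) (Q i) (%x. x i) = Q i"
    by (rule distr_PiM_component) (auto simp: assms)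
  show "(\<integral>x. g (x i) \<partial>PiM UNIV Q) = (\<integral>y. g y \<partial>Q i)"
    using integral_distr[of "%x. x i" "PiM UNIV Q" "Q i" g] assms 1 by simp
  show "integrable (PiM UNIV Q) (%x. g (x i)) \<longleftrightarrow> integrable (Q i) g"
    using integrable_distr_eq[of "%x. x i" "PiM UNIV Q" "Q i" g] assms 1 by simp
qed

text \<open>Abstracts the indicators of lower orthants. Values in the unit interval turn the
  L1-Lipschitz bound into a variance bound of order \<open>1 / 2^m\<close> for neighbours at level
  \<open>m\<close>, and monotonicity in the index controls what happens between grid points.\<close>

locale unif_class = prob_space P for P :: "'s measure" +
  fixes f :: "real^'p => 's => real" and C :: real
  assumes f_meas[measurable]: "!!u. f u \<in> borel_measurable P"
    and f01: "!!u x. 0 <= f u x" "!!u x. f u x <= 1"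
    and f_mono: "!!u v x. (!!i. u $ i <= v $ i) ==> f u x <= f v x"
    and C: "0 <= C"
    and f_lip: "!!u v. u \<in> cbox 0 1 ==> v \<in> cbox 0 1 ==> expectation (%x. \<bar>f u x - f v x\<bar>) <= C * (\<Sum>i\<in>UNIV. \<bar>u $ i - v $ i\<bar>)"
begin

definition T :: "nat set => real^'p => (nat => 's) => real" where
  "T J u x = (\<Sum>i\<in>J. f u (x i) - expectation (f u))"

sublocale seqP: prob_space "PiM UNIV (%_::nat. P)"
  by (intro prob_space_PiM) unfold_locales

lemma f_int: "integrable P (f u)"
  by (intro integrable_const_bound[of _ 1]) (auto simp: f01)

lemma Ef: "0 <= expectation (f u)" "expectation (f u) <= 1"
proof -
  show "0 <= expectation (f u)" using f01 by (intro Bochner_Integration.integral_nonneg) auto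
  have "expectation (f u) <= expectation (%_. 1)" using f01 f_int by (intro integral_mono) auto
  then show "expectation (f u) <= 1" by (simp add: prob_space)
qed

lemma Ef_diff: "u \<in> cbox 0 1 ==> v \<in> cbox 0 1 ==> \<bar>expectation (f u) - expectation (f v)\<bar> <= C * (\<Sum>i\<in>UNIV. \<bar>u $ i - v $ i\<bar>)"
proof -
  assume uv: "u \<in> cbox 0 1" "v \<in> cbox 0 1"
  have "\<bar>expectation (f u) - expectation (f v)\<bar> = \<bar>expectation (%x. f u x - f v x)\<bar>" using f_int by simp
  also have "... <= expectation (%x. \<bar>f u x - f v x\<bar>)" by (rule integral_abs_bound)
  finally show ?thesis using f_lip[OF uv] by linarith
qed

lemma T_meas[measurable]: "T J u \<in> borel_measurable (PiM UNIV (%_. P))"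
  unfolding T_def by measurable

text \<open>The bounds on \<open>g\<close> and \<open>\<mu>\<close> keep the exponent at most 1,
  where \<open>exp y \<le> 1 + y + y\<^sup>2\<close>; the linear term vanishes by centring, and
  independence multiplies the factors.\<close>

lemma mgf_sum:
  assumes g[measurable]: "g \<in> borel_measurable P" and g2: "!!y. \<bar>g y\<bar> <= 2" and "expectation g = 0"
    and s: "expectation (%y. (g y)\<^sup>2) <= s" and \<mu>: "\<bar>\<mu>\<bar> <= 1/2" and J: "finite J"
  shows "integrable (PiM UNIV (%_::nat. P)) (%x. exp (\<mu> * (\<Sum>i\<in>J. g (x i))))"
    and "seqP.expectation (%x. exp (\<mu> * (\<Sum>i\<in>J. g (x i)))) <= exp (real (card J) * (\<mu>\<^sup>2 * s))"
proof -
  have le1: "\<bar>\<mu> * g y\<bar> <= 1" for y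
  proof -
    have "\<bar>\<mu>\<bar> * \<bar>g y\<bar> <= 1/2 * 2" using \<mu> g2 by (intro mult_mono) auto
    then show ?thesis by (simp add: abs_mult)
  qed
  have i0: "integrable P g" "integrable P (%y. (g y)\<^sup>2)"
  proof -
    show "integrable P g" by (rule integrable_const_bound[of _ 2]) (auto simp: g2)
    have "(g y)\<^sup>2 <= 4" for y using power_mono[OF g2[of y], of 2] by simp
    then show "integrable P (%y. (g y)\<^sup>2)" by (intro integrable_const_bound[of _ 4]) auto
  qed
  have ie: "integrable P (%y. exp (\<mu> * g y))"
    using le1 by (intro integrable_const_bound[of _ "exp 1"]) (auto simp: abs_le_iff)
  have e1: "expectation (%y. exp (\<mu> * g y)) <= exp (\<mu>\<^sup>2 * s)"
  proof -
    have "expectation (%y. exp (\<mu> * g y)) <= expectation (%y. 1 + \<mu> * g y + (\<mu> * g y)\<^sup>2)"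
      using ie i0 le1 by (intro integral_mono exp_le_quadratic) (auto simp: abs_le_iff power_mult_distrib)
    also have "... = 1 + \<mu>\<^sup>2 * expectation (%y. (g y)\<^sup>2)"
      using i0 assms(3) by (simp add: power_mult_distrib prob_space)
    also have "... <= 1 + \<mu>\<^sup>2 * s" using s by (intro add_left_mono mult_left_mono) auto
    also have "... <= exp (\<mu>\<^sup>2 * s)" by (rule exp_ge_add_one_self)
    finally show ?thesis .
  qed
  have ind: "seqP.indep_vars (%_. borel) (%i x. exp (\<mu> * g (x i))) J"
    using seqP.indep_vars_compose2[OF seqP.indep_vars_subset[OF PiM_indep_coords[of "%_::nat. P"]], of J "%_ y. exp (\<mu> * g y)"]
      prob_space_axioms by simp
  have eq: "exp (\<mu> * (\<Sum>i\<in>J. g (x i))) = (\<Prod>i\<in>J. exp (\<mu> * g (x i)))" for x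
    using J by (simp add: sum_distrib_left exp_sum)
  have ic: "integrable (PiM UNIV (%_::nat. P)) (%x. exp (\<mu> * g (x i)))" for i
    using integral_PiM_component(2)[of "%_::nat. P" "%y. exp (\<mu> * g y)" i] ie prob_space_axioms by simp
  show "integrable (PiM UNIV (%_::nat. P)) (%x. exp (\<mu> * (\<Sum>i\<in>J. g (x i))))"
    unfolding eq by (rule seqP.indep_vars_integrable[OF J ind ic])
  have "seqP.expectation (%x. exp (\<mu> * (\<Sum>i\<in>J. g (x i)))) = (\<Prod>i\<in>J. seqP.expectation (%x. exp (\<mu> * g (x i))))"
    unfolding eq by (rule seqP.indep_vars_lebesgue_integral[OF J ind ic])
  also have "... = (\<Prod>i\<in>J. expectation (%y. exp (\<mu> * g y)))"
    using integral_PiM_component(1)[of "%_::nat. P" "%y. exp (\<mu> * g y)"] prob_space_axioms by simp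
  also have "... <= (\<Prod>i\<in>J. exp (\<mu>\<^sup>2 * s))" using e1 by (intro prod_mono) auto
  also have "... = exp (real (card J) * (\<mu>\<^sup>2 * s))" by (simp add: exp_of_nat_mult)
  finally show "seqP.expectation (%x. exp (\<mu> * (\<Sum>i\<in>J. g (x i)))) <= exp (real (card J) * (\<mu>\<^sup>2 * s))" .
qed

lemma level_bound:
  assumes J: "finite J" and k: "2^m <= card J"
  shows "\<exists>Mx. Mx \<in> borel_measurable (PiM UNIV (%_::nat. P)) & integrable (PiM UNIV (%_::nat. P)) Mx &
    (\<forall>(a, b)\<in>dpairs m. \<forall>x. \<bar>T J a x - T J b x\<bar> <= Mx x) &
    seqP.expectation Mx <= sqrt (card J) * chain_const CARD('p) C m"
proof -
  let ?k = "real (card J)"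
  have "real (2^m) <= ?k" using k by (rule of_nat_mono)
  then have k': "2^m <= ?k" by simp
  then have k0: "?k > 0" by (rule less_le_trans[rotated]) simp
  \<comment> \<open>The slope for which \<open>?k * (lam\<^sup>2 * s)\<close> is the constant
    \<open>C * real CARD('p) / 4\<close>. It is at most 1/2 because the level satisfies
    \<open>2^m \<le> card J\<close>.\<close>
  define lam where "lam = sqrt (2^m) / (2 * sqrt ?k)"
  have lam0: "lam > 0" using k0 by (simp add: lam_def)
  have lam1: "lam <= 1/2" using k' k0 by (simp add: lam_def field_simps)
  define s where "s = C * real CARD('p) / 2^m"
  let ?d = "%(a, b) x. T J a x - T J b x"
  have bd: "integrable (PiM UNIV (%_::nat. P)) (%x. exp (\<mu> * ?d ab x)) &
      seqP.expectation (%x. exp (\<mu> * ?d ab x)) <= exp (C * real CARD('p))"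
    if ab: "ab \<in> dpairs m" and \<mu>: "\<bar>\<mu>\<bar> = lam" for ab \<mu>
  proof -
    obtain a b where [simp]: "ab = (a, b)" by (cases ab)
    have cube: "a \<in> cbox 0 1" "b \<in> cbox 0 1" using ab dgrid_cube by (auto simp: dpairs_def)
    define g where "g y = (f a y - f b y) - (expectation (f a) - expectation (f b))" for y
    have gm: "g \<in> borel_measurable P" unfolding g_def by measurable
    have g2: "\<bar>g y\<bar> <= 2" for y unfolding g_def
      using f01(1)[of a y] f01(1)[of b y] f01(2)[of a y] f01(2)[of b y] Ef[of a] Ef[of b] by linarith
    have g0: "expectation g = 0" unfolding g_def using f_int by (simp add: prob_space)
    have sq: "(f a y - f b y)\<^sup>2 <= \<bar>f a y - f b y\<bar>" for y
    proof -
      have "\<bar>f a y - f b y\<bar> <= 1" using f01(1)[of a y] f01(1)[of b y] f01(2)[of a y] f01(2)[of b y] by linarith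
      then have "\<bar>f a y - f b y\<bar> * \<bar>f a y - f b y\<bar> <= \<bar>f a y - f b y\<bar> * 1" by (intro mult_left_mono) auto
      then show ?thesis by (simp add: power2_eq_square)
    qed
    have isq: "integrable P (%y. (f a y - f b y)\<^sup>2)"
    proof (rule integrable_const_bound[of _ 1])
      show "AE x in P. norm ((f a x - f b x)\<^sup>2) <= 1"
      proof (rule AE_I2)
        fix y show "norm ((f a y - f b y)\<^sup>2) <= 1"
          using sq[of y] f01(1)[of a y] f01(1)[of b y] f01(2)[of a y] f01(2)[of b y] by simp
      qed
    qed simp
    have "expectation (%y. (g y)\<^sup>2) = expectation (%y. (f a y - f b y)\<^sup>2) - (expectation (f a) - expectation (f b))\<^sup>2"
    proof -
      let ?c = "expectation (f a) - expectation (f b)"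
      have "(%y. (g y)\<^sup>2) = (%y. (f a y - f b y)\<^sup>2 - 2 * ?c * (f a y - f b y) + ?c\<^sup>2)"
        by (rule ext) (simp add: g_def power2_eq_square algebra_simps)
      then show ?thesis using isq f_int by (simp add: prob_space) (simp add: power2_eq_square algebra_simps)
    qed
    also have "... <= expectation (%y. (f a y - f b y)\<^sup>2)" by simp
    also have "... <= expectation (%y. \<bar>f a y - f b y\<bar>)" using isq f_int sq by (intro integral_mono) auto
    also have "... <= C * (\<Sum>i\<in>UNIV. \<bar>a $ i - b $ i\<bar>)" by (rule f_lip[OF cube])
    also have "... <= C * (\<Sum>i\<in>(UNIV::'p set). 1 / 2^m)"
      using ab C by (intro mult_left_mono sum_mono) (auto simp: dpairs_def)
    also have "... = s" by (simp add: s_def)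
    finally have gs: "expectation (%y. (g y)\<^sup>2) <= s" .
    have deq: "?d ab x = (\<Sum>i\<in>J. g (x i))" for x
      by (simp add: T_def g_def sum_subtractf[symmetric] algebra_simps)
    have \<mu>': "\<bar>\<mu>\<bar> <= 1/2" using \<mu> lam1 by simp
    have "?k * (\<mu>\<^sup>2 * s) = C * real CARD('p) / 4"
    proof -
      have "\<mu>\<^sup>2 = lam\<^sup>2" using \<mu> by (metis power2_abs)
      also have "... = 2^m / (4 * ?k)" using k0 by (simp add: lam_def power_divide power_mult_distrib)
      finally show ?thesis using k0 by (simp add: s_def)
    qed
    moreover have "C * real CARD('p) / 4 <= C * real CARD('p)" using C by simp
    ultimately have "exp (?k * (\<mu>\<^sup>2 * s)) <= exp (C * real CARD('p))" by simp
    then show ?thesis unfolding deq using mgf_sum[OF gm g2 g0 gs \<mu>' J] by linarith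
  qed
  have ne: "(dpairs m :: ((real^'p) \<times> (real^'p)) set) ~= {}"
  proof -
    have "(0, 0) \<in> (dpairs m :: ((real^'p) \<times> (real^'p)) set)" by (auto simp: dpairs_def dgrid_iff intro: exI[of _ 0])
    then show ?thesis by blast
  qed
  have "\<exists>Mx. Mx \<in> borel_measurable (PiM UNIV (%_::nat. P)) & integrable (PiM UNIV (%_::nat. P)) Mx &
     (\<forall>ab\<in>dpairs m. \<forall>x. \<bar>?d ab x\<bar> <= Mx x) &
    seqP.expectation Mx <= (ln (2 * real (card (dpairs m :: ((real^'p) \<times> (real^'p)) set))) + C * real CARD('p)) / lam"
  proof (rule seqP.max_via_mgf[OF finite_dpairs ne lam0])
    fix ab :: "(real^'p) \<times> (real^'p)" assume ab: "ab \<in> dpairs m"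
    show "?d ab \<in> borel_measurable (PiM UNIV (%_::nat. P))" by (cases ab) simp
    show "integrable (PiM UNIV (%_::nat. P)) (%x. exp (lam * ?d ab x))" "integrable (PiM UNIV (%_::nat. P)) (%x. exp (- lam * ?d ab x))"
       "seqP.expectation (%x. exp (lam * ?d ab x)) <= exp (C * real CARD('p))" "seqP.expectation (%x. exp (- lam * ?d ab x)) <= exp (C * real CARD('p))"
      using bd[OF ab, of lam] bd[OF ab, of "- lam"] lam0 by auto
  qed
  then obtain Mx where Mx: "Mx \<in> borel_measurable (PiM UNIV (%_::nat. P))" "integrable (PiM UNIV (%_::nat. P)) Mx"
     "\<forall>ab\<in>dpairs m. \<forall>x. \<bar>?d ab x\<bar> <= Mx x"
    "seqP.expectation Mx <= (ln (2 * real (card (dpairs m :: ((real^'p) \<times> (real^'p)) set))) + C * real CARD('p)) / lam"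
    by blast
  have "(ln (2 * real (card (dpairs m :: ((real^'p) \<times> (real^'p)) set))) + C * real CARD('p)) / lam
     <= (1 + 2 * real CARD('p) * (real m + 1) + C * real CARD('p)) / lam"
    using lam0 by (intro divide_right_mono add_right_mono ln_card_dpairs) auto
  also have "... = sqrt ?k * chain_const CARD('p) C m"
    by (simp add: lam_def chain_const_def field_simps)
  finally show ?thesis using Mx by fastforce
qed

text \<open>The exponential bounds reach only levels \<open>m\<close> with
  \<open>2^m \<le> card J\<close>. Beyond the finest such level, monotonicity sandwiches the sum at
  \<open>u\<close> between those at its lower and upper grid neighbours, and the drift of the
  expectations is bounded by a constant. The majorant vanishes for empty \<open>J\<close>, which
  later confines the additive constant to thresholds below the largest weight.\<close>

lemma modulus_bound:
  assumes J: "finite J"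
  shows "\<exists>R. R \<in> borel_measurable (PiM UNIV (%_::nat. P)) & integrable (PiM UNIV (%_::nat. P)) R &
    (\<forall>x. 0 <= R x) & (J = {} --> (\<forall>x. R x = 0)) &
    (\<forall>u\<in>cbox 0 1. \<forall>v\<in>cbox 0 1. (\<forall>i. \<bar>u $ i - v $ i\<bar> <= 1 / 2^l) --> (\<forall>x. \<bar>T J u x - T J v x\<bar> <= R x)) &
    seqP.expectation R <= 4 * chain_tail CARD('p) C l * sqrt (card J) + (2 * 2^l + 4 * (C * CARD('p)))"
proof (cases "J = {}")
  case True
  have "0 <= chain_tail CARD('p) C l"
    using chain_sum_le_tail[of "real CARD('p)" C l 0] C chain_const_nonneg[of "real CARD('p)" C]
    by (intro order_trans[OF sum_nonneg chain_sum_le_tail[of "real CARD('p)" C l 0]]) auto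
  then show ?thesis using C True by (intro exI[of _ "%_. 0"]) (auto simp: T_def)
next
  case Jne: False
  let ?k = "real (card J)"
  have tail0: "0 <= chain_tail CARD('p) C l"
    using C by (intro order_trans[OF sum_nonneg chain_sum_le_tail[of "real CARD('p)" C l 0]]) (auto intro: chain_const_nonneg)
  show ?thesis
  \<comment> \<open>With fewer than \<open>2^l\<close> points no level from \<open>l\<close> on is
    available, but the crude bound by the number of points already fits into the additive term
    \<open>2 * 2^l\<close>.\<close>
  proof (cases "card J < 2^l")
    case True
    have "real (card J) <= real (2^l)" using True by (intro of_nat_mono) simp
    then have kl: "?k <= 2^l" by simp
    have T1: "\<bar>T J u x\<bar> <= ?k" for u x
    proof -
      have "\<bar>T J u x\<bar> <= (\<Sum>i\<in>J. \<bar>f u (x i) - expectation (f u)\<bar>)" unfolding T_def by (rule sum_abs)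
      also have "... <= (\<Sum>i\<in>J. 1)"
      proof (rule sum_mono)
        fix i show "\<bar>f u (x i) - expectation (f u)\<bar> <= 1"
          using f01(1)[of u "x i"] f01(2)[of u "x i"] Ef[of u] by linarith
      qed
      finally show ?thesis by simp
    qed
    have "\<bar>T J u x - T J v x\<bar> <= 2 * 2^l" for u v x
      using T1[of u x] T1[of v x] kl by linarith
    then show ?thesis using C tail0 Jne
      by (intro exI[of _ "%_. 2 * 2^l"]) (auto simp: seqP.prob_space)
  next
    case False
    then have kl: "2^l <= card J" by simp
    have "card J > 0" using Jne J by (simp add: card_gt_0_iff)
    then obtain L where L: "2^L <= card J" "card J < 2^(L+1)" using ex_power_ivl1[of 2 "card J"] by auto
    have "2^l < (2::nat)^(L+1)" using kl L by simp
    then have lL: "l <= L" using power_less_imp_less_exp[of "2::nat" l "L+1"] by simp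
    have "\<exists>Mm. \<forall>m\<le>L. Mm m \<in> borel_measurable (PiM UNIV (%_::nat. P)) & integrable (PiM UNIV (%_::nat. P)) (Mm m) &
       (\<forall>(a, b)\<in>dpairs m. \<forall>x. \<bar>T J a x - T J b x\<bar> <= Mm m x) &
       seqP.expectation (Mm m) <= sqrt ?k * chain_const CARD('p) C m"
    proof (intro choice allI)
      fix m
      have "2^m <= card J" if "m <= L" using power_increasing[OF that, of "2::nat"] L(1) by linarith
      then show "\<exists>Mx. m <= L --> Mx \<in> borel_measurable (PiM UNIV (%_::nat. P)) & integrable (PiM UNIV (%_::nat. P)) Mx &
       (\<forall>(a, b)\<in>dpairs m. \<forall>x. \<bar>T J a x - T J b x\<bar> <= Mx x) &
       seqP.expectation Mx <= sqrt ?k * chain_const CARD('p) C m"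
        using level_bound[OF J] by blast
    qed
    then obtain Mm where Mm: "!!m. m <= L ==> Mm m \<in> borel_measurable (PiM UNIV (%_::nat. P))"
       "!!m. m <= L ==> integrable (PiM UNIV (%_::nat. P)) (Mm m)"
       "!!m a b x. m <= L ==> (a, b) \<in> dpairs m ==> \<bar>T J a x - T J b x\<bar> <= Mm m x"
       "!!m. m <= L ==> seqP.expectation (Mm m) <= sqrt ?k * chain_const CARD('p) C m"
      by (metis (no_types, lifting) case_prodD)
    have Mm0: "0 <= Mm m x" if "m <= L" for m x
    proof -
      have "(0, 0) \<in> (dpairs m :: ((real^'p) \<times> (real^'p)) set)" by (auto simp: dpairs_def dgrid_iff intro: exI[of _ 0])
      from Mm(3)[OF that this] show ?thesis by simp
    qed
    define R where "R x = 4 * (\<Sum>m\<in>{l..L}. Mm m x) + 4 * (C * CARD('p))" for x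
    have kL: "?k / 2^L <= 2"
    proof -
      have "?k <= real (2^(L+1))" using L(2) by (intro of_nat_mono) simp
      then show ?thesis by (simp add: divide_le_eq)
    qed
    \<comment> \<open>Replacing \<open>u\<close> by \<open>dproj L u\<close> costs one increment
      between grid neighbours plus the drift of the mean over one mesh. The drift is at most
      \<open>card J / 2^L\<close> times \<open>C * CARD('p)\<close>, and the choice of
      \<open>L\<close> bounds the first factor by 2.\<close>
    have near: "\<bar>T J u x - T J (dproj L u) x\<bar> <= Mm L x + 2 * (C * CARD('p))" if u: "u \<in> cbox 0 1" for u x
    proof -
      let ?a = "dproj L u" and ?b = "dceil L u"
      note pr = dproj_dceil[OF u, where l=L]
      have cube: "?a \<in> cbox 0 1" "?b \<in> cbox 0 1" using pr(1) dgrid_cube by (auto simp: dpairs_def)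
      have E: "?k * \<bar>expectation (f w) - expectation (f ?a)\<bar> <= 2 * (C * CARD('p))"
        if w: "w \<in> cbox 0 1" "!!i. \<bar>w $ i - ?a $ i\<bar> <= 1 / 2^L" for w
      proof -
        have "\<bar>expectation (f w) - expectation (f ?a)\<bar> <= C * (\<Sum>i\<in>UNIV. \<bar>w $ i - ?a $ i\<bar>)"
          by (rule Ef_diff[OF w(1) cube(1)])
        also have "... <= C * (\<Sum>i\<in>(UNIV::'p set). 1 / 2^L)"
          using C w by (intro mult_left_mono sum_mono) auto
        finally have "?k * \<bar>expectation (f w) - expectation (f ?a)\<bar> <= ?k * (C * (\<Sum>i\<in>(UNIV::'p set). 1 / 2^L))"
          by (intro mult_left_mono) auto
        also have "... = (?k / 2^L) * (C * CARD('p))" by simp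
        also have "... <= 2 * (C * CARD('p))" using kL C by (intro mult_right_mono) auto
        finally show ?thesis .
      qed
      have E1: "?k * \<bar>expectation (f u) - expectation (f ?a)\<bar> <= 2 * (C * CARD('p))"
        by (rule E[OF u]) (use dproj_dist[of u _ L] in simp)
      have E2: "?k * \<bar>expectation (f ?b) - expectation (f ?a)\<bar> <= 2 * (C * CARD('p))"
        by (rule E[OF cube(2)]) (use pr(1) in \<open>auto simp: dpairs_def\<close>)
      have s1: "0 <= (\<Sum>i\<in>J. f u (x i) - f ?a (x i))" by (intro sum_nonneg) (simp add: f_mono pr)
      have s2: "(\<Sum>i\<in>J. f u (x i) - f ?a (x i)) <= (\<Sum>i\<in>J. f ?b (x i) - f ?a (x i))"
        by (intro sum_mono) (simp add: f_mono pr)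
      have t1: "T J w x - T J ?a x = (\<Sum>i\<in>J. f w (x i) - f ?a (x i)) - ?k * (expectation (f w) - expectation (f ?a))" for w
        by (simp add: T_def sum_subtractf algebra_simps)
      have ab: "\<bar>T J ?b x - T J ?a x\<bar> <= Mm L x" by (rule Mm(3)[OF order_refl pr(1)])
      have mono: "0 <= ?k * (expectation (f u) - expectation (f ?a))"
        by (intro mult_nonneg_nonneg) (auto intro!: integral_mono f_int f_mono pr)
      have mono2: "?k * (expectation (f u) - expectation (f ?a)) <= 2 * (C * CARD('p))"
        using E1 by (smt (verit) mult_left_mono of_nat_0_le_iff)
      have mono3: "?k * (expectation (f ?b) - expectation (f ?a)) <= 2 * (C * CARD('p))"
        using E2 by (smt (verit) mult_left_mono of_nat_0_le_iff)
      have M0: "0 <= Mm L x" by (rule Mm0) simp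
      show ?thesis using s1 s2 t1[of u] t1[of ?b] ab mono mono2 mono3 M0 by linarith
    qed
    have R: "\<bar>T J u x - T J v x\<bar> <= R x"
      if uv: "u \<in> cbox 0 1" "v \<in> cbox 0 1" "!!i. \<bar>u $ i - v $ i\<bar> <= 1 / 2^l" for u v x
    proof -
      have "\<bar>T J (dproj L u) x - T J (dproj L v) x\<bar> <= 2 * (\<Sum>m\<in>{l..L}. Mm m x)"
        by (rule chain_pair[of l L "%u. T J u x", OF _ uv lL]) (rule Mm(3))
      moreover have "Mm L x <= (\<Sum>m\<in>{l..L}. Mm m x)"
        using lL by (intro member_le_sum[of L "{l..L}" "%m. Mm m x"]) (auto intro: Mm0)
      ultimately show ?thesis unfolding R_def using near[OF uv(1), of x] near[OF uv(2), of x] by linarith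
    qed
    have Rint: "integrable (PiM UNIV (%_::nat. P)) R"
      unfolding R_def by (intro Bochner_Integration.integrable_add integrable_mult_right Bochner_Integration.integrable_sum Mm(2)) auto
    have "seqP.expectation R = 4 * (\<Sum>m\<in>{l..L}. seqP.expectation (Mm m)) + 4 * (C * CARD('p))"
      unfolding R_def using Mm(2) by (subst Bochner_Integration.integral_add) (auto simp: seqP.prob_space)
    also have "... <= 4 * (\<Sum>m\<in>{l..L}. sqrt ?k * chain_const CARD('p) C m) + 4 * (C * CARD('p))"
      by (intro add_right_mono mult_left_mono sum_mono Mm(4)) auto
    also have "(\<Sum>m\<in>{l..L}. sqrt ?k * chain_const CARD('p) C m) = sqrt ?k * (\<Sum>m\<in>{l..L}. chain_const CARD('p) C m)"
      by (simp add: sum_distrib_left)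
    also have "... <= sqrt ?k * chain_tail CARD('p) C l"
      using C by (intro mult_left_mono chain_sum_le_tail) auto
    finally have a: "seqP.expectation R <= 4 * (sqrt ?k * chain_tail CARD('p) C l) + 4 * (C * CARD('p))" by simp
    have "4 * (sqrt ?k * chain_tail CARD('p) C l) = 4 * chain_tail CARD('p) C l * sqrt ?k" "0 <= 2 * (2::real)^l" by simp_all
    with a have "seqP.expectation R <= 4 * chain_tail CARD('p) C l * sqrt ?k + (2 * 2^l + 4 * (C * CARD('p)))" by linarith
    moreover have "0 <= R x" for x unfolding R_def using Mm0 C by (intro add_nonneg_nonneg mult_nonneg_nonneg sum_nonneg) auto
    ultimately show ?thesis using R Rint Jne by (intro exI[of _ R]) auto
  qed
qed

end

section \<open>The limiting Gaussian process\<close>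

text \<open>The covariance left after the coordinates below \<open>r\<close> have been projected
  out, one pivot at a time. A zero pivot is harmless: its column vanishes for a positive
  semidefinite kernel, and division by zero yields 0.\<close>

fun schur :: "(nat => nat => real) => nat => nat => nat => real" where
  "schur K 0 i j = K i j"
| "schur K (Suc r) i j = schur K r i j - schur K r i r * schur K r j r / schur K r r r"

definition psd :: "(nat => nat => real) => bool" where
  "psd K \<longleftrightarrow> (\<forall>i j. K i j = K j i) & (\<forall>F c. finite F --> 0 <= (\<Sum>i\<in>F. \<Sum>j\<in>F. c i * c j * K i j))"

lemma psd_sym: "psd K ==> K i j = K j i"
  unfolding psd_def by blast

lemma psdD: "psd K ==> finite F ==> 0 <= (\<Sum>i\<in>F. \<Sum>j\<in>F. c i * c j * K i j)"
  unfolding psd_def by simp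

lemma psd_diag: "psd K ==> 0 <= K r r"
  using psdD[of K "{r}" "%_. 1"] by simp

lemma psd_zero_pivot:
  assumes K: "psd K" and r: "K r r = 0" shows "K i r = 0"
proof (rule ccontr)
  assume n: "K i r ~= 0"
  then have ir: "i ~= r" using r by auto
  have sym: "K r i = K i r" by (rule psd_sym[OF K])
  \<comment> \<open>Chosen so that the quadratic form with coefficient 1 at \<open>i\<close> and
    \<open>t\<close> at \<open>r\<close> equals -1.\<close>
  define t where "t = - (K i i + 1) / (2 * K i r)"
  have "0 <= (\<Sum>a\<in>{i,r}. \<Sum>b\<in>{i,r}. (if a = i then 1 else t) * (if b = i then 1 else t) * K a b)"
    by (rule psdD[OF K]) simp
  also have "... = K i i + 2 * t * K i r" using ir r sym by simp
  also have "... = -1" using n by (simp add: t_def field_simps)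
  finally show False by simp
qed

lemma psd_schur_step:
  assumes K: "psd K" shows "psd (%i j. K i j - K i r * K j r / K r r)"
proof (cases "K r r = 0")
  case True then show ?thesis using K by simp
next
  case False
  have sym: "K i j = K j i" for i j by (rule psd_sym[OF K])
  have "0 <= (\<Sum>i\<in>F. \<Sum>j\<in>F. c i * c j * (K i j - K i r * K j r / K r r))" if F: "finite F" for F c
  proof -
    \<comment> \<open>\<open>r\<close> may or may not lie in \<open>F\<close>; extending
      \<open>c\<close> by 0 treats both cases at once.\<close>
    define c0 where "c0 i = (if i \<in> F then c i else 0)" for i
    define b where "b = (\<Sum>i\<in>F. c i * K i r)"
    \<comment> \<open>The minimiser over the coefficient added at \<open>r\<close>: completing the
      square turns the form of \<open>K\<close> into that of the Schur complement.\<close>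
    define t where "t = - b / K r r"
    let ?F = "insert r F"
    have s1: "(\<Sum>i\<in>?F. c0 i * g i) = (\<Sum>i\<in>F. c i * g i)" for g :: "nat => real"
    proof -
      have "(\<Sum>i\<in>F. c0 i * g i) = (\<Sum>i\<in>?F. c0 i * g i)"
        using F by (intro sum.mono_neutral_left) (auto simp: c0_def)
      then show ?thesis by (simp add: c0_def)
    qed
    have s2: "(\<Sum>i\<in>?F. (if i = r then t else 0) * g i) = t * g r" for g :: "nat => real"
      using F by (subst sum.remove[of _ r]) (auto intro!: sum.neutral)
    have "0 <= (\<Sum>i\<in>?F. \<Sum>j\<in>?F. (c0 i + (if i = r then t else 0)) * (c0 j + (if j = r then t else 0)) * K i j)"
      by (rule psdD[OF K]) (simp add: F)
    also have "... = (\<Sum>i\<in>?F. (c0 i + (if i = r then t else 0)) * ((\<Sum>j\<in>?F. c0 j * K i j) + (\<Sum>j\<in>?F. (if j = r then t else 0) * K i j)))"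
      by (intro sum.cong refl) (simp add: sum_distrib_left sum.distrib[symmetric] algebra_simps)
    also have "... = (\<Sum>i\<in>?F. (c0 i + (if i = r then t else 0)) * ((\<Sum>j\<in>F. c j * K i j) + t * K i r))"
      unfolding s1 s2 ..
    also have "... = (\<Sum>i\<in>?F. c0 i * ((\<Sum>j\<in>F. c j * K i j) + t * K i r)) + (\<Sum>i\<in>?F. (if i = r then t else 0) * ((\<Sum>j\<in>F. c j * K i j) + t * K i r))"
      by (simp only: distrib_right sum.distrib)
    also have "... = (\<Sum>i\<in>F. c i * ((\<Sum>j\<in>F. c j * K i j) + t * K i r)) + t * ((\<Sum>j\<in>F. c j * K r j) + t * K r r)"
      unfolding s1 s2 ..
    also have "(\<Sum>j\<in>F. c j * K r j) = b" unfolding b_def by (simp add: sym[of r])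
    also have "(\<Sum>i\<in>F. c i * ((\<Sum>j\<in>F. c j * K i j) + t * K i r)) = (\<Sum>i\<in>F. \<Sum>j\<in>F. c i * c j * K i j) + t * b"
      unfolding b_def by (simp add: distrib_left sum.distrib sum_distrib_left mult_ac)
    also have "(\<Sum>i\<in>F. \<Sum>j\<in>F. c i * c j * K i j) + t * b + t * (b + t * K r r) = (\<Sum>i\<in>F. \<Sum>j\<in>F. c i * c j * K i j) - b * b / K r r"
      using False by (simp add: t_def field_simps)
    also have "... = (\<Sum>i\<in>F. \<Sum>j\<in>F. c i * c j * (K i j - K i r * K j r / K r r))"
      unfolding b_def sum_product by (simp add: right_diff_distrib sum_subtractf sum_divide_distrib mult_ac)
    finally show ?thesis .
  qed
  moreover have "K i j - K i r * K j r / K r r = K j i - K j r * K i r / K r r" for i j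
    using sym by (simp add: mult.commute)
  ultimately show ?thesis unfolding psd_def by simp
qed

lemma psd_schur: "psd K ==> psd (schur K r)"
proof (induction r)
  case 0 then show ?case by (simp add: psd_def)
next
  case (Suc r)
  have "schur K (Suc r) = (%i j. schur K r i j - schur K r i r * schur K r j r / schur K r r r)" by (intro ext) simp
  then show ?case using psd_schur_step[OF Suc.IH[OF Suc.prems], of r] by simp
qed

lemma schur_zero:
  assumes K: "psd K" shows "s < r ==> schur K r i s = 0"
proof (induction r arbitrary: i s)
  case (Suc r)
  have sym: "schur K r i j = schur K r j i" for i j by (rule psd_sym[OF psd_schur[OF K]])
  show ?case
  proof (cases "s = r")
    case True
    then show ?thesis using psd_zero_pivot[OF psd_schur[OF K], of r r i] by (cases "schur K r r r = 0") auto
  next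
    case False
    then have "s < r" using Suc.prems by simp
    then show ?thesis using Suc.IH[of s i] Suc.IH[of s r] sym[of s r] by simp
  qed
qed simp

text \<open>Each elimination step subtracts a rank-one kernel built from one scaled column. Once the
  pivots up to \<open>n\<close> are eliminated, the columns up to \<open>n\<close> of the remainder
  are zero, so the sum telescopes to \<open>K\<close> there.\<close>

lemma cholesky:
  assumes K: "psd K"
  obtains L :: "nat => nat => real" where "!!i j n. i <= n ==> j <= n ==> K i j = (\<Sum>r\<le>n. L i r * L j r)"
proof
  let ?L = "%i r. schur K r i r / sqrt (schur K r r r)"
  have LL: "?L i r * ?L j r = schur K r i r * schur K r j r / schur K r r r" for i j r
    using psd_diag[OF psd_schur[OF K], of r r] by (simp add: field_simps)
  have tel: "K i j = schur K n i j + (\<Sum>r<n. ?L i r * ?L j r)" for i j n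
  proof (induction n)
    case (Suc n)
    have "schur K (Suc n) i j = schur K n i j - ?L i n * ?L j n" by (simp only: schur.simps LL)
    then show ?case using Suc by (simp only: sum.lessThan_Suc)
  qed simp
  fix i j n :: nat assume "i <= n" "j <= n"
  then show "K i j = (\<Sum>r\<le>n. ?L i r * ?L j r)"
    using tel[of i j "Suc n"] schur_zero[OF K, of j "Suc n" i] unfolding lessThan_Suc_atMost by simp
qed

section \<open>Linear forms in independent standard normal variables\<close>

lemma std_normal_mgf:
  "integrable std_normal_distribution (%x. exp (a * x))"
  "(\<integral>x. exp (a * x) \<partial>std_normal_distribution) = exp (a\<^sup>2 / 2)"
proof -
  have eq: "std_normal_density x *\<^sub>R exp (a * x) = exp (a\<^sup>2 / 2) * normal_density a 1 x" for x
  proof -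
    have "- (x\<^sup>2) / 2 + a * x = a\<^sup>2 / 2 + (- (x - a)\<^sup>2 / 2)" by (simp add: power2_eq_square algebra_simps add_divide_distrib diff_divide_distrib)
    then have "exp (- (x\<^sup>2) / 2) * exp (a * x) = exp (a\<^sup>2 / 2) * exp (- (x - a)\<^sup>2 / 2)"
      by (metis exp_add)
    then show ?thesis by (simp add: normal_density_def mult_ac)
  qed
  have b: "integrable lborel (%x. exp (a\<^sup>2 / 2) * normal_density a 1 x)" by simp
  show "integrable std_normal_distribution (%x. exp (a * x))"
    by (subst integrable_density) (use b in \<open>auto simp: eq[simplified]\<close>)
  have "(\<integral>x. exp (a * x) \<partial>std_normal_distribution) = (\<integral>x. std_normal_density x *\<^sub>R exp (a * x) \<partial>lborel)"
    by (subst integral_density) auto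
  also have "... = exp (a\<^sup>2 / 2)" unfolding eq by simp
  finally show "(\<integral>x. exp (a * x) \<partial>std_normal_distribution) = exp (a\<^sup>2 / 2)" .
qed

abbreviation "gauss_seq \<equiv> PiM UNIV (%_::nat. std_normal_distribution)"

lemma prob_space_std_normal: "prob_space std_normal_distribution"
  using real_dist_normal_dist by (simp add: real_distribution_def)

lemma prob_space_gauss_seq: "prob_space gauss_seq"
  by (intro prob_space_PiM prob_space_std_normal)

lemma gauss_seq_coord_meas[measurable]: "(%x. x i) \<in> borel_measurable gauss_seq"
proof -
  have "(%x. x i) \<in> measurable gauss_seq std_normal_distribution" by measurable
  then show ?thesis by simp
qed

lemma gauss_seq_linear:
  shows "(\<integral>x. iexp (\<Sum>r\<le>n. a r * x r) \<partial>gauss_seq) = complex_of_real (exp (- (\<Sum>r\<le>n. (a r)\<^sup>2) / 2))"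
    and "integrable gauss_seq (%x. exp (\<Sum>r\<le>n. a r * x r))"
    and "(\<integral>x. exp (\<Sum>r\<le>n. a r * x r) \<partial>gauss_seq) = exp ((\<Sum>r\<le>n. (a r)\<^sup>2) / 2)"
proof -
  interpret prob_space gauss_seq by (rule prob_space_gauss_seq)
  have ind: "indep_vars (%_. borel) (%r x. g r (x r)) {..n}" if "!!r. g r \<in> borel_measurable borel"
    for g :: "nat => real => 'b::{banach, second_countable_topology}"
    using indep_vars_compose2[OF indep_vars_subset[OF PiM_indep_coords[of "%_::nat. std_normal_distribution"]], of "{..n}" g "%_. borel"]
      prob_space_std_normal that by simp
  note comp = integral_PiM_component[of "%_::nat. std_normal_distribution", OF prob_space_std_normal]
  have "(\<integral>x. iexp (\<Sum>r\<le>n. a r * x r) \<partial>gauss_seq) = (\<integral>x. (\<Prod>r\<le>n. iexp (a r * x r)) \<partial>gauss_seq)"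
    by (simp add: exp_sum sum_distrib_left)
  also have "... = (\<Prod>r\<le>n. \<integral>x. iexp (a r * x r) \<partial>gauss_seq)"
  proof (rule indep_vars_lebesgue_integral)
    show "indep_vars (%_. borel) (%r x. iexp (a r * x r)) {..n}"
      by (rule ind[of "%r y. iexp (a r * y)"]) simp
    show "integrable gauss_seq (%x. iexp (a r * x r))" for r
      by (rule integrable_const_bound[of _ 1]) (auto simp del: of_real_mult)
  qed simp
  also have "... = (\<Prod>r\<le>n. complex_of_real (exp (- (a r)\<^sup>2 / 2)))"
  proof (rule prod.cong[OF refl])
    fix r
    have "(\<integral>x. iexp (a r * x r) \<partial>gauss_seq) = char std_normal_distribution (a r)"
      unfolding char_def by (rule comp(1)) simp
    then show "(\<integral>x. iexp (a r * x r) \<partial>gauss_seq) = complex_of_real (exp (- (a r)\<^sup>2 / 2))"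
      by (simp add: char_std_normal_distribution)
  qed
  also have "... = complex_of_real (exp (\<Sum>r\<le>n. - (a r)\<^sup>2 / 2))" by (simp add: exp_sum)
  finally show "(\<integral>x. iexp (\<Sum>r\<le>n. a r * x r) \<partial>gauss_seq) = complex_of_real (exp (- (\<Sum>r\<le>n. (a r)\<^sup>2) / 2))"
    by (simp add: sum_negf sum_divide_distrib)
  have i: "integrable gauss_seq (%x. exp (a r * x r))" for r
    using comp(2)[of "%y. exp (a r * y)" r] std_normal_mgf(1) by simp
  have ind': "indep_vars (%_. borel) (%r x. exp (a r * x r)) {..n}"
    by (rule ind[of "%r y. exp (a r * y)"]) simp
  have eq: "exp (\<Sum>r\<le>n. a r * x r) = (\<Prod>r\<le>n. exp (a r * x r))" for x by (simp add: exp_sum)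
  show "integrable gauss_seq (%x. exp (\<Sum>r\<le>n. a r * x r))"
    unfolding eq by (rule indep_vars_integrable[OF _ ind' i]) simp
  have "(\<integral>x. exp (\<Sum>r\<le>n. a r * x r) \<partial>gauss_seq) = (\<Prod>r\<le>n. \<integral>x. exp (a r * x r) \<partial>gauss_seq)"
    unfolding eq by (rule indep_vars_lebesgue_integral[OF _ ind' i]) simp
  also have "... = (\<Prod>r\<le>n. exp ((a r)\<^sup>2 / 2))"
    using comp(1)[of "%y. exp (a _ * y)"] std_normal_mgf(2) by simp
  also have "... = exp ((\<Sum>r\<le>n. (a r)\<^sup>2) / 2)" by (simp add: exp_sum sum_divide_distrib)
  finally show "(\<integral>x. exp (\<Sum>r\<le>n. a r * x r) \<partial>gauss_seq) = exp ((\<Sum>r\<le>n. (a r)\<^sup>2) / 2)" .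
qed

section \<open>Gaussian process on the dyadic points\<close>

locale unif_family = prob_space P for P :: "'s measure" +
  fixes f :: "'m::finite => real^'p => 's => real" and C :: real
  assumes fk: "!!k. unif_class P (f k) C"
begin

definition cov :: "'m \<times> (real^'p) => 'm \<times> (real^'p) => real" where
  "cov s t = expectation (%x. f (fst s) (snd s) x * f (fst t) (snd t) x) - expectation (f (fst s) (snd s)) * expectation (f (fst t) (snd t))"

definition cf :: "'m \<times> (real^'p) => 's => real" where
  "cf s x = f (fst s) (snd s) x - expectation (f (fst s) (snd s))"

lemma C0: "0 <= C" using unif_class.C[OF fk] .

lemma fk_meas[measurable]: "f k u \<in> borel_measurable P" using unif_class.f_meas[OF fk] .
lemma fk_int: "integrable P (f k u)" using unif_class.f_int[OF fk] .
lemma fk01: "0 <= f k u x" "f k u x <= 1" using unif_class.f01[OF fk] by auto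
lemma fk_lip: "u \<in> cbox 0 1 ==> v \<in> cbox 0 1 ==> expectation (%x. \<bar>f k u x - f k v x\<bar>) <= C * (\<Sum>i\<in>UNIV. \<bar>u $ i - v $ i\<bar>)"
  using unif_class.f_lip[OF fk] .

lemma cf_meas[measurable]: "cf s \<in> borel_measurable P" unfolding cf_def by measurable

lemma cf_bound: "\<bar>cf s x\<bar> <= 1"
  unfolding cf_def using fk01[of "fst s" "snd s" x] unif_class.Ef[OF fk, of "fst s" "snd s"] by (auto simp: abs_le_iff)

lemma cf_int: "integrable P (cf s)" "expectation (cf s) = 0"
  unfolding cf_def using fk_int by (auto simp: prob_space)

lemma ff_int: "integrable P (%x. f k u x * f k' v x)"
  using fk01 by (intro integrable_const_bound[of _ 1]) (auto simp: mult_le_one)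

lemma cov_cf: "cov s t = expectation (%x. cf s x * cf t x)"
proof -
  let ?f = "f (fst s) (snd s)" and ?g = "f (fst t) (snd t)"
  have "(%x. cf s x * cf t x) = (%x. ?f x * ?g x - expectation ?g * ?f x - expectation ?f * ?g x + expectation ?f * expectation ?g)"
    by (rule ext) (simp add: cf_def algebra_simps)
  then show ?thesis unfolding cov_def using ff_int fk_int by (simp add: prob_space)
qed

lemma cf_prod_int: "integrable P (%x. cf s x * cf t x)"
proof (rule integrable_const_bound[of _ 1])
  show "AE x in P. norm (cf s x * cf t x) <= 1"
    by (intro AE_I2) (simp add: abs_mult mult_le_one cf_bound)
qed simp

text \<open>The right-hand side is the mean of a square, which gives positive semidefiniteness of
  the covariance and, with two terms, the variance of an increment.\<close>

lemma cov_quadratic: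
  assumes "finite F"
  shows "(\<Sum>i\<in>F. \<Sum>j\<in>F. c i * c j * cov (\<sigma> i) (\<sigma> j)) = expectation (%x. (\<Sum>i\<in>F. c i * cf (\<sigma> i) x)\<^sup>2)"
proof -
  have "expectation (%x. (\<Sum>i\<in>F. c i * cf (\<sigma> i) x)\<^sup>2) = expectation (%x. \<Sum>i\<in>F. \<Sum>j\<in>F. c i * c j * (cf (\<sigma> i) x * cf (\<sigma> j) x))"
    by (rule arg_cong[where f=expectation]) (auto simp: power2_eq_square sum_product mult_ac)
  also have "... = (\<Sum>i\<in>F. \<Sum>j\<in>F. c i * c j * cov (\<sigma> i) (\<sigma> j))"
    using cf_prod_int by (simp add: cov_cf Bochner_Integration.integral_sum)
  finally show ?thesis ..
qed

lemma cov_sym: "cov s t = cov t s"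
  unfolding cov_def by (simp add: mult.commute)

lemma cov_lip:
  assumes "u \<in> cbox 0 1" "u' \<in> cbox 0 1" "v \<in> cbox 0 1" "v' \<in> cbox 0 1"
  shows "\<bar>cov (k, u) (l, v) - cov (k, u') (l, v')\<bar> <= 2 * C * ((\<Sum>i\<in>UNIV. \<bar>u $ i - u' $ i\<bar>) + (\<Sum>i\<in>UNIV. \<bar>v $ i - v' $ i\<bar>))"
proof -
  have prod: "\<bar>a * b - a' * b'\<bar> <= \<bar>a - a'\<bar> + \<bar>b - b'\<bar>" if "0 <= a" "a <= 1" "0 <= b'" "b' <= 1" for a b a' b' :: real
  proof -
    have "\<bar>a * b - a' * b'\<bar> = \<bar>a * (b - b') + (a - a') * b'\<bar>" by (simp add: algebra_simps)
    also have "... <= \<bar>a\<bar> * \<bar>b - b'\<bar> + \<bar>a - a'\<bar> * \<bar>b'\<bar>" by (metis abs_mult abs_triangle_ineq)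
    also have "... <= 1 * \<bar>b - b'\<bar> + \<bar>a - a'\<bar> * 1" using that by (intro add_mono mult_mono) auto
    finally show ?thesis by simp
  qed
  let ?E = "%k u u'. expectation (%x. \<bar>f k u x - f k u' x\<bar>)"
  have "\<bar>expectation (%x. f k u x * f l v x) - expectation (%x. f k u' x * f l v' x)\<bar> = \<bar>expectation (%x. f k u x * f l v x - f k u' x * f l v' x)\<bar>"
    using ff_int by simp
  also have "... <= expectation (%x. \<bar>f k u x * f l v x - f k u' x * f l v' x\<bar>)" by (rule integral_abs_bound)
  also have "... <= expectation (%x. \<bar>f k u x - f k u' x\<bar> + \<bar>f l v x - f l v' x\<bar>)"
    using ff_int fk_int fk01 by (intro integral_mono prod) auto
  also have "... = ?E k u u' + ?E l v v'" using fk_int by simp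
  finally have 1: "\<bar>expectation (%x. f k u x * f l v x) - expectation (%x. f k u' x * f l v' x)\<bar> <= ?E k u u' + ?E l v v'" .
  have 2: "\<bar>expectation (f k u) * expectation (f l v) - expectation (f k u') * expectation (f l v')\<bar>
      <= \<bar>expectation (f k u) - expectation (f k u')\<bar> + \<bar>expectation (f l v) - expectation (f l v')\<bar>"
    by (rule prod) (auto simp: unif_class.Ef[OF fk])
  have "\<bar>cov (k, u) (l, v) - cov (k, u') (l, v')\<bar> <= (C * (\<Sum>i\<in>UNIV. \<bar>u $ i - u' $ i\<bar>) + C * (\<Sum>i\<in>UNIV. \<bar>v $ i - v' $ i\<bar>))
     + (C * (\<Sum>i\<in>UNIV. \<bar>u $ i - u' $ i\<bar>) + C * (\<Sum>i\<in>UNIV. \<bar>v $ i - v' $ i\<bar>))"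
    unfolding cov_def fst_conv snd_conv
    using 1 2 fk_lip[OF assms(1,2), of k] fk_lip[OF assms(3,4), of l]
      unif_class.Ef_diff[OF fk assms(1,2), of k] unif_class.Ef_diff[OF fk assms(3,4), of l] by linarith
  then show ?thesis by (simp add: algebra_simps)
qed

text \<open>The dyadic points are countable, so the covariance becomes a kernel on the naturals and
  factorises. Lower triangularity makes each coordinate of the process a finite linear form, so no
  convergence question arises.\<close>

lemma cov_factor:
  obtains L :: "'m \<times> (real^'p) => nat => real" and idx :: "'m \<times> (real^'p) => nat" where
    "!!s r. idx s < r ==> L s r = 0"
    "!!s t n. snd s \<in> (\<Union>l. dgrid l) ==> snd t \<in> (\<Union>l. dgrid l) ==> idx s <= n ==> idx t <= n ==>
       cov s t = (\<Sum>r\<le>n. L s r * L t r)"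
proof -
  define S :: "('m \<times> (real^'p)) set" where "S = UNIV \<times> (\<Union>l. dgrid l)"
  have cS: "countable S" unfolding S_def by (rule countable_SIGMA) (auto intro: countable_finite finite_dgrid)
  define e where "e = from_nat_into S"
  define idx where "idx = to_nat_on S"
  have eidx: "e (idx s) = s" if "s \<in> S" for s unfolding e_def idx_def using cS that by simp
  define K where "K i j = cov (e i) (e j)" for i j
  have "psd K" unfolding psd_def K_def
    by (auto simp: cov_sym cov_quadratic[where \<sigma>=e])
  then obtain L where L: "!!i j n. i <= n ==> j <= n ==> K i j = (\<Sum>r\<le>n. L i r * L j r)" using cholesky by blast
  \<comment> \<open>Both truncations of the factorisation represent \<open>K i i\<close>, so the
    squares beyond \<open>i\<close> sum to zero.\<close>
  have cut: "L i r = 0" if "i < r" for i r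
  proof -
    have "K i i = (\<Sum>r\<le>i. L i r * L i r)" "K i i = (\<Sum>r\<le>r. L i r * L i r)" using L that by auto
    moreover have "(\<Sum>r\<le>r. L i r * L i r) = (\<Sum>r\<le>i. L i r * L i r) + (\<Sum>r\<in>{i<..r}. L i r * L i r)"
      using that by (subst sum.union_disjoint[symmetric]) (auto intro!: sum.cong)
    ultimately have "(\<Sum>r\<in>{i<..r}. L i r * L i r) = 0" by simp
    then have "L i r * L i r = 0" using that by (subst (asm) sum_nonneg_eq_0_iff) auto
    then show ?thesis by simp
  qed
  show thesis
  proof (rule that[of idx "%s. L (idx s)"])
    fix s t :: "'m \<times> (real^'p)" and n
    assume st: "snd s \<in> (\<Union>l. dgrid l)" "snd t \<in> (\<Union>l. dgrid l)" and n: "idx s <= n" "idx t <= n"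
    have "s \<in> S" "t \<in> S" using st by (auto simp: S_def mem_Times_iff)
    then have "cov s t = K (idx s) (idx t)" unfolding K_def by (simp add: eidx)
    then show "cov s t = (\<Sum>r\<le>n. L (idx s) r * L (idx t) r)" using L[OF n] by simp
  qed (rule cut)
qed

lemma lin_comb_factor:
  fixes L :: "'m \<times> (real^'p) => nat => real" and idx :: "'m \<times> (real^'p) => nat" and F :: "'j set"
  assumes cut: "!!s r. idx s < r ==> L s r = 0"
    and L: "!!s t n. snd s \<in> (\<Union>l. dgrid l) ==> snd t \<in> (\<Union>l. dgrid l) ==> idx s <= n ==> idx t <= n ==>
       cov s t = (\<Sum>r\<le>n. L s r * L t r)"
    and F: "finite F" and \<sigma>: "!!i. i \<in> F ==> snd (\<sigma> i) \<in> (\<Union>l. dgrid l)"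
  shows "\<exists>n a. (\<forall>x. (\<Sum>i\<in>F. c i * (\<Sum>r\<le>idx (\<sigma> i). L (\<sigma> i) r * x r)) = (\<Sum>r\<le>n. a r * x r)) &
    (\<Sum>r\<le>n. (a r)\<^sup>2) = (\<Sum>i\<in>F. \<Sum>j\<in>F. c i * c j * cov (\<sigma> i) (\<sigma> j))"
proof (intro exI conjI allI)
  define n where "n = Max (insert 0 ((%i. idx (\<sigma> i)) ` F))"
  have n: "idx (\<sigma> i) <= n" if "i \<in> F" for i unfolding n_def using F that by (intro Max_ge) auto
  define a where "a r = (\<Sum>i\<in>F. c i * L (\<sigma> i) r)" for r
  have Yn: "(\<Sum>r\<le>idx s. L s r * x r) = (\<Sum>r\<le>n. L s r * x r)" if "idx s <= n" for s x
    using that cut by (intro sum.mono_neutral_left) auto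
  have "(\<Sum>i\<in>F. c i * (\<Sum>r\<le>idx (\<sigma> i). L (\<sigma> i) r * x r)) = (\<Sum>i\<in>F. \<Sum>r\<le>n. c i * L (\<sigma> i) r * x r)" for x
    by (intro sum.cong refl) (simp add: Yn[OF n] sum_distrib_left mult.assoc)
  moreover have "(\<Sum>i\<in>F. \<Sum>r\<le>n. c i * L (\<sigma> i) r * x r) = (\<Sum>r\<le>n. a r * x r)" for x
    unfolding a_def by (subst sum.swap) (simp add: sum_distrib_right)
  ultimately show "(\<Sum>i\<in>F. c i * (\<Sum>r\<le>idx (\<sigma> i). L (\<sigma> i) r * x r)) = (\<Sum>r\<le>n. a r * x r)" for x by simp
  have "(\<Sum>r\<le>n. (a r)\<^sup>2) = (\<Sum>r\<le>n. \<Sum>i\<in>F. \<Sum>j\<in>F. c i * c j * (L (\<sigma> i) r * L (\<sigma> j) r))"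
    unfolding a_def power2_eq_square sum_product by (simp add: mult_ac)
  also have "... = (\<Sum>i\<in>F. \<Sum>j\<in>F. \<Sum>r\<le>n. c i * c j * (L (\<sigma> i) r * L (\<sigma> j) r))"
    by (subst sum.swap, intro sum.cong refl, subst sum.swap) simp
  also have "... = (\<Sum>i\<in>F. \<Sum>j\<in>F. c i * c j * cov (\<sigma> i) (\<sigma> j))"
  proof (intro sum.cong refl)
    fix i j assume ij: "i \<in> F" "j \<in> F"
    have "cov (\<sigma> i) (\<sigma> j) = (\<Sum>r\<le>n. L (\<sigma> i) r * L (\<sigma> j) r)" using n \<sigma> ij by (intro L) auto
    then show "(\<Sum>r\<le>n. c i * c j * (L (\<sigma> i) r * L (\<sigma> j) r)) = c i * c j * cov (\<sigma> i) (\<sigma> j)"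
      by (simp add: sum_distrib_left)
  qed
  finally show "(\<Sum>r\<le>n. (a r)\<^sup>2) = (\<Sum>i\<in>F. \<Sum>j\<in>F. c i * c j * cov (\<sigma> i) (\<sigma> j))" .
qed

lemma dyadic_gaussian:
  obtains Y :: "'m \<times> (real^'p) => (nat => real) => real" where
    "!!s. Y s \<in> borel_measurable gauss_seq"
    "!!F (\<sigma> :: 'i => _) c. finite F ==> (!!i. i \<in> F ==> snd (\<sigma> i) \<in> (\<Union>l. dgrid l)) ==>
      (\<integral>x. iexp (\<Sum>i\<in>F. c i * Y (\<sigma> i) x) \<partial>gauss_seq) = complex_of_real (exp (- (\<Sum>i\<in>F. \<Sum>j\<in>F. c i * c j * cov (\<sigma> i) (\<sigma> j)) / 2))"
    "!!s t a. snd s \<in> (\<Union>l. dgrid l) ==> snd t \<in> (\<Union>l. dgrid l) ==> integrable gauss_seq (%x. exp (a * (Y s x - Y t x)))"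
    "!!s t a. snd s \<in> (\<Union>l. dgrid l) ==> snd t \<in> (\<Union>l. dgrid l) ==>
      (\<integral>x. exp (a * (Y s x - Y t x)) \<partial>gauss_seq) = exp (a\<^sup>2 * expectation (%x. (cf s x - cf t x)\<^sup>2) / 2)"
proof -
  obtain L and idx :: "'m \<times> (real^'p) => nat" where cut: "!!s r. idx s < r ==> L s r = 0"
    and L: "!!s t n. snd s \<in> (\<Union>l. dgrid l) ==> snd t \<in> (\<Union>l. dgrid l) ==> idx s <= n ==> idx t <= n ==>
       cov s t = (\<Sum>r\<le>n. L s r * L t r)"
    by (rule cov_factor) (rule that, assumption+)
  define Y where "Y s x = (\<Sum>r\<le>idx s. L s r * x r)" for s x
  show thesis
  proof (rule that[of Y])
    show "Y s \<in> borel_measurable gauss_seq" for s unfolding Y_def by measurable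
    show "(\<integral>x. iexp (\<Sum>i\<in>F. c i * Y (\<sigma> i) x) \<partial>gauss_seq) = complex_of_real (exp (- (\<Sum>i\<in>F. \<Sum>j\<in>F. c i * c j * cov (\<sigma> i) (\<sigma> j)) / 2))"
      if F: "finite F" "!!i. i \<in> F ==> snd (\<sigma> i) \<in> (\<Union>l. dgrid l)" for F :: "'i set" and \<sigma> c
    proof -
      have "\<exists>n a. (\<forall>x. (\<Sum>i\<in>F. c i * (\<Sum>r\<le>idx (\<sigma> i). L (\<sigma> i) r * x r)) = (\<Sum>r\<le>n. a r * x r)) &
          (\<Sum>r\<le>n. (a r)\<^sup>2) = (\<Sum>i\<in>F. \<Sum>j\<in>F. c i * c j * cov (\<sigma> i) (\<sigma> j))"
        by (rule lin_comb_factor[where idx=idx and L=L and \<sigma>=\<sigma> and c=c, OF cut L F])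
      then obtain n a where na: "(\<forall>x. (\<Sum>i\<in>F. c i * (\<Sum>r\<le>idx (\<sigma> i). L (\<sigma> i) r * x r)) = (\<Sum>r\<le>n. a r * x r)) &
          (\<Sum>r\<le>n. (a r)\<^sup>2) = (\<Sum>i\<in>F. \<Sum>j\<in>F. c i * c j * cov (\<sigma> i) (\<sigma> j))"
        by (elim exE) (rule that)
      note 1 = na[THEN conjunct1, rule_format] and 2 = na[THEN conjunct2]
      show ?thesis unfolding Y_def 1 using gauss_seq_linear(1)[of a n] unfolding 2 .
    qed
    have mg: "integrable gauss_seq (%x. exp (a * (Y s x - Y t x))) &
      (\<integral>x. exp (a * (Y s x - Y t x)) \<partial>gauss_seq) = exp (a\<^sup>2 * expectation (%x. (cf s x - cf t x)\<^sup>2) / 2)"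
      if st: "snd s \<in> (\<Union>l. dgrid l)" "snd t \<in> (\<Union>l. dgrid l)" for s t a
    proof -
      let ?\<sigma> = "%b. if b then s else t" and ?c = "%b. if b then a else - a"
      have "snd (?\<sigma> i) \<in> (\<Union>l. dgrid l)" for i using st by auto
      note \<sigma> = this
      have "\<exists>n b. (\<forall>x. (\<Sum>i\<in>UNIV. ?c i * (\<Sum>r\<le>idx (?\<sigma> i). L (?\<sigma> i) r * x r)) = (\<Sum>r\<le>n. b r * x r)) &
          (\<Sum>r\<le>n. (b r)\<^sup>2) = (\<Sum>i\<in>UNIV. \<Sum>j\<in>UNIV. ?c i * ?c j * cov (?\<sigma> i) (?\<sigma> j))"
        by (rule lin_comb_factor[where idx=idx and L=L and \<sigma>="?\<sigma>" and c="?c", OF cut L finite_class.finite_UNIV \<sigma>])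
      then obtain n b where nb: "(\<forall>x. (\<Sum>i\<in>UNIV. ?c i * (\<Sum>r\<le>idx (?\<sigma> i). L (?\<sigma> i) r * x r)) = (\<Sum>r\<le>n. b r * x r)) &
          (\<Sum>r\<le>n. (b r)\<^sup>2) = (\<Sum>i\<in>UNIV. \<Sum>j\<in>UNIV. ?c i * ?c j * cov (?\<sigma> i) (?\<sigma> j))"
        by (elim exE) (rule that)
      note 1 = nb[THEN conjunct1, rule_format] and 2 = nb[THEN conjunct2]
      have 3: "(\<Sum>r\<le>n. (b r)\<^sup>2) = a\<^sup>2 * expectation (%x. (cf s x - cf t x)\<^sup>2)"
      proof -
        have "(%x. (\<Sum>i\<in>UNIV. ?c i * cf (?\<sigma> i) x)\<^sup>2) = (%x. a\<^sup>2 * (cf s x - cf t x)\<^sup>2)"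
          by (rule ext) (simp add: UNIV_bool power2_eq_square algebra_simps)
        then show ?thesis unfolding 2 cov_quadratic[OF finite_class.finite_UNIV, where \<sigma>="?\<sigma>"] by simp
      qed
      have 4: "a * (Y s x - Y t x) = (\<Sum>r\<le>n. b r * x r)" for x
        using 1[of x] by (simp add: UNIV_bool algebra_simps Y_def)
      show ?thesis unfolding 4 using gauss_seq_linear(2,3)[of b n] unfolding 3 by simp
    qed
    show "integrable gauss_seq (%x. exp (a * (Y s x - Y t x)))" if "snd s \<in> (\<Union>l. dgrid l)" "snd t \<in> (\<Union>l. dgrid l)" for s t a
      using mg[OF that] by blast
    show "(\<integral>x. exp (a * (Y s x - Y t x)) \<partial>gauss_seq) = exp (a\<^sup>2 * expectation (%x. (cf s x - cf t x)\<^sup>2) / 2)"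
      if "snd s \<in> (\<Union>l. dgrid l)" "snd t \<in> (\<Union>l. dgrid l)" for s t a
      using mg[OF that] by blast
  qed
qed

text \<open>The exact Gaussian moment generating function puts no restriction on the slope, so
  \<open>sqrt (2^m)\<close> serves at every level, and the bound is again
  \<open>chain_const\<close>, now without a sample size.\<close>

lemma gaussian_level_bound:
  fixes Y :: "'m \<times> (real^'p) => (nat => real) => real"
  assumes Ym: "!!s. Y s \<in> borel_measurable gauss_seq"
    and Yi: "!!s t a. snd s \<in> (\<Union>l. dgrid l) ==> snd t \<in> (\<Union>l. dgrid l) ==> integrable gauss_seq (%x. exp (a * (Y s x - Y t x)))"
    and Ye: "!!s t a. snd s \<in> (\<Union>l. dgrid l) ==> snd t \<in> (\<Union>l. dgrid l) ==>
      (\<integral>x. exp (a * (Y s x - Y t x)) \<partial>gauss_seq) = exp (a\<^sup>2 * expectation (%x. (cf s x - cf t x)\<^sup>2) / 2)"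
  shows "\<exists>Mx. Mx \<in> borel_measurable gauss_seq & integrable gauss_seq Mx &
    (\<forall>ab\<in>dpairs m. \<forall>x. \<bar>Y (k, fst ab) x - Y (k, snd ab) x\<bar> <= Mx x) &
    (\<integral>x. Mx x \<partial>gauss_seq) <= chain_const CARD('p) C m"
proof -
  interpret G: prob_space gauss_seq by (rule prob_space_gauss_seq)
  define lam :: real where "lam = sqrt (2^m)"
  have lam0: "lam > 0" by (simp add: lam_def)
  let ?d = "%ab x. Y (k, fst ab) x - Y (k, snd ab) x"
  have bd: "integrable gauss_seq (%x. exp (\<mu> * ?d ab x)) & (\<integral>x. exp (\<mu> * ?d ab x) \<partial>gauss_seq) <= exp (C * real CARD('p))"
    if ab: "ab \<in> dpairs m" and \<mu>: "\<bar>\<mu>\<bar> = lam" for ab \<mu>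
  proof -
    obtain a b where [simp]: "ab = (a, b)" by (cases ab)
    have gr: "a \<in> dgrid m" "b \<in> dgrid m" using ab by (auto simp: dpairs_def)
    then have gr': "snd (k, a) \<in> (\<Union>l. dgrid l)" "snd (k, b) \<in> (\<Union>l. dgrid l)" by auto
    have cube: "a \<in> cbox 0 1" "b \<in> cbox 0 1" using gr dgrid_cube by auto
    have "expectation (%x. (cf (k, a) x - cf (k, b) x)\<^sup>2) <= expectation (%x. \<bar>f k a x - f k b x\<bar>)"
    proof -
      let ?c = "expectation (f k a) - expectation (f k b)"
      have b1: "\<bar>f k a y - f k b y\<bar> <= 1" for y using fk01[of k a y] fk01[of k b y] by linarith
      have sq: "(f k a y - f k b y)\<^sup>2 <= \<bar>f k a y - f k b y\<bar>" for y
        using mult_left_mono[OF b1[of y], of "\<bar>f k a y - f k b y\<bar>"] by (simp add: power2_eq_square)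
      have isq: "integrable P (%y. (f k a y - f k b y)\<^sup>2)"
      proof (rule integrable_const_bound[of _ 1])
        show "AE x in P. norm ((f k a x - f k b x)\<^sup>2) <= 1"
          by (rule AE_I2) (use sq b1 in \<open>auto intro: order_trans\<close>)
      qed simp
      have "(%y. (cf (k, a) y - cf (k, b) y)\<^sup>2) = (%y. (f k a y - f k b y)\<^sup>2 - 2 * ?c * (f k a y - f k b y) + ?c\<^sup>2)"
        by (rule ext) (simp add: cf_def power2_eq_square algebra_simps)
      then have "expectation (%y. (cf (k, a) y - cf (k, b) y)\<^sup>2) = expectation (%y. (f k a y - f k b y)\<^sup>2) - ?c\<^sup>2"
        using isq fk_int by (simp add: prob_space) (simp add: power2_eq_square algebra_simps)
      also have "... <= expectation (%y. (f k a y - f k b y)\<^sup>2)" by simp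
      also have "... <= expectation (%y. \<bar>f k a y - f k b y\<bar>)" using isq fk_int sq by (intro integral_mono) auto
      finally show ?thesis .
    qed
    also have "... <= C * (\<Sum>i\<in>UNIV. \<bar>a $ i - b $ i\<bar>)" by (rule fk_lip[OF cube])
    also have "... <= C * (\<Sum>i\<in>(UNIV::'p set). 1 / 2^m)"
      using ab C0 by (intro mult_left_mono sum_mono) (auto simp: dpairs_def)
    finally have v: "expectation (%x. (cf (k, a) x - cf (k, b) x)\<^sup>2) <= C * real CARD('p) / 2^m" by simp
    have \<mu>2: "\<mu>\<^sup>2 = 2^m" using \<mu> by (metis lam_def power2_abs real_sqrt_pow2 zero_le_numeral zero_le_power)
    have "\<mu>\<^sup>2 * expectation (%x. (cf (k, a) x - cf (k, b) x)\<^sup>2) / 2 <= 2^m * (C * real CARD('p) / 2^m) / 2"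
      unfolding \<mu>2 using v by (intro divide_right_mono mult_left_mono) auto
    also have "... <= C * real CARD('p)" using C0 by simp
    finally show ?thesis using Yi[OF gr', of \<mu>] Ye[OF gr', of \<mu>] by simp
  qed
  have ne: "(dpairs m :: ((real^'p) \<times> (real^'p)) set) ~= {}"
  proof -
    have "(0, 0) \<in> (dpairs m :: ((real^'p) \<times> (real^'p)) set)" by (auto simp: dpairs_def dgrid_iff intro: exI[of _ 0])
    then show ?thesis by blast
  qed
  have "\<exists>Mx. Mx \<in> borel_measurable gauss_seq & integrable gauss_seq Mx & (\<forall>ab\<in>dpairs m. \<forall>x. \<bar>?d ab x\<bar> <= Mx x) &
    G.expectation Mx <= (ln (2 * real (card (dpairs m :: ((real^'p) \<times> (real^'p)) set))) + C * real CARD('p)) / lam"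
  proof (rule G.max_via_mgf[OF finite_dpairs ne lam0])
    fix ab :: "(real^'p) \<times> (real^'p)" assume ab: "ab \<in> dpairs m"
    show "?d ab \<in> borel_measurable gauss_seq" using Ym by simp
    show "integrable gauss_seq (%x. exp (lam * ?d ab x))" "integrable gauss_seq (%x. exp (- lam * ?d ab x))"
       "G.expectation (%x. exp (lam * ?d ab x)) <= exp (C * real CARD('p))" "G.expectation (%x. exp (- lam * ?d ab x)) <= exp (C * real CARD('p))"
      using bd[OF ab, of lam] bd[OF ab, of "- lam"] lam0 by auto
  qed
  then obtain Mx where Mx: "Mx \<in> borel_measurable gauss_seq" "integrable gauss_seq Mx"
     "\<forall>ab\<in>dpairs m. \<forall>x. \<bar>?d ab x\<bar> <= Mx x"
    "G.expectation Mx <= (ln (2 * real (card (dpairs m :: ((real^'p) \<times> (real^'p)) set))) + C * real CARD('p)) / lam"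
    by blast
  have "(ln (2 * real (card (dpairs m :: ((real^'p) \<times> (real^'p)) set))) + C * real CARD('p)) / lam
     <= (2 * (1 + 2 * real CARD('p) * (real m + 1) + C * real CARD('p))) / lam"
  proof (rule divide_right_mono)
    have "0 <= 1 + 2 * real CARD('p) * (real m + 1) + C * real CARD('p)" using C0 by simp
    then show "ln (2 * real (card (dpairs m :: ((real^'p) \<times> (real^'p)) set))) + C * real CARD('p) <= 2 * (1 + 2 * real CARD('p) * (real m + 1) + C * real CARD('p))"
      using ln_card_dpairs[where 'p='p, of m] by argo
  qed (use lam0 in simp)
  also have "... = chain_const CARD('p) C m" by (simp add: lam_def chain_const_def)
  finally show ?thesis using Mx by fastforce
qed

end

text \<open>The Gaussian family is required at all arguments, while chaining covers only the cube.
  Paths are extended by projecting their arguments to the cube.\<close>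

definition clamp01 :: "real^'p => real^'p" where
  "clamp01 u = (\<chi> i. max 0 (min 1 (u $ i)))"

lemma clamp01_cube: "clamp01 u \<in> cbox 0 1"
  by (auto simp: clamp01_def mem_box_cart)

lemma clamp01_id: "u \<in> cbox 0 1 ==> clamp01 u = u"
  by (auto simp: clamp01_def mem_box_cart vec_eq_iff)

context unif_family begin

text \<open>Summability of the level maxima makes the values along the dyadic roundings converge,
  with a common modulus, outside a null set. On the null set the path is set to 0, so continuity,
  and with it boundedness on the cube, holds for every outcome.\<close>

lemma continuous_gaussian:
  obtains B :: "'m => real^'p => (nat => real) => real" where
    "!!k u. B k u \<in> borel_measurable gauss_seq"
    "!!k x. continuous_on (cbox 0 1) (%u. B k u x)"
    "!!F c. finite F ==> (\<integral>x. iexp (\<Sum>s\<in>F. c s * B (fst s) (snd s) x) \<partial>gauss_seq) =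
      complex_of_real (exp (- (\<Sum>s\<in>F. \<Sum>t\<in>F. c s * c t * cov (fst s, clamp01 (snd s)) (fst t, clamp01 (snd t))) / 2))"
proof -
  interpret G: prob_space gauss_seq by (rule prob_space_gauss_seq)
  obtain Y :: "'m \<times> (real^'p) => (nat => real) => real" where
    Ym[measurable]: "!!s. Y s \<in> borel_measurable gauss_seq"
    and Yc: "!!F (\<sigma> :: 'm \<times> (real^'p) => _) c. finite F ==> (!!i. i \<in> F ==> snd (\<sigma> i) \<in> (\<Union>l. dgrid l)) ==>
      (\<integral>x. iexp (\<Sum>i\<in>F. c i * Y (\<sigma> i) x) \<partial>gauss_seq) = complex_of_real (exp (- (\<Sum>i\<in>F. \<Sum>j\<in>F. c i * c j * cov (\<sigma> i) (\<sigma> j)) / 2))"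
    and Yi: "!!s t a. snd s \<in> (\<Union>l. dgrid l) ==> snd t \<in> (\<Union>l. dgrid l) ==> integrable gauss_seq (%x. exp (a * (Y s x - Y t x)))"
    and Ye: "!!s t a. snd s \<in> (\<Union>l. dgrid l) ==> snd t \<in> (\<Union>l. dgrid l) ==>
      (\<integral>x. exp (a * (Y s x - Y t x)) \<partial>gauss_seq) = exp (a\<^sup>2 * expectation (%x. (cf s x - cf t x)\<^sup>2) / 2)"
    by (rule dyadic_gaussian[where 'i="'m \<times> (real^'p)"]) blast
  have "\<forall>k. \<exists>Mx. \<forall>m. Mx m \<in> borel_measurable gauss_seq & integrable gauss_seq (Mx m) &
    (\<forall>ab\<in>dpairs m. \<forall>x. \<bar>Y (k, fst ab) x - Y (k, snd ab) x\<bar> <= Mx m x) &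
    (\<integral>x. Mx m x \<partial>gauss_seq) <= chain_const CARD('p) C m"
    by (intro allI choice gaussian_level_bound[OF Ym Yi Ye])
  from choice[OF this] obtain Mx where Mx: "\<forall>k m. Mx k m \<in> borel_measurable gauss_seq & integrable gauss_seq (Mx k m) &
    (\<forall>ab\<in>dpairs m. \<forall>x. \<bar>Y (k, fst ab) x - Y (k, snd ab) x\<bar> <= Mx k m x) &
    (\<integral>x. Mx k m x \<partial>gauss_seq) <= chain_const CARD('p) C m" by blast
  have Mm[measurable]: "Mx k m \<in> borel_measurable gauss_seq" and Mi: "integrable gauss_seq (Mx k m)"
    and Me: "(\<integral>x. Mx k m x \<partial>gauss_seq) <= chain_const CARD('p) C m" for k m using Mx by auto
  have Mb: "\<bar>Y (k, a) x - Y (k, b) x\<bar> <= Mx k m x" if "(a, b) \<in> dpairs m" for k m a b x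
    using Mx that by fastforce
  have M0: "0 <= Mx k m x" for k m x
  proof -
    have "(0, 0) \<in> (dpairs m :: ((real^'p) \<times> (real^'p)) set)" by (auto simp: dpairs_def dgrid_iff intro: exI[of _ 0])
    from Mb[OF this, of k x] show ?thesis by simp
  qed
  define good where "good x \<longleftrightarrow> (\<forall>k. (\<Sum>m. ennreal (Mx k m x)) ~= top)" for x
  have good_meas[measurable]: "Measurable.pred gauss_seq good" unfolding good_def by measurable
  have good_sum: "summable (%m. Mx k m x)" if "good x" for k x
    using that M0 unfolding good_def by (intro summable_suminf_not_top) auto
  have good_AE: "AE x in gauss_seq. good x"
  proof -
    have "AE x in gauss_seq. (\<Sum>m. ennreal (Mx k m x)) ~= top" for k
    proof -
      have "(\<integral>\<^sup>+x. (\<Sum>m. ennreal (Mx k m x)) \<partial>gauss_seq) = (\<Sum>m. \<integral>\<^sup>+x. ennreal (Mx k m x) \<partial>gauss_seq)"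
        by (rule nn_integral_suminf) measurable
      also have "... = (\<Sum>m. ennreal (\<integral>x. Mx k m x \<partial>gauss_seq))"
        using Mi M0 by (simp add: nn_integral_eq_integral)
      also have "... <= (\<Sum>m. ennreal (chain_const CARD('p) C m))"
        by (intro suminf_le ennreal_leI Me) auto
      also have "... = ennreal (\<Sum>m. chain_const CARD('p) C m)"
        by (rule suminf_ennreal2) (auto intro: chain_const_nonneg C0 summable_chain_const)
      also have "... < top" by simp
      finally have "(\<integral>\<^sup>+x. (\<Sum>m. ennreal (Mx k m x)) \<partial>gauss_seq) ~= top" by simp
      then show ?thesis by (intro nn_integral_noteq_infinite[where 'a="nat => real", simplified infinity_ennreal_def]) measurable
    qed
    then show ?thesis unfolding good_def by (subst AE_all_countable) auto
  qed
  define B where "B k u x = (if good x then lim (%l. Y (k, dproj l (clamp01 u)) x) else 0)" for k u x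
  have Bm: "B k u \<in> borel_measurable gauss_seq" for k u unfolding B_def by measurable
  have conv: "(%l. Y (k, dproj l u) x) \<longlonglongrightarrow> B k u x" if g: "good x" and u: "u \<in> cbox 0 1" for k u x
  proof -
    have "summable (%l. Y (k, dproj (Suc l) u) x - Y (k, dproj l u) x)"
    proof (rule summable_comparison_test'[of "%l. Mx k (Suc l) x" 0])
      show "summable (%l. Mx k (Suc l) x)" by (rule summable_Suc_iff[THEN iffD2]) (rule good_sum[OF g])
      show "norm (Y (k, dproj (Suc l) u) x - Y (k, dproj l u) x) <= Mx k (Suc l) x" for l
        using Mb[OF dproj_Suc_pair[OF u]] by simp
    qed
    then have "convergent (%n. \<Sum>l<n. Y (k, dproj (Suc l) u) x - Y (k, dproj l u) x)" by (simp add: summable_iff_convergent)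
    then have "convergent (%n. Y (k, dproj n u) x - Y (k, dproj 0 u) x)"
      by (simp add: sum_lessThan_telescope[where f="%l. Y (k, dproj l u) x"])
    then have "convergent (%n. Y (k, dproj n u) x)" by (simp add: convergent_diff_const_right_iff)
    then show ?thesis unfolding B_def using g u by (simp add: clamp01_id convergent_LIMSEQ_iff)
  qed
  have mod: "\<bar>B k u x - B k v x\<bar> <= 2 * (\<Sum>m. Mx k (m + l) x)"
    if g: "good x" and uv: "u \<in> cbox 0 1" "v \<in> cbox 0 1" "!!i. \<bar>u $ i - v $ i\<bar> <= 1 / 2^l" for k u v x l
  proof (rule LIMSEQ_le_const2)
    show "(%L. \<bar>Y (k, dproj L u) x - Y (k, dproj L v) x\<bar>) \<longlonglongrightarrow> \<bar>B k u x - B k v x\<bar>"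
      by (intro tendsto_intros conv g uv)
    have "\<bar>Y (k, dproj L u) x - Y (k, dproj L v) x\<bar> <= 2 * (\<Sum>m. Mx k (m + l) x)" if L: "l <= L" for L
    proof -
      have "\<bar>Y (k, dproj L u) x - Y (k, dproj L v) x\<bar> <= 2 * (\<Sum>m\<in>{l..L}. Mx k m x)"
        by (rule chain_pair[of l L "%u. Y (k, u) x", OF _ uv L]) (rule Mb)
      also have "(\<Sum>m\<in>{l..L}. Mx k m x) = (\<Sum>m\<in>{0..L-l}. Mx k (m + l) x)"
        using sum.shift_bounds_cl_nat_ivl[of "%m. Mx k m x" 0 l "L - l"] L by simp
      also have "... <= (\<Sum>m. Mx k (m + l) x)"
        by (intro sum_le_suminf summable_ignore_initial_segment good_sum[OF g]) (auto simp: M0)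
      finally show ?thesis by simp
    qed
    then show "\<exists>N. \<forall>n\<ge>N. \<bar>Y (k, dproj n u) x - Y (k, dproj n v) x\<bar> <= 2 * (\<Sum>m. Mx k (m + l) x)" by blast
  qed
  have cont: "continuous_on (cbox 0 1) (%u. B k u x)" for k x
  proof (cases "good x")
    case False then show ?thesis by (simp add: B_def)
  next
    case g: True
    show ?thesis unfolding continuous_on_iff
    proof (intro ballI allI impI)
      fix u :: "real^'p" and e :: real assume u: "u \<in> cbox 0 1" and e: "e > 0"
      have "(%l. 2 * (\<Sum>m. Mx k (m + l) x)) \<longlonglongrightarrow> 2 * 0"
        by (intro tendsto_intros suminf_exist_split2 good_sum[OF g])
      then have "\<forall>\<^sub>F l in sequentially. 2 * (\<Sum>m. Mx k (m + l) x) < e"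
        using e by (intro order_tendstoD) auto
      then obtain l where l: "2 * (\<Sum>m. Mx k (m + l) x) < e" by (auto simp: eventually_sequentially)
      show "\<exists>d>0. \<forall>v\<in>cbox 0 1. dist v u < d --> dist (B k v x) (B k u x) < e"
      proof (intro exI[of _ "1 / 2^l"] conjI ballI impI)
        fix v :: "real^'p" assume v: "v \<in> cbox 0 1" "dist v u < 1 / 2^l"
        have "\<bar>v $ i - u $ i\<bar> <= 1 / 2^l" for i
          using dist_vec_nth_le[of v i u] v(2) by (simp add: dist_real_def)
        from mod[OF g v(1) u this, of k] l show "dist (B k v x) (B k u x) < e" by (simp add: dist_real_def)
      qed simp
    qed
  qed
  have char: "(\<integral>x. iexp (\<Sum>s\<in>F. c s * B (fst s) (snd s) x) \<partial>gauss_seq) =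
      complex_of_real (exp (- (\<Sum>s\<in>F. \<Sum>t\<in>F. c s * c t * cov (fst s, clamp01 (snd s)) (fst t, clamp01 (snd t))) / 2))"
    if F: "finite F" for F c
  proof -
    let ?\<sigma> = "%l s. (fst s, dproj l (clamp01 (snd s))) :: 'm \<times> (real^'p)"
    let ?I = "%l. \<integral>x. iexp (\<Sum>s\<in>F. c s * Y (?\<sigma> l s) x) \<partial>gauss_seq"
    have "?I \<longlonglongrightarrow> (\<integral>x. iexp (\<Sum>s\<in>F. c s * B (fst s) (snd s) x) \<partial>gauss_seq)"
    proof (rule integral_dominated_convergence[where w="%_. 1"])
      show "(%x. iexp (\<Sum>s\<in>F. c s * B (fst s) (snd s) x)) \<in> borel_measurable gauss_seq"
        using Bm by (simp del: of_real_sum)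
      show "(%x. iexp (\<Sum>s\<in>F. c s * Y (?\<sigma> l s) x)) \<in> borel_measurable gauss_seq" for l
        by (simp del: of_real_sum)
      show "AE x in gauss_seq. (%l. iexp (\<Sum>s\<in>F. c s * Y (?\<sigma> l s) x)) \<longlonglongrightarrow> iexp (\<Sum>s\<in>F. c s * B (fst s) (snd s) x)"
        using good_AE
      proof eventually_elim
        case (elim x)
        have "(%l. Y (?\<sigma> l s) x) \<longlonglongrightarrow> B (fst s) (snd s) x" for s
        proof -
          have "B (fst s) (clamp01 (snd s)) x = B (fst s) (snd s) x" unfolding B_def by (simp add: clamp01_id clamp01_cube)
          then show ?thesis using conv[OF elim clamp01_cube, of "fst s" "snd s"] by simp
        qed
        then show ?case by (intro tendsto_intros)
      qed
    qed (auto simp del: of_real_sum)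
    moreover have "?I l = complex_of_real (exp (- (\<Sum>s\<in>F. \<Sum>t\<in>F. c s * c t * cov (?\<sigma> l s) (?\<sigma> l t)) / 2))" for l
      by (rule Yc[OF F]) (auto intro: dproj_grid clamp01_cube)
    moreover have "(%l. complex_of_real (exp (- (\<Sum>s\<in>F. \<Sum>t\<in>F. c s * c t * cov (?\<sigma> l s) (?\<sigma> l t)) / 2))) \<longlonglongrightarrow>
       complex_of_real (exp (- (\<Sum>s\<in>F. \<Sum>t\<in>F. c s * c t * cov (fst s, clamp01 (snd s)) (fst t, clamp01 (snd t))) / 2))"
    proof -
      have "(%l. cov (k, dproj l u) (k', dproj l v)) \<longlonglongrightarrow> cov (k, u) (k', v)"
        if u: "u \<in> cbox 0 1" and v: "v \<in> cbox 0 1" for k k' u v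
      proof (rule Lim_null[THEN iffD2], rule Lim_null_comparison)
        have cl: "dproj l w \<in> cbox 0 1" if "w \<in> cbox 0 1" for l and w :: "real^'p" using dproj_grid[OF that] dgrid_cube by blast
        have sm: "(\<Sum>i\<in>UNIV. \<bar>dproj l w $ i - w $ i\<bar>) <= real CARD('p) * (1/2)^l" for l and w :: "real^'p"
        proof -
          have "(\<Sum>i\<in>UNIV. \<bar>dproj l w $ i - w $ i\<bar>) <= (\<Sum>i\<in>(UNIV::'p set). 1 / 2^l)"
          proof (rule sum_mono)
            fix i show "\<bar>dproj l w $ i - w $ i\<bar> <= 1 / 2^l" using dproj_dist[of w i l] by linarith
          qed
          then show ?thesis by (simp add: power_divide)
        qed
        show "\<forall>\<^sub>F l in sequentially. norm (cov (k, dproj l u) (k', dproj l v) - cov (k, u) (k', v)) <= 4 * C * real CARD('p) * (1/2)^l"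
        proof (intro always_eventually allI)
          fix l
          have "norm (cov (k, dproj l u) (k', dproj l v) - cov (k, u) (k', v)) <= 2 * C * ((\<Sum>i\<in>UNIV. \<bar>dproj l u $ i - u $ i\<bar>) + (\<Sum>i\<in>UNIV. \<bar>dproj l v $ i - v $ i\<bar>))"
            unfolding real_norm_def by (rule cov_lip[OF cl[OF u] u cl[OF v] v])
          also have "... <= 2 * C * (real CARD('p) * (1/2)^l + real CARD('p) * (1/2)^l)"
            using C0 by (intro mult_left_mono add_mono sm) auto
          finally show "norm (cov (k, dproj l u) (k', dproj l v) - cov (k, u) (k', v)) <= 4 * C * real CARD('p) * (1/2)^l"
            by (simp add: algebra_simps)
        qed
        have "(%l. 4 * C * real CARD('p) * (1/2)^l) \<longlonglongrightarrow> 4 * C * real CARD('p) * 0"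
          by (intro tendsto_intros LIMSEQ_power_zero) auto
        then show "(%l. 4 * C * real CARD('p) * (1/2)^l) \<longlonglongrightarrow> 0" by simp
      qed
      then have "(%l. cov (?\<sigma> l s) (?\<sigma> l t)) \<longlonglongrightarrow> cov (fst s, clamp01 (snd s)) (fst t, clamp01 (snd t))" for s t
        using clamp01_cube by blast
      then show ?thesis by (intro tendsto_intros) auto
    qed
    ultimately show ?thesis by (simp only: LIMSEQ_unique)
  qed
  show thesis by (rule that[OF Bm cont char])
qed

end

section \<open>Realisation on the real line and independent copies\<close>

lemma inj_seq_seq_real: "\<exists>\<phi> :: (nat => nat => real) => real. inj \<phi>"
proof -
  obtain b :: "nat set => real" where b: "bij_betw b UNIV UNIV"
    using nat_sets_eqpoll_reals unfolding eqpoll_def by blast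
  \<comment> \<open>Reals are first identified with sets of naturals by \<open>b\<close>; a double
    sequence of such sets is then coded as one set of triples.\<close>
  define \<phi>0 :: "(nat => nat => real) => nat set" where
    "\<phi>0 g = {prod_encode (i, prod_encode (j, n)) | i j n. n \<in> inv b (g i j)}" for g
  have "inj \<phi>0"
  proof (rule injI, intro ext)
    fix g g' :: "nat => nat => real" and i j assume eq: "\<phi>0 g = \<phi>0 g'"
    have mem: "n \<in> inv b (h i j) \<longleftrightarrow> prod_encode (i, prod_encode (j, n)) \<in> \<phi>0 h" for n h
      unfolding \<phi>0_def by (auto simp: prod_encode_eq)
    have "inv b (g i j) = inv b (g' i j)" using mem[of _ g] mem[of _ g'] eq by auto
    moreover have "surj b" using b by (simp add: bij_betw_def)
    ultimately show "g i j = g' i j" by (metis surj_f_inv_f)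
  qed
  then have "inj (b \<circ> \<phi>0)" using b by (intro inj_compose) (auto simp: bij_betw_def)
  then show ?thesis by blast
qed

text \<open>A left inverse \<open>\<psi>\<close> of an injection \<open>\<phi>\<close> into the
  reals pulls the sigma-algebra of \<open>Q\<close> back to the reals. There \<open>\<phi>\<close>
  is measurable, because \<open>\<psi>\<close> after \<open>\<phi>\<close> is the identity. The
  image measure lives on this pulled-back sigma-algebra, not on the Borel sets.\<close>

lemma real_realization:
  fixes Q :: "(nat => nat => real) measure"
  assumes "prob_space Q" "space Q = UNIV"
  obtains N :: "real measure" and \<psi> where "prob_space N" "\<psi> \<in> measurable N Q" "distr N Q \<psi> = Q"
proof -
  obtain \<phi> :: "(nat => nat => real) => real" where \<phi>: "inj \<phi>" using inj_seq_seq_real by blast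
  define \<psi> where "\<psi> = inv \<phi>"
  have \<psi>\<phi>: "\<psi> (\<phi> x) = x" for x unfolding \<psi>_def using \<phi> by simp
  let ?V = "vimage_algebra UNIV \<psi> Q"
  have m1: "\<phi> \<in> measurable Q ?V"
    by (rule measurable_vimage_algebra2) (auto simp: assms \<psi>\<phi>)
  have m2: "\<psi> \<in> measurable (distr Q ?V \<phi>) Q"
    using measurable_vimage_algebra1[of \<psi> UNIV Q] assms by simp
  have "distr (distr Q ?V \<phi>) Q \<psi> = distr Q Q (\<psi> \<circ> \<phi>)"
    using m2 m1 by (intro distr_distr) auto
  also have "... = Q" by (simp add: comp_def \<psi>\<phi> distr_id2)
  finally show ?thesis using that[OF prob_space.prob_space_distr[OF assms(1) m1] m2] by blast
qed

context unif_family begin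

definition covc :: "'m \<times> (real^'p) => 'm \<times> (real^'p) => real" where
  "covc s t = cov (fst s, clamp01 (snd s)) (fst t, clamp01 (snd t))"

text \<open>The copies are driven by the coordinates of an i.i.d. sequence of Gaussian sequences.
  Their independence concerns the whole random families, with the product sigma-algebra over all
  pairs \<open>(k, u)\<close>.\<close>

lemma gaussian_copies:
  obtains N :: "real measure" and B :: "nat => 'm => real^'p => real => real" where
    "prob_space N"
    "!!j k u. B j k u \<in> borel_measurable N"
    "!!j k om. continuous_on (cbox 0 1) (%u. B j k u om)"
    "!!J F c. finite J ==> (!!j. finite (F j)) ==>
       (\<integral>om. iexp (\<Sum>j\<in>J. \<Sum>s\<in>F j. c j s * B j (fst s) (snd s) om) \<partial>N) =
       complex_of_real (exp (- (\<Sum>j\<in>J. \<Sum>s\<in>F j. \<Sum>t\<in>F j. c j s * c j t * covc s t) / 2))"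
    "prob_space.indep_vars N (%_. PiM UNIV (%_. borel)) (%j om. %(k, u). B j k u om) UNIV"
proof -
  obtain B0 :: "'m => real^'p => (nat => real) => real" where
    Bm[measurable]: "!!k u. B0 k u \<in> borel_measurable gauss_seq"
    and Bc: "!!k x. continuous_on (cbox 0 1) (%u. B0 k u x)"
    and Bch: "!!F c. finite F ==> (\<integral>x. iexp (\<Sum>s\<in>F. c s * B0 (fst s) (snd s) x) \<partial>gauss_seq) =
      complex_of_real (exp (- (\<Sum>s\<in>F. \<Sum>t\<in>F. c s * c t * cov (fst s, clamp01 (snd s)) (fst t, clamp01 (snd t))) / 2))"
    by (rule continuous_gaussian) (rule that, assumption+)
  let ?Q = "PiM UNIV (%_::nat. gauss_seq)"
  have pQ: "prob_space ?Q" by (intro prob_space_PiM prob_space_gauss_seq)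
  have sQ: "space ?Q = UNIV" by (auto simp: space_PiM)
  obtain N :: "real measure" and \<psi> where N: "prob_space N" and \<psi>[measurable]: "\<psi> \<in> measurable N ?Q" and dN: "distr N ?Q \<psi> = ?Q"
    by (rule real_realization[OF pQ sQ]) (rule that, assumption+)
  interpret N: prob_space N by fact
  interpret Q: prob_space ?Q by fact
  define B where "B j k u om = B0 k u (\<psi> om j)" for j k u om
  have comp: "(%om. \<psi> om j) \<in> measurable N gauss_seq" for j
    by (rule measurable_compose[OF \<psi>]) measurable
  show thesis
  proof (rule that[of N B])
    show "B j k u \<in> borel_measurable N" for j k u
      unfolding B_def by (rule measurable_compose[OF comp Bm])
    show "continuous_on (cbox 0 1) (%u. B j k u om)" for j k om unfolding B_def by (rule Bc)
    show "(\<integral>om. iexp (\<Sum>j\<in>J. \<Sum>s\<in>F j. c j s * B j (fst s) (snd s) om) \<partial>N) =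
       complex_of_real (exp (- (\<Sum>j\<in>J. \<Sum>s\<in>F j. \<Sum>t\<in>F j. c j s * c j t * covc s t) / 2))"
      if J: "finite J" and F: "!!j. finite (F j)" for J :: "nat set" and F c
    proof -
      define h where "h j y = (\<Sum>s\<in>F j. c j s * B0 (fst s) (snd s) y)" for j y
      have hm[measurable]: "h j \<in> borel_measurable gauss_seq" for j unfolding h_def by measurable
      have "(\<integral>om. iexp (\<Sum>j\<in>J. \<Sum>s\<in>F j. c j s * B j (fst s) (snd s) om) \<partial>N) = (\<integral>om. (\<Prod>j\<in>J. iexp (h j (\<psi> om j))) \<partial>N)"
        using J by (simp add: exp_sum[symmetric] sum_distrib_left[symmetric] h_def B_def)
      also have "... = (\<integral>x. (\<Prod>j\<in>J. iexp (h j (x j))) \<partial>distr N ?Q \<psi>)"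
        by (rule integral_distr[symmetric]) measurable
      also have "... = (\<integral>x. (\<Prod>j\<in>J. iexp (h j (x j))) \<partial>?Q)" unfolding dN ..
      also have "... = (\<Prod>j\<in>J. \<integral>x. iexp (h j (x j)) \<partial>?Q)"
      proof (rule Q.indep_vars_lebesgue_integral[OF J])
        show "Q.indep_vars (%_. borel) (%j x. iexp (h j (x j))) J"
          using Q.indep_vars_compose2[OF Q.indep_vars_subset[OF PiM_indep_coords[of "%_::nat. gauss_seq"]], of J "%j y. iexp (h j y)" "%_. borel"]
            prob_space_gauss_seq by simp
        show "integrable ?Q (%x. iexp (h j (x j)))" for j
          by (rule Q.integrable_const_bound[of _ 1]) auto
      qed
      also have "... = (\<Prod>j\<in>J. complex_of_real (exp (- (\<Sum>s\<in>F j. \<Sum>t\<in>F j. c j s * c j t * covc s t) / 2)))"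
      proof (rule prod.cong[OF refl])
        fix j
        have "(\<integral>x. iexp (h j (x j)) \<partial>?Q) = (\<integral>y. iexp (h j y) \<partial>gauss_seq)"
          by (rule integral_PiM_component(1)[of "%_::nat. gauss_seq"]) (auto intro: prob_space_gauss_seq)
        then show "(\<integral>x. iexp (h j (x j)) \<partial>?Q) = complex_of_real (exp (- (\<Sum>s\<in>F j. \<Sum>t\<in>F j. c j s * c j t * covc s t) / 2))"
          unfolding h_def using Bch[OF F] unfolding covc_def by simp
      qed
      also have "... = complex_of_real (exp (- (\<Sum>j\<in>J. \<Sum>s\<in>F j. \<Sum>t\<in>F j. c j s * c j t * covc s t) / 2))"
        using J by (simp add: exp_sum[symmetric] of_real_prod[symmetric] sum_negf sum_divide_distrib del: of_real_prod)
      finally show ?thesis .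
    qed
    let ?\<Psi> = "%y. %(k, u). B0 k u y"
    have \<Psi>: "?\<Psi> \<in> measurable gauss_seq (PiM UNIV (%_. borel))"
      by (rule measurable_PiM_single') (auto simp: space_PiM)
    have iQ: "Q.indep_vars (%_. gauss_seq) (%j x. x j) UNIV"
      by (rule PiM_indep_coords) (rule prob_space_gauss_seq)
    have "N.indep_vars (%_. gauss_seq) (%j om. \<psi> om j) UNIV"
    proof (subst N.indep_vars_iff_distr_eq_PiM')
      have c: "distr N gauss_seq (%om. \<psi> om j) = gauss_seq" for j
      proof -
        have "distr N gauss_seq (%om. \<psi> om j) = distr (distr N ?Q \<psi>) gauss_seq (%x. x j)"
          by (subst distr_distr) (auto simp: comp_def)
        then show ?thesis unfolding dN by (subst (asm) distr_PiM_component) (auto intro: prob_space_gauss_seq)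
      qed
      show "distr N (PiM UNIV (%_. gauss_seq)) (%x. \<lambda>i\<in>UNIV. \<psi> x i) = (\<Pi>\<^sub>M i\<in>UNIV. distr N gauss_seq (%om. \<psi> om i))"
        unfolding c restrict_UNIV using dN by simp
    qed (auto intro: comp)
    from N.indep_vars_compose2[OF this, of "%_. ?\<Psi>" "%_. PiM UNIV (%_. borel)"] \<Psi>
    show "N.indep_vars (%_. PiM UNIV (%_. borel)) (%j om. %(k, u). B j k u om) UNIV"
      unfolding B_def by simp
  qed (rule N)
qed

end

section \<open>The multiplier empirical process\<close>

text \<open>A number is the integral over \<open>t \<ge> 0\<close> of the indicator that it exceeds
  \<open>t\<close>, minus the same for its negative. A weighted sum thereby becomes an integral of
  unweighted sums over index sets that depend on the weights alone.\<close>

lemma layer_cake_bound: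
  fixes v a :: "nat => real"
  assumes I: "finite I"
  shows "ennreal \<bar>\<Sum>i\<in>I. v i * a i\<bar> <= (\<integral>\<^sup>+t. indicator {0..} t *
     (ennreal \<bar>\<Sum>i\<in>{i\<in>I. v i > t}. a i\<bar> + ennreal \<bar>\<Sum>i\<in>{i\<in>I. - v i > t}. a i\<bar>) \<partial>lborel)"
proof -
  define g where "g t = (\<Sum>i\<in>I. (indicator {0..<max (v i) 0} t - indicator {0..<max (- v i) 0} t) * a i)" for t :: real
  have ind: "integrable lborel (indicator {0..<max y 0} :: real => real)" "(\<integral>t. indicator {0..<max y 0} t \<partial>lborel) = max y 0" for y :: real
    by (simp_all add: integrable_indicator_iff)
  have gi: "integrable lborel g" unfolding g_def using ind by (intro Bochner_Integration.integrable_sum integrable_mult_left Bochner_Integration.integrable_diff)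
  have gint: "(\<integral>t. g t \<partial>lborel) = (\<Sum>i\<in>I. v i * a i)"
  proof -
    have "(\<integral>t. g t \<partial>lborel) = (\<Sum>i\<in>I. (max (v i) 0 - max (- v i) 0) * a i)"
      unfolding g_def using ind by (subst Bochner_Integration.integral_sum) auto
    also have "... = (\<Sum>i\<in>I. v i * a i)" by (intro sum.cong refl) (auto simp: max_def)
    finally show ?thesis .
  qed
  have gb: "ennreal \<bar>g t\<bar> <= indicator {0..} t * (ennreal \<bar>\<Sum>i\<in>{i\<in>I. v i > t}. a i\<bar> + ennreal \<bar>\<Sum>i\<in>{i\<in>I. - v i > t}. a i\<bar>)" for t
  proof (cases "t >= 0")
    case False
    then have "g t = 0" unfolding g_def by (intro sum.neutral) (auto simp: indicator_def)
    then show ?thesis by simp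
  next
    case True
    have "g t = (\<Sum>i\<in>I. if v i > t then a i else 0) - (\<Sum>i\<in>I. if - v i > t then a i else 0)"
      unfolding g_def sum_subtractf[symmetric] using True by (intro sum.cong refl) (auto simp: indicator_def max_def)
    also have "... = (\<Sum>i\<in>{i\<in>I. v i > t}. a i) - (\<Sum>i\<in>{i\<in>I. - v i > t}. a i)"
      using I by (simp add: sum.inter_filter)
    finally have "\<bar>g t\<bar> <= \<bar>\<Sum>i\<in>{i\<in>I. v i > t}. a i\<bar> + \<bar>\<Sum>i\<in>{i\<in>I. - v i > t}. a i\<bar>" by simp
    then have "ennreal \<bar>g t\<bar> <= ennreal (\<bar>\<Sum>i\<in>{i\<in>I. v i > t}. a i\<bar> + \<bar>\<Sum>i\<in>{i\<in>I. - v i > t}. a i\<bar>)" by (rule ennreal_leI)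
    then show ?thesis using True by simp
  qed
  have "ennreal \<bar>\<Sum>i\<in>I. v i * a i\<bar> = ennreal (norm (\<integral>t. g t \<partial>lborel))" by (simp add: gint)
  also have "... <= (\<integral>\<^sup>+t. norm (g t) \<partial>lborel)" by (rule integral_norm_bound_ennreal[OF gi])
  also have "... <= (\<integral>\<^sup>+t. indicator {0..} t * (ennreal \<bar>\<Sum>i\<in>{i\<in>I. v i > t}. a i\<bar> + ennreal \<bar>\<Sum>i\<in>{i\<in>I. - v i > t}. a i\<bar>) \<partial>lborel)"
    by (intro nn_integral_mono) (use gb in simp)
  finally show ?thesis .
qed

text \<open>The random index set takes finitely many values, so a family of majorants chosen
  separately for each index set can be evaluated at it measurably.\<close>

lemma measurable_filter_set:
  assumes "!!i. i < (n::nat) ==> Measurable.pred M (Q i)"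
  shows "(%x. {i\<in>{..<n}. Q i x}) \<in> measurable M (count_space (Pow {..<n}))"
proof (rule measurable_count_space_eq2[THEN iffD2])
  show "finite (Pow {..<n})" by simp
  show "(%x. {i\<in>{..<n}. Q i x}) \<in> space M \<rightarrow> Pow {..<n} & (\<forall>J\<in>Pow {..<n}. (%x. {i\<in>{..<n}. Q i x}) -` {J} \<inter> space M \<in> sets M)"
  proof (intro conjI ballI)
    fix J assume J: "J \<in> Pow {..<n}"
    have "(%x. {i\<in>{..<n}. Q i x}) -` {J} \<inter> space M = {x\<in>space M. \<forall>i\<in>{..<n}. Q i x \<longleftrightarrow> i \<in> J}"
      using J by auto
    also have "... \<in> sets M"
    proof (rule sets.sets_Collect_finite_All)
      fix i assume "i \<in> {..<n}"
      then have [measurable]: "Measurable.pred M (Q i)" using assms by simp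
      show "{x \<in> space M. Q i x \<longleftrightarrow> i \<in> J} \<in> sets M" by measurable
    qed simp
    finally show "(%x. {i\<in>{..<n}. Q i x}) -` {J} \<inter> space M \<in> sets M" .
  qed auto
qed

text \<open>The arithmetic-geometric mean inequality. With \<open>m\<close> the square root of the
  mean of \<open>s\<^sup>2\<close>, it bounds the mean of \<open>s\<close> by
  \<open>m\<close>.\<close>

lemma le_square_over_plus: "s <= s\<^sup>2 / (2 * m) + m / 2" if "m > 0" for s m :: real
proof -
  have "s\<^sup>2 / (2 * m) + m / 2 - s = (s - m)\<^sup>2 / (2 * m)"
    using that by (simp add: field_simps power2_eq_square)
  moreover have "0 <= (s - m)\<^sup>2 / (2 * m)" using that by simp
  ultimately show ?thesis by linarith
qed

context unif_class begin

definition Rmod :: "nat => nat set => (nat => 's) => real" where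
  "Rmod l J = (SOME R. R \<in> borel_measurable (PiM UNIV (%_::nat. P)) & integrable (PiM UNIV (%_::nat. P)) R &
    (\<forall>x. 0 <= R x) & (J = {} --> (\<forall>x. R x = 0)) &
    (\<forall>u\<in>cbox 0 1. \<forall>v\<in>cbox 0 1. (\<forall>i. \<bar>u $ i - v $ i\<bar> <= 1 / 2^l) --> (\<forall>x. \<bar>T J u x - T J v x\<bar> <= R x)) &
    seqP.expectation R <= 4 * chain_tail CARD('p) C l * sqrt (card J) + (2 * 2^l + 4 * (C * CARD('p))))"

definition cmod_l :: "nat => real" where
  "cmod_l l = 2 * 2^l + 4 * (C * CARD('p))"

lemma Rmod:
  assumes "finite J"
  shows "Rmod l J \<in> borel_measurable (PiM UNIV (%_::nat. P))" "integrable (PiM UNIV (%_::nat. P)) (Rmod l J)"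
    "0 <= Rmod l J x" "J = {} ==> Rmod l J x = 0"
    "u \<in> cbox 0 1 ==> v \<in> cbox 0 1 ==> (!!i. \<bar>u $ i - v $ i\<bar> <= 1 / 2^l) ==> \<bar>T J u x - T J v x\<bar> <= Rmod l J x"
    "seqP.expectation (Rmod l J) <= 4 * chain_tail CARD('p) C l * sqrt (card J) + cmod_l l"
  using someI_ex[OF modulus_bound[OF assms, of l], folded Rmod_def] unfolding cmod_l_def by auto

lemma chain_tail_nonneg: "0 <= chain_tail CARD('p) C l"
  using C by (intro order_trans[OF sum_nonneg chain_sum_le_tail[of "real CARD('p)" C l 0]]) (auto intro: chain_const_nonneg)

lemma cmod_l_nonneg: "0 <= cmod_l l" unfolding cmod_l_def using C by simp

text \<open>A measurable majorant for the oscillation of the weighted sums at scale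
  \<open>1 / 2^l\<close>; the supremum itself runs over uncountably many arguments.\<close>

definition Qm :: "nat => nat => (nat => real) => (nat => 's) => ennreal" where
  "Qm l n v x = (\<integral>\<^sup>+t. indicator {0..} t *
     (ennreal (Rmod l {i\<in>{..<n}. v i > t} x) + ennreal (Rmod l {i\<in>{..<n}. - v i > t} x)) \<partial>lborel)"

lemma Qm_bound:
  assumes "u \<in> cbox 0 1" "u' \<in> cbox 0 1" "!!i. \<bar>u $ i - u' $ i\<bar> <= 1 / 2^l"
  shows "ennreal \<bar>(\<Sum>i<n. v i * (f u (x i) - expectation (f u))) - (\<Sum>i<n. v i * (f u' (x i) - expectation (f u')))\<bar> <= Qm l n v x"
proof -
  let ?a = "%i. (f u (x i) - expectation (f u)) - (f u' (x i) - expectation (f u'))"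
  have s: "(\<Sum>i\<in>J. ?a i) = T J u x - T J u' x" for J by (simp add: T_def sum_subtractf)
  have b: "ennreal \<bar>\<Sum>i\<in>J. ?a i\<bar> <= ennreal (Rmod l J x)" if "finite J" for J
    unfolding s by (intro ennreal_leI Rmod(5)[OF that] assms)
  have "(\<Sum>i<n. v i * (f u (x i) - expectation (f u))) - (\<Sum>i<n. v i * (f u' (x i) - expectation (f u'))) = (\<Sum>i<n. v i * ?a i)"
    by (simp only: sum_subtractf[symmetric] right_diff_distrib)
  then have "ennreal \<bar>(\<Sum>i<n. v i * (f u (x i) - expectation (f u))) - (\<Sum>i<n. v i * (f u' (x i) - expectation (f u')))\<bar>
     <= (\<integral>\<^sup>+t. indicator {0..} t * (ennreal \<bar>\<Sum>i\<in>{i\<in>{..<n}. v i > t}. ?a i\<bar> + ennreal \<bar>\<Sum>i\<in>{i\<in>{..<n}. - v i > t}. ?a i\<bar>) \<partial>lborel)"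
    using layer_cake_bound[of "{..<n}" v ?a] by simp
  also have "... <= Qm l n v x" unfolding Qm_def
    by (intro nn_integral_mono mult_left_mono add_mono b) auto
  finally show ?thesis .
qed

lemma Qm_integrand_measurable:
  fixes V :: "'b => nat => real"
  assumes V: "!!i. i < n ==> (%om. V om i) \<in> borel_measurable N" and X: "X \<in> measurable N (PiM UNIV (%_::nat. P))"
  shows "(%(om, t). indicator {0..} t *
     (ennreal (Rmod l {i\<in>{..<n}. V om i > t} (X om)) + ennreal (Rmod l {i\<in>{..<n}. - V om i > t} (X om)))) \<in> borel_measurable (N \<Otimes>\<^sub>M lborel)"
proof -
  have 1: "(%z. Rmod l J (X (fst z))) \<in> borel_measurable (N \<Otimes>\<^sub>M lborel)" if "J \<in> Pow {..<n}" for J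
    using that finite_subset by (intro measurable_compose[OF measurable_compose[OF measurable_fst X] Rmod(1)]) auto
  have p: "Measurable.pred (N \<Otimes>\<^sub>M lborel) (%z. V (fst z) i > snd z)" "Measurable.pred (N \<Otimes>\<^sub>M lborel) (%z. - V (fst z) i > snd z)" if "i < n" for i
  proof -
    have a: "(%z. V (fst z) i) \<in> borel_measurable (N \<Otimes>\<^sub>M (lborel :: real measure))" by (rule measurable_compose[OF measurable_fst V[OF that]])
    have b: "(%z. snd z :: real) \<in> borel_measurable (N \<Otimes>\<^sub>M lborel)" using measurable_snd[of N "lborel :: real measure"] by (simp add: measurable_def)
    show "Measurable.pred (N \<Otimes>\<^sub>M lborel) (%z. V (fst z) i > snd z)" "Measurable.pred (N \<Otimes>\<^sub>M lborel) (%z. - V (fst z) i > snd z)"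
      unfolding pred_def by (rule borel_measurable_less[OF b a], rule borel_measurable_less[OF b borel_measurable_uminus[OF a]])
  qed
  have 2: "(%z. Rmod l {i\<in>{..<n}. V (fst z) i > snd z} (X (fst z))) \<in> borel_measurable (N \<Otimes>\<^sub>M lborel)"
    by (rule measurable_compose_countable'[OF 1 measurable_filter_set[OF p(1)]]) (auto intro: countable_finite)
  have 3: "(%z. Rmod l {i\<in>{..<n}. - V (fst z) i > snd z} (X (fst z))) \<in> borel_measurable (N \<Otimes>\<^sub>M lborel)"
    by (rule measurable_compose_countable'[OF 1 measurable_filter_set[OF p(2)]]) (auto intro: countable_finite)
  show ?thesis unfolding case_prod_beta using 2 3 by measurable
qed

lemma Qm_measurable:
  fixes V :: "'b => nat => real"
  assumes V: "!!i. i < n ==> (%om. V om i) \<in> borel_measurable N" and X: "X \<in> measurable N (PiM UNIV (%_::nat. P))"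
  shows "(%om. Qm l n (V om) (X om)) \<in> borel_measurable N"
  unfolding Qm_def using Qm_integrand_measurable[OF V X, where l=l and n=n] by (rule lborel.borel_measurable_nn_integral)

text \<open>Both index sets at threshold \<open>t\<close> are contained in the set where the modulus
  of the weight exceeds \<open>t\<close>, which doubles the constants of \<open>Rmod\<close>. The
  additive constant counts only while that set is nonempty.\<close>

lemma Qm_expectation_sample:
  "(\<integral>\<^sup>+x. Qm l n v x \<partial>PiM UNIV (%_::nat. P)) \<le>
   (\<integral>\<^sup>+t. indicator {0..} t * (ennreal (8 * chain_tail CARD('p) C l * sqrt (card {i\<in>{..<n}. \<bar>v i\<bar> > t}))
      + (if {i\<in>{..<n}. \<bar>v i\<bar> > t} = {} then 0 else ennreal (2 * cmod_l l))) \<partial>lborel)"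
proof -
  interpret pair_sigma_finite "PiM UNIV (%_::nat. P)" lborel ..
  let ?g = "%x t. indicator {0..} t * (ennreal (Rmod l {i\<in>{..<n}. v i > t} x) + ennreal (Rmod l {i\<in>{..<n}. - v i > t} x))"
  have "(%(x, t). ?g x t) \<in> borel_measurable (PiM UNIV (%_::nat. P) \<Otimes>\<^sub>M lborel)"
    using Qm_integrand_measurable[of n "%_. v" "PiM UNIV (%_::nat. P)" "%x. x" l] by simp
  from Fubini[OF this]
  have "(\<integral>\<^sup>+x. Qm l n v x \<partial>PiM UNIV (%_::nat. P)) = (\<integral>\<^sup>+t. \<integral>\<^sup>+x. ?g x t \<partial>PiM UNIV (%_::nat. P) \<partial>lborel)"
    unfolding Qm_def by simp
  also have "... <= (\<integral>\<^sup>+t. indicator {0..} t * (ennreal (8 * chain_tail CARD('p) C l * sqrt (card {i\<in>{..<n}. \<bar>v i\<bar> > t}))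
      + (if {i\<in>{..<n}. \<bar>v i\<bar> > t} = {} then 0 else ennreal (2 * cmod_l l))) \<partial>lborel)"
  proof (rule nn_integral_mono)
    fix t :: real
    let ?N = "{i\<in>{..<n}. \<bar>v i\<bar> > t}"
    have R: "(\<integral>\<^sup>+x. ennreal (Rmod l J x) \<partial>PiM UNIV (%_::nat. P)) <= ennreal (4 * chain_tail CARD('p) C l * sqrt (card ?N)) + (if ?N = {} then 0 else ennreal (cmod_l l))"
      if J: "J \<subseteq> ?N" for J
    proof (cases "?N = {}")
      case True
      then have "J = {}" using J by blast
      then show ?thesis using Rmod(4)[of "{}"] by simp
    next
      case False
      have fJ: "finite J" using J finite_subset by fastforce
      have "(\<integral>\<^sup>+x. ennreal (Rmod l J x) \<partial>PiM UNIV (%_::nat. P)) = ennreal (seqP.expectation (Rmod l J))"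
        by (rule nn_integral_eq_integral[OF Rmod(2)[OF fJ]]) (simp add: Rmod(3)[OF fJ])
      also have "... <= ennreal (4 * chain_tail CARD('p) C l * sqrt (card J) + cmod_l l)"
        by (rule ennreal_leI[OF Rmod(6)[OF fJ]])
      also have "... <= ennreal (4 * chain_tail CARD('p) C l * sqrt (card ?N) + cmod_l l)"
        using J chain_tail_nonneg by (intro ennreal_leI add_right_mono mult_left_mono real_sqrt_le_mono of_nat_mono card_mono) auto
      also have "... = ennreal (4 * chain_tail CARD('p) C l * sqrt (card ?N)) + ennreal (cmod_l l)"
        using chain_tail_nonneg cmod_l_nonneg by (intro ennreal_plus) auto
      finally show ?thesis unfolding if_not_P[OF False] .
    qed
    show "(\<integral>\<^sup>+x. ?g x t \<partial>PiM UNIV (%_::nat. P)) <= indicator {0..} t * (ennreal (8 * chain_tail CARD('p) C l * sqrt (card ?N)) + (if ?N = {} then 0 else ennreal (2 * cmod_l l)))"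
    proof (cases "t >= 0")
      case True
      let ?J1 = "{i\<in>{..<n}. v i > t}" and ?J2 = "{i\<in>{..<n}. - v i > t}"
      have [measurable]: "Rmod l ?J1 \<in> borel_measurable (PiM UNIV (%_::nat. P))" "Rmod l ?J2 \<in> borel_measurable (PiM UNIV (%_::nat. P))"
        by (auto intro: Rmod)
      have "(\<integral>\<^sup>+x. ?g x t \<partial>PiM UNIV (%_::nat. P)) = (\<integral>\<^sup>+x. ennreal (Rmod l ?J1 x) \<partial>PiM UNIV (%_::nat. P)) + (\<integral>\<^sup>+x. ennreal (Rmod l ?J2 x) \<partial>PiM UNIV (%_::nat. P))"
      proof -
        have "(\<integral>\<^sup>+x. ?g x t \<partial>PiM UNIV (%_::nat. P)) = (\<integral>\<^sup>+x. ennreal (Rmod l ?J1 x) + ennreal (Rmod l ?J2 x) \<partial>PiM UNIV (%_::nat. P))"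
          using True by (intro nn_integral_cong) simp
        also have "... = (\<integral>\<^sup>+x. ennreal (Rmod l ?J1 x) \<partial>PiM UNIV (%_::nat. P)) + (\<integral>\<^sup>+x. ennreal (Rmod l ?J2 x) \<partial>PiM UNIV (%_::nat. P))"
          by (rule nn_integral_add) measurable
        finally show ?thesis .
      qed
      also have "... <= (ennreal (4 * chain_tail CARD('p) C l * sqrt (card ?N)) + (if ?N = {} then 0 else ennreal (cmod_l l)))
          + (ennreal (4 * chain_tail CARD('p) C l * sqrt (card ?N)) + (if ?N = {} then 0 else ennreal (cmod_l l)))"
        by (intro add_mono R) auto
      also have "... = ennreal (8 * chain_tail CARD('p) C l * sqrt (card ?N)) + (if ?N = {} then 0 else ennreal (2 * cmod_l l))"
      proof -
        let ?y = "4 * chain_tail CARD('p) C l * sqrt (card ?N)"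
        have "0 <= ?y" using chain_tail_nonneg by simp
        then have "ennreal ?y + ennreal ?y = ennreal (8 * chain_tail CARD('p) C l * sqrt (card ?N))" by (simp flip: ennreal_plus)
        moreover have "ennreal (cmod_l l) + ennreal (cmod_l l) = ennreal (2 * cmod_l l)" using cmod_l_nonneg by (simp flip: ennreal_plus)
        ultimately show ?thesis by (auto simp: algebra_simps)
      qed
      finally show ?thesis using True by simp
    qed simp
  qed
  finally show ?thesis .
qed

text \<open>Since all weights have the same tail, the mean number of weights above \<open>t\<close>
  in modulus is \<open>n\<close> times that tail, and the mean of its square root is at most the
  square root of the mean; this produces the first integral. The thresholds at which some weight is
  still larger form an interval whose length is the largest modulus, which produces the
  second.\<close>

lemma Qm_expectation:
  fixes N :: "'b measure" and V :: "'b => nat => real"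
  assumes "prob_space N" and V: "!!i. i < n ==> (%om. V om i) \<in> borel_measurable N" and n: "n >= 1"
    and ex: "!!i t. i < n ==> measure N {om\<in>space N. \<bar>V om i\<bar> > t} = measure N {om\<in>space N. \<bar>V om 0\<bar> > t}"
  shows "(\<integral>\<^sup>+om. \<integral>\<^sup>+x. Qm l n (V om) x \<partial>PiM UNIV (%_::nat. P) \<partial>N) \<le>
     ennreal (8 * chain_tail CARD('p) C l) * ennreal (sqrt n) *
        (\<integral>\<^sup>+t. indicator {0..} t * ennreal (sqrt (measure N {om\<in>space N. \<bar>V om 0\<bar> > t})) \<partial>lborel)
     + ennreal (2 * cmod_l l) * (\<integral>\<^sup>+om. ennreal (Max ((%i. \<bar>V om i\<bar>) ` {..<n})) \<partial>N)"
proof -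
  interpret N: prob_space N by fact
  interpret pair_sigma_finite N lborel ..
  define Nt where "Nt om t = {i\<in>{..<n}. \<bar>V om i\<bar> > t}" for om t
  have Vp: "Measurable.pred (N \<Otimes>\<^sub>M lborel) (%z. \<bar>V (fst z) i\<bar> > snd z)" if "i < n" for i
  proof -
    have a: "(%z. V (fst z) i) \<in> borel_measurable (N \<Otimes>\<^sub>M (lborel :: real measure))" by (rule measurable_compose[OF measurable_fst V[OF that]])
    have b: "(%z. snd z :: real) \<in> borel_measurable (N \<Otimes>\<^sub>M lborel)" using measurable_snd[of N "lborel :: real measure"] by (simp add: measurable_def)
    show ?thesis unfolding pred_def by (rule borel_measurable_less[OF b borel_measurable_abs[OF a]])
  qed
  have Ntm[measurable]: "(%z. Nt (fst z) (snd z)) \<in> measurable (N \<Otimes>\<^sub>M lborel) (count_space (Pow {..<n}))"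
    unfolding Nt_def by (rule measurable_filter_set) (rule Vp)
  have sqm: "(%(om, t). indicator {0..} t * ennreal (sqrt (card (Nt om t)))) \<in> borel_measurable (N \<Otimes>\<^sub>M lborel)"
  proof -
    have "(%z. ennreal (sqrt (card (Nt (fst z) (snd z))))) \<in> borel_measurable (N \<Otimes>\<^sub>M lborel)"
      by (rule measurable_compose[OF Ntm]) simp
    then show ?thesis unfolding case_prod_beta by measurable
  qed
  have nem: "(%(om, t). indicator {0..} t * (if Nt om t = {} then 0 else 1 :: ennreal)) \<in> borel_measurable (N \<Otimes>\<^sub>M lborel)"
  proof -
    have "(%z. (if Nt (fst z) (snd z) = {} then 0 else 1 :: ennreal)) \<in> borel_measurable (N \<Otimes>\<^sub>M lborel)"
      by (rule measurable_compose[OF Ntm]) simp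
    then show ?thesis unfolding case_prod_beta by measurable
  qed
  have sq1: "(%t. indicator {0..} t * ennreal (sqrt (card (Nt om t)))) \<in> borel_measurable lborel" if "om \<in> space N" for om
    using measurable_Pair2[OF sqm that] by simp
  have ne1: "(%t. indicator {0..} t * (if Nt om t = {} then 0 else 1 :: ennreal)) \<in> borel_measurable lborel" if "om \<in> space N" for om
    using measurable_Pair2[OF nem that] by simp
  let ?c1 = "ennreal (8 * chain_tail CARD('p) C l)" and ?c2 = "ennreal (2 * cmod_l l)"
  have "(\<integral>\<^sup>+om. \<integral>\<^sup>+x. Qm l n (V om) x \<partial>PiM UNIV (%_::nat. P) \<partial>N) \<le>
     (\<integral>\<^sup>+om. ?c1 * (\<integral>\<^sup>+t. indicator {0..} t * ennreal (sqrt (card (Nt om t))) \<partial>lborel)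
        + ?c2 * (\<integral>\<^sup>+t. indicator {0..} t * (if Nt om t = {} then 0 else 1) \<partial>lborel) \<partial>N)"
  proof (rule nn_integral_mono)
    fix om assume w: "om \<in> space N"
    have "(\<integral>\<^sup>+x. Qm l n (V om) x \<partial>PiM UNIV (%_::nat. P)) \<le>
       (\<integral>\<^sup>+t. indicator {0..} t * (ennreal (8 * chain_tail CARD('p) C l * sqrt (card (Nt om t))) + (if Nt om t = {} then 0 else ?c2)) \<partial>lborel)"
      using Qm_expectation_sample[of l n "V om"] unfolding Nt_def .
    also have "... = (\<integral>\<^sup>+t. ?c1 * (indicator {0..} t * ennreal (sqrt (card (Nt om t)))) + ?c2 * (indicator {0..} t * (if Nt om t = {} then 0 else 1)) \<partial>lborel)"
      using chain_tail_nonneg by (intro nn_integral_cong) (auto simp: ennreal_mult indicator_def algebra_simps)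
    also have "... = ?c1 * (\<integral>\<^sup>+t. indicator {0..} t * ennreal (sqrt (card (Nt om t))) \<partial>lborel)
        + ?c2 * (\<integral>\<^sup>+t. indicator {0..} t * (if Nt om t = {} then 0 else 1) \<partial>lborel)"
      using sq1[OF w] ne1[OF w] by (simp add: nn_integral_add nn_integral_cmult)
    finally show "(\<integral>\<^sup>+x. Qm l n (V om) x \<partial>PiM UNIV (%_::nat. P)) <= ..." .
  qed
  also have "... = ?c1 * (\<integral>\<^sup>+om. \<integral>\<^sup>+t. indicator {0..} t * ennreal (sqrt (card (Nt om t))) \<partial>lborel \<partial>N)
      + ?c2 * (\<integral>\<^sup>+om. \<integral>\<^sup>+t. indicator {0..} t * (if Nt om t = {} then 0 else 1) \<partial>lborel \<partial>N)"
    using lborel.borel_measurable_nn_integral[OF sqm] lborel.borel_measurable_nn_integral[OF nem]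
    by (simp add: nn_integral_add nn_integral_cmult)
  also have "... <= ?c1 * (ennreal (sqrt n) * (\<integral>\<^sup>+t. indicator {0..} t * ennreal (sqrt (measure N {om\<in>space N. \<bar>V om 0\<bar> > t})) \<partial>lborel))
      + ?c2 * (\<integral>\<^sup>+om. ennreal (Max ((%i. \<bar>V om i\<bar>) ` {..<n})) \<partial>N)"
  proof (intro add_mono mult_left_mono)
    have "(\<integral>\<^sup>+om. \<integral>\<^sup>+t. indicator {0..} t * ennreal (sqrt (card (Nt om t))) \<partial>lborel \<partial>N) =
       (\<integral>\<^sup>+t. \<integral>\<^sup>+om. indicator {0..} t * ennreal (sqrt (card (Nt om t))) \<partial>N \<partial>lborel)"
      by (rule Fubini'[OF sqm, symmetric])
    also have "... <= (\<integral>\<^sup>+t. ennreal (sqrt n) * (indicator {0..} t * ennreal (sqrt (measure N {om\<in>space N. \<bar>V om 0\<bar> > t}))) \<partial>lborel)"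
    proof (rule nn_integral_mono)
      fix t :: real
      let ?p = "measure N {om\<in>space N. \<bar>V om 0\<bar> > t}"
      have evm: "{om\<in>space N. \<bar>V om i\<bar> > t} \<in> sets N" if "i < n" for i using V[OF that] by measurable
      have cardeq: "real (card (Nt om t)) = (\<Sum>i<n. indicator {om\<in>space N. \<bar>V om i\<bar> > t} om)" if "om \<in> space N" for om
      proof -
        have "(\<Sum>i<n. indicator {om\<in>space N. \<bar>V om i\<bar> > t} om) = (\<Sum>i<n. if \<bar>V om i\<bar> > t then 1 else 0 :: real)"
          using that by (intro sum.cong) (auto simp: indicator_def)
        then show ?thesis unfolding Nt_def by (simp add: sum.If_cases Int_def)
      qed
      have iS: "integrable N (%om. \<Sum>i<n. indicator {om\<in>space N. \<bar>V om i\<bar> > t} om :: real)"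
        using evm by (intro Bochner_Integration.integrable_sum) (auto simp: integrable_indicator_iff N.emeasure_eq_measure)
      have ES: "N.expectation (%om. \<Sum>i<n. indicator {om\<in>space N. \<bar>V om i\<bar> > t} om :: real) = n * ?p"
      proof -
        have "N.expectation (%om. \<Sum>i<n. indicator {om\<in>space N. \<bar>V om i\<bar> > t} om :: real) = (\<Sum>i<n. N.expectation (indicator {om\<in>space N. \<bar>V om i\<bar> > t}))"
          using evm by (intro Bochner_Integration.integral_sum) (auto simp: integrable_indicator_iff N.emeasure_eq_measure)
        also have "... = (\<Sum>i<n. ?p)"
        proof (rule sum.cong[OF refl])
          fix i assume "i \<in> {..<n}"
          then have i: "i < n" by simp
          have "N.expectation (indicator {om\<in>space N. \<bar>V om i\<bar> > t}) = measure N {om\<in>space N. \<bar>V om i\<bar> > t}"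
            using evm[OF i] by simp
          then show "N.expectation (indicator {om\<in>space N. \<bar>V om i\<bar> > t}) = ?p" by (rule trans) (rule ex[OF i])
        qed
        finally show ?thesis by simp
      qed
      have main: "(\<integral>\<^sup>+om. ennreal (sqrt (card (Nt om t))) \<partial>N) <= ennreal (sqrt n * sqrt ?p)"
      \<comment> \<open>The mean square argument divides by \<open>?m\<close>, so a vanishing tail
        is treated separately: then almost surely no weight exceeds \<open>t\<close>.\<close>
      proof (cases "?p = 0")
        case True
        have "AE om in N. card (Nt om t) = 0"
        proof -
          have "AE om in N. \<not> \<bar>V om i\<bar> > t" if i: "i < n" for i
          proof -
            have "{om\<in>space N. \<bar>V om i\<bar> > t} \<in> null_sets N"
              using ex[OF i, of t] True evm[OF i] by (auto simp: null_sets_def N.emeasure_eq_measure)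
            from AE_not_in[OF this] show ?thesis by (rule AE_mp) (auto intro!: AE_I2)
          qed
          then have "AE om in N. \<forall>i\<in>{..<n}. \<not> \<bar>V om i\<bar> > t" by (intro AE_finite_allI) auto
          then show ?thesis by (rule AE_mp) (auto intro!: AE_I2 simp: Nt_def)
        qed
        then have "(\<integral>\<^sup>+om. ennreal (sqrt (card (Nt om t))) \<partial>N) = (\<integral>\<^sup>+om. 0 \<partial>N)"
          by (intro nn_integral_cong_AE) auto
        then show ?thesis by simp
      next
        case False
        then have p0: "?p > 0" using zero_less_measure_iff by blast
        let ?m = "sqrt n * sqrt ?p"
        have m0: "?m > 0" using p0 n by simp
        have "(\<integral>\<^sup>+om. ennreal (sqrt (card (Nt om t))) \<partial>N) <= (\<integral>\<^sup>+om. ennreal ((\<Sum>i<n. indicator {om\<in>space N. \<bar>V om i\<bar> > t} om) / (2 * ?m) + ?m / 2) \<partial>N)"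
        proof (intro nn_integral_mono ennreal_leI)
          fix om assume w: "om \<in> space N"
          let ?s = "sqrt (card (Nt om t))"
          have "?s <= ?s\<^sup>2 / (2 * ?m) + ?m / 2" by (rule le_square_over_plus[OF m0])
          then show "?s <= (\<Sum>i<n. indicator {om\<in>space N. \<bar>V om i\<bar> > t} om) / (2 * ?m) + ?m / 2"
            using cardeq[OF w] by simp
        qed
        also have "... = ennreal (N.expectation (%om. (\<Sum>i<n. indicator {om\<in>space N. \<bar>V om i\<bar> > t} om) / (2 * ?m) + ?m / 2))"
          using iS m0 by (intro nn_integral_eq_integral) (auto intro!: AE_I2 add_nonneg_nonneg divide_nonneg_nonneg sum_nonneg)
        also have "N.expectation (%om. (\<Sum>i<n. indicator {om\<in>space N. \<bar>V om i\<bar> > t} om) / (2 * ?m) + ?m / 2) = n * ?p / (2 * ?m) + ?m / 2"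
        proof -
          have "N.expectation (%om. (\<Sum>i<n. indicator {om\<in>space N. \<bar>V om i\<bar> > t} om) / (2 * ?m) + ?m / 2)
            = N.expectation (%om. (\<Sum>i<n. indicator {om\<in>space N. \<bar>V om i\<bar> > t} om) / (2 * ?m)) + N.expectation (%om. ?m / 2)"
            using iS by (intro Bochner_Integration.integral_add) auto
          then show ?thesis using ES by (simp add: N.prob_space)
        qed
        also have "n * ?p / (2 * ?m) + ?m / 2 = ?m"
        proof -
          have "?m * ?m = (sqrt n * sqrt n) * (sqrt ?p * sqrt ?p)" by (simp only: mult_ac)
          then have "n * ?p = ?m * ?m" by simp
          then show ?thesis using m0 by simp
        qed
        finally show ?thesis .
      qed
      show "(\<integral>\<^sup>+om. indicator {0..} t * ennreal (sqrt (card (Nt om t))) \<partial>N) <= ennreal (sqrt n) * (indicator {0..} t * ennreal (sqrt ?p))"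
        using main by (cases "t >= 0") (auto simp: ennreal_mult)
    qed
    also have "... = ennreal (sqrt n) * (\<integral>\<^sup>+t. indicator {0..} t * ennreal (sqrt (measure N {om\<in>space N. \<bar>V om 0\<bar> > t})) \<partial>lborel)"
    proof (rule nn_integral_cmult)
      \<comment> \<open>Measurability in the threshold comes from monotonicity of the tail.\<close>
      have "antimono (%t. measure N {om\<in>space N. \<bar>V om 0\<bar> > t})"
        using V[of 0] n by (intro antimonoI N.finite_measure_mono) auto
      then have "mono (%t. - measure N {om\<in>space N. \<bar>V om 0\<bar> > t})" by (simp add: antimono_def mono_def)
      from borel_measurable_mono[OF this]
      have "(%t. - (- measure N {om\<in>space N. \<bar>V om 0\<bar> > t})) \<in> borel_measurable borel" by (intro borel_measurable_uminus) simp
      then have [measurable]: "(%t. measure N {om\<in>space N. \<bar>V om 0\<bar> > t}) \<in> borel_measurable borel" by simp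
      show "(%t. indicator {0..} t * ennreal (sqrt (measure N {om\<in>space N. \<bar>V om 0\<bar> > t}))) \<in> borel_measurable lborel"
        by simp
    qed
    finally show "(\<integral>\<^sup>+om. \<integral>\<^sup>+t. indicator {0..} t * ennreal (sqrt (card (Nt om t))) \<partial>lborel \<partial>N) \<le>
        ennreal (sqrt n) * (\<integral>\<^sup>+t. indicator {0..} t * ennreal (sqrt (measure N {om\<in>space N. \<bar>V om 0\<bar> > t})) \<partial>lborel)" .
    show "(\<integral>\<^sup>+om. \<integral>\<^sup>+t. indicator {0..} t * (if Nt om t = {} then 0 else 1) \<partial>lborel \<partial>N) <= (\<integral>\<^sup>+om. ennreal (Max ((%i. \<bar>V om i\<bar>) ` {..<n})) \<partial>N)"
    proof (rule nn_integral_mono)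
      fix om
      let ?m = "Max ((%i. \<bar>V om i\<bar>) ` {..<n})"
      have m0: "0 <= ?m" using n by (intro order_trans[OF abs_ge_zero[of "V om 0"] Max_ge]) auto
      have "(\<integral>\<^sup>+t. indicator {0..} t * (if Nt om t = {} then 0 else 1) \<partial>lborel) <= (\<integral>\<^sup>+t. indicator {0..?m} t \<partial>lborel)"
      proof (rule nn_integral_mono)
        fix t :: real
        have "t <= ?m" if ne: "Nt om t ~= {}"
        proof -
          obtain i where "i < n" "\<bar>V om i\<bar> > t" using ne unfolding Nt_def by auto
          moreover have "\<bar>V om i\<bar> <= ?m" using \<open>i < n\<close> by (intro Max_ge) auto
          ultimately show ?thesis by linarith
        qed
        then show "indicator {0..} t * (if Nt om t = {} then 0 else 1) <= (indicator {0..?m} t :: ennreal)"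
          by (auto simp: indicator_def)
      qed
      also have "... = ennreal ?m" using m0 by simp
      finally show "(\<integral>\<^sup>+t. indicator {0..} t * (if Nt om t = {} then 0 else 1) \<partial>lborel) <= ennreal ?m" .
    qed
  qed auto
  finally show ?thesis by (simp add: mult.assoc)
qed

end

section \<open>Integrating out the sample for fixed weights\<close>

lemma (in prob_space) distr_pair_of_indep_set:
  assumes X: "X \<in> measurable M S" and Y: "Y \<in> measurable M T"
    and ind: "indep_set (sets (vimage_algebra (space M) X S)) (sets (vimage_algebra (space M) Y T))"
  shows "distr M S X \<Otimes>\<^sub>M distr M T Y = distr M (S \<Otimes>\<^sub>M T) (%x. (X x, Y x))"
proof (rule pair_measure_eqI)
  show "sigma_finite_measure (distr M S X)" "sigma_finite_measure (distr M T Y)"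
    using X Y by (auto intro!: prob_space_imp_sigma_finite prob_space_distr)
  show "sets (distr M S X \<Otimes>\<^sub>M distr M T Y) = sets (distr M (S \<Otimes>\<^sub>M T) (%x. (X x, Y x)))"
    by (simp cong: sets_pair_measure_cong)
  fix A B assume "A \<in> sets (distr M S X)" "B \<in> sets (distr M T Y)"
  then have AB: "A \<in> sets S" "B \<in> sets T" by auto
  have "prob ((X -` A \<inter> space M) \<inter> (Y -` B \<inter> space M)) = prob (X -` A \<inter> space M) * prob (Y -` B \<inter> space M)"
    by (rule indep_setD[OF ind]) (auto intro: in_vimage_algebra AB)
  moreover have "(X -` A \<inter> space M) \<inter> (Y -` B \<inter> space M) = (%x. (X x, Y x)) -` (A \<times> B) \<inter> space M" by auto
  moreover have "(%x. (X x, Y x)) \<in> measurable M (S \<Otimes>\<^sub>M T)" using X Y by measurable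
  ultimately show "emeasure (distr M S X) A * emeasure (distr M T Y) B = emeasure (distr M (S \<Otimes>\<^sub>M T) (%x. (X x, Y x))) (A \<times> B)"
    using AB X Y by (simp add: emeasure_distr emeasure_eq_measure ennreal_mult)
qed

lemma (in prob_space) nn_integral_indep_var:
  assumes X[measurable]: "X \<in> measurable M S" and Y[measurable]: "Y \<in> measurable M T"
    and eq: "distr M S X \<Otimes>\<^sub>M distr M T Y = distr M (S \<Otimes>\<^sub>M T) (%x. (X x, Y x))"
    and F: "(%(x, y). F x y) \<in> borel_measurable (S \<Otimes>\<^sub>M T)"
  shows "(\<integral>\<^sup>+om. F (X om) (Y om) \<partial>M) = (\<integral>\<^sup>+om. \<integral>\<^sup>+x. F x (Y om) \<partial>distr M S X \<partial>M)"
proof -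
  interpret X: prob_space "distr M S X" by (rule prob_space_distr[OF X])
  interpret Y: prob_space "distr M T Y" by (rule prob_space_distr[OF Y])
  interpret pair_sigma_finite "distr M S X" "distr M T Y" ..
  have F': "(%(x, y). F x y) \<in> borel_measurable (distr M S X \<Otimes>\<^sub>M distr M T Y)"
    using F by (simp cong: measurable_cong_sets sets_pair_measure_cong)
  have "(\<integral>\<^sup>+om. F (X om) (Y om) \<partial>M) = (\<integral>\<^sup>+z. (case z of (x, y) => F x y) \<partial>distr M (S \<Otimes>\<^sub>M T) (%x. (X x, Y x)))"
    using F by (subst nn_integral_distr) auto
  also have "... = (\<integral>\<^sup>+y. \<integral>\<^sup>+x. F x y \<partial>distr M S X \<partial>distr M T Y)"
    unfolding eq[symmetric] using nn_integral_snd[OF F'] by simp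
  also have "... = (\<integral>\<^sup>+om. \<integral>\<^sup>+x. F x (Y om) \<partial>distr M S X \<partial>M)"
  proof -
    have "(%(y, x). F x y) \<in> borel_measurable (distr M T Y \<Otimes>\<^sub>M distr M S X)"
      using measurable_pair_swap[OF F'] by (simp add: case_prod_beta)
    from X.borel_measurable_nn_integral[OF this]
    have "(%y. \<integral>\<^sup>+x. F x y \<partial>distr M S X) \<in> borel_measurable T" by simp
    then show ?thesis by (simp add: nn_integral_distr[OF Y])
  qed
  finally show ?thesis .
qed

lemma (in prob_space) integral_indep_var:
  fixes F :: "'b => 'c => complex"
  assumes X[measurable]: "X \<in> measurable M S" and Y[measurable]: "Y \<in> measurable M T"
    and eq: "distr M S X \<Otimes>\<^sub>M distr M T Y = distr M (S \<Otimes>\<^sub>M T) (%x. (X x, Y x))"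
    and F: "(%(x, y). F x y) \<in> borel_measurable (S \<Otimes>\<^sub>M T)" and b: "!!x y. norm (F x y) <= 1"
  shows "(\<integral>om. F (X om) (Y om) \<partial>M) = (\<integral>om. \<integral>x. F x (Y om) \<partial>distr M S X \<partial>M)"
    and "(%om. \<integral>x. F x (Y om) \<partial>distr M S X) \<in> borel_measurable M"
proof -
  interpret X: prob_space "distr M S X" by (rule prob_space_distr[OF X])
  interpret Y: prob_space "distr M T Y" by (rule prob_space_distr[OF Y])
  interpret pair_prob_space "distr M S X" "distr M T Y" ..
  have F': "(%(x, y). F x y) \<in> borel_measurable (distr M S X \<Otimes>\<^sub>M distr M T Y)"
    using F by (simp cong: measurable_cong_sets sets_pair_measure_cong)
  have Fi: "integrable (distr M S X \<Otimes>\<^sub>M distr M T Y) (%(x, y). F x y)"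
    using b by (intro P.integrable_const_bound[of _ 1] F') auto
  have m: "(%y. \<integral>x. F x y \<partial>distr M S X) \<in> borel_measurable T"
  proof -
    have "(%(y, x). F x y) \<in> borel_measurable (distr M T Y \<Otimes>\<^sub>M distr M S X)"
      using measurable_pair_swap[OF F'] by (simp add: case_prod_beta)
    from X.borel_measurable_lebesgue_integral[OF this] show ?thesis by simp
  qed
  from measurable_compose[OF Y m] show "(%om. \<integral>x. F x (Y om) \<partial>distr M S X) \<in> borel_measurable M" .
  have "(\<integral>om. F (X om) (Y om) \<partial>M) = (\<integral>z. (case z of (x, y) => F x y) \<partial>distr M (S \<Otimes>\<^sub>M T) (%x. (X x, Y x)))"
    using F by (subst integral_distr) auto
  also have "... = (\<integral>y. \<integral>x. F x y \<partial>distr M S X \<partial>distr M T Y)"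
    unfolding eq[symmetric] using integral_snd[OF Fi] by simp
  also have "... = (\<integral>om. \<integral>x. F x (Y om) \<partial>distr M S X \<partial>M)"
    by (rule integral_distr[OF Y m])
  finally show "(\<integral>om. F (X om) (Y om) \<partial>M) = (\<integral>om. \<integral>x. F x (Y om) \<partial>distr M S X \<partial>M)" .
qed

section \<open>Truncated moments of exchangeable weights\<close>

lemma permutes_two_points:
  assumes "i < n" "k < n" "i ~= k" "i' < n" "k' < n" "i' ~= k'"
  obtains \<pi> :: "nat => nat" where "\<pi> permutes {..<n}" "\<pi> i = i'" "\<pi> k = k'"
proof
  let ?k = "Transposition.transpose i i' k"
  have k: "?k < n" "?k ~= i'" using assms by (auto simp: Transposition.transpose_def)
  show "Transposition.transpose ?k k' \<circ> Transposition.transpose i i' permutes {..<n}"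
    using assms k by (intro permutes_compose permutes_swap_id) auto
  show "(Transposition.transpose ?k k' \<circ> Transposition.transpose i i') i = i'" using assms k by (simp add: Transposition.transpose_def)
  show "(Transposition.transpose ?k k' \<circ> Transposition.transpose i i') k = k'" using assms k by simp
qed

definition wcent :: "nat => (nat => real) => nat => real" where
  "wcent n y i = y i - wbar n y"

lemma wcent_restrict: "i < n ==> wcent n (restrict y {..<n}) i = wcent n y i"
  by (simp add: wcent_def wbar_def)

lemma wcent_sum: "(\<Sum>i<n. wcent n y i) = 0"
  by (cases "n = 0") (simp_all add: wcent_def wbar_def sum_subtractf)

lemma wcent_permute:
  assumes "\<pi> permutes {..<n}" shows "wcent n (%i. y (\<pi> i)) i = wcent n y (\<pi> i)"
  unfolding wcent_def wbar_def using sum.permute[OF assms, of y] by (simp add: comp_def)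

lemma wcent_meas: "i < n ==> (%y. wcent n y i) \<in> borel_measurable (PiM {..<n} (%_. borel))"
  unfolding wcent_def wbar_def by (intro borel_measurable_diff borel_measurable_divide borel_measurable_sum) auto

locale exch_array = prob_space M for M :: "'a measure" +
  fixes Wn :: "nat => nat => 'a => real"
  assumes Wmeas: "!!n i. i < n ==> Wn n i \<in> borel_measurable M"
    and exch: "exch_weights M Wn" and cW: "condW M Wn"
begin

definition vn :: "nat => 'a => nat => real" where
  "vn n om i = wcent n (%i. Wn n i om) i"

lemma vn_meas[measurable]: "i < n ==> (%om. vn n om i) \<in> borel_measurable M"
  unfolding vn_def wcent_def wbar_def using Wmeas
  by (intro borel_measurable_diff borel_measurable_divide borel_measurable_sum) auto

lemma Wvec_meas: "(%om. restrict (%i. Wn n i om) {..<n}) \<in> measurable M (PiM {..<n} (%_. borel))"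
  using Wmeas by (intro measurable_restrict) auto

lemma exch_expectation:
  assumes \<pi>: "\<pi> permutes {..<n}" and g: "g \<in> borel_measurable (PiM {..<n} (%_. borel))"
    and g': "!!y. g (restrict y {..<n}) = g y"
  shows "expectation (%om. g (%i. Wn n (\<pi> i) om)) = (expectation (%om. g (%i. Wn n i om)) :: real)"
proof -
  have W2: "(%om. restrict (%i. Wn n (\<pi> i) om) {..<n}) \<in> measurable M (PiM {..<n} (%_. borel))"
    using Wmeas permutes_in_image[OF \<pi>] by (intro measurable_restrict) auto
  have eq: "distr M (PiM {..<n} (%_. borel)) (%om. restrict (%i. Wn n (\<pi> i) om) {..<n})
        = distr M (PiM {..<n} (%_. borel)) (%om. restrict (%i. Wn n i om) {..<n})"
    using exch \<pi> unfolding exch_weights_def by blast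
  have "expectation (%om. g (%i. Wn n (\<pi> i) om)) = integral\<^sup>L (distr M (PiM {..<n} (%_. borel)) (%om. restrict (%i. Wn n (\<pi> i) om) {..<n})) g"
    using g' by (subst integral_distr[OF W2 g]) simp
  also have "... = expectation (%om. g (%i. Wn n i om))"
    unfolding eq using g' by (subst integral_distr[OF Wvec_meas g]) simp
  finally show ?thesis .
qed

text \<open>Centring commutes with permutations, so the transposition of 0 and \<open>i\<close>
  carries one centred weight into the other.\<close>

lemma vn_tail_exch:
  assumes i: "i < n"
  shows "prob {om\<in>space M. \<bar>vn n om i\<bar> > t} = prob {om\<in>space M. \<bar>vn n om 0\<bar> > t}"
proof -
  have n: "0 < n" using i by simp
  define g where "g y = (if \<bar>wcent n y 0\<bar> > t then 1 else 0 :: real)" for y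
  have gm: "g \<in> borel_measurable (PiM {..<n} (%_. borel))"
    unfolding g_def using wcent_meas[OF n] by measurable
  have \<pi>: "Transposition.transpose 0 i permutes {..<n}" using i n by (intro permutes_swap_id) auto
  have ex: "expectation (%om. g (%k. Wn n (Transposition.transpose 0 i k) om)) = expectation (%om. g (%k. Wn n k om))"
    by (rule exch_expectation[OF \<pi> gm]) (simp add: g_def wcent_restrict[OF n])
  have pr: "expectation (%om. if \<bar>vn n om k\<bar> > t then 1 else 0) = prob {om\<in>space M. \<bar>vn n om k\<bar> > t}" if k: "k < n" for k
  proof -
    have "expectation (%om. if \<bar>vn n om k\<bar> > t then 1 else 0) = expectation (indicator {om\<in>space M. \<bar>vn n om k\<bar> > t})"
      by (intro Bochner_Integration.integral_cong) (auto simp: indicator_def)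
    also have "{om\<in>space M. \<bar>vn n om k\<bar> > t} \<in> sets M" using vn_meas[OF k] by measurable
    then have "expectation (indicator {om\<in>space M. \<bar>vn n om k\<bar> > t}) = prob {om\<in>space M. \<bar>vn n om k\<bar> > t}" by simp
    finally show ?thesis .
  qed
  show ?thesis using ex pr[OF i] pr[OF n] unfolding g_def wcent_permute[OF \<pi>, of "%k. Wn n k om" for om] vn_def by simp
qed

text \<open>Indicator of the event that the squared centred weights sum to at most twice their
  asymptotic total. There all products are bounded by \<open>2 * real n\<close>, so integrability is
  immediate; and the event is invariant under permutations, so exchangeability survives the
  truncation.\<close>

definition trunc_ev :: "nat => 'a => real" where
  "trunc_ev n om = (if (\<Sum>i<n. (vn n om i)\<^sup>2) <= 2 * real n then 1 else 0)"

lemma trunc_ev_meas[measurable]: "trunc_ev n \<in> borel_measurable M"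
proof -
  have "(%om. \<Sum>i<n. (vn n om i)\<^sup>2) \<in> borel_measurable M" by (intro borel_measurable_sum) auto
  then show ?thesis unfolding trunc_ev_def by measurable
qed

definition cm :: "nat => nat => nat => real" where
  "cm n i k = expectation (%om. trunc_ev n om * (vn n om i * vn n om k))"

lemma trunc_vn_bound: "i < n ==> trunc_ev n om * (vn n om i)\<^sup>2 <= 2 * real n"
proof (cases "(\<Sum>i<n. (vn n om i)\<^sup>2) <= 2 * real n")
  case True
  assume "i < n"
  then have "(vn n om i)\<^sup>2 <= (\<Sum>i<n. (vn n om i)\<^sup>2)" by (intro member_le_sum) auto
  then show ?thesis using True by (simp add: trunc_ev_def)
qed (simp add: trunc_ev_def)

lemma trunc_prod_bound: "i < n ==> k < n ==> \<bar>trunc_ev n om * (vn n om i * vn n om k)\<bar> <= 2 * real n"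
proof -
  assume ik: "i < n" "k < n"
  have t: "trunc_ev n om \<in> {0, 1}" by (simp add: trunc_ev_def)
  have "\<bar>vn n om i * vn n om k\<bar> <= ((vn n om i)\<^sup>2 + (vn n om k)\<^sup>2) / 2"
  proof -
    have "0 <= (\<bar>vn n om i\<bar> - \<bar>vn n om k\<bar>)\<^sup>2" by simp
    then show ?thesis by (simp add: power2_diff abs_mult)
  qed
  then show ?thesis using t trunc_vn_bound[OF ik(1), of om] trunc_vn_bound[OF ik(2), of om] by auto
qed

lemma trunc_prod_int: "i < n ==> k < n ==> integrable M (%om. trunc_ev n om * (vn n om i * vn n om k))"
  by (intro integrable_const_bound[of _ "2 * real n"]) (auto simp: trunc_prod_bound)

lemma cm_permute:
  assumes \<pi>: "\<pi> permutes {..<n}" and ik: "i < n" "k < n"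
  shows "cm n (\<pi> i) (\<pi> k) = cm n i k"
proof -
  define g where "g y = (if (\<Sum>i<n. (wcent n y i)\<^sup>2) <= 2 * real n then 1 else 0) * (wcent n y i * wcent n y k)" for y
  have sm: "(%y. \<Sum>i<n. (wcent n y i)\<^sup>2) \<in> borel_measurable (PiM {..<n} (%_. borel))"
    using wcent_meas by (intro borel_measurable_sum borel_measurable_power) auto
  have gm: "g \<in> borel_measurable (PiM {..<n} (%_. borel))"
    unfolding g_def using wcent_meas[OF ik(1)] wcent_meas[OF ik(2)] sm by measurable
  have "expectation (%om. g (%k. Wn n (\<pi> k) om)) = expectation (%om. g (%k. Wn n k om))"
    by (rule exch_expectation[OF \<pi> gm]) (simp add: g_def wcent_restrict ik)
  moreover have "(\<Sum>i<n. (wcent n y (\<pi> i))\<^sup>2) = (\<Sum>i<n. (wcent n y i)\<^sup>2)" for y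
    using sum.permute[OF \<pi>, of "%i. (wcent n y i)\<^sup>2"] by (simp add: comp_def)
  ultimately show ?thesis unfolding g_def wcent_permute[OF \<pi>, of "%k. Wn n k om" for om] cm_def trunc_ev_def vn_def by simp
qed

text \<open>Exchangeability leaves one diagonal and one off-diagonal value. The centred weights sum
  to zero, so each row does as well, which ties the two together; the truncation bounds the trace by
  \<open>2 * real n\<close> and hence the diagonal by 2.\<close>

lemma cm_values:
  assumes n: "2 <= n"
  obtains c where "0 <= c" "c <= 2" "!!i k. i < n ==> k < n ==> cm n i k = (if i = k then c else - c / (real n - 1))"
proof
  let ?c = "cm n 0 0" and ?d = "cm n 0 1"
  have diag: "cm n i i = ?c" if "i < n" for i
    using cm_permute[of "Transposition.transpose 0 i" n 0 0] that n permutes_swap_id[of 0 "{..<n}" i] by simp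
  have off: "cm n i k = ?d" if ik: "i < n" "k < n" "i ~= k" for i k
  proof -
    obtain \<pi> where "\<pi> permutes {..<n}" "\<pi> 0 = i" "\<pi> 1 = k"
      by (rule permutes_two_points[of 0 n 1 i k]) (use ik n in auto)
    then show ?thesis using cm_permute[of \<pi> n 0 1] n by auto
  qed
  have "(\<Sum>k<n. cm n 0 k) = expectation (%om. \<Sum>k<n. trunc_ev n om * (vn n om 0 * vn n om k))"
    unfolding cm_def using n by (intro Bochner_Integration.integral_sum[symmetric] trunc_prod_int) auto
  also have "(%om. \<Sum>k<n. trunc_ev n om * (vn n om 0 * vn n om k)) = (%om. 0)"
    by (rule ext) (simp add: sum_distrib_left[symmetric] vn_def wcent_sum)
  finally have "(\<Sum>k<n. cm n 0 k) = 0" by simp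
  moreover have "(\<Sum>k<n. cm n 0 k) = ?c + (real n - 1) * ?d"
  proof -
    have "(\<Sum>k<n. cm n 0 k) = cm n 0 0 + (\<Sum>k\<in>{..<n}-{0}. cm n 0 k)" using n by (subst sum.remove[of _ 0]) auto
    also have "(\<Sum>k\<in>{..<n}-{0}. cm n 0 k) = (\<Sum>k\<in>{..<n}-{0}. ?d)" using n by (intro sum.cong refl off) auto
    finally show ?thesis using n by (simp add: of_nat_diff)
  qed
  ultimately have d: "?d = - ?c / (real n - 1)" using n by (simp add: field_simps)
  show "0 <= ?c" unfolding cm_def by (intro Bochner_Integration.integral_nonneg) (auto simp: trunc_ev_def)
  have "(\<Sum>i<n. cm n i i) = (\<Sum>i<n. ?c)" by (intro sum.cong refl diag) auto
  then have "real n * ?c = (\<Sum>i<n. cm n i i)" by simp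
  also have "... = expectation (%om. \<Sum>i<n. trunc_ev n om * (vn n om i * vn n om i))"
    unfolding cm_def by (intro Bochner_Integration.integral_sum[symmetric] trunc_prod_int) auto
  also have "... <= expectation (%om. 2 * real n)"
  proof (intro integral_mono Bochner_Integration.integrable_sum trunc_prod_int)
    fix om
    show "(\<Sum>i<n. trunc_ev n om * (vn n om i * vn n om i)) <= 2 * real n"
      by (auto simp: trunc_ev_def power2_eq_square)
  qed auto
  finally show "?c <= 2" using n by (simp add: prob_space)
  show "cm n i k = (if i = k then ?c else - ?c / (real n - 1))" if "i < n" "k < n" for i k
  proof (cases "i = k")
    case True then show ?thesis using diag[OF that(1)] by simp
  next
    case False then show ?thesis using off[OF that False] d by simp
  qed
qed

lemma trunc_prob_tendsto: "(%n. prob {om\<in>space M. trunc_ev n om = 0}) \<longlonglongrightarrow> 0"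
proof -
  have lim: "(%n. prob {om \<in> space M. \<bar>(\<Sum>i<n. (vn n om i)\<^sup>2) / real n - 1\<bar> > 1/2}) \<longlonglongrightarrow> 0"
    using cW unfolding condW_def vn_def wcent_def by (auto dest: spec[of _ "1/2"])
  show ?thesis
  proof (rule tendsto_sandwich[OF _ _ tendsto_const lim])
    have "prob {om\<in>space M. trunc_ev n om = 0} <= prob {om \<in> space M. \<bar>(\<Sum>i<n. (vn n om i)\<^sup>2) / real n - 1\<bar> > 1/2}" if n: "n >= 1" for n
    proof (rule finite_measure_mono)
      have [measurable]: "(%om. \<Sum>i<n. (vn n om i)\<^sup>2) \<in> borel_measurable M" by (intro borel_measurable_sum) auto
      show "{om \<in> space M. \<bar>(\<Sum>i<n. (vn n om i)\<^sup>2) / real n - 1\<bar> > 1/2} \<in> sets M" by measurable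
      show "{om\<in>space M. trunc_ev n om = 0} \<subseteq> {om \<in> space M. \<bar>(\<Sum>i<n. (vn n om i)\<^sup>2) / real n - 1\<bar> > 1/2}"
      proof safe
        fix om assume "trunc_ev n om = 0"
        then have "(\<Sum>i<n. (vn n om i)\<^sup>2) > 2 * real n" by (simp add: trunc_ev_def split: if_splits)
        then have "(\<Sum>i<n. (vn n om i)\<^sup>2) / real n > 2" using n by (simp add: field_simps)
        then show "\<bar>(\<Sum>i<n. (vn n om i)\<^sup>2) / real n - 1\<bar> > 1/2" by linarith
      qed
    qed
    then show "\<forall>\<^sub>F n in sequentially. prob {om\<in>space M. trunc_ev n om = 0} <= prob {om \<in> space M. \<bar>(\<Sum>i<n. (vn n om i)\<^sup>2) / real n - 1\<bar> > 1/2}"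
      by (auto simp: eventually_sequentially)
  qed (auto intro: always_eventually)
qed

lemma max_prob_tendsto:
  assumes e: "e > 0"
  shows "(%n. prob {om\<in>space M. \<exists>i<n. \<bar>vn n om i\<bar> > e * sqrt n}) \<longlonglongrightarrow> 0"
proof -
  let ?E = "%n. \<integral>\<^sup>+om. ennreal (Max ((%i. \<bar>vn n om i\<bar>) ` {..<n})) \<partial>M"
  have lim: "(%n. ennreal (1 / sqrt (real n)) * ?E n) \<longlonglongrightarrow> 0"
    using cW unfolding condW_def vn_def wcent_def by auto
  have "(%n. ennreal (1/e) * (ennreal (1 / sqrt (real n)) * ?E n)) \<longlonglongrightarrow> ennreal (1/e) * 0"
    by (intro ennreal_tendsto_cmult lim) simp
  then have lim2: "(%n. ennreal (1/e) * (ennreal (1 / sqrt (real n)) * ?E n)) \<longlonglongrightarrow> 0" by simp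
  have "(%n. ennreal (prob {om\<in>space M. \<exists>i<n. \<bar>vn n om i\<bar> > e * sqrt n})) \<longlonglongrightarrow> 0"
  proof (rule tendsto_sandwich[OF _ _ tendsto_const lim2])
    have "ennreal (prob {om\<in>space M. \<exists>i<n. \<bar>vn n om i\<bar> > e * sqrt n}) <= ennreal (1/e) * (ennreal (1 / sqrt (real n)) * ?E n)" if n: "n >= 1" for n
    proof -
      have pos: "e * sqrt n > 0" using e n by simp
      have S: "{om\<in>space M. \<exists>i<n. \<bar>vn n om i\<bar> > e * sqrt n} \<in> sets M"
      proof -
        have "{om\<in>space M. \<exists>i\<in>{..<n}. \<bar>vn n om i\<bar> > e * sqrt n} \<in> sets M"
          by (rule sets.sets_Collect_finite_Ex) (use vn_meas in auto)
        then show ?thesis by (simp add: Bex_def)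
      qed
      have "ennreal (prob {om\<in>space M. \<exists>i<n. \<bar>vn n om i\<bar> > e * sqrt n}) = (\<integral>\<^sup>+om. indicator {om\<in>space M. \<exists>i<n. \<bar>vn n om i\<bar> > e * sqrt n} om \<partial>M)"
        using S by (simp add: emeasure_eq_measure)
      also have "... <= (\<integral>\<^sup>+om. ennreal (1 / (e * sqrt n)) * ennreal (Max ((%i. \<bar>vn n om i\<bar>) ` {..<n})) \<partial>M)"
      proof (rule nn_integral_mono)
        fix om assume "om \<in> space M"
        show "indicator {om\<in>space M. \<exists>i<n. \<bar>vn n om i\<bar> > e * sqrt n} om <= ennreal (1 / (e * sqrt n)) * ennreal (Max ((%i. \<bar>vn n om i\<bar>) ` {..<n}))"
        proof (cases "\<exists>i<n. \<bar>vn n om i\<bar> > e * sqrt n")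
          case True
          then obtain i where i: "i < n" "\<bar>vn n om i\<bar> > e * sqrt n" by auto
          have "\<bar>vn n om i\<bar> <= Max ((%i. \<bar>vn n om i\<bar>) ` {..<n})" using i(1) by (intro Max_ge) auto
          then have "1 <= 1 / (e * sqrt n) * Max ((%i. \<bar>vn n om i\<bar>) ` {..<n})" using i(2) pos by (simp add: field_simps)
          then have "ennreal 1 <= ennreal (1 / (e * sqrt n) * Max ((%i. \<bar>vn n om i\<bar>) ` {..<n}))" by (rule ennreal_leI)
          also have "... = ennreal (1 / (e * sqrt n)) * ennreal (Max ((%i. \<bar>vn n om i\<bar>) ` {..<n}))"
            using pos by (intro ennreal_mult') simp
          finally show ?thesis by (rule order_trans[rotated]) (simp add: indicator_def)
        next
          case False
          then have "om \<notin> {om\<in>space M. \<exists>i<n. \<bar>vn n om i\<bar> > e * sqrt n}" by blast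
          then show ?thesis by (subst indicator_simps(2)) auto
        qed
      qed
      also have "... = ennreal (1 / (e * sqrt n)) * ?E n"
      proof (rule nn_integral_cmult)
        have "(%om. Max ((%i. \<bar>vn n om i\<bar>) ` {..<n})) \<in> borel_measurable M"
          using n vn_meas by (intro borel_measurable_Max) auto
        then show "(%om. ennreal (Max ((%i. \<bar>vn n om i\<bar>) ` {..<n}))) \<in> borel_measurable M" by measurable
      qed
      also have "... = ennreal (1/e) * (ennreal (1 / sqrt (real n)) * ?E n)"
        using e by (simp add: ennreal_mult'[symmetric] mult.assoc[symmetric])
      finally show ?thesis .
    qed
    then show "\<forall>\<^sub>F n in sequentially. ennreal (prob {om\<in>space M. \<exists>i<n. \<bar>vn n om i\<bar> > e * sqrt n}) <= ennreal (1/e) * (ennreal (1 / sqrt (real n)) * ?E n)"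
      by (auto simp: eventually_sequentially)
  qed (auto intro: always_eventually)
  then show ?thesis by (simp add: ennreal_tendsto_0_iff)
qed

end

section \<open>Central limit bounds for independent summands\<close>

lemma exp_second_order: "\<bar>exp (- y / 2) - (1 - y / 2)\<bar> <= y\<^sup>2" if "0 <= y" "y <= 1" for y :: real
proof -
  have 1: "exp (- y / 2) <= 1 + (- y / 2) + (- y / 2)\<^sup>2" by (rule exp_le_quadratic) (use that in simp)
  have 2: "1 + (- y / 2) <= exp (- y / 2)" by (rule exp_ge_add_one_self)
  have "(- y / 2)\<^sup>2 <= y\<^sup>2" by (simp add: power2_eq_square)
  then show ?thesis using 1 2 by (simp add: abs_le_iff)
qed

lemma abs_exp_diff_le: "\<bar>exp (- a) - exp (- b)\<bar> <= \<bar>a - b\<bar>" if "0 <= a" "0 <= b" for a b :: real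
proof -
  have *: "exp (- a) - exp (- b) <= b - a" if "a <= b" "0 <= a" for a b :: real
  proof -
    have "exp (- a) - exp (- b) = exp (- a) * (1 - exp (- (b - a)))" by (simp add: algebra_simps exp_add[symmetric])
    also have "... <= 1 * (b - a)"
    proof (rule mult_mono)
      show "1 - exp (- (b - a)) <= b - a" using exp_ge_add_one_self[of "- (b - a)"] by linarith
    qed (use that in auto)
    finally show ?thesis by simp
  qed
  show ?thesis using *[of a b] *[of b a] that by (cases "a <= b") auto
qed

context prob_space begin

text \<open>The cubic Taylor remainder is at most \<open>b\<close> times the square, so boundedness
  takes the place of a third moment.\<close>

lemma char_small_approx:
  assumes Y[measurable]: "Y \<in> borel_measurable M" and b: "!!x. \<bar>Y x\<bar> <= b" and E0: "expectation Y = 0"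
  shows "cmod (expectation (%x. iexp (Y x)) - complex_of_real (1 - expectation (%x. (Y x)\<^sup>2) / 2)) <= b * expectation (%x. (Y x)\<^sup>2)"
proof -
  have b0: "0 <= b" using b[of undefined] by linarith
  have i1: "integrable M Y" by (rule integrable_const_bound[of _ b]) (auto simp: b)
  have sq: "(Y x)\<^sup>2 <= b\<^sup>2" for x using power_mono[OF b[of x], of 2] by simp
  have i2: "integrable M (%x. (Y x)\<^sup>2)" by (rule integrable_const_bound[of _ "b\<^sup>2"]) (auto simp: sq)
  have ie: "integrable M (%x. iexp (Y x))" by (rule integrable_const_bound[of _ 1]) auto
  have i3: "integrable M (%x. 1 + \<i> * complex_of_real (Y x) - complex_of_real ((Y x)\<^sup>2) / 2)"
    using i1 i2 by (intro Bochner_Integration.integrable_diff Bochner_Integration.integrable_add integrable_divide integrable_mult_right integrable_of_real) auto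
  have "expectation (%x. 1 + \<i> * complex_of_real (Y x) - complex_of_real ((Y x)\<^sup>2) / 2) = 1 + \<i> * complex_of_real (expectation Y) - complex_of_real (expectation (%x. (Y x)\<^sup>2)) / 2"
  proof -
    have "expectation (%x. 1 + \<i> * complex_of_real (Y x) - complex_of_real ((Y x)\<^sup>2) / 2)
      = expectation (%x. 1 + \<i> * complex_of_real (Y x)) - expectation (%x. complex_of_real ((Y x)\<^sup>2) / 2)"
      using i1 i2 by (intro Bochner_Integration.integral_diff Bochner_Integration.integrable_add integrable_divide integrable_mult_right integrable_of_real) auto
    also have "expectation (%x. 1 + \<i> * complex_of_real (Y x)) = expectation (%x. 1) + expectation (%x. \<i> * complex_of_real (Y x))"
      using i1 by (intro Bochner_Integration.integral_add integrable_mult_right integrable_of_real) auto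
    finally show ?thesis using i1 i2 by (simp add: prob_space del: of_real_power)
  qed
  then have "expectation (%x. iexp (Y x)) - complex_of_real (1 - expectation (%x. (Y x)\<^sup>2) / 2) =
     expectation (%x. iexp (Y x) - (1 + \<i> * complex_of_real (Y x) - complex_of_real ((Y x)\<^sup>2) / 2))"
    using ie i3 E0 by simp
  also have "cmod ... <= expectation (%x. cmod (iexp (Y x) - (1 + \<i> * complex_of_real (Y x) - complex_of_real ((Y x)\<^sup>2) / 2)))"
    by (rule integral_norm_bound)
  also have "... <= expectation (%x. b * (Y x)\<^sup>2)"
  proof (intro integral_mono)
    show "integrable M (%x. cmod (iexp (Y x) - (1 + \<i> * complex_of_real (Y x) - complex_of_real ((Y x)\<^sup>2) / 2)))"
      by (intro integrable_norm Bochner_Integration.integrable_diff[OF ie i3])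
    show "integrable M (%x. b * (Y x)\<^sup>2)" using i2 by simp
    fix x
    have "cmod (iexp (Y x) - (\<Sum>k\<le>2. (\<i> * Y x)^k / fact k)) <= \<bar>Y x\<bar>^(Suc 2) / fact (Suc 2)" by (rule iexp_approx1)
    moreover have "(\<Sum>k\<le>2. (\<i> * complex_of_real (Y x))^k / fact k) = 1 + \<i> * complex_of_real (Y x) - complex_of_real ((Y x)\<^sup>2) / 2"
      by (simp add: numeral_eq_Suc power_mult_distrib)
    moreover have "\<bar>Y x\<bar>^(Suc 2) / fact (Suc 2) <= b * (Y x)\<^sup>2"
    proof -
      have "\<bar>Y x\<bar>^(Suc 2) / fact (Suc 2) <= \<bar>Y x\<bar>^(Suc 2) / 1" by (intro divide_left_mono) (auto simp: fact_ge_1)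
      also have "... = \<bar>Y x\<bar> * (Y x)\<^sup>2" by (simp only: power_Suc div_by_1 power2_abs)
      also have "... <= b * (Y x)\<^sup>2" using b[of x] by (intro mult_right_mono) auto
      finally show ?thesis .
    qed
    ultimately show "cmod (iexp (Y x) - (1 + \<i> * complex_of_real (Y x) - complex_of_real ((Y x)\<^sup>2) / 2)) <= b * (Y x)\<^sup>2" by simp
  qed
  finally show ?thesis by simp
qed

text \<open>Each factor of the characteristic function differs from its Gaussian counterpart by at
  most \<open>2 * b\<close> times its variance, and all factors lie in the unit disc, so the errors
  in the product add up.\<close>

lemma clt_indep_bound:
  fixes Y :: "nat => 'a => real"
  assumes Y: "!!i. Y i \<in> borel_measurable M" and b: "!!i x. i < n ==> \<bar>Y i x\<bar> <= b" and b1: "b <= 1"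
    and E0: "!!i. i < n ==> expectation (Y i) = 0"
  shows "cmod ((\<integral>x. iexp (\<Sum>i<n. Y i (x i)) \<partial>PiM UNIV (%_::nat. M)) - complex_of_real (exp (- (\<Sum>i<n. expectation (%x. (Y i x)\<^sup>2)) / 2)))
     <= 2 * b * (\<Sum>i<n. expectation (%x. (Y i x)\<^sup>2))"
proof -
  interpret S: prob_space "PiM UNIV (%_::nat. M)" by (intro prob_space_PiM) unfold_locales
  note [measurable] = Y
  let ?s = "%i. expectation (%x. (Y i x)\<^sup>2)"
  have sq: "(Y i x)\<^sup>2 <= b\<^sup>2" if "i < n" for i x using power_mono[OF b[OF that, of x], of 2] by simp
  have s0: "0 <= ?s i" for i by simp
  have sb: "?s i <= b" if i: "i < n" for i
  proof -
    have b0: "0 <= b" using b[OF i, of undefined] by linarith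
    have "?s i <= expectation (%x. b\<^sup>2)"
      by (intro integral_mono integrable_const_bound[of _ "b\<^sup>2"]) (auto simp: sq[OF i])
    also have "... <= b" using b0 b1 by (simp add: prob_space power2_eq_square mult_left_le)
    finally show ?thesis .
  qed
  have "(\<integral>x. iexp (\<Sum>i<n. Y i (x i)) \<partial>PiM UNIV (%_::nat. M)) = (\<integral>x. (\<Prod>i<n. iexp (Y i (x i))) \<partial>PiM UNIV (%_::nat. M))"
    by (simp add: exp_sum sum_distrib_left)
  also have "... = (\<Prod>i<n. \<integral>x. iexp (Y i (x i)) \<partial>PiM UNIV (%_::nat. M))"
  proof (rule S.indep_vars_lebesgue_integral)
    show "S.indep_vars (%_. borel) (%i x. iexp (Y i (x i))) {..<n}"
      using S.indep_vars_compose2[OF S.indep_vars_subset[OF PiM_indep_coords[of "%_::nat. M"]], of "{..<n}" "%i y. iexp (Y i y)" "%_. borel"]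
        prob_space_axioms by simp
    show "integrable (PiM UNIV (%_::nat. M)) (%x. iexp (Y i (x i)))" for i
      by (rule S.integrable_const_bound[of _ 1]) auto
  qed simp
  also have "... = (\<Prod>i<n. expectation (%y. iexp (Y i y)))"
    by (intro prod.cong refl integral_PiM_component(1)[of "%_::nat. M"]) (auto intro: prob_space_axioms)
  finally have eq: "(\<integral>x. iexp (\<Sum>i<n. Y i (x i)) \<partial>PiM UNIV (%_::nat. M)) = (\<Prod>i<n. expectation (%y. iexp (Y i y)))" .
  have eq2: "complex_of_real (exp (- (\<Sum>i<n. ?s i) / 2)) = (\<Prod>i<n. complex_of_real (exp (- ?s i / 2)))"
    by (simp add: exp_sum[symmetric] of_real_prod[symmetric] sum_negf sum_divide_distrib del: of_real_prod)
  have "cmod ((\<Prod>i<n. expectation (%y. iexp (Y i y))) - (\<Prod>i<n. complex_of_real (exp (- ?s i / 2))))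
     <= (\<Sum>i<n. cmod (expectation (%y. iexp (Y i y)) - complex_of_real (exp (- ?s i / 2))))"
  proof (rule norm_prod_diff)
    fix i
    have "cmod (expectation (%y. iexp (Y i y))) <= expectation (%y. cmod (iexp (Y i y)))" by (rule integral_norm_bound)
    then show "cmod (expectation (%y. iexp (Y i y))) <= 1" by (simp add: prob_space)
    show "cmod (complex_of_real (exp (- ?s i / 2))) <= 1" using s0[of i] by simp
  qed
  also have "... <= (\<Sum>i<n. 2 * b * ?s i)"
  proof (rule sum_mono)
    fix i assume "i \<in> {..<n}"
    then have i: "i < n" by simp
    have 1: "cmod (expectation (%y. iexp (Y i y)) - complex_of_real (1 - ?s i / 2)) <= b * ?s i"
      by (rule char_small_approx[OF Y b[OF i] E0[OF i]])
    have "\<bar>exp (- ?s i / 2) - (1 - ?s i / 2)\<bar> <= (?s i)\<^sup>2"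
      using sb[OF i] b1 s0 by (intro exp_second_order) auto
    also have "... <= b * ?s i" unfolding power2_eq_square[of "?s i"] using sb[OF i] s0 by (intro mult_right_mono) auto
    finally have 2: "cmod (complex_of_real (1 - ?s i / 2) - complex_of_real (exp (- ?s i / 2))) <= b * ?s i"
      by (simp only: of_real_diff[symmetric] norm_of_real abs_minus_commute)
    show "cmod (expectation (%y. iexp (Y i y)) - complex_of_real (exp (- ?s i / 2))) <= 2 * b * ?s i"
      using norm_triangle_ineq[of "expectation (%y. iexp (Y i y)) - complex_of_real (1 - ?s i / 2)" "complex_of_real (1 - ?s i / 2) - complex_of_real (exp (- ?s i / 2))"] 1 2
      by simp
  qed
  also have "... = 2 * b * (\<Sum>i<n. ?s i)" by (simp add: sum_distrib_left)
  finally show ?thesis unfolding eq eq2 .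
qed

text \<open>The same sample point enters for every \<open>j\<close>, so the variance of the sum
  involves the cross products of the weights; their nearness to the identity matrix is what
  separates the different \<open>j\<close>. The remainder is explicit because the weights are random
  when the bound is applied.\<close>

lemma clt_weighted_bound:
  fixes g :: "nat => 'a => real" and a :: "nat => nat => real"
  assumes g: "!!j. g j \<in> borel_measurable M" and G: "!!j x. \<bar>g j x\<bar> <= G" and g0: "!!j. expectation (g j) = 0"
    and n: "n >= 1" and cv: "!!j j'. j <= Mb ==> j' <= Mb ==> \<bar>(\<Sum>i<n. a j i * a j' i) / n - (if j = j' then 1 else 0)\<bar> <= \<eta>"
    and mx: "!!j i. j <= Mb ==> i < n ==> \<bar>a j i\<bar> <= \<eta> * sqrt n"
    and \<eta>: "0 <= \<eta>" "real (Suc Mb) * G * \<eta> <= 1" "\<eta> <= 1"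
  shows "cmod ((\<integral>x. iexp (\<Sum>i<n. (\<Sum>j\<le>Mb. a j i * g j (x i)) / sqrt n) \<partial>PiM UNIV (%_::nat. M)) - complex_of_real (exp (- (\<Sum>j\<le>Mb. expectation (%x. (g j x)\<^sup>2)) / 2)))
     <= \<eta> * (2 * (real (Suc Mb) * G) * (2 * (real (Suc Mb) * G)\<^sup>2) + (real (Suc Mb) * G)\<^sup>2)"
proof -
  define K where "K = real (Suc Mb) * G"
  have G0: "0 <= G" using G[of 0 undefined] by linarith
  then have K0: "0 <= K" by (simp add: K_def)
  define Y where "Y i x = (\<Sum>j\<le>Mb. a j i * g j x) / sqrt n" for i x
  note [measurable] = g
  have sn: "sqrt n > 0" using n by simp
  have Ym: "Y i \<in> borel_measurable M" for i unfolding Y_def by measurable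
  have Yb: "\<bar>Y i x\<bar> <= K * \<eta>" if i: "i < n" for i x
  proof -
    have "\<bar>\<Sum>j\<le>Mb. a j i * g j x\<bar> <= (\<Sum>j\<le>Mb. \<bar>a j i * g j x\<bar>)" by (rule sum_abs)
    also have "... <= (\<Sum>j\<le>Mb. (\<eta> * sqrt n) * G)" unfolding abs_mult using mx[OF _ i] G \<eta> by (intro sum_mono mult_mono) auto
    also have "... = K * \<eta> * sqrt n" by (simp add: K_def)
    finally show ?thesis using sn by (simp add: Y_def abs_divide divide_le_eq)
  qed
  have gi: "integrable M (g j)" for j by (rule integrable_const_bound[of _ G]) (auto simp: G)
  have Y0: "expectation (Y i) = 0" for i unfolding Y_def using gi g0 by simp
  have ggb: "\<bar>g j x * g j' x\<bar> <= G\<^sup>2" for j j' x unfolding abs_mult power2_eq_square using G G0 by (intro mult_mono) auto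
  have ggi: "integrable M (%x. g j x * g j' x)" for j j' by (rule integrable_const_bound[of _ "G\<^sup>2"]) (auto simp: ggb)
  have Egg: "\<bar>expectation (%x. g j x * g j' x)\<bar> <= G\<^sup>2" for j j'
  proof -
    have "\<bar>expectation (%x. g j x * g j' x)\<bar> <= expectation (%x. \<bar>g j x * g j' x\<bar>)" by (rule integral_abs_bound)
    also have "... <= expectation (%x. G\<^sup>2)" using ggi ggb by (intro integral_mono) auto
    finally show ?thesis by (simp add: prob_space)
  qed
  let ?S = "\<Sum>i<n. expectation (%x. (Y i x)\<^sup>2)" and ?V = "\<Sum>j\<le>Mb. expectation (%x. (g j x)\<^sup>2)"
  have Seq: "?S = (\<Sum>j\<le>Mb. \<Sum>j'\<le>Mb. (\<Sum>i<n. a j i * a j' i) / n * expectation (%x. g j x * g j' x))"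
  proof -
    have "expectation (%x. (Y i x)\<^sup>2) = (\<Sum>j\<le>Mb. \<Sum>j'\<le>Mb. a j i * a j' i / n * expectation (%x. g j x * g j' x))" for i
    proof -
      have "(%x. (Y i x)\<^sup>2) = (%x. \<Sum>j\<le>Mb. \<Sum>j'\<le>Mb. a j i * a j' i / n * (g j x * g j' x))"
        by (rule ext) (simp add: Y_def power_divide power2_eq_square sum_product sum_divide_distrib mult_ac)
      then show ?thesis using ggi by (simp add: Bochner_Integration.integral_sum)
    qed
    then have "?S = (\<Sum>i<n. \<Sum>j\<le>Mb. \<Sum>j'\<le>Mb. a j i * a j' i / n * expectation (%x. g j x * g j' x))" by simp
    also have "... = (\<Sum>j\<le>Mb. \<Sum>j'\<le>Mb. \<Sum>i<n. a j i * a j' i / n * expectation (%x. g j x * g j' x))"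
      by (subst sum.swap, rule sum.cong[OF refl], rule sum.swap)
    finally show ?thesis by (simp add: sum_divide_distrib sum_distrib_right)
  qed
  have Veq: "?V = (\<Sum>j\<le>Mb. \<Sum>j'\<le>Mb. (if j = j' then 1 else 0) * expectation (%x. g j x * g j' x))"
    by (intro sum.cong refl) (simp add: power2_eq_square if_distrib[where f="%y. y * _"] cong: if_cong)
  have "\<bar>?S - ?V\<bar> = \<bar>\<Sum>j\<le>Mb. \<Sum>j'\<le>Mb. ((\<Sum>i<n. a j i * a j' i) / n - (if j = j' then 1 else 0)) * expectation (%x. g j x * g j' x)\<bar>"
    unfolding Seq Veq by (simp only: sum_subtractf[symmetric] left_diff_distrib)
  also have "... <= (\<Sum>j\<le>Mb. \<Sum>j'\<le>Mb. \<eta> * G\<^sup>2)"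
  proof (rule order_trans[OF sum_abs], rule sum_mono, rule order_trans[OF sum_abs], rule sum_mono)
    fix j j' assume "j \<in> {..Mb}" "j' \<in> {..Mb}"
    then show "\<bar>((\<Sum>i<n. a j i * a j' i) / n - (if j = j' then 1 else 0)) * expectation (%x. g j x * g j' x)\<bar> <= \<eta> * G\<^sup>2"
      unfolding abs_mult using cv Egg \<eta> by (intro mult_mono) auto
  qed
  also have "... = \<eta> * K\<^sup>2" by (simp add: K_def power2_eq_square)
  finally have SV: "\<bar>?S - ?V\<bar> <= \<eta> * K\<^sup>2" .
  have V0: "0 <= ?V" by (intro sum_nonneg) simp
  have S0: "0 <= ?S" by (intro sum_nonneg) simp
  have VK: "?V <= K\<^sup>2"
  proof -
    have "?V <= (\<Sum>j\<le>Mb. G\<^sup>2)" using Egg[of j j for j] by (intro sum_mono) (auto simp: power2_eq_square abs_le_iff)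
    also have "... = real (Suc Mb) * G\<^sup>2" by simp
    also have "... <= (real (Suc Mb) * real (Suc Mb)) * G\<^sup>2" by (intro mult_right_mono) auto
    also have "... = K\<^sup>2" by (simp add: K_def power2_eq_square algebra_simps)
    finally show ?thesis .
  qed
  have "\<eta> * K\<^sup>2 <= 1 * K\<^sup>2" using \<eta> by (intro mult_right_mono) auto
  then have SK: "?S <= 2 * K\<^sup>2" using SV VK by linarith
  have "cmod ((\<integral>x. iexp (\<Sum>i<n. Y i (x i)) \<partial>PiM UNIV (%_::nat. M)) - complex_of_real (exp (- ?S / 2))) <= 2 * (K * \<eta>) * ?S"
    by (rule clt_indep_bound[OF Ym Yb _ Y0]) (use \<eta> in \<open>auto simp: K_def\<close>)
  also have "... <= 2 * (K * \<eta>) * (2 * K\<^sup>2)" using K0 \<eta> SK by (intro mult_left_mono) auto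
  finally have 1: "cmod ((\<integral>x. iexp (\<Sum>i<n. Y i (x i)) \<partial>PiM UNIV (%_::nat. M)) - complex_of_real (exp (- ?S / 2))) <= 2 * (K * \<eta>) * (2 * K\<^sup>2)" .
  have "\<bar>exp (- ?S / 2) - exp (- ?V / 2)\<bar> <= \<bar>?S / 2 - ?V / 2\<bar>"
    using abs_exp_diff_le[of "?S / 2" "?V / 2"] S0 V0 by simp
  also have "... <= \<eta> * K\<^sup>2" using SV by (simp add: abs_if split: if_splits)
  finally have 2: "cmod (complex_of_real (exp (- ?S / 2)) - complex_of_real (exp (- ?V / 2))) <= \<eta> * K\<^sup>2"
    by (simp only: of_real_diff[symmetric] norm_of_real)
  have "cmod ((\<integral>x. iexp (\<Sum>i<n. Y i (x i)) \<partial>PiM UNIV (%_::nat. M)) - complex_of_real (exp (- ?V / 2))) <= 2 * (K * \<eta>) * (2 * K\<^sup>2) + \<eta> * K\<^sup>2"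
    using norm_triangle_ineq[of "(\<integral>x. iexp (\<Sum>i<n. Y i (x i)) \<partial>PiM UNIV (%_::nat. M)) - complex_of_real (exp (- ?S / 2))" "complex_of_real (exp (- ?S / 2)) - complex_of_real (exp (- ?V / 2))"] 1 2
    by simp
  also have "... = \<eta> * (2 * K * (2 * K\<^sup>2) + K\<^sup>2)" by (simp add: algebra_simps)
  finally show ?thesis unfolding Y_def K_def .
qed

end

section \<open>The bootstrap empirical process\<close>

locale boot = unif_family P f C + M: prob_space M
  for P :: "'s measure" and f :: "'m::finite => real^'p => 's => real" and C :: real and M :: "'a measure" +
  fixes \<xi> :: "nat => 'a => 's" and W :: "nat => nat => nat => 'a => real" and Mb :: nat
  assumes xi_meas: "(%om i. \<xi> i om) \<in> measurable M (PiM UNIV (%_::nat. P))"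
    and xi_distr: "distr M (PiM UNIV (%_::nat. P)) (%om i. \<xi> i om) = PiM UNIV (%_::nat. P)"
    and W_indep: "!!n. M.indep_vars (%_. PiM {..<n} (%_. borel)) (%j om. restrict (%i. W j n i om) {..<n}) {1..Mb}"
    and W_xi: "!!n. distr M (PiM UNIV (%_::nat. P)) (%om i. \<xi> i om) \<Otimes>\<^sub>M
        distr M (PiM {1..Mb} (%_. PiM {..<n} (%_. borel))) (%om. restrict (%j. restrict (%i. W j n i om) {..<n}) {1..Mb})
      = distr M (PiM UNIV (%_::nat. P) \<Otimes>\<^sub>M PiM {1..Mb} (%_. PiM {..<n} (%_. borel)))
          (%om. (%i. \<xi> i om, restrict (%j. restrict (%i. W j n i om) {..<n}) {1..Mb}))"
    and W_exch: "!!j. j \<in> {1..Mb} ==> exch_weights M (W j)"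
    and W_cond: "!!j. j \<in> {1..Mb} ==> condW M (W j)"
begin

abbreviation "Pseq \<equiv> PiM UNIV (%_::nat. P)"
abbreviation "WS n \<equiv> PiM {1..Mb} (%_. PiM {..<n} (%_. borel :: real measure))"

definition Wv :: "nat => 'a => nat => nat => real" where
  "Wv n om = restrict (%j. restrict (%i. W j n i om) {..<n}) {1..Mb}"

text \<open>The multipliers as a function of a realised weight array, so that Fubini's theorem can
  be applied with the weights held fixed.\<close>

definition vw :: "nat => (nat => nat => real) => nat => nat => real" where
  "vw n ws j i = (if j = 0 then 1 else wcent n (ws j) i)"

definition v :: "nat => 'a => nat => nat => real" where
  "v n om j i = (if j = 0 then 1 else wcent n (%i. W j n i om) i)"

text \<open>Slot 0, with weights 1, is the empirical process of the sample; the other slots are the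
  bootstrap processes. Subtracting the mean changes nothing in the latter, since centred weights sum
  to zero, but it makes all slots instances of one formula.\<close>

definition alpha :: "nat => 'a => nat => 'm => real^'p => real" where
  "alpha n om j k u = (\<Sum>i<n. v n om j i * (f k u (\<xi> i om) - expectation (f k u))) / sqrt n"

lemma W_vec_meas: "j \<in> {1..Mb} ==> (%om. restrict (%i. W j n i om) {..<n}) \<in> measurable M (PiM {..<n} (%_. borel))"
  using W_indep[of n] unfolding M.indep_vars_def by blast

lemma W_meas: "j \<in> {1..Mb} ==> i < n ==> W j n i \<in> borel_measurable M"
proof -
  assume "j \<in> {1..Mb}" "i < n"
  then have "(%om. restrict (%i. W j n i om) {..<n} i) \<in> borel_measurable M"
    by (intro measurable_compose[OF W_vec_meas measurable_component_singleton]) auto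
  then show ?thesis using \<open>i < n\<close> by simp
qed

lemma ea: "j \<in> {1..Mb} ==> exch_array M (W j)"
  by unfold_locales (auto intro: W_meas W_exch W_cond)

lemma v_eq_vn: "j \<in> {1..Mb} ==> v n om j i = exch_array.vn (W j) n om i"
  by (auto simp: v_def exch_array.vn_def[OF ea])

lemma v_meas: "j <= Mb ==> i < n ==> (%om. v n om j i) \<in> borel_measurable M"
  using exch_array.vn_meas[OF ea, of j i n] v_eq_vn[of j n _ i] by (cases "j = 0") (auto simp: v_def)

lemma Wv_meas: "Wv n \<in> measurable M (WS n)"
  unfolding Wv_def by (intro measurable_restrict W_vec_meas)

lemma vw_Wv: "j <= Mb ==> i < n ==> vw n (Wv n om) j i = v n om j i"
  by (auto simp: vw_def v_def Wv_def wcent_restrict)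

lemma vw_meas: "j <= Mb ==> i < n ==> (%ws. vw n ws j i) \<in> borel_measurable (WS n)"
proof (cases "j = 0")
  case False
  assume a: "j <= Mb" "i < n"
  then have "(%ws. ws j) \<in> measurable (WS n) (PiM {..<n} (%_. borel))" using False by (intro measurable_component_singleton) auto
  from measurable_compose[OF this wcent_meas[OF a(2)]] show ?thesis using False by (simp add: vw_def)
qed (simp add: vw_def)

lemma decouple_nn:
  assumes "(%(x, ws). F x ws) \<in> borel_measurable (Pseq \<Otimes>\<^sub>M WS n)"
  shows "(\<integral>\<^sup>+om. F (%i. \<xi> i om) (Wv n om) \<partial>M) = (\<integral>\<^sup>+om. \<integral>\<^sup>+x. F x (Wv n om) \<partial>Pseq \<partial>M)"
  using M.nn_integral_indep_var[OF xi_meas Wv_meas W_xi[of n, folded Wv_def] assms] unfolding xi_distr .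

lemma decouple_complex:
  fixes F :: "(nat => 's) => (nat => nat => real) => complex"
  assumes "(%(x, ws). F x ws) \<in> borel_measurable (Pseq \<Otimes>\<^sub>M WS n)" "!!x y. norm (F x y) <= 1"
  shows "(\<integral>om. F (%i. \<xi> i om) (Wv n om) \<partial>M) = (\<integral>om. \<integral>x. F x (Wv n om) \<partial>Pseq \<partial>M)"
    and "(%om. \<integral>x. F x (Wv n om) \<partial>Pseq) \<in> borel_measurable M"
  using M.integral_indep_var[OF xi_meas Wv_meas W_xi[of n, folded Wv_def] assms] unfolding xi_distr by auto

section \<open>Asymptotic equicontinuity of the weighted processes\<close>

definition Q :: "nat => nat => nat => 'm => 'a => ennreal" where
  "Q n l j k om = ennreal (1 / sqrt n) * unif_class.Qm P (f k) C l n (v n om j) (%i. \<xi> i om)"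

lemma Q_meas: "j <= Mb ==> Q n l j k \<in> borel_measurable M"
  unfolding Q_def using unif_class.Qm_measurable[OF fk, of n "%om. v n om j" M "%om i. \<xi> i om" k l] v_meas xi_meas
  by (intro borel_measurable_times_ennreal) auto

lemma Q_bound:
  assumes "u \<in> cbox 0 1" "u' \<in> cbox 0 1" "!!i. \<bar>u $ i - u' $ i\<bar> <= 1 / 2^l"
  shows "ennreal \<bar>alpha n om j k u - alpha n om j k u'\<bar> <= Q n l j k om"
proof -
  let ?d = "(\<Sum>i<n. v n om j i * (f k u (\<xi> i om) - expectation (f k u))) - (\<Sum>i<n. v n om j i * (f k u' (\<xi> i om) - expectation (f k u')))"
  have eq: "\<bar>alpha n om j k u - alpha n om j k u'\<bar> = 1 / sqrt n * \<bar>?d\<bar>"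
    by (simp add: alpha_def diff_divide_distrib[symmetric] abs_divide)
  have "ennreal \<bar>alpha n om j k u - alpha n om j k u'\<bar> = ennreal (1 / sqrt n) * ennreal \<bar>?d\<bar>"
    unfolding eq by (rule ennreal_mult) auto
  also have "... <= Q n l j k om" unfolding Q_def
    by (intro mult_left_mono unif_class.Qm_bound[OF fk assms]) auto
  finally show ?thesis .
qed

text \<open>The functional of Lorentz (2,1) type of the first multiplier, which Condition (W) bounds
  uniformly in \<open>n\<close>.\<close>

definition L21 :: "nat => nat => ennreal" where
  "L21 n j = (\<integral>\<^sup>+t. indicator {0..} t * ennreal (sqrt (measure M {om\<in>space M. \<bar>v n om j 0\<bar> > t})) \<partial>lborel)"

definition EM :: "nat => nat => ennreal" where
  "EM n j = ennreal (1 / sqrt n) * (\<integral>\<^sup>+om. ennreal (Max ((%i. \<bar>v n om j i\<bar>) ` {..<n})) \<partial>M)"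

lemma Q_expectation:
  assumes j: "j <= Mb" and n: "n >= 1"
  shows "(\<integral>\<^sup>+om. Q n l j k om \<partial>M) <= ennreal (8 * chain_tail CARD('p) C l) * L21 n j + ennreal (2 * unif_class.cmod_l (TYPE('p)) C l) * EM n j"
proof -
  interpret U: unif_class P "f k" C by (rule fk)
  have Fm: "(%(x, ws). U.Qm l n (vw n ws j) x) \<in> borel_measurable (Pseq \<Otimes>\<^sub>M WS n)"
    unfolding case_prod_beta
    by (rule U.Qm_measurable[of n "%z. vw n (snd z) j" _ fst]) (rule measurable_compose[OF measurable_snd vw_meas[OF j]], assumption, rule measurable_fst)
  have Qc: "U.Qm l n (vw n (Wv n om) j) x = U.Qm l n (v n om j) x" for om x
  proof -
    have "{i \<in> {..<n}. vw n (Wv n om) j i > t} = {i \<in> {..<n}. v n om j i > t}" "{i \<in> {..<n}. - vw n (Wv n om) j i > t} = {i \<in> {..<n}. - v n om j i > t}" for t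
      using vw_Wv[OF j] by auto
    then show ?thesis unfolding U.Qm_def by simp
  qed
  have "(\<integral>\<^sup>+om. Q n l j k om \<partial>M) = ennreal (1 / sqrt n) * (\<integral>\<^sup>+om. U.Qm l n (v n om j) (%i. \<xi> i om) \<partial>M)"
    unfolding Q_def using U.Qm_measurable[of n "%om. v n om j" M "%om i. \<xi> i om" l] v_meas[OF j] xi_meas
    by (intro nn_integral_cmult) auto
  also have "... <= ennreal (1 / sqrt n) * (ennreal (8 * chain_tail CARD('p) C l) * ennreal (sqrt n) * L21 n j
     + ennreal (2 * U.cmod_l l) * (\<integral>\<^sup>+om. ennreal (Max ((%i. \<bar>v n om j i\<bar>) ` {..<n})) \<partial>M))"
  proof (rule mult_left_mono)
    have "(\<integral>\<^sup>+om. U.Qm l n (v n om j) (%i. \<xi> i om) \<partial>M) = (\<integral>\<^sup>+om. \<integral>\<^sup>+x. U.Qm l n (v n om j) x \<partial>Pseq \<partial>M)"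
      using decouple_nn[OF Fm] unfolding Qc .
  also have "... <= ennreal (8 * chain_tail CARD('p) C l) * ennreal (sqrt n) * L21 n j
     + ennreal (2 * U.cmod_l l) * (\<integral>\<^sup>+om. ennreal (Max ((%i. \<bar>v n om j i\<bar>) ` {..<n})) \<partial>M)"
    unfolding L21_def
  proof (rule U.Qm_expectation[OF M.prob_space_axioms v_meas[OF j] n])
    fix i t assume i: "i < n"
    show "measure M {om\<in>space M. \<bar>v n om j i\<bar> > t} = measure M {om\<in>space M. \<bar>v n om j 0\<bar> > t}"
    proof (cases "j = 0")
      case False
      then have jj: "j \<in> {1..Mb}" using j by auto
      show ?thesis unfolding v_eq_vn[OF jj] by (rule exch_array.vn_tail_exch[OF ea[OF jj] i])
    qed (simp add: v_def)
  qed
    finally show "(\<integral>\<^sup>+om. U.Qm l n (v n om j) (%i. \<xi> i om) \<partial>M) <= ennreal (8 * chain_tail CARD('p) C l) * ennreal (sqrt n) * L21 n j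
     + ennreal (2 * U.cmod_l l) * (\<integral>\<^sup>+om. ennreal (Max ((%i. \<bar>v n om j i\<bar>) ` {..<n})) \<partial>M)" .
  qed simp
  also have "... = (ennreal (1 / sqrt n) * ennreal (sqrt n)) * (ennreal (8 * chain_tail CARD('p) C l) * L21 n j) + ennreal (2 * U.cmod_l l) * EM n j"
    unfolding EM_def by (simp only: distrib_left mult_ac)
  also have "ennreal (1 / sqrt n) * ennreal (sqrt n) = 1" using n by (simp add: ennreal_mult[symmetric])
  finally show ?thesis by simp
qed

lemma L21_bound: "\<exists>B\<ge>0. \<forall>j\<le>Mb. \<forall>n\<ge>1. L21 n j <= ennreal B"
proof -
  have "\<exists>B\<ge>0. \<forall>n\<ge>1. L21 n j <= ennreal B" if j: "j <= Mb" for j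
  proof (cases "j = 0")
    case True
    have "L21 n j <= ennreal 1" for n
    proof -
      have "L21 n j <= (\<integral>\<^sup>+t. indicator {0..1} (t::real) \<partial>lborel)" unfolding L21_def
      proof (rule nn_integral_mono)
        fix t :: real
        show "indicator {0..} t * ennreal (sqrt (measure M {om\<in>space M. \<bar>v n om j 0\<bar> > t})) <= indicator {0..1} t"
          using True M.prob_space by (auto simp: indicator_def v_def)
      qed
      then show ?thesis by simp
    qed
    then show ?thesis by (intro exI[of _ 1]) auto
  next
    case False
    then have jj: "j \<in> {1..Mb}" using j by auto
    obtain B where B: "\<forall>n\<ge>1. L21 n j <= ennreal B"
      using W_cond[OF jj] False unfolding condW_def L21_def v_def wcent_def by auto
    show ?thesis by (rule exI[of _ "max B 0"]) (use B in \<open>auto simp: ennreal_max_0\<close>)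
  qed
  then obtain B where B: "!!j. j <= Mb ==> B j >= 0 & (\<forall>n\<ge>1. L21 n j <= ennreal (B j))" by metis
  define B' where "B' = (\<Sum>j\<le>Mb. B j)"
  have "B j <= B'" if "j <= Mb" for j unfolding B'_def using B that by (intro member_le_sum) auto
  then have "L21 n j <= ennreal B'" if "j <= Mb" "n >= 1" for j n
    using B[OF that(1)] that by (meson ennreal_leI order_trans)
  moreover have "0 <= B'" unfolding B'_def using B by (intro sum_nonneg) auto
  ultimately show ?thesis by blast
qed

lemma EM_tendsto: "j <= Mb ==> (%n. EM n j) \<longlonglongrightarrow> 0"
proof (cases "j = 0")
  case True
  have lim: "(%n. ennreal (1 / sqrt (real n))) \<longlonglongrightarrow> 0"
  proof -
    have "(%n. 1 / sqrt (real n)) \<longlonglongrightarrow> 0" by real_asymp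
    then show ?thesis by (simp add: ennreal_tendsto_0_iff)
  qed
  have "EM n j = ennreal (1 / sqrt (real n))" if "n >= 1" for n
  proof -
    have "(%i::nat. \<bar>1::real\<bar>) ` {..<n} = {1}" using that by (auto simp: image_constant_conv lessThan_empty_iff)
    then show ?thesis unfolding EM_def using True by (simp add: v_def M.emeasure_space_1)
  qed
  then have "\<forall>\<^sub>F n in sequentially. ennreal (1 / sqrt (real n)) = EM n j"
    unfolding eventually_sequentially by (intro exI[of _ 1]) auto
  then show ?thesis by (rule Lim_transform_eventually[OF lim])
next
  case False
  assume "j <= Mb"
  then have jj: "j \<in> {1..Mb}" using False by auto
  show ?thesis using W_cond[OF jj] False unfolding condW_def EM_def v_def wcent_def by simp
qed

text \<open>The constant multiplying \<open>EM\<close> grows with the level, but the level is fixed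
  while \<open>n\<close> tends to infinity, so that term vanishes and only the chaining tail
  remains.\<close>

lemma Q_expectation_eventually:
  "\<exists>B\<ge>0. \<forall>l e. e > 0 --> (\<forall>\<^sub>F n in sequentially. \<forall>j\<in>{..Mb}. \<forall>k. (\<integral>\<^sup>+om. Q n l j k om \<partial>M) <= ennreal (8 * chain_tail CARD('p) C l * B + e))"
proof -
  obtain B where B: "B >= 0" "!!j n. j <= Mb ==> n >= 1 ==> L21 n j <= ennreal B" using L21_bound by blast
  have "\<forall>\<^sub>F n in sequentially. \<forall>j\<in>{..Mb}. \<forall>k. (\<integral>\<^sup>+om. Q n l j k om \<partial>M) <= ennreal (8 * chain_tail CARD('p) C l * B + e)" if e: "e > 0" for l e
  proof (rule eventually_ball_finite)
    show "\<forall>j\<in>{..Mb}. \<forall>\<^sub>F n in sequentially. \<forall>k. (\<integral>\<^sup>+om. Q n l j k om \<partial>M) <= ennreal (8 * chain_tail CARD('p) C l * B + e)"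
    proof
      fix j assume "j \<in> {..Mb}"
      then have j: "j <= Mb" by simp
      let ?c = "ennreal (2 * unif_class.cmod_l (TYPE('p)) C l)"
      have "(%n. ?c * EM n j) \<longlonglongrightarrow> ?c * 0" by (intro ennreal_tendsto_cmult EM_tendsto[OF j]) simp
      then have "\<forall>\<^sub>F n in sequentially. ?c * EM n j < ennreal e" using e by (intro order_tendstoD) auto
      then show "\<forall>\<^sub>F n in sequentially. \<forall>k. (\<integral>\<^sup>+om. Q n l j k om \<partial>M) <= ennreal (8 * chain_tail CARD('p) C l * B + e)"
        using eventually_ge_at_top[of 1]
      proof eventually_elim
        case (elim n)
        have t0: "0 <= chain_tail CARD('p) C l" using unif_class.chain_tail_nonneg[OF fk] .
        have "(\<integral>\<^sup>+om. Q n l j k om \<partial>M) <= ennreal (8 * chain_tail CARD('p) C l) * ennreal B + ennreal e" for k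
          using Q_expectation[OF j elim(2), of l k] B(2)[OF j elim(2)] elim(1)
          by (meson add_mono less_imp_le mult_left_mono order_trans zero_le)
        also have "ennreal (8 * chain_tail CARD('p) C l) * ennreal B + ennreal e = ennreal (8 * chain_tail CARD('p) C l * B + e)"
          using t0 B(1) e by (simp add: ennreal_mult ennreal_plus)
        finally show ?case by blast
      qed
    qed
  qed simp
  then show ?thesis using B(1) by blast
qed

lemma Q_small:
  assumes e: "e > 0"
  shows "\<exists>l. \<forall>\<^sub>F n in sequentially. \<forall>j\<in>{..Mb}. \<forall>k. (\<integral>\<^sup>+om. Q n l j k om \<partial>M) <= ennreal e"
proof -
  obtain B where B: "B >= 0" "!!l e. e > 0 ==> (\<forall>\<^sub>F n in sequentially. \<forall>j\<in>{..Mb}. \<forall>k. (\<integral>\<^sup>+om. Q n l j k om \<partial>M) <= ennreal (8 * chain_tail CARD('p) C l * B + e))"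
    using Q_expectation_eventually by blast
  have "(%l. 8 * chain_tail CARD('p) C l * B) \<longlonglongrightarrow> 8 * 0 * B" by (intro tendsto_intros chain_tail_tendsto)
  then have "\<forall>\<^sub>F l in sequentially. 8 * chain_tail CARD('p) C l * B < e / 2" using e by (intro order_tendstoD) auto
  then obtain l where l: "8 * chain_tail CARD('p) C l * B < e / 2" by (auto simp: eventually_sequentially)
  have "\<forall>\<^sub>F n in sequentially. \<forall>j\<in>{..Mb}. \<forall>k. (\<integral>\<^sup>+om. Q n l j k om \<partial>M) <= ennreal e"
  proof (rule eventually_mono)
    show "\<forall>\<^sub>F n in sequentially. \<forall>j\<in>{..Mb}. \<forall>k. (\<integral>\<^sup>+om. Q n l j k om \<partial>M) <= ennreal (8 * chain_tail CARD('p) C l * B + e / 2)"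
      by (rule B(2)) (use e in simp)
    fix n assume a: "\<forall>j\<in>{..Mb}. \<forall>k. (\<integral>\<^sup>+om. Q n l j k om \<partial>M) <= ennreal (8 * chain_tail CARD('p) C l * B + e / 2)"
    have "ennreal (8 * chain_tail CARD('p) C l * B + e / 2) <= ennreal e" using l by (intro ennreal_leI) simp
    then show "\<forall>j\<in>{..Mb}. \<forall>k. (\<integral>\<^sup>+om. Q n l j k om \<partial>M) <= ennreal e" using a order_trans by blast
  qed
  then show ?thesis by blast
qed

text \<open>At level 0 the mesh covers the whole cube. Once the processes are known to vanish at the
  origin, this yields tightness of their suprema.\<close>

lemma Q0_bounded: "\<exists>K\<ge>0. \<forall>\<^sub>F n in sequentially. \<forall>j\<in>{..Mb}. \<forall>k. (\<integral>\<^sup>+om. Q n 0 j k om \<partial>M) <= ennreal K"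
proof -
  obtain B where B: "B >= 0" "!!l e. e > 0 ==> (\<forall>\<^sub>F n in sequentially. \<forall>j\<in>{..Mb}. \<forall>k. (\<integral>\<^sup>+om. Q n l j k om \<partial>M) <= ennreal (8 * chain_tail CARD('p) C l * B + e))"
    using Q_expectation_eventually by blast
  have "0 <= 8 * chain_tail CARD('p) C 0 * B + 1" using B(1) unif_class.chain_tail_nonneg[OF fk] by simp
  then show ?thesis
    by (intro exI[of _ "8 * chain_tail CARD('p) C 0 * B + 1"] conjI) (assumption, rule B(2), simp)
qed

text \<open>A second moment bound on the truncation events. Independence of the two weight vectors
  factorises the second moment into products of entries of \<open>cm\<close>. The off-diagonal
  entries are of order \<open>1 / n\<close> in each factor, so the double sum is of order
  \<open>n\<close> instead of \<open>n\<^sup>2\<close>, and Markov's inequality applies.\<close>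

lemma cross_tendsto:
  assumes jj: "j \<in> {1..Mb}" "j' \<in> {1..Mb}" "j ~= j'" and e: "e > 0"
  shows "(%n. M.prob {om\<in>space M. \<bar>(\<Sum>i<n. v n om j i * v n om j' i) / n\<bar> > e}) \<longlonglongrightarrow> 0"
proof -
  interpret A: exch_array M "W j" by (rule ea[OF jj(1)])
  interpret B: exch_array M "W j'" by (rule ea[OF jj(2)])
  have le: "M.prob {om\<in>space M. \<bar>(\<Sum>i<n. v n om j i * v n om j' i) / n\<bar> > e}
     <= M.prob {om\<in>space M. A.trunc_ev n om = 0} + M.prob {om\<in>space M. B.trunc_ev n om = 0} + 8 / (e\<^sup>2 * n)" if n: "n >= 2" for n
  proof -
    define Y where "Y om = A.trunc_ev n om * B.trunc_ev n om * (\<Sum>i<n. A.vn n om i * B.vn n om i)\<^sup>2" for om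
    have sumexp: "Y om = (\<Sum>i<n. \<Sum>k<n. (A.trunc_ev n om * (A.vn n om i * A.vn n om k)) * (B.trunc_ev n om * (B.vn n om i * B.vn n om k)))" for om
      unfolding Y_def power2_eq_square sum_product by (simp add: sum_distrib_left mult_ac)
    have ind: "integrable M (%om. (A.trunc_ev n om * (A.vn n om i * A.vn n om k)) * (B.trunc_ev n om * (B.vn n om i * B.vn n om k)))
        & M.expectation (%om. (A.trunc_ev n om * (A.vn n om i * A.vn n om k)) * (B.trunc_ev n om * (B.vn n om i * B.vn n om k))) = A.cm n i k * B.cm n i k"
      if ik: "i < n" "k < n" for i k
    proof -
      define g where "g y = (if (\<Sum>i<n. (wcent n y i)\<^sup>2) <= 2 * real n then 1 else 0) * (wcent n y i * wcent n y k)" for y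
      have sm: "(%y. \<Sum>i<n. (wcent n y i)\<^sup>2) \<in> borel_measurable (PiM {..<n} (%_. borel))"
        using wcent_meas by (intro borel_measurable_sum borel_measurable_power) auto
      have gm: "g \<in> borel_measurable (PiM {..<n} (%_. borel))"
        unfolding g_def using wcent_meas[OF ik(1)] wcent_meas[OF ik(2)] sm by measurable
      have gr: "g (restrict y {..<n}) = g y" for y by (simp add: g_def wcent_restrict ik)
      have iv: "M.indep_vars (%_. borel) (%j om. g (restrict (%i. W j n i om) {..<n})) {j, j'}"
        by (rule M.indep_vars_compose2[OF M.indep_vars_subset[OF W_indep[of n]]]) (use jj gm in auto)
      have ga: "g (%i. W j n i om) = A.trunc_ev n om * (A.vn n om i * A.vn n om k)"
        "g (%i. W j' n i om) = B.trunc_ev n om * (B.vn n om i * B.vn n om k)" for om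
        by (simp_all add: g_def A.trunc_ev_def B.trunc_ev_def A.vn_def B.vn_def)
      have int: "integrable M (%om. g (restrict (%i. W l n i om) {..<n}))" if "l \<in> {j, j'}" for l
        using that A.trunc_prod_int[OF ik] B.trunc_prod_int[OF ik] unfolding gr by (auto simp: ga)
      show ?thesis
        using M.indep_vars_integrable[OF _ iv int] M.indep_vars_lebesgue_integral[OF _ iv int] jj(3)
        unfolding gr by (simp add: ga A.cm_def B.cm_def)
    qed
    have Yi: "integrable M Y" unfolding sumexp using ind by (intro Bochner_Integration.integrable_sum) auto
    let ?y = "%i k om. (A.trunc_ev n om * (A.vn n om i * A.vn n om k)) * (B.trunc_ev n om * (B.vn n om i * B.vn n om k))"
    have "M.expectation Y = (\<Sum>i<n. M.expectation (%om. \<Sum>k<n. ?y i k om))"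
      unfolding sumexp by (rule Bochner_Integration.integral_sum) (rule Bochner_Integration.integrable_sum, use ind in simp)
    also have "... = (\<Sum>i<n. \<Sum>k<n. M.expectation (?y i k))"
      by (rule sum.cong[OF refl], rule Bochner_Integration.integral_sum) (use ind in simp)
    also have "... = (\<Sum>i<n. \<Sum>k<n. A.cm n i k * B.cm n i k)"
      by (rule sum.cong[OF refl], rule sum.cong[OF refl]) (use ind in simp)
    also have "... <= 8 * real n"
    proof -
      obtain c where c: "0 <= c" "c <= 2" "!!i k. i < n ==> k < n ==> A.cm n i k = (if i = k then c else - c / (real n - 1))"
        by (rule A.cm_values[OF n]) (rule that, assumption+)
      obtain d where d: "0 <= d" "d <= 2" "!!i k. i < n ==> k < n ==> B.cm n i k = (if i = k then d else - d / (real n - 1))"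
        by (rule B.cm_values[OF n]) (rule that, assumption+)
      have n1: "real n - 1 >= 1" using n by simp
      have cd: "c * d <= 4" using mult_mono[of c 2 d 2] c d by simp
      have cd0: "0 <= c * d" using c d by simp
      \<comment> \<open>The diagonal contributes \<open>c * d\<close>; the \<open>n - 1\<close>
        off-diagonal terms of size \<open>c * d / (real n - 1)\<^sup>2\<close> contribute at most as
        much again.\<close>
      have row: "(\<Sum>k<n. A.cm n i k * B.cm n i k) <= 8" if i: "i < n" for i
      proof -
        have "(\<Sum>k<n. A.cm n i k * B.cm n i k) = c * d + (\<Sum>k\<in>{..<n}-{i}. A.cm n i k * B.cm n i k)"
          using i c(3)[OF i i] d(3)[OF i i] by (subst sum.remove[of _ i]) auto
        also have "(\<Sum>k\<in>{..<n}-{i}. A.cm n i k * B.cm n i k) = (\<Sum>k\<in>{..<n}-{i}. c * d / (real n - 1)\<^sup>2)"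
          by (rule sum.cong[OF refl]) (use i c(3) d(3) in \<open>auto simp: power2_eq_square\<close>)
        also have "... = c * d / (real n - 1)" using i n by (simp add: of_nat_diff power2_eq_square)
        also have "... <= c * d" using n1 cd0 mult_left_mono[of 1 "real n - 1" "c * d"] by (simp add: divide_le_eq)
        finally show ?thesis using cd by simp
      qed
      have "(\<Sum>i<n. \<Sum>k<n. A.cm n i k * B.cm n i k) <= (\<Sum>i<n. 8)" by (intro sum_mono row) auto
      then show ?thesis by simp
    qed
    finally have EY: "M.expectation Y <= 8 * real n" .
    have n0: "real n > 0" using n by simp
    have Y0: "0 <= Y om" for om by (simp add: Y_def A.trunc_ev_def B.trunc_ev_def)
    have "M.prob {om\<in>space M. Y om >= (e * n)\<^sup>2} <= M.expectation Y / (e * n)\<^sup>2"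
      using integral_Markov_inequality_measure[OF Yi _, of "space M" "(e * n)\<^sup>2"] Y0 e n0 by (simp add: sets.top)
    also have "... <= 8 * real n / (e * n)\<^sup>2" using EY by (intro divide_right_mono) auto
    also have "... = 8 / (e\<^sup>2 * n)" using n0 by (simp add: power2_eq_square field_simps)
    finally have mk: "M.prob {om\<in>space M. Y om >= (e * n)\<^sup>2} <= 8 / (e\<^sup>2 * n)" .
    let ?A = "{om\<in>space M. A.trunc_ev n om = 0}" and ?B = "{om\<in>space M. B.trunc_ev n om = 0}" and ?C = "{om\<in>space M. Y om >= (e * n)\<^sup>2}"
    have ABC: "?A \<in> sets M" "?B \<in> sets M" "?C \<in> sets M" using Yi by (auto intro: borel_measurable_integrable)
    have "{om\<in>space M. \<bar>(\<Sum>i<n. v n om j i * v n om j' i) / n\<bar> > e} \<subseteq> ?A \<union> ?B \<union> ?C"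
    proof
      fix om assume "om \<in> {om\<in>space M. \<bar>(\<Sum>i<n. v n om j i * v n om j' i) / n\<bar> > e}"
      then have w: "om \<in> space M" "\<bar>(\<Sum>i<n. A.vn n om i * B.vn n om i) / n\<bar> > e"
        using v_eq_vn[OF jj(1)] v_eq_vn[OF jj(2)] by auto
      from w(2) have "e * n <= \<bar>\<Sum>i<n. A.vn n om i * B.vn n om i\<bar>" using n0 by (simp add: abs_divide field_simps)
      then have "(e * n)\<^sup>2 <= (\<Sum>i<n. A.vn n om i * B.vn n om i)\<^sup>2" using e n0 power_mono[of "e * n" "\<bar>\<Sum>i<n. A.vn n om i * B.vn n om i\<bar>" 2] by simp
      then show "om \<in> ?A \<union> ?B \<union> ?C" using w(1) by (auto simp: Y_def A.trunc_ev_def B.trunc_ev_def split: if_splits)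
    qed
    then have "M.prob {om\<in>space M. \<bar>(\<Sum>i<n. v n om j i * v n om j' i) / n\<bar> > e} <= M.prob (?A \<union> ?B \<union> ?C)"
      using ABC by (intro M.finite_measure_mono) auto
    also have "... <= M.prob (?A \<union> ?B) + M.prob ?C" using ABC by (intro measure_Un_le) auto
    also have "... <= (M.prob ?A + M.prob ?B) + 8 / (e\<^sup>2 * n)" using ABC mk by (intro add_mono measure_Un_le) auto
    finally show ?thesis .
  qed
  have "(%n. 8 / (e\<^sup>2 * real n)) \<longlonglongrightarrow> 0" using e by real_asymp
  then have lim: "(%n. M.prob {om\<in>space M. A.trunc_ev n om = 0} + M.prob {om\<in>space M. B.trunc_ev n om = 0} + 8 / (e\<^sup>2 * n)) \<longlonglongrightarrow> 0 + 0 + 0"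
    by (intro tendsto_add A.trunc_prob_tendsto B.trunc_prob_tendsto)
  show ?thesis
  proof (rule tendsto_sandwich[OF _ _ tendsto_const lim[simplified]])
    show "\<forall>\<^sub>F n in sequentially. M.prob {om\<in>space M. \<bar>(\<Sum>i<n. v n om j i * v n om j' i) / n\<bar> > e}
     <= M.prob {om\<in>space M. A.trunc_ev n om = 0} + M.prob {om\<in>space M. B.trunc_ev n om = 0} + 8 / (e\<^sup>2 * n)"
      using eventually_ge_at_top[of 2] by (rule eventually_mono) (rule le)
  qed simp
qed

section \<open>Finite-dimensional limits conditionally on the weights\<close>

definition BadA :: "nat => real => nat => 'a set" where
  "BadA n e j = {om\<in>space M. \<exists>i<n. \<bar>v n om j i\<bar> > e * sqrt n}"

definition BadB :: "nat => real => nat => 'a set" where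
  "BadB n e j = {om\<in>space M. \<bar>(\<Sum>i<n. (v n om j i)\<^sup>2) / n - 1\<bar> > e}"

definition BadC :: "nat => real => nat \<times> nat => 'a set" where
  "BadC n e jj = {om\<in>space M. \<bar>(\<Sum>i<n. v n om (fst jj) i * v n om (snd jj) i) / n\<bar> > e}"

definition wpairs :: "(nat \<times> nat) set" where
  "wpairs = {jj \<in> {1..Mb} \<times> {1..Mb}. fst jj ~= snd jj}"

text \<open>The weight realisations for which the hypotheses of \<open>clt_weighted_bound\<close>
  may fail.\<close>

definition Bad :: "nat => real => 'a set" where
  "Bad n e = (\<Union>j\<in>{1..Mb}. BadA n e j) \<union> (\<Union>j\<in>{1..Mb}. BadB n e j) \<union> (\<Union>jj\<in>wpairs. BadC n e jj)"

lemma finite_wpairs: "finite wpairs" unfolding wpairs_def by simp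

lemma Bad_pieces_meas: "j \<in> {1..Mb} ==> BadA n e j \<in> sets M" "j \<in> {1..Mb} ==> BadB n e j \<in> sets M" "jj \<in> wpairs ==> BadC n e jj \<in> sets M"
proof -
  show "BadA n e j \<in> sets M" if "j \<in> {1..Mb}"
  proof -
    have j: "j <= Mb" using that by simp
    have "{om\<in>space M. \<exists>i\<in>{..<n}. \<bar>v n om j i\<bar> > e * sqrt n} \<in> sets M"
    proof (rule sets.sets_Collect_finite_Ex)
      fix i assume "i \<in> {..<n}"
      then have "i < n" by simp
      show "{om\<in>space M. \<bar>v n om j i\<bar> > e * sqrt n} \<in> sets M"
        by (rule borel_measurable_less[OF borel_measurable_const borel_measurable_abs[OF v_meas[OF j \<open>i < n\<close>]]])
    qed simp
    then show ?thesis unfolding BadA_def Bex_def lessThan_iff .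
  qed
  show "BadB n e j \<in> sets M" if "j \<in> {1..Mb}"
  proof -
    have j: "j <= Mb" using that by simp
    have [measurable]: "(%om. \<Sum>i<n. (v n om j i)\<^sup>2) \<in> borel_measurable M"
      by (intro borel_measurable_sum borel_measurable_power v_meas j; simp)
    show ?thesis unfolding BadB_def by measurable
  qed
  show "BadC n e jj \<in> sets M" if "jj \<in> wpairs"
  proof -
    have j: "fst jj <= Mb" "snd jj <= Mb" using that by (auto simp: wpairs_def)
    have [measurable]: "(%om. \<Sum>i<n. v n om (fst jj) i * v n om (snd jj) i) \<in> borel_measurable M"
      by (intro borel_measurable_sum borel_measurable_times v_meas j; simp)
    show ?thesis unfolding BadC_def by measurable
  qed
qed

lemma Bad_meas: "Bad n e \<in> sets M"
  unfolding Bad_def by (intro sets.Un sets.finite_UN finite_wpairs Bad_pieces_meas finite_atLeastAtMost)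

lemma Bad_tendsto:
  assumes e: "e > 0" shows "(%n. M.prob (Bad n e)) \<longlonglongrightarrow> 0"
proof -
  have le: "M.prob (Bad n e) <= (\<Sum>j\<in>{1..Mb}. M.prob (BadA n e j)) + (\<Sum>j\<in>{1..Mb}. M.prob (BadB n e j)) + (\<Sum>jj\<in>wpairs. M.prob (BadC n e jj))" for n
  proof -
    have mA: "(\<Union>j\<in>{1..Mb}. BadA n e j) \<in> sets M" by (intro sets.finite_UN Bad_pieces_meas finite_atLeastAtMost)
    have mB: "(\<Union>j\<in>{1..Mb}. BadB n e j) \<in> sets M" by (intro sets.finite_UN Bad_pieces_meas finite_atLeastAtMost)
    have mC: "(\<Union>jj\<in>wpairs. BadC n e jj) \<in> sets M" by (intro sets.finite_UN Bad_pieces_meas finite_wpairs)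
    note m = mA mB mC
    have "M.prob (Bad n e) <= M.prob ((\<Union>j\<in>{1..Mb}. BadA n e j) \<union> (\<Union>j\<in>{1..Mb}. BadB n e j)) + M.prob (\<Union>jj\<in>wpairs. BadC n e jj)"
      unfolding Bad_def by (intro measure_Un_le sets.Un m)
    also have "... <= (M.prob (\<Union>j\<in>{1..Mb}. BadA n e j) + M.prob (\<Union>j\<in>{1..Mb}. BadB n e j)) + M.prob (\<Union>jj\<in>wpairs. BadC n e jj)"
      by (intro add_right_mono measure_Un_le m)
    also have "... <= ((\<Sum>j\<in>{1..Mb}. M.prob (BadA n e j)) + (\<Sum>j\<in>{1..Mb}. M.prob (BadB n e j))) + (\<Sum>jj\<in>wpairs. M.prob (BadC n e jj))"
      by (intro add_mono measure_UNION_le Bad_pieces_meas finite_wpairs finite_atLeastAtMost)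
    finally show ?thesis .
  qed
  have "(%n. (\<Sum>j\<in>{1..Mb}. M.prob (BadA n e j)) + (\<Sum>j\<in>{1..Mb}. M.prob (BadB n e j)) + (\<Sum>jj\<in>wpairs. M.prob (BadC n e jj))) \<longlonglongrightarrow> (\<Sum>j\<in>{1..Mb}. 0) + (\<Sum>j\<in>{1..Mb}. 0) + (\<Sum>jj\<in>wpairs. 0)"
  proof (intro tendsto_add tendsto_sum)
    fix j assume j: "j \<in> {1..Mb}"
    show "(%n. M.prob (BadA n e j)) \<longlonglongrightarrow> 0" unfolding BadA_def v_eq_vn[OF j] by (rule exch_array.max_prob_tendsto[OF ea[OF j] e])
    show "(%n. M.prob (BadB n e j)) \<longlonglongrightarrow> 0" using W_cond[OF j] j e unfolding BadB_def condW_def v_def wcent_def by simp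
  next
    fix jj assume "jj \<in> wpairs"
    then have "fst jj \<in> {1..Mb}" "snd jj \<in> {1..Mb}" "fst jj ~= snd jj" by (auto simp: wpairs_def)
    then show "(%n. M.prob (BadC n e jj)) \<longlonglongrightarrow> 0" unfolding BadC_def by (intro cross_tendsto e)
  qed
  then have lim: "(%n. (\<Sum>j\<in>{1..Mb}. M.prob (BadA n e j)) + (\<Sum>j\<in>{1..Mb}. M.prob (BadB n e j)) + (\<Sum>jj\<in>wpairs. M.prob (BadC n e jj))) \<longlonglongrightarrow> 0" by simp
  show ?thesis by (rule tendsto_sandwich[OF _ _ tendsto_const lim]) (simp, rule always_eventually, rule allI, rule le)
qed

text \<open>Slot 0 needs no control of randomness: its weights are 1, their mean square is exactly
  1, and their products with a centred vector sum to zero. The condition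
  \<open>1 \<le> e * sqrt n\<close> is what bounds these unit weights.\<close>

lemma not_Bad:
  assumes w: "om \<in> space M" "om \<notin> Bad n e" and n: "n >= 1" "1 <= e * sqrt n" and e: "e > 0"
  shows "j <= Mb ==> j' <= Mb ==> \<bar>(\<Sum>i<n. v n om j i * v n om j' i) / n - (if j = j' then 1 else 0)\<bar> <= e"
    and "j <= Mb ==> i < n ==> \<bar>v n om j i\<bar> <= e * sqrt n"
proof -
  show "\<bar>v n om j i\<bar> <= e * sqrt n" if "j <= Mb" "i < n"
  proof (cases "j = 0")
    case True then show ?thesis using n by (simp add: v_def)
  next
    case False
    then have j: "j \<in> {1..Mb}" using that by auto
    have "om \<notin> BadA n e j" using w(2) j unfolding Bad_def by blast
    then have "\<not> \<bar>v n om j i\<bar> > e * sqrt n" using w(1) that(2) unfolding BadA_def by blast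
    then show ?thesis by simp
  qed
  assume jj: "j <= Mb" "j' <= Mb"
  have z: "(\<Sum>i<n. v n om 0 i * v n om 0 i) = n" by (simp add: v_def)
  have zj: "(\<Sum>i<n. v n om l i) = 0" if "l ~= 0" for l using that wcent_sum by (simp add: v_def)
  show "\<bar>(\<Sum>i<n. v n om j i * v n om j' i) / n - (if j = j' then 1 else 0)\<bar> <= e"
  proof (cases "j = 0 \<or> j' = 0")
    case True
    then consider "j = 0" "j' = 0" | "j = 0" "j' ~= 0" | "j ~= 0" "j' = 0" by blast
    then show ?thesis
    proof cases
      case 1 then show ?thesis using z n e by simp
    next
      case 2 then show ?thesis using zj[of j'] e by (simp add: v_def)
    next
      case 3 then show ?thesis using zj[of j] e by (simp add: v_def)
    qed
  next
    case False
    then have j: "j \<in> {1..Mb}" "j' \<in> {1..Mb}" using jj by auto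
    show ?thesis
    proof (cases "j = j'")
      case True
      have "om \<notin> BadB n e j" using w(2) j unfolding Bad_def by blast
      then have "\<bar>(\<Sum>i<n. (v n om j i)\<^sup>2) / n - 1\<bar> <= e" using w(1) unfolding BadB_def by (simp add: not_less)
      then show ?thesis using True by (simp add: power2_eq_square)
    next
      case False
      have "(j, j') \<in> wpairs" using j False by (simp add: wpairs_def)
      then have "om \<notin> BadC n e (j, j')" using w(2) unfolding Bad_def by blast
      then show ?thesis using False w(1) unfolding BadC_def by (simp add: not_less)
    qed
  qed
qed

text \<open>Conditionally on the weights the linear combination is a sum of independent variables.
  Off \<open>Bad\<close> its characteristic function is close to a limit free of the weights; on
  \<open>Bad\<close> the trivial bound 2 is multiplied by a vanishing probability.\<close>

lemma fidi_char:
  assumes J: "J \<subseteq> {..Mb}" and F: "!!j. finite (F j)"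
  shows "(%n. \<integral>om. iexp (\<Sum>j\<in>J. \<Sum>s\<in>F j. c j s * alpha n om j (fst s) (snd s)) \<partial>M) \<longlonglongrightarrow>
    complex_of_real (exp (- (\<Sum>j\<in>J. \<Sum>s\<in>F j. \<Sum>t\<in>F j. c j s * c j t * cov s t) / 2))"
proof -
  have fJ: "finite J" using J finite_subset by blast
  define g where "g j y = (if j \<in> J then \<Sum>s\<in>F j. c j s * cf s y else 0)" for j y
  have gm[measurable]: "g j \<in> borel_measurable P" for j unfolding g_def by (cases "j \<in> J") auto
  define G where "G = (\<Sum>j\<in>J. \<Sum>s\<in>F j. \<bar>c j s\<bar>)"
  have G0: "0 <= G" unfolding G_def by (intro sum_nonneg) auto
  have gG: "\<bar>g j y\<bar> <= G" for j y
  proof (cases "j \<in> J")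
    case True
    have "\<bar>g j y\<bar> <= (\<Sum>s\<in>F j. \<bar>c j s * cf s y\<bar>)" using True by (simp add: g_def sum_abs)
    also have "... <= (\<Sum>s\<in>F j. \<bar>c j s\<bar>)" unfolding abs_mult using cf_bound by (intro sum_mono) (simp add: mult_left_le)
    also have "... <= G" unfolding G_def using True fJ by (intro member_le_sum[of j J "%j. \<Sum>s\<in>F j. \<bar>c j s\<bar>"]) (auto intro: sum_nonneg)
    finally show ?thesis .
  qed (simp add: g_def G0)
  have g0: "expectation (g j) = 0" for j
    by (cases "j \<in> J") (simp_all add: g_def[abs_def] cf_int Bochner_Integration.integral_sum)
  let ?V = "\<Sum>j\<le>Mb. expectation (%x. (g j x)\<^sup>2)"
  have Veq: "?V = (\<Sum>j\<in>J. \<Sum>s\<in>F j. \<Sum>t\<in>F j. c j s * c j t * cov s t)"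
  proof -
    have "?V = (\<Sum>j\<in>J. expectation (%x. (g j x)\<^sup>2))"
      using J by (intro sum.mono_neutral_right) (auto simp: g_def)
    also have "... = (\<Sum>j\<in>J. \<Sum>s\<in>F j. \<Sum>t\<in>F j. c j s * c j t * cov s t)"
      by (intro sum.cong refl) (simp add: g_def cov_quadratic[OF F, where \<sigma>="%s. s"])
    finally show ?thesis .
  qed
  let ?L = "complex_of_real (exp (- ?V / 2))"
  let ?K = "2 * (real (Suc Mb) * G) * (2 * (real (Suc Mb) * G)\<^sup>2) + (real (Suc Mb) * G)\<^sup>2"
  define Fn where "Fn n x ws = iexp (\<Sum>i<n. (\<Sum>j\<le>Mb. vw n ws j i * g j (x i)) / sqrt n)" for n x ws
  have Fm: "(%(x, ws). Fn n x ws) \<in> borel_measurable (Pseq \<Otimes>\<^sub>M WS n)" for n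
  proof -
    have "(%z. \<Sum>i<n. (\<Sum>j\<le>Mb. vw n (snd z) j i * g j (fst z i)) / sqrt n) \<in> borel_measurable (Pseq \<Otimes>\<^sub>M WS n)"
    proof (intro borel_measurable_sum borel_measurable_divide borel_measurable_times borel_measurable_const)
      fix i j assume "i \<in> {..<n}" "j \<in> {..Mb}"
      then show "(%z. vw n (snd z) j i) \<in> borel_measurable (Pseq \<Otimes>\<^sub>M WS n)" by (intro measurable_compose[OF measurable_snd vw_meas]) auto
      have "(%z. fst z i) \<in> measurable (Pseq \<Otimes>\<^sub>M WS n) P" by (rule measurable_compose[OF measurable_fst]) simp
      then show "(%z. g j (fst z i)) \<in> borel_measurable (Pseq \<Otimes>\<^sub>M WS n)" by (rule measurable_compose[OF _ gm])
    qed
    then show ?thesis unfolding Fn_def case_prod_beta by (simp del: of_real_sum of_real_divide)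
  qed
  have Fb: "norm (Fn n x ws) <= 1" for n x ws unfolding Fn_def by (simp del: of_real_sum of_real_divide)
  have lin: "(\<Sum>j\<in>J. \<Sum>s\<in>F j. c j s * alpha n om j (fst s) (snd s)) = (\<Sum>i<n. (\<Sum>j\<le>Mb. vw n (Wv n om) j i * g j (\<xi> i om)) / sqrt n)" for n om
  proof -
    have 1: "(\<Sum>s\<in>F j. c j s * alpha n om j (fst s) (snd s)) = (\<Sum>i<n. v n om j i * g j (\<xi> i om)) / sqrt n" if "j \<in> J" for j
    proof -
      have "(\<Sum>s\<in>F j. c j s * alpha n om j (fst s) (snd s)) = (\<Sum>s\<in>F j. \<Sum>i<n. v n om j i * (c j s * cf s (\<xi> i om)) / sqrt n)"
        unfolding alpha_def cf_def by (intro sum.cong refl) (simp add: sum_distrib_left sum_divide_distrib mult_ac)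
      also have "... = (\<Sum>i<n. \<Sum>s\<in>F j. v n om j i * (c j s * cf s (\<xi> i om)) / sqrt n)" by (rule sum.swap)
      also have "... = (\<Sum>i<n. v n om j i * g j (\<xi> i om)) / sqrt n" using that by (simp add: g_def sum_distrib_left sum_divide_distrib)
      finally show ?thesis .
    qed
    have "(\<Sum>j\<in>J. \<Sum>s\<in>F j. c j s * alpha n om j (fst s) (snd s)) = (\<Sum>j\<in>J. (\<Sum>i<n. v n om j i * g j (\<xi> i om)) / sqrt n)"
      by (intro sum.cong refl 1)
    also have "... = (\<Sum>j\<le>Mb. (\<Sum>i<n. v n om j i * g j (\<xi> i om)) / sqrt n)"
      using J by (intro sum.mono_neutral_left) (auto simp: g_def)
    also have "... = (\<Sum>j\<le>Mb. \<Sum>i<n. v n om j i * g j (\<xi> i om) / sqrt n)" by (simp add: sum_divide_distrib)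
    also have "... = (\<Sum>i<n. \<Sum>j\<le>Mb. v n om j i * g j (\<xi> i om) / sqrt n)" by (rule sum.swap)
    also have "... = (\<Sum>i<n. (\<Sum>j\<le>Mb. vw n (Wv n om) j i * g j (\<xi> i om)) / sqrt n)"
      by (intro sum.cong refl) (simp add: sum_divide_distrib vw_Wv)
    finally show ?thesis .
  qed
  have key: "\<forall>\<^sub>F n in sequentially. cmod ((\<integral>om. iexp (\<Sum>j\<in>J. \<Sum>s\<in>F j. c j s * alpha n om j (fst s) (snd s)) \<partial>M) - ?L) <= e * ?K + 2 * M.prob (Bad n e)"
    if e: "e > 0" "real (Suc Mb) * G * e <= 1" "e <= 1" for e
  proof -
    have "\<forall>\<^sub>F n in sequentially. 1 <= e * sqrt (real n)" using e(1) by real_asymp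
    then show ?thesis using eventually_ge_at_top[of 1]
    proof eventually_elim
      case (elim n)
      have D: "cmod ((\<integral>x. Fn n x (Wv n om) \<partial>Pseq) - ?L) <= e * ?K + 2 * indicator (Bad n e) om" if w: "om \<in> space M" for om
      proof (cases "om \<in> Bad n e")
        case False
        have "cmod ((\<integral>x. Fn n x (Wv n om) \<partial>Pseq) - ?L) <= e * ?K" unfolding Fn_def
        proof (rule clt_weighted_bound[OF gm gG g0 elim(2)])
          show "\<bar>(\<Sum>i<n. vw n (Wv n om) j i * vw n (Wv n om) j' i) / n - (if j = j' then 1 else 0)\<bar> <= e" if "j <= Mb" "j' <= Mb" for j j'
            using not_Bad(1)[OF w False elim(2,1) e(1) that] vw_Wv that by simp
          show "\<bar>vw n (Wv n om) j i\<bar> <= e * sqrt n" if "j <= Mb" "i < n" for j i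
            using not_Bad(2)[OF w False elim(2,1) e(1) that] vw_Wv that by simp
        qed (use e in auto)
        then show ?thesis using False by simp
      next
        case True
        have "cmod (\<integral>x. Fn n x (Wv n om) \<partial>Pseq) <= 1"
        proof -
          interpret S: prob_space Pseq by (intro prob_space_PiM) unfold_locales
          have Fi: "cmod (\<integral>x. Fn n x (Wv n om) \<partial>Pseq) <= (\<integral>x. cmod (Fn n x (Wv n om)) \<partial>Pseq)" by (rule integral_norm_bound)
          have "cmod (Fn n x ws) = 1" for x ws unfolding Fn_def by (simp del: of_real_sum of_real_divide)
          then show ?thesis using Fi by (simp add: S.prob_space)
        qed
        moreover have "cmod ?L <= 1"
        proof -
          have "0 <= ?V" by (intro sum_nonneg) simp
          then show ?thesis by simp
        qed
        ultimately have "cmod ((\<integral>x. Fn n x (Wv n om) \<partial>Pseq) - ?L) <= 2" using norm_triangle_ineq4[of "\<integral>x. Fn n x (Wv n om) \<partial>Pseq" ?L] by linarith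
        moreover have "0 <= e * ?K" using e G0 by simp
        ultimately show ?thesis using True by simp
      qed
      have Im: "(%om. \<integral>x. Fn n x (Wv n om) \<partial>Pseq) \<in> borel_measurable M" by (rule decouple_complex(2)[OF Fm Fb])
      have Ii: "integrable M (%om. \<integral>x. Fn n x (Wv n om) \<partial>Pseq)"
      proof (rule M.integrable_const_bound[of _ "e * ?K + 2 + cmod ?L"])
        show "AE om in M. cmod (\<integral>x. Fn n x (Wv n om) \<partial>Pseq) <= e * ?K + 2 + cmod ?L"
        proof (rule AE_I2)
          fix om assume w: "om \<in> space M"
          have "cmod (\<integral>x. Fn n x (Wv n om) \<partial>Pseq) <= cmod ((\<integral>x. Fn n x (Wv n om) \<partial>Pseq) - ?L) + cmod ?L" using norm_triangle_ineq[of "(\<integral>x. Fn n x (Wv n om) \<partial>Pseq) - ?L" ?L] by simp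
          also have "... <= (e * ?K + 2 * indicator (Bad n e) om) + cmod ?L" using D[OF w] by simp
          also have "... <= e * ?K + 2 + cmod ?L" by (simp add: indicator_def)
          finally show "cmod (\<integral>x. Fn n x (Wv n om) \<partial>Pseq) <= e * ?K + 2 + cmod ?L" .
        qed
      qed (rule Im)
      have Bi2: "integrable M (%om. 2 * indicator (Bad n e) om :: real)"
        by (intro integrable_mult_right integrable_real_indicator Bad_meas) (simp add: M.emeasure_eq_measure)
      have Bi: "integrable M (%om. e * ?K + 2 * indicator (Bad n e) om :: real)"
        by (rule Bochner_Integration.integrable_add[OF M.integrable_const Bi2])
      have "(\<integral>om. iexp (\<Sum>j\<in>J. \<Sum>s\<in>F j. c j s * alpha n om j (fst s) (snd s)) \<partial>M) = (\<integral>om. Fn n (%i. \<xi> i om) (Wv n om) \<partial>M)"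
        unfolding lin Fn_def ..
      also have "... = (\<integral>om. \<integral>x. Fn n x (Wv n om) \<partial>Pseq \<partial>M)" by (rule decouple_complex(1)[OF Fm Fb])
      finally have E: "(\<integral>om. iexp (\<Sum>j\<in>J. \<Sum>s\<in>F j. c j s * alpha n om j (fst s) (snd s)) \<partial>M) = (\<integral>om. \<integral>x. Fn n x (Wv n om) \<partial>Pseq \<partial>M)" .
      have cst: "(\<integral>om. z \<partial>M) = z" for z :: complex by (simp add: M.prob_space)
      have E2: "(\<integral>om. iexp (\<Sum>j\<in>J. \<Sum>s\<in>F j. c j s * alpha n om j (fst s) (snd s)) \<partial>M) - ?L = (\<integral>om. (\<integral>x. Fn n x (Wv n om) \<partial>Pseq) - ?L \<partial>M)"
        unfolding E Bochner_Integration.integral_diff[OF Ii M.integrable_const] cst ..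
      have "cmod ((\<integral>om. iexp (\<Sum>j\<in>J. \<Sum>s\<in>F j. c j s * alpha n om j (fst s) (snd s)) \<partial>M) - ?L) <= (\<integral>om. cmod ((\<integral>x. Fn n x (Wv n om) \<partial>Pseq) - ?L) \<partial>M)"
        unfolding E2 by (rule integral_norm_bound)
      also have "... <= (\<integral>om. e * ?K + 2 * indicator (Bad n e) om \<partial>M)"
      proof (rule integral_mono[OF _ _ D])
        show "integrable M (%om. cmod ((\<integral>x. Fn n x (Wv n om) \<partial>Pseq) - ?L))"
          by (rule integrable_norm[OF Bochner_Integration.integrable_diff[OF Ii M.integrable_const]])
        show "integrable M (%om. e * ?K + 2 * indicator (Bad n e) om)" by (rule Bi)
      qed
      also have "... = e * ?K + 2 * M.prob (Bad n e)"
      proof -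
        have "(\<integral>om. e * ?K + 2 * indicator (Bad n e) om \<partial>M) = (\<integral>om. e * ?K \<partial>M) + (\<integral>om. 2 * indicator (Bad n e) om \<partial>M)"
          by (rule Bochner_Integration.integral_add[OF M.integrable_const Bi2])
        then show ?thesis using Bad_meas[of n e] by (simp add: M.prob_space)
      qed
      finally show ?case .
    qed
  qed
  have K0: "0 <= ?K" using G0 by simp
  show ?thesis unfolding Veq[symmetric]
  proof (rule Lim_null[THEN iffD2], rule tendstoI)
    fix d :: real assume d: "d > 0"
    \<comment> \<open>Three demands: the two smallness conditions of
      \<open>clt_weighted_bound\<close>, and a remainder of at most \<open>d / 2\<close>. The added
      ones guard against zero denominators.\<close>
    define e where "e = min (min 1 (1 / (real (Suc Mb) * G + 1))) (d / (2 * (?K + 1)))"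
    have KG: "0 <= real (Suc Mb) * G" using G0 by simp
    have e0: "e > 0" unfolding e_def using d K0 KG by simp
    have e1: "e <= 1" unfolding e_def by simp
    have e2: "real (Suc Mb) * G * e <= 1"
    proof -
      have "real (Suc Mb) * G * e <= (real (Suc Mb) * G + 1) * (1 / (real (Suc Mb) * G + 1))"
        using KG e0 by (intro mult_mono) (auto simp: e_def)
      also have "... = 1" using KG by simp
      finally show ?thesis .
    qed
    have e3: "e * ?K < d / 2 \<or> e * ?K = 0 \<or> e * ?K <= d / 2"
    proof -
      have "e * ?K <= (d / (2 * (?K + 1))) * (?K + 1)" using K0 e0 d by (intro mult_mono) (auto simp: e_def)
      also have "... = d / 2" using K0 by (simp add: field_simps)
      finally show ?thesis by blast
    qed
    then have e3: "e * ?K <= d / 2" using d by auto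
    have "\<forall>\<^sub>F n in sequentially. M.prob (Bad n e) < d / 4" using Bad_tendsto[OF e0] d by (intro order_tendstoD) auto
    then show "\<forall>\<^sub>F n in sequentially. dist ((\<integral>om. iexp (\<Sum>j\<in>J. \<Sum>s\<in>F j. c j s * alpha n om j (fst s) (snd s)) \<partial>M) - ?L) 0 < d"
      using key[OF e0 e2 e1]
    proof eventually_elim
      case (elim n)
      then show ?case unfolding dist_norm diff_0_right using e3 by linarith
    qed
  qed
qed

end

section \<open>Linearisation of the rank-based estimators\<close>

lemma cube_iff: "u \<in> cbox 0 1 \<longleftrightarrow> (\<forall>i. 0 <= u $ i & u $ i <= 1)" for u :: "real^'p"
  by (simp add: mem_box_cart)

definition at1 :: "real => 'p => real^'p" where
  "at1 s l = (\<chi> i. if i = l then s else 1)"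

lemma onek_at1: "onek u l = at1 (u $ l) l" by (simp add: onek_def at1_def)
lemma at1_one: "at1 1 l = ones" by (simp add: at1_def ones_def vec_eq_iff)
lemma at1_cube: "0 <= s ==> s <= 1 ==> at1 s l \<in> cbox 0 1" by (simp add: cube_iff at1_def)
lemma ones_cube: "ones \<in> cbox 0 1" by (simp add: cube_iff ones_def)
lemma upd_nth: "upd u k s $ i = (if i = k then s else u $ i)" by (simp add: upd_def)
lemma upd_cube: "u \<in> cbox 0 1 ==> 0 <= s ==> s <= 1 ==> upd u k s \<in> cbox 0 1" by (simp add: cube_iff upd_nth)
lemma upd_upd: "upd (upd u k s) k t = upd u k t" by (simp add: upd_def vec_eq_iff)
lemma prod_diff_le:
  fixes x x' y y' :: real
  assumes "\<bar>x - y\<bar> <= c * t" "\<bar>x' - y'\<bar> <= c' * t" "\<bar>x\<bar> <= X" "\<bar>y'\<bar> <= Y" "0 <= c" "0 <= c'" "0 <= t"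
  shows "\<bar>x * x' - y * y'\<bar> <= (X * c' + c * Y) * t"
proof -
  have "\<bar>x * x' - y * y'\<bar> = \<bar>x * (x' - y') + (x - y) * y'\<bar>" by (simp add: algebra_simps)
  also have "... <= \<bar>x\<bar> * \<bar>x' - y'\<bar> + \<bar>x - y\<bar> * \<bar>y'\<bar>" by (metis abs_mult abs_triangle_ineq)
  also have "... <= X * (c' * t) + (c * t) * Y"
    using assms by (intro add_mono mult_mono) auto
  finally show ?thesis by (simp add: algebra_simps)
qed

text \<open>\<open>D\<close> stands for the distribution function of U^A on the event that Z lies in
  one set, and \<open>p0\<close> for its total mass. The bound on \<open>dd\<close> is required at
  all points, since \<open>Cinf'\<close> uses \<open>dd\<close> on the whole cube, including faces
  where it may not be a derivative.\<close>

locale copula_fun =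
  fixes D :: "real^'p => real" and p0 :: real and dd :: "real^'p => 'p => real" and K :: real
  assumes p0: "0 < p0" "p0 <= 1" and K1: "1 <= K"
    and D_lip: "!!u v. \<bar>D u - D v\<bar> <= p0 * (\<Sum>i\<in>UNIV. \<bar>u $ i - v $ i\<bar>)"
    and D_marg: "!!s l. 0 <= s ==> s <= 1 ==> D (at1 s l) = p0 * s"
    and D_bd: "!!u. 0 <= D u" "!!u. D u <= p0"
    and dd_der: "!!u l. u \<in> cbox 0 1 ==> 0 < u $ l ==> u $ l < 1 ==> ((%s. D (upd u l s)) has_real_derivative dd u l) (at (u $ l))"
    and dd_cont: "!!l. continuous_on {u \<in> cbox 0 1. 0 < u $ l & u $ l < 1} (%u. dd u l)"
    and dd_bd: "!!u l. \<bar>dd u l\<bar> <= K"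
begin

lemma D_ones: "D ones = p0" using D_marg[of 1] by (simp add: at1_one)

definition Cinf' :: "(real^'p => real) => real^'p => real" where
  "Cinf' B u = B u / p0 - (\<Sum>i\<in>UNIV. dd u i / p0\<^sup>2 * (B (onek u i) - u $ i * B ones)) - D u / p0\<^sup>2 * B ones"

lemma mean_value:
  assumes z: "z \<in> cbox 0 1" and st: "0 <= s" "s <= 1" "0 <= t" "t <= 1" and ne: "s ~= t"
  obtains \<zeta> where "min s t < \<zeta>" "\<zeta> < max s t" "D (upd z l s) - D (upd z l t) = dd (upd z l \<zeta>) l * (s - t)"
proof -
  have main: "\<exists>\<zeta>. a < \<zeta> & \<zeta> < b & D (upd z l b) - D (upd z l a) = dd (upd z l \<zeta>) l * (b - a)"
    if ab: "0 <= a" "a < b" "b <= 1" for a b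
  proof -
    have sumupd: "(\<Sum>i\<in>UNIV. \<bar>upd z l x $ i - upd z l y $ i\<bar>) = \<bar>x - y\<bar>" for x y
      by (subst sum.remove[of _ l]) (auto simp: upd_nth intro!: sum.neutral)
    have cont: "continuous_on {a..b} (%x. D (upd z l x))"
    proof (rule continuous_on_subset[of UNIV])
      show "continuous_on UNIV (%x. D (upd z l x))"
      proof (rule lipschitz_on_continuous_on[of p0])
        show "lipschitz_on p0 UNIV (%x. D (upd z l x))"
          using D_lip[of "upd z l _" "upd z l _"] p0(1) by (auto simp: lipschitz_on_def dist_real_def sumupd)
      qed
    qed simp
    have der: "((%x. D (upd z l x)) has_real_derivative dd (upd z l x) l) (at x)" if "a < x" "x < b" for x
      using dd_der[of "upd z l x" l] upd_cube[OF z, of x l] that ab by (simp add: upd_nth upd_upd)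
    obtain d \<zeta> where \<zeta>: "a < \<zeta>" "\<zeta> < b" "DERIV (%x. D (upd z l x)) \<zeta> :> d" "D (upd z l b) - D (upd z l a) = (b - a) * d"
      using MVT[OF ab(2) cont] der real_differentiable_def by metis
    have "d = dd (upd z l \<zeta>) l" using DERIV_unique[OF \<zeta>(3) der[OF \<zeta>(1,2)]] .
    then show ?thesis using \<zeta> by (auto simp: mult.commute)
  qed
  show thesis
  proof (cases "s < t")
    case True
    from main[of s t] st True obtain \<zeta> where "s < \<zeta>" "\<zeta> < t" "D (upd z l t) - D (upd z l s) = dd (upd z l \<zeta>) l * (t - s)" by auto
    then show ?thesis using that[of \<zeta>] True by (simp add: algebra_simps)
  next
    case False
    then have "t < s" using ne by simp
    from main[of t s] st this obtain \<zeta> where "t < \<zeta>" "\<zeta> < s" "D (upd z l s) - D (upd z l t) = dd (upd z l \<zeta>) l * (s - t)" by auto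
    then show ?thesis using that[of \<zeta>] \<open>t < s\<close> by simp
  qed
qed

text \<open>Coordinates are moved one after the other, and the one-dimensional theorem is applied to
  each move. The moved coordinate of the intermediate point lies strictly inside the unit interval,
  where Condition (C) supplies a derivative.\<close>

lemma mean_value_multi:
  assumes u: "u \<in> cbox 0 1" and w: "w \<in> cbox 0 1" and r: "!!i. \<bar>w $ i - u $ i\<bar> <= r"
  obtains d :: "'p => real" where "D w - D u = (\<Sum>l\<in>UNIV. d l * (w $ l - u $ l))"
    "!!l. w $ l ~= u $ l ==> \<exists>z\<in>cbox 0 1. d l = dd z l & 0 < z $ l & z $ l < 1 & (\<forall>i. \<bar>z $ i - u $ i\<bar> <= r)"
    "!!l. w $ l = u $ l ==> d l = 0"
proof -
  define mix where "mix S = (\<chi> i. if i \<in> S then w $ i else u $ i)" for S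
  have r0: "0 <= r" using r[of undefined] by linarith
  have "\<exists>d. D (mix S) - D u = (\<Sum>l\<in>S. d l * (w $ l - u $ l)) &
     (\<forall>l\<in>S. (w $ l ~= u $ l --> (\<exists>z\<in>cbox 0 1. d l = dd z l & 0 < z $ l & z $ l < 1 & (\<forall>i. \<bar>z $ i - u $ i\<bar> <= r))) & (w $ l = u $ l --> d l = 0))"
    if "finite S" for S
    using that
  proof (induction S)
    case empty
    have "mix {} = u" by (simp add: mix_def vec_eq_iff)
    then show ?case by simp
  next
    case (insert l S)
    then obtain d where d: "D (mix S) - D u = (\<Sum>l\<in>S. d l * (w $ l - u $ l))"
     "!!l. l \<in> S ==> (w $ l ~= u $ l --> (\<exists>z\<in>cbox 0 1. d l = dd z l & 0 < z $ l & z $ l < 1 & (\<forall>i. \<bar>z $ i - u $ i\<bar> <= r))) & (w $ l = u $ l --> d l = 0)"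
      by blast
    have mc: "mix S \<in> cbox 0 1" using u w by (auto simp: cube_iff mix_def)
    have m1: "mix (insert l S) = upd (mix S) l (w $ l)" by (auto simp: mix_def upd_def vec_eq_iff)
    have m2: "mix S = upd (mix S) l (u $ l)" using insert(2) by (auto simp: mix_def upd_def vec_eq_iff)
    have "\<exists>e. D (mix (insert l S)) - D (mix S) = e * (w $ l - u $ l) &
       (w $ l ~= u $ l --> (\<exists>z\<in>cbox 0 1. e = dd z l & 0 < z $ l & z $ l < 1 & (\<forall>i. \<bar>z $ i - u $ i\<bar> <= r))) & (w $ l = u $ l --> e = 0)"
    proof (cases "w $ l = u $ l")
      case True
      then have "mix (insert l S) = mix S" using m1 m2 by simp
      then show ?thesis using True by simp
    next
      case False
      obtain \<zeta> where \<zeta>: "min (w $ l) (u $ l) < \<zeta>" "\<zeta> < max (w $ l) (u $ l)" "D (upd (mix S) l (w $ l)) - D (upd (mix S) l (u $ l)) = dd (upd (mix S) l \<zeta>) l * (w $ l - u $ l)"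
        using mean_value[OF mc, of "w $ l" "u $ l" l] u w False by (auto simp: cube_iff)
      have b: "0 <= w $ l" "w $ l <= 1" "0 <= u $ l" "u $ l <= 1" using u w by (auto simp: cube_iff)
      have z1: "0 < \<zeta>" "\<zeta> < 1" using \<zeta>(1,2) b by auto
      have "\<bar>upd (mix S) l \<zeta> $ i - u $ i\<bar> <= r" for i
        using \<zeta>(1,2) r[of i] r0 by (auto simp: upd_nth mix_def abs_le_iff min_def max_def split: if_splits)
      then show ?thesis using \<zeta>(3) m1 m2 z1 upd_cube[OF mc, of \<zeta> l] False
        by (intro exI[of _ "dd (upd (mix S) l \<zeta>) l"]) (auto simp: upd_nth)
    qed
    then obtain e where e: "D (mix (insert l S)) - D (mix S) = e * (w $ l - u $ l)"
       "(w $ l ~= u $ l --> (\<exists>z\<in>cbox 0 1. e = dd z l & 0 < z $ l & z $ l < 1 & (\<forall>i. \<bar>z $ i - u $ i\<bar> <= r))) & (w $ l = u $ l --> e = 0)" by blast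
    have "(\<Sum>i\<in>S. (d(l := e)) i * (w $ i - u $ i)) = (\<Sum>i\<in>S. d i * (w $ i - u $ i))" using insert(2) by (intro sum.cong) auto
    then have "D (mix (insert l S)) - D u = (\<Sum>i\<in>insert l S. (d(l := e)) i * (w $ i - u $ i))"
      using d(1) e(1) insert(1,2) by simp
    moreover have "\<forall>i\<in>insert l S. (w $ i ~= u $ i --> (\<exists>z\<in>cbox 0 1. (d(l := e)) i = dd z i & 0 < z $ i & z $ i < 1 & (\<forall>j. \<bar>z $ j - u $ j\<bar> <= r))) & (w $ i = u $ i --> (d(l := e)) i = 0)"
      using d(2) e(2) insert(2) by auto
    ultimately show ?case by (intro exI[of _ "d(l := e)"]) blast
  qed
  from this[of UNIV] obtain d where d: "D (mix UNIV) - D u = (\<Sum>l\<in>UNIV. d l * (w $ l - u $ l))"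
     "!!l. (w $ l ~= u $ l --> (\<exists>z\<in>cbox 0 1. d l = dd z l & 0 < z $ l & z $ l < 1 & (\<forall>i. \<bar>z $ i - u $ i\<bar> <= r))) & (w $ l = u $ l --> d l = 0)"
    by auto
  have "mix UNIV = w" by (simp add: mix_def vec_eq_iff)
  then show thesis using that[of d] d by auto
qed

text \<open>Away from the two faces of the l-th coordinate the domain is compact; since there are
  finitely many coordinates, one radius serves all.\<close>

lemma dd_unif_cont:
  assumes d1: "0 < \<delta>" and t: "0 < \<theta>"
  shows "\<exists>\<rho>>0. \<forall>l. \<forall>u\<in>cbox 0 1. \<forall>z\<in>cbox 0 1. \<delta> <= u $ l & u $ l <= 1 - \<delta> & \<delta> <= z $ l & z $ l <= 1 - \<delta> & (\<forall>i. \<bar>z $ i - u $ i\<bar> <= \<rho>)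
     --> \<bar>dd z l - dd u l\<bar> <= \<theta>"
proof -
  have "\<exists>\<rho>>0. \<forall>u\<in>cbox 0 1. \<forall>z\<in>cbox 0 1. \<delta> <= u $ l & u $ l <= 1 - \<delta> & \<delta> <= z $ l & z $ l <= 1 - \<delta> & (\<forall>i. \<bar>z $ i - u $ i\<bar> <= \<rho>)
     --> \<bar>dd z l - dd u l\<bar> <= \<theta>" for l
  proof -
    let ?S = "cbox 0 1 \<inter> {u. \<delta> <= u $ l} \<inter> {u. u $ l <= 1 - \<delta>}"
    have "compact ?S"
      by (intro compact_Int_closed compact_cbox closed_Collect_le continuous_intros)
    moreover have "continuous_on ?S (%u. dd u l)"
      by (rule continuous_on_subset[OF dd_cont[of l]]) (use d1 in auto)
    ultimately have "uniformly_continuous_on ?S (%u. dd u l)" by (rule compact_uniformly_continuous[rotated])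
    then obtain e where e: "e > 0" "!!u z. u \<in> ?S ==> z \<in> ?S ==> dist z u < e ==> dist (dd z l) (dd u l) < \<theta>"
      unfolding uniformly_continuous_on_def using t by blast
    define \<rho> where "\<rho> = e / (2 * real CARD('p))"
    have "\<rho> > 0" using e(1) by (simp add: \<rho>_def)
    moreover have "dist z u < e" if "\<forall>i. \<bar>z $ i - u $ i\<bar> <= \<rho>" for z u :: "real^'p"
    proof -
      have "dist z u <= (\<Sum>i\<in>UNIV. \<bar>(z - u) $ i\<bar>)" unfolding dist_norm by (rule norm_le_l1_cart)
      also have "... <= (\<Sum>i\<in>(UNIV::'p set). \<rho>)" using that by (intro sum_mono) simp
      also have "... = e / 2" by (simp add: \<rho>_def)
      finally show ?thesis using e(1) by linarith
    qed
    ultimately show ?thesis using e(2) by (intro exI[of _ \<rho>]) (fastforce simp: dist_real_def)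
  qed
  then obtain \<rho> where \<rho>: "!!l. \<rho> l > 0" "!!l u z. u \<in> cbox 0 1 ==> z \<in> cbox 0 1 ==> \<delta> <= u $ l & u $ l <= 1 - \<delta> & \<delta> <= z $ l & z $ l <= 1 - \<delta> & (\<forall>i. \<bar>z $ i - u $ i\<bar> <= \<rho> l)
     ==> \<bar>dd z l - dd u l\<bar> <= \<theta>" by metis
  have "Min (range \<rho>) > 0" using \<rho>(1) by (subst Min_gr_iff) auto
  moreover have "Min (range \<rho>) <= \<rho> l" for l by (rule Min_le) auto
  ultimately show ?thesis using \<rho>(2) by (intro exI[of _ "Min (range \<rho>)"]) (meson order_trans)
qed

end

section \<open>Deterministic error bounds\<close>

lemma at1_nth: "at1 s l $ i = (if i = l then s else 1)" by (simp add: at1_def)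

lemma ones_nth: "ones $ i = 1" by (simp add: ones_def)

context copula_fun begin

definition good :: "real => real => real => (real^'p => real) => bool" where
  "good R \<theta> \<delta> a \<longleftrightarrow> (\<forall>u\<in>cbox 0 1. \<bar>a u\<bar> <= R & ((\<exists>l. u $ l = 0) --> a u = 0) &
     (\<forall>v\<in>cbox 0 1. (\<forall>i. \<bar>u $ i - v $ i\<bar> <= \<delta>) --> \<bar>a u - a v\<bar> <= \<theta>))"

text \<open>The bridge of the l-th margin. It vanishes at \<open>u $ l = 1\<close>, and at
  \<open>u $ l = 0\<close> for paths that are zero on the lower faces; this compensates for the
  missing continuity of \<open>dd\<close> there.\<close>

definition beta :: "(real^'p => real) => 'p => real^'p => real" where
  "beta a l u = a (onek u l) - u $ l * a ones"

text \<open>With \<open>sn\<close> in the role of \<open>sqrt n\<close> and \<open>a\<close> in that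
  of the empirical process, this is the empirical distribution function.\<close>

definition Dsum :: "real => (real^'p => real) => real^'p => real" where
  "Dsum sn a u = D u + a u / sn"

definition qvec :: "('p => real => real) => real^'p => real^'p" where
  "qvec q u = (\<chi> l. q l (u $ l))"

definition dquot :: "real => (real^'p => real) => ('p => real => real) => real^'p => 'p => real" where
  "dquot sn a q u l = (let up = min (u $ l + 1 / sn) 1; um = max (u $ l - 1 / sn) 0 in
      (Dsum sn a (qvec q (upd u l up)) - Dsum sn a (qvec q (upd u l um))) / (up - um))"

definition Dboot :: "real => (real^'p => real) => ('p => real => real) => (real^'p => real) => real^'p => real" where
  "Dboot sn a q b u = b (qvec q u) - (1 / Dsum sn a ones) * (\<Sum>l\<in>UNIV. dquot sn a q u l *
          (b (qvec q (onek u l)) - u $ l * b (qvec q ones)))"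

lemma Cinf'_beta: "Cinf' a u = (a u - (\<Sum>l\<in>UNIV. dd u l * beta a l u) / p0 - D u / p0 * a ones) / p0"
  using p0 by (simp add: Cinf'_def beta_def sum_divide_distrib diff_divide_distrib power2_eq_square)

end

text \<open>The quantity \<open>(2 * R + 1) / (p0 * sn)\<close> bounds the distance of the sample
  quantiles from the identity. \<open>\<delta>1\<close> is the width of the layer along the faces in
  which bridges are small, \<open>\<rho>\<close> the radius of uniform continuity of
  \<open>dd\<close> away from the faces, and \<open>\<theta>\<close> the common error unit.
  \<open>qD\<close> says that \<open>q l\<close> inverts the l-th empirical margin up to one
  observation, as \<open>sn\<^sup>2\<close> is the sample size.\<close>

locale det_est = copula_fun D p0 dd K for D :: "real^'p => real" and p0 dd K +
  fixes \<theta> R \<delta> \<delta>1 \<rho> sn m :: real and a :: "real^'p => real" and q :: "'p => real => real"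
  assumes m: "m = real CARD('p)" and th: "0 < \<theta>" "\<theta> <= 1" and R1: "1 <= R" and sn0: "0 < sn"
    and s1: "R / sn <= \<theta>" and s2: "R / sn <= p0 / 2" and s3: "2 / sn <= \<theta>"
    and r1: "(2 * R + 1) / (p0 * sn) <= \<theta>"
    and r2: "2 * ((2 * R + 1) / (p0 * sn)) + 2 / sn <= \<delta>"
    and r3: "(2 * R + 1) / (p0 * sn) + 1 / sn <= \<delta>1 / 2"
    and r4: "(2 * R + 1) / (p0 * sn) + 1 / sn <= \<rho>"
    and d1: "0 < \<delta>1" "\<delta>1 <= \<delta>" "\<delta>1 * R <= \<theta>"
    and uc: "!!l u z. u \<in> cbox 0 1 ==> z \<in> cbox 0 1 ==> \<delta>1 / 2 <= u $ l ==> u $ l <= 1 - \<delta>1 / 2 ==>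
        \<delta>1 / 2 <= z $ l ==> z $ l <= 1 - \<delta>1 / 2 ==> (!!i. \<bar>z $ i - u $ i\<bar> <= \<rho>) ==> \<bar>dd z l - dd u l\<bar> <= \<theta>"
    and ga: "good R \<theta> \<delta> a"
    and q01: "!!l s. 0 <= s ==> s <= 1 ==> 0 <= q l s" "!!l s. 0 <= s ==> s <= 1 ==> q l s <= 1"
    and q1: "!!l. q l 1 = 1"
    and qD: "!!l s. 0 <= s ==> s <= 1 ==> \<bar>Dsum sn a (at1 (q l s) l) - s * Dsum sn a ones\<bar> <= 1 / sn\<^sup>2"
begin

abbreviation "r \<equiv> (2 * R + 1) / (p0 * sn)"
abbreviation "ph \<equiv> Dsum sn a ones"
abbreviation "w \<equiv> qvec q"

lemma goodD:
  assumes "good R \<theta> \<delta> b" "u \<in> cbox 0 1"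
  shows "\<bar>b u\<bar> <= R" "u $ l = 0 ==> b u = 0"
    "v \<in> cbox 0 1 ==> (!!i. \<bar>u $ i - v $ i\<bar> <= \<delta>) ==> \<bar>b u - b v\<bar> <= \<theta>"
  using assms unfolding good_def by blast+

lemma r_nonneg: "0 <= r" using R1 p0 sn0 by simp

lemma inv_sn: "0 < 1 / sn" "1 / sn <= \<theta> / 2" "1 / sn <= 1 / 2"
  proof -
  show "0 < 1 / sn" "1 / sn <= \<theta> / 2" using s3 sn0 by auto
  then show "1 / sn <= 1 / 2" using th by linarith
qed

lemma ph_close: "\<bar>ph - p0\<bar> <= 1 * \<theta>" and ph_ge: "p0 / 2 <= ph"
proof -
  have "\<bar>a ones\<bar> <= R" by (rule goodD(1)[OF ga ones_cube])
  then have "\<bar>a ones / sn\<bar> <= R / sn" using sn0 by (simp add: divide_right_mono)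
  moreover have "ph = p0 + a ones / sn" by (simp add: Dsum_def D_ones)
  ultimately show "\<bar>ph - p0\<bar> <= 1 * \<theta>" "p0 / 2 <= ph" using s1 s2 unfolding mult_1 by linarith+
qed

lemma ph_pos: "0 < ph" using ph_ge p0 by linarith

lemma inv_ph: "\<bar>1 / ph - 1 / p0\<bar> <= (2 / p0\<^sup>2) * \<theta>" "\<bar>1 / ph\<bar> <= 2 / p0"
proof -
  have b: "1 / ph <= 2 / p0" using ph_ge p0 ph_pos by (simp add: field_simps)
  then show "\<bar>1 / ph\<bar> <= 2 / p0" using ph_pos by simp
  have "1 / ph - 1 / p0 = (p0 - ph) * (1 / ph) * (1 / p0)" using ph_pos p0 by (simp add: field_simps)
  then have "\<bar>1 / ph - 1 / p0\<bar> = \<bar>ph - p0\<bar> * (1 / ph) * (1 / p0)" using ph_pos p0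
    by (simp add: abs_mult abs_minus_commute)
  also have "... <= \<theta> * (2 / p0) * (1 / p0)"
    using ph_close b p0 ph_pos th by (intro mult_mono mult_nonneg_nonneg) auto
  finally show "\<bar>1 / ph - 1 / p0\<bar> <= (2 / p0\<^sup>2) * \<theta>" by (simp add: power2_eq_square field_simps)
qed

lemma q_lin:
  assumes s: "0 <= s" "s <= 1"
  shows "\<bar>p0 * sn * (q l s - s) + a (at1 (q l s) l) - s * a ones\<bar> <= 1 / sn"
proof -
  have "p0 * sn * (q l s - s) + a (at1 (q l s) l) - s * a ones = sn * (Dsum sn a (at1 (q l s) l) - s * ph)"
    using D_marg[OF q01(1)[OF s, of l] q01(2)[OF s, of l], of l] sn0 by (simp add: Dsum_def D_ones field_simps)
  then have "\<bar>p0 * sn * (q l s - s) + a (at1 (q l s) l) - s * a ones\<bar> = sn * \<bar>Dsum sn a (at1 (q l s) l) - s * ph\<bar>"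
    using sn0 by (simp add: abs_mult)
  also have "... <= sn * (1 / sn\<^sup>2)" using qD[OF s] sn0 by (intro mult_left_mono) auto
  finally show ?thesis using sn0 by (simp add: power2_eq_square)
qed

lemma q_close:
  assumes s: "0 <= s" "s <= 1"
  shows "\<bar>q l s - s\<bar> <= r"
proof -
  have "\<bar>a (at1 (q l s) l)\<bar> <= R" "\<bar>a ones\<bar> <= R"
    using goodD(1)[OF ga] at1_cube[OF q01(1)[OF s] q01(2)[OF s]] ones_cube by auto
  moreover have "\<bar>s * a ones\<bar> <= 1 * \<bar>a ones\<bar>" unfolding abs_mult using s by (intro mult_right_mono) auto
  ultimately have "\<bar>p0 * sn * (q l s - s)\<bar> <= 2 * R + 1" using q_lin[OF s, of l] inv_sn by linarith
  then have "p0 * sn * \<bar>q l s - s\<bar> <= 2 * R + 1" using p0 sn0 by (simp add: abs_mult)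
  then show ?thesis using p0 sn0 by (simp add: field_simps)
qed

lemma r_le: "r <= \<delta>" using r2 r_nonneg inv_sn by linarith

text \<open>Near the lower face the path is compared with its value 0 on that face, near the upper
  face with its value at \<open>ones\<close>; the remaining summand is small because
  \<open>\<delta>1 * R \<le> \<theta>\<close>.\<close>

lemma beta_bd:
  assumes b: "good R \<theta> \<delta> b" and u: "u \<in> cbox 0 1"
  shows "\<bar>beta b l u\<bar> <= 2 * R" "\<not> (\<delta>1 <= u $ l & u $ l <= 1 - \<delta>1) ==> \<bar>beta b l u\<bar> <= 2 * \<theta>"
proof -
  have ul: "0 <= u $ l" "u $ l <= 1" using u by (auto simp: cube_iff)
  have oc: "onek u l \<in> cbox 0 1" unfolding onek_at1 using ul by (rule at1_cube)
  have bR: "\<bar>b (onek u l)\<bar> <= R" "\<bar>b ones\<bar> <= R" using goodD(1)[OF b] oc ones_cube by auto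
  have "\<bar>u $ l * b ones\<bar> <= 1 * \<bar>b ones\<bar>" unfolding abs_mult using ul by (intro mult_right_mono) auto
  then show "\<bar>beta b l u\<bar> <= 2 * R" using bR unfolding beta_def by linarith
  assume "\<not> (\<delta>1 <= u $ l & u $ l <= 1 - \<delta>1)"
  then consider "u $ l < \<delta>1" | "u $ l > 1 - \<delta>1" by linarith
  then show "\<bar>beta b l u\<bar> <= 2 * \<theta>"
  proof cases
    case 1
    have z: "b (at1 0 l) = 0" by (rule goodD(2)[OF b, of _ l]) (simp_all add: at1_cube at1_nth)
    have "\<bar>b (onek u l) - b (at1 0 l)\<bar> <= \<theta>"
      by (rule goodD(3)[OF b oc]) (use 1 ul d1 in \<open>auto simp: at1_cube at1_nth onek_at1\<close>)
    moreover have "\<bar>u $ l * b ones\<bar> <= \<delta>1 * R" unfolding abs_mult using 1 ul bR d1 by (intro mult_mono) auto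
    ultimately show ?thesis using d1(3) z unfolding beta_def by linarith
  next
    case 2
    have "\<bar>b (onek u l) - b ones\<bar> <= \<theta>"
      by (rule goodD(3)[OF b oc ones_cube]) (use 2 ul d1 in \<open>auto simp: ones_nth at1_nth onek_at1\<close>)
    moreover have "\<bar>(1 - u $ l) * b ones\<bar> <= \<delta>1 * R" unfolding abs_mult using 2 ul bR d1 by (intro mult_mono) auto
    moreover have "beta b l u = (b (onek u l) - b ones) + (1 - u $ l) * b ones" by (simp add: beta_def algebra_simps)
    ultimately show ?thesis using d1(3) by linarith
  qed
qed

text \<open>A Bahadur representation: solving the margin equation for \<open>q\<close> gives minus
  the bridge over \<open>p0\<close> to first order, once the argument \<open>q l (u $ l)\<close> of
  the path is replaced by \<open>u $ l\<close> through its modulus.\<close>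

lemma q_beta:
  assumes u: "u \<in> cbox 0 1"
  shows "\<bar>sn * (q l (u $ l) - u $ l) + beta a l u / p0\<bar> <= 2 * \<theta> / p0"
proof -
  have ul: "0 <= u $ l" "u $ l <= 1" using u by (auto simp: cube_iff)
  have "\<bar>a (at1 (q l (u $ l)) l) - a (onek u l)\<bar> <= \<theta>"
    by (rule goodD(3)[OF ga]) (use q_close[OF ul, of l] r_le r_nonneg ul q01[OF ul] in \<open>auto simp: at1_cube at1_nth onek_at1\<close>)
  then have "\<bar>p0 * sn * (q l (u $ l) - u $ l) + beta a l u\<bar> <= 2 * \<theta>"
    using q_lin[OF ul, of l] inv_sn unfolding beta_def by linarith
  moreover have "sn * (q l (u $ l) - u $ l) + beta a l u / p0 = (p0 * sn * (q l (u $ l) - u $ l) + beta a l u) / p0"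
    using p0 by (simp add: field_simps)
  ultimately show ?thesis using p0 by (simp add: divide_right_mono)
qed

lemma w_cube: "u \<in> cbox 0 1 ==> w u \<in> cbox 0 1" using q01 by (auto simp: cube_iff qvec_def)

lemma w_close: "u \<in> cbox 0 1 ==> \<bar>w u $ i - u $ i\<bar> <= r" using q_close by (auto simp: cube_iff qvec_def)

lemma a_w: "good R \<theta> \<delta> b ==> u \<in> cbox 0 1 ==> \<bar>b (w u) - b u\<bar> <= \<theta>"
  by (rule goodD(3)) (use w_cube w_close r_le order_trans in blast)+

lemma w_ones: "w ones = ones" by (simp add: qvec_def ones_def vec_eq_iff q1)

text \<open>The mean value derivative is traded for the derivative at \<open>u\<close> only after
  multiplication by the bridge. In the interior the two derivatives are within
  \<open>\<theta>\<close>; in the boundary layer they may be far apart, but there the bridge is at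
  most \<open>2 * \<theta>\<close>.\<close>

lemma D_w_expand:
  assumes u: "u \<in> cbox 0 1"
  shows "\<bar>sn * (D (w u) - D u) + (\<Sum>l\<in>UNIV. dd u l * beta a l u) / p0\<bar> <= m * ((6 * K + 2 * R) / p0) * \<theta>"
proof -
  obtain d where d: "D (w u) - D u = (\<Sum>l\<in>UNIV. d l * (w u $ l - u $ l))"
    "!!l. w u $ l ~= u $ l ==> \<exists>z\<in>cbox 0 1. d l = dd z l & 0 < z $ l & z $ l < 1 & (\<forall>i. \<bar>z $ i - u $ i\<bar> <= r)"
    "!!l. w u $ l = u $ l ==> d l = 0"
    using mean_value_multi[OF u w_cube[OF u] w_close[OF u]] by blast
  have trm: "\<bar>d l * (sn * (w u $ l - u $ l)) + dd u l * (beta a l u / p0)\<bar> <= (6 * K + 2 * R) / p0 * \<theta>" for l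
  proof -
    have qb: "\<bar>sn * (w u $ l - u $ l) + beta a l u / p0\<bar> <= 2 * \<theta> / p0" using q_beta[OF u, of l] by (simp add: qvec_def)
    have tp: "0 <= \<theta> / p0" "0 <= 2 * R * \<theta> / p0" "0 <= 4 * K * \<theta> / p0" using th p0 R1 K1 by auto
    show ?thesis
    proof (cases "w u $ l = u $ l")
      \<comment> \<open>A quantile that does not move leaves no mean value point, but then the
        Bahadur representation itself forces the bridge to be small.\<close>
      case True
      then have "\<bar>beta a l u / p0\<bar> <= 2 * \<theta> / p0" using qb by simp
      then have "\<bar>dd u l * (beta a l u / p0)\<bar> <= K * (2 * \<theta> / p0)" unfolding abs_mult using dd_bd[of u l] K1 by (intro mult_mono) auto
      moreover have "(6 * K + 2 * R) / p0 * \<theta> = K * (2 * \<theta> / p0) + 4 * K * \<theta> / p0 + 2 * R * \<theta> / p0" using p0 by (simp add: field_simps)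
      ultimately show ?thesis using True d(3)[OF True] tp by simp
    next
      case False
      then obtain z where z: "z \<in> cbox 0 1" "d l = dd z l" "0 < z $ l" "z $ l < 1" "!!i. \<bar>z $ i - u $ i\<bar> <= r" using d(2) by blast
      have 1: "\<bar>d l * (sn * (w u $ l - u $ l) + beta a l u / p0)\<bar> <= K * (2 * \<theta> / p0)"
        unfolding abs_mult z(2) using qb dd_bd[of z l] K1 by (intro mult_mono) auto
      have 2: "\<bar>(dd u l - d l) * (beta a l u / p0)\<bar> <= 2 * R * \<theta> / p0 + 4 * K * \<theta> / p0"
      proof (cases "\<delta>1 <= u $ l & u $ l <= 1 - \<delta>1")
        case True
        have rz: "r <= \<delta>1 / 2" "r <= \<rho>" using r3 r4 inv_sn by linarith+
        have "\<bar>dd z l - dd u l\<bar> <= \<theta>"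
          proof (rule uc[OF u z(1)])
          show "\<delta>1 / 2 <= u $ l" "u $ l <= 1 - \<delta>1 / 2" using True d1 by linarith+
          show "\<delta>1 / 2 <= z $ l" "z $ l <= 1 - \<delta>1 / 2" using True z(5)[of l] rz by linarith+
          show "\<bar>z $ i - u $ i\<bar> <= \<rho>" for i using z(5)[of i] rz by linarith
        qed
        moreover have "\<bar>beta a l u / p0\<bar> <= 2 * R / p0" using beta_bd(1)[OF ga u, of l] p0 by (simp add: divide_right_mono)
        ultimately have "\<bar>(dd u l - d l) * (beta a l u / p0)\<bar> <= \<theta> * (2 * R / p0)"
          unfolding abs_mult z(2) using th by (intro mult_mono) auto
        moreover have "\<theta> * (2 * R / p0) = 2 * R * \<theta> / p0" by simp
        ultimately show ?thesis using tp by linarith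
      next
        case False
        have "\<bar>beta a l u / p0\<bar> <= 2 * \<theta> / p0" using beta_bd(2)[OF ga u False] p0 by (simp add: divide_right_mono)
        moreover have "\<bar>dd u l - d l\<bar> <= 2 * K" using dd_bd[of u l] dd_bd[of z l] z(2) by linarith
        ultimately have "\<bar>(dd u l - d l) * (beta a l u / p0)\<bar> <= (2 * K) * (2 * \<theta> / p0)"
          unfolding abs_mult using K1 by (intro mult_mono) auto
        moreover have "(2 * K) * (2 * \<theta> / p0) = 4 * K * \<theta> / p0" by simp
        ultimately show ?thesis using tp by linarith
      qed
      have "d l * (sn * (w u $ l - u $ l)) + dd u l * (beta a l u / p0)
        = d l * (sn * (w u $ l - u $ l) + beta a l u / p0) + (dd u l - d l) * (beta a l u / p0)" by (simp only: distrib_left left_diff_distrib)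
      moreover have "K * (2 * \<theta> / p0) + (2 * R * \<theta> / p0 + 4 * K * \<theta> / p0) = (6 * K + 2 * R) / p0 * \<theta>"
        using p0 by (simp add: field_simps)
      ultimately show ?thesis using 1 2 by linarith
    qed
  qed
  have "sn * (D (w u) - D u) + (\<Sum>l\<in>UNIV. dd u l * beta a l u) / p0
     = (\<Sum>l\<in>UNIV. d l * (sn * (w u $ l - u $ l)) + dd u l * (beta a l u / p0))"
    unfolding d(1) by (simp add: sum.distrib sum_distrib_left sum_divide_distrib mult_ac)
  also have "\<bar>...\<bar> <= (\<Sum>l\<in>(UNIV::'p set). (6 * K + 2 * R) / p0 * \<theta>)"
    by (intro order_trans[OF sum_abs] sum_mono trm)
  finally show ?thesis by (simp add: mult_ac m)
qed

lemma sum_dd_beta: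
  assumes b: "good R \<theta> \<delta> b" and u: "u \<in> cbox 0 1"
  shows "\<bar>\<Sum>l\<in>UNIV. dd u l * beta b l u\<bar> <= m * (K * (2 * R))"
proof -
  have "\<bar>dd u l * beta b l u\<bar> <= K * (2 * R)" for l
    unfolding abs_mult using dd_bd[of u l] beta_bd(1)[OF b u, of l] K1 by (intro mult_mono) auto
  then have "\<bar>\<Sum>l\<in>UNIV. dd u l * beta b l u\<bar> <= (\<Sum>l\<in>(UNIV::'p set). K * (2 * R))"
    by (intro order_trans[OF sum_abs] sum_mono)
  then show ?thesis by (simp add: m)
qed

lemma D_ratio: "\<bar>D u / p0\<bar> <= 1" using D_bd[of u] p0 by simp

lemma Cb_est:
  assumes u: "u \<in> cbox 0 1"
  shows "\<bar>sn * (Dsum sn a (w u) / ph - D u / p0) - Cinf' a u\<bar>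
     <= (2 / p0 * (m * ((6 * K + 2 * R) / p0) + 1) + 2 / p0\<^sup>2 * (2 * R + m * (K * (2 * R)) / p0)) * \<theta>"
proof -
  \<comment> \<open>The numerators over \<open>ph\<close> and \<open>p0\<close> are compared first;
    the two divisors are exchanged at the end by \<open>prod_diff_le\<close>.\<close>
  define N1 where "N1 = sn * (D (w u) - D u) + a (w u) - D u / p0 * a ones"
  define N2 where "N2 = a u - (\<Sum>l\<in>UNIV. dd u l * beta a l u) / p0 - D u / p0 * a ones"
  have phe: "sn * ph = sn * p0 + a ones" using sn0 by (simp add: Dsum_def D_ones field_simps)
  have "ph * (sn * (Dsum sn a (w u) / ph - D u / p0)) = sn * Dsum sn a (w u) - (sn * ph) * (D u / p0)"
    using ph_pos by (simp add: field_simps)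
  also have "... = N1" unfolding phe N1_def unfolding Dsum_def using sn0 p0 by (simp add: field_simps)
  finally have e1: "sn * (Dsum sn a (w u) / ph - D u / p0) = 1 / ph * N1"
    using ph_pos by (metis less_irrefl mult.left_neutral nonzero_mult_div_cancel_left times_divide_eq_left)
  have e2: "Cinf' a u = 1 / p0 * N2" unfolding Cinf'_beta N2_def by simp
  have "N1 - N2 = (sn * (D (w u) - D u) + (\<Sum>l\<in>UNIV. dd u l * beta a l u) / p0) + (a (w u) - a u)"
    unfolding N1_def N2_def by simp
  then have d12: "\<bar>N1 - N2\<bar> <= (m * ((6 * K + 2 * R) / p0) + 1) * \<theta>"
    using D_w_expand[OF u] a_w[OF ga u] unfolding distrib_right by linarith
  have ao: "\<bar>a ones\<bar> <= R" by (rule goodD(1)[OF ga ones_cube])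
  have "\<bar>D u / p0 * a ones\<bar> <= 1 * R" unfolding abs_mult using D_ratio[of u] ao R1 by (intro mult_mono) auto
  moreover have "\<bar>(\<Sum>l\<in>UNIV. dd u l * beta a l u) / p0\<bar> <= m * (K * (2 * R)) / p0"
    using sum_dd_beta[OF ga u] p0 by (simp add: divide_right_mono)
  ultimately have N2b: "\<bar>N2\<bar> <= 2 * R + m * (K * (2 * R)) / p0" using goodD(1)[OF ga u] unfolding N2_def by linarith
  show ?thesis unfolding e1 e2
    by (rule prod_diff_le[OF inv_ph(1) d12 inv_ph(2) N2b]) (use p0 K1 R1 th m in \<open>auto intro!: add_nonneg_nonneg divide_nonneg_pos mult_nonneg_nonneg\<close>)
qed

text \<open>The quotient splits into the part of \<open>D\<close>, which the mean value theorem
  writes as a derivative times the slope \<open>\<rho>'\<close> of the quantile function over the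
  bandwidth, and the part \<open>\<kappa>\<close> of the path. The slope is near 1 because the
  deviation of \<open>q\<close> from the identity has size \<open>1 / sn\<close> and varies little
  over one bandwidth.\<close>

lemma dquot_form:
  assumes u: "u \<in> cbox 0 1"
  obtains d \<rho>' \<kappa> where "dquot sn a q u l = d * \<rho>' + \<kappa>" "\<bar>\<kappa>\<bar> <= \<theta>" "\<bar>\<rho>' - 1\<bar> <= 4 * \<theta> / p0" "\<bar>d\<bar> <= K"
    "\<delta>1 <= u $ l ==> u $ l <= 1 - \<delta>1 ==> \<bar>d - dd u l\<bar> <= \<theta>"
proof -
  have ul: "0 <= u $ l" "u $ l <= 1" using u by (auto simp: cube_iff)
  define up where "up = min (u $ l + 1 / sn) 1"
  define um where "um = max (u $ l - 1 / sn) 0"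
  have pm: "0 <= up" "up <= 1" "0 <= um" "um <= 1" "up - um >= 1 / sn" "up - um <= 2 / sn"
     "\<bar>up - u $ l\<bar> <= 1 / sn" "\<bar>um - u $ l\<bar> <= 1 / sn"
    proof -
    define x where "x = 1 / sn"
    have x: "2 / sn = x + x" "0 < x" "x <= 1 / 2" using inv_sn by (auto simp: x_def)
    show "0 <= up" "up <= 1" "0 <= um" "um <= 1" "up - um >= 1 / sn" "up - um <= 2 / sn"
     "\<bar>up - u $ l\<bar> <= 1 / sn" "\<bar>um - u $ l\<bar> <= 1 / sn"
      unfolding up_def um_def x(1) x_def[symmetric] using ul x(2,3) by linarith+
  qed
  have gap: "up - um > 0" using pm(5) inv_sn by linarith
  \<comment> \<open>The bandwidth is at least \<open>1 / sn\<close> even when cut off at a face, so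
    the path increment is divided by a number not below 1 and keeps the size of its modulus.\<close>
  have gap2: "sn * (up - um) >= 1" using pm(5) sn0 by (simp add: field_simps)
  have wp: "w (upd u l x) = upd (w u) l (q l x)" for x by (simp add: qvec_def upd_def vec_eq_iff)
  have qp: "\<bar>q l up - up\<bar> <= r" "\<bar>q l um - um\<bar> <= r" using q_close pm by auto
  have qq: "\<bar>q l up - q l um\<bar> <= \<delta>" proof -
    have "2 / sn = 1 / sn + 1 / sn" by simp
    then show ?thesis using qp pm(7,8) r2 by linarith
  qed
  have qb: "0 <= q l up" "q l up <= 1" "0 <= q l um" "q l um <= 1" using q01 pm by auto
  define \<rho>' where "\<rho>' = (q l up - q l um) / (up - um)"
  define \<kappa> where "\<kappa> = (a (w (upd u l up)) - a (w (upd u l um))) / (sn * (up - um))"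
  have dpos: "0 <= \<delta>" using d1 by linarith
  have "\<bar>a (w (upd u l up)) - a (w (upd u l um))\<bar> <= \<theta>"
    unfolding wp by (rule goodD(3)[OF ga]) (use qq dpos qb w_cube[OF u] in \<open>auto simp: upd_nth intro!: upd_cube\<close>)
  then have "\<bar>\<kappa>\<bar> <= \<theta> / 1" unfolding \<kappa>_def abs_divide using gap gap2 th by (intro frac_le) auto
  then have k: "\<bar>\<kappa>\<bar> <= \<theta>" by simp
  have rho: "\<bar>\<rho>' - 1\<bar> <= 4 * \<theta> / p0"
  proof -
    have aa: "\<bar>a (at1 (q l up) l) - a (at1 (q l um) l)\<bar> <= \<theta>"
      by (rule goodD(3)[OF ga]) (use qq dpos qb in \<open>auto simp: at1_nth intro!: at1_cube\<close>)
    have "\<bar>(up - um) * a ones\<bar> <= (2 / sn) * R"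
      unfolding abs_mult using pm(6) gap goodD(1)[OF ga ones_cube] sn0 by (intro mult_mono) auto
    moreover have "(2 / sn) * R = 2 * (R / sn)" by simp
    ultimately have b1: "\<bar>(up - um) * a ones\<bar> <= 2 * \<theta>" using s1 by linarith
    have "p0 * sn * ((q l up - q l um) - (up - um)) = (p0 * sn * (q l up - up) + a (at1 (q l up) l) - up * a ones)
       - (p0 * sn * (q l um - um) + a (at1 (q l um) l) - um * a ones) - (a (at1 (q l up) l) - a (at1 (q l um) l)) + (up - um) * a ones"
      by (simp add: algebra_simps)
    then have "\<bar>p0 * sn * ((q l up - q l um) - (up - um))\<bar> <= 1 / sn + 1 / sn + \<theta> + 2 * \<theta>"
      using q_lin[OF pm(1,2), of l] q_lin[OF pm(3,4), of l] aa b1 by linarith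
    then have b2: "\<bar>p0 * sn * ((q l up - q l um) - (up - um))\<bar> <= 4 * \<theta>" using inv_sn by linarith
    have "\<rho>' - 1 = (p0 * sn * ((q l up - q l um) - (up - um)) / (sn * (up - um))) / p0"
      unfolding \<rho>'_def using gap sn0 p0 by (simp add: field_simps)
    moreover have "\<bar>p0 * sn * ((q l up - q l um) - (up - um)) / (sn * (up - um))\<bar> <= 4 * \<theta> / 1"
      unfolding abs_divide using b2 gap gap2 th by (intro frac_le) auto
    ultimately show ?thesis using p0 by (simp add: divide_right_mono)
  qed
  have form: "dquot sn a q u l = (D (upd (w u) l (q l up)) - D (upd (w u) l (q l um))) / (up - um) + \<kappa>"
    unfolding dquot_def Let_def up_def[symmetric] um_def[symmetric] Dsum_def \<kappa>_def wp by (simp add: add_divide_distrib diff_divide_distrib)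
  show thesis
  proof (cases "q l up = q l um")
    \<comment> \<open>Equal quantiles give slope 0 and annihilate whatever derivative is named;
      \<open>dd u l\<close> satisfies the remaining clauses trivially.\<close>
    case True
    have r0: "\<rho>' = 0" by (simp add: \<rho>'_def True)
    show thesis
      by (rule that[of "dd u l" \<rho>' \<kappa>]) (use form True r0 k rho dd_bd th in auto)
  next
    case False
    obtain \<zeta> where \<zeta>: "min (q l up) (q l um) < \<zeta>" "\<zeta> < max (q l up) (q l um)"
       "D (upd (w u) l (q l up)) - D (upd (w u) l (q l um)) = dd (upd (w u) l \<zeta>) l * (q l up - q l um)"
      using mean_value[OF w_cube[OF u] qb False, of l] by blast
    let ?z = "upd (w u) l \<zeta>"
    have z01: "0 < \<zeta>" "\<zeta> < 1" using \<zeta>(1,2) qb by auto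
    have zc: "?z \<in> cbox 0 1" using z01 by (intro upd_cube w_cube u) auto
    have zl: "\<bar>\<zeta> - u $ l\<bar> <= r + 1 / sn" using \<zeta>(1,2) qp pm(7,8) by (auto simp: abs_le_iff min_def max_def split: if_splits)
    have zi: "\<bar>?z $ i - u $ i\<bar> <= r + 1 / sn" for i
      using zl order_trans[OF w_close[OF u, of i], of "r + 1 / sn"] inv_sn(1) by (cases "i = l") (auto simp: upd_nth)
    show thesis
    proof (rule that[of "dd ?z l" \<rho>' \<kappa>])
      show "dquot sn a q u l = dd ?z l * \<rho>' + \<kappa>" unfolding form \<zeta>(3) \<rho>'_def by simp
      show "\<bar>dd ?z l - dd u l\<bar> <= \<theta>" if "\<delta>1 <= u $ l" "u $ l <= 1 - \<delta>1"
      proof (rule uc[OF u zc])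
        show "\<bar>?z $ i - u $ i\<bar> <= \<rho>" for i using zi[of i] r4 by linarith
        have "?z $ l = \<zeta>" by (simp add: upd_nth)
        then show "\<delta>1 / 2 <= ?z $ l" "?z $ l <= 1 - \<delta>1 / 2" using zl r3 that by linarith+
        show "\<delta>1 / 2 <= u $ l" "u $ l <= 1 - \<delta>1 / 2" using that d1 by linarith+
      qed
    qed (use k rho dd_bd in auto)
  qed
qed

abbreviation "H \<equiv> K * (1 + 4 / p0) + 1"
abbreviation "E0 \<equiv> 4 * K / p0 + 2"
abbreviation "E1 \<equiv> H + (E0 * (2 * R) + (H + K) * 2)"

lemma dquot_est:
  assumes u: "u \<in> cbox 0 1"
  shows "\<bar>dquot sn a q u l\<bar> <= H" "\<delta>1 <= u $ l ==> u $ l <= 1 - \<delta>1 ==> \<bar>dquot sn a q u l - dd u l\<bar> <= E0 * \<theta>"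
proof -
  obtain d \<rho>' \<kappa> where d: "dquot sn a q u l = d * \<rho>' + \<kappa>" "\<bar>\<kappa>\<bar> <= \<theta>" "\<bar>\<rho>' - 1\<bar> <= 4 * \<theta> / p0" "\<bar>d\<bar> <= K"
    "\<delta>1 <= u $ l ==> u $ l <= 1 - \<delta>1 ==> \<bar>d - dd u l\<bar> <= \<theta>"
    by (rule dquot_form[OF u, of l]) (rule that, assumption+)
  have e: "d * \<rho>' + \<kappa> = d * (\<rho>' - 1) + d + \<kappa>" by (simp add: algebra_simps)
  have b: "\<bar>d * (\<rho>' - 1)\<bar> <= K * (4 * \<theta> / p0)" unfolding abs_mult using d(3,4) by (intro mult_mono) auto
  have "K * (4 * \<theta> / p0) <= K * (4 / p0)" using th K1 p0 by (intro mult_left_mono divide_right_mono) auto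
  then have b': "\<bar>d * (\<rho>' - 1)\<bar> <= K * (4 / p0)" using b by linarith
  show "\<bar>dquot sn a q u l\<bar> <= H" unfolding d(1) e distrib_left using b' d(2,4) th by linarith
  assume "\<delta>1 <= u $ l" "u $ l <= 1 - \<delta>1"
  then have "\<bar>d - dd u l\<bar> <= \<theta>" by (rule d(5))
  then have "\<bar>dquot sn a q u l - dd u l\<bar> <= K * (4 * \<theta> / p0) + 2 * \<theta>" unfolding d(1) e using b d(2) by linarith
  then show "\<bar>dquot sn a q u l - dd u l\<bar> <= E0 * \<theta>" by (simp add: algebra_simps)
qed

text \<open>The derivative estimate has to be accurate only in the interior; in the boundary layer
  it is merely bounded by \<open>H\<close>, and the bridge provides the smallness.\<close>

lemma term_est:
  assumes u: "u \<in> cbox 0 1" and b: "good R \<theta> \<delta> b"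
  shows "\<bar>dquot sn a q u l * (b (w (onek u l)) - u $ l * b (w ones)) - dd u l * beta b l u\<bar> <= E1 * \<theta>"
proof -
  have ul: "0 <= u $ l" "u $ l <= 1" using u by (auto simp: cube_iff)
  have oc: "onek u l \<in> cbox 0 1" unfolding onek_at1 using ul by (rule at1_cube)
  define g where "g = b (w (onek u l)) - u $ l * b (w ones)"
  have H0: "0 <= H" "0 <= E0" using K1 p0 by auto
  have "\<bar>b (w (onek u l)) - b (onek u l)\<bar> <= \<theta>" using a_w[OF b oc] .
  then have g: "\<bar>g - beta b l u\<bar> <= \<theta>" by (simp add: g_def beta_def w_ones)
  have 1: "\<bar>dquot sn a q u l * (g - beta b l u)\<bar> <= H * \<theta>"
    unfolding abs_mult using dquot_est(1)[OF u, of l] g H0 by (intro mult_mono) auto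
  have 2: "\<bar>(dquot sn a q u l - dd u l) * beta b l u\<bar> <= (E0 * (2 * R) + (H + K) * 2) * \<theta>"
  proof (cases "\<delta>1 <= u $ l & u $ l <= 1 - \<delta>1")
    case True
    then have "\<bar>(dquot sn a q u l - dd u l) * beta b l u\<bar> <= (E0 * \<theta>) * (2 * R)"
      unfolding abs_mult using dquot_est(2)[OF u, of l] beta_bd(1)[OF b u, of l] H0 th by (intro mult_mono mult_nonneg_nonneg) auto
    moreover have "0 <= (H + K) * 2 * \<theta>" using H0 K1 th by (intro mult_nonneg_nonneg) auto
    ultimately show ?thesis by (simp add: algebra_simps)
  next
    case False
    have "\<bar>dquot sn a q u l - dd u l\<bar> <= H + K" using dquot_est(1)[OF u, of l] dd_bd[of u l] by linarith
    then have "\<bar>(dquot sn a q u l - dd u l) * beta b l u\<bar> <= (H + K) * (2 * \<theta>)"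
      unfolding abs_mult using beta_bd(2)[OF b u False] H0 K1 by (intro mult_mono) auto
    moreover have "0 <= E0 * (2 * R) * \<theta>" using H0 R1 th by (intro mult_nonneg_nonneg) auto
    ultimately show ?thesis by (simp add: algebra_simps)
  qed
  have "dquot sn a q u l * g - dd u l * beta b l u = dquot sn a q u l * (g - beta b l u) + (dquot sn a q u l - dd u l) * beta b l u"
    by (simp add: algebra_simps)
  then show ?thesis using 1 2 unfolding g_def[symmetric] distrib_right[of H] by linarith
qed

abbreviation "E2 \<equiv> 1 + (2 / p0 * (m * E1) + 2 / p0\<^sup>2 * (m * (K * (2 * R))))"
abbreviation "E3 \<equiv> 2 / p0 * (m + 1) + 2 / p0\<^sup>2 * 1"

lemma Ct_est:
  assumes u: "u \<in> cbox 0 1" and b: "good R \<theta> \<delta> b"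
  shows "\<bar>Dboot sn a q b u / ph - Dsum sn a (w u) * Dboot sn a q b ones / ph\<^sup>2 - Cinf' b u\<bar>
     <= (2 / p0 * (E2 + E3 * R) + 2 / p0\<^sup>2 * (2 * R + m * (K * (2 * R)) / p0)) * \<theta>"
proof -
  define S where "S = (\<Sum>l\<in>UNIV. dquot sn a q u l * (b (w (onek u l)) - u $ l * b (w ones)))"
  define S' where "S' = (\<Sum>l\<in>UNIV. dd u l * beta b l u)"
  have E1n: "0 <= E1" using K1 p0 R1 by (intro add_nonneg_nonneg mult_nonneg_nonneg) auto
  have eqS: "S - S' = (\<Sum>l\<in>UNIV. dquot sn a q u l * (b (w (onek u l)) - u $ l * b (w ones)) - dd u l * beta b l u)"
    by (simp add: S_def S'_def sum_subtractf)
  have "\<bar>S - S'\<bar> <= (\<Sum>l\<in>(UNIV::'p set). E1 * \<theta>)"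
    unfolding eqS by (intro order_trans[OF sum_abs] sum_mono term_est[OF u b])
  then have SS: "\<bar>S - S'\<bar> <= (m * E1) * \<theta>" unfolding m sum_constant by (simp only: mult.assoc)
  have S'b: "\<bar>S'\<bar> <= m * (K * (2 * R))" unfolding S'_def by (rule sum_dd_beta[OF b u])
  have A1: "\<bar>1 / ph * S - 1 / p0 * S'\<bar> <= (2 / p0 * (m * E1) + 2 / p0\<^sup>2 * (m * (K * (2 * R)))) * \<theta>"
    by (rule prod_diff_le[OF inv_ph(1) SS inv_ph(2) S'b])
      (use mult_nonneg_nonneg[OF _ E1n, of m] m th in simp_all)
  have bo: "\<bar>b ones\<bar> <= R" by (rule goodD(1)[OF b ones_cube])
  define T where "T = Dboot sn a q b u"
  define T' where "T' = b u - S' / p0"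
  have TT: "\<bar>T - T'\<bar> <= E2 * \<theta>"
    using A1 a_w[OF b u] unfolding T_def T'_def Dboot_def S_def[symmetric] distrib_right[of 1] by simp
  have "\<bar>S' / p0\<bar> <= m * (K * (2 * R)) / p0" using S'b p0 by (simp add: divide_right_mono)
  then have T'b: "\<bar>T'\<bar> <= R + m * (K * (2 * R)) / p0" using goodD(1)[OF b u] unfolding T'_def by linarith
  \<comment> \<open>At \<open>ones\<close> every bridge is zero, so the correction term of the
    bootstrap disappears.\<close>
  have o1: "Dboot sn a q b ones = b ones"
  proof -
    have "onek ones l = ones" for l :: 'p by (simp add: onek_def ones_def vec_eq_iff)
    then show ?thesis unfolding Dboot_def by (simp add: w_ones) (simp add: ones_def)
  qed
  have DD: "\<bar>Dsum sn a (w u) - D u\<bar> <= (m + 1) * \<theta>"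
  proof -
    have "\<bar>D (w u) - D u\<bar> <= p0 * (\<Sum>i\<in>UNIV. \<bar>w u $ i - u $ i\<bar>)" by (rule D_lip)
    also have "... <= 1 * (\<Sum>i\<in>(UNIV::'p set). \<theta>)"
      using p0 w_close[OF u] r1 by (intro mult_mono sum_mono sum_nonneg) (auto intro: order_trans)
    finally have "\<bar>D (w u) - D u\<bar> <= m * \<theta>" by (simp add: m)
    moreover have "\<bar>a (w u) / sn\<bar> <= R / sn" using goodD(1)[OF ga w_cube[OF u]] sn0 by (simp add: divide_right_mono)
    ultimately show ?thesis using s1 unfolding Dsum_def distrib_right by linarith
  qed
  have Dub: "\<bar>D u\<bar> <= 1" using D_bd[of u] p0 by linarith
  have A2: "\<bar>1 / ph * Dsum sn a (w u) - 1 / p0 * D u\<bar> <= E3 * \<theta>"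
    by (rule prod_diff_le[OF inv_ph(1) DD inv_ph(2) Dub]) (use p0 th m in auto)
  have E3n: "0 <= E3" using p0 m by auto
  define V where "V = T - 1 / ph * Dsum sn a (w u) * b ones"
  define V' where "V' = T' - 1 / p0 * D u * b ones"
  have "\<bar>(1 / ph * Dsum sn a (w u) - 1 / p0 * D u) * b ones\<bar> <= (E3 * \<theta>) * R"
    unfolding abs_mult using A2 bo E3n th by (intro mult_mono mult_nonneg_nonneg) auto
  moreover have "V - V' = (T - T') - (1 / ph * Dsum sn a (w u) - 1 / p0 * D u) * b ones"
    unfolding V_def V'_def by (simp add: algebra_simps)
  ultimately have "\<bar>V - V'\<bar> <= E2 * \<theta> + (E3 * \<theta>) * R" using TT by linarith
  moreover have "x * \<theta> + (y * \<theta>) * R = (x + y * R) * \<theta>" for x y :: real by (simp add: algebra_simps)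
  ultimately have VV: "\<bar>V - V'\<bar> <= (E2 + E3 * R) * \<theta>" by (simp only:)
  have "\<bar>1 / p0 * D u * b ones\<bar> <= 1 * R" unfolding abs_mult[of _ "b ones"] using D_ratio[of u] bo R1 by (intro mult_mono) auto
  then have V'b: "\<bar>V'\<bar> <= 2 * R + m * (K * (2 * R)) / p0" using T'b unfolding V'_def by linarith
  have "\<bar>1 / ph * V - 1 / p0 * V'\<bar> <= (2 / p0 * (E2 + E3 * R) + 2 / p0\<^sup>2 * (2 * R + m * (K * (2 * R)) / p0)) * \<theta>"
  proof (rule prod_diff_le[OF inv_ph(1) VV inv_ph(2) V'b])
    have "0 <= 2 / p0 * (m * E1)" using E1n p0 m by (intro mult_nonneg_nonneg) auto
    moreover have "0 <= 2 / p0\<^sup>2 * (m * (K * (2 * R)))" using K1 R1 m by (intro mult_nonneg_nonneg) auto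
    moreover have "0 <= E3 * R" using E3n R1 by (intro mult_nonneg_nonneg) auto
    ultimately show "0 <= E2 + E3 * R" by linarith
  qed (use th in auto)
  moreover have "Dboot sn a q b u / ph - Dsum sn a (w u) * Dboot sn a q b ones / ph\<^sup>2 = 1 / ph * V"
    unfolding o1 V_def T_def using ph_pos by (simp add: field_simps power2_eq_square)
  moreover have "Cinf' b u = 1 / p0 * V'" unfolding Cinf'_beta V'_def T'_def S'_def by simp
  ultimately show ?thesis by simp
qed

end

context copula_fun begin

text \<open>The order of quantifiers matters: the modulus bound has to be chosen before its scale.\<close>

lemma empirical_linearization:
  assumes R1: "1 <= R" and \<epsilon>: "0 < \<epsilon>"
  obtains \<theta> where "0 < \<theta>" "!!\<delta>. 0 < \<delta> ==> \<exists>s0. \<forall>sn\<ge>s0. \<forall>a q. good R \<theta> \<delta> a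
      & (\<forall>l. q l 1 = 1) & (\<forall>l s. 0 <= s & s <= 1 --> 0 <= q l s & q l s <= 1
            & \<bar>Dsum sn a (at1 (q l s) l) - s * Dsum sn a ones\<bar> <= 1 / sn\<^sup>2)
      --> Dsum sn a ones > 0 & (\<forall>u\<in>cbox 0 1.
        \<bar>sn * (Dsum sn a (qvec q u) / Dsum sn a ones - D u / p0) - Cinf' a u\<bar> <= \<epsilon> &
        (\<forall>b. good R \<theta> \<delta> b --> \<bar>Dboot sn a q b u / Dsum sn a ones
            - Dsum sn a (qvec q u) * Dboot sn a q b ones / (Dsum sn a ones)\<^sup>2 - Cinf' b u\<bar> <= \<epsilon>))"
proof -
  let ?m = "real CARD('p)"
  let ?H = "K * (1 + 4 / p0) + 1"
  let ?E1 = "?H + ((4 * K / p0 + 2) * (2 * R) + (?H + K) * 2)"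
  let ?E2 = "1 + (2 / p0 * (?m * ?E1) + 2 / p0\<^sup>2 * (?m * (K * (2 * R))))"
  let ?E3 = "2 / p0 * (?m + 1) + 2 / p0\<^sup>2 * 1"
  define c1 where "c1 = (2 / p0 * (?m * ((6 * K + 2 * R) / p0) + 1) + 2 / p0\<^sup>2 * (2 * R + ?m * (K * (2 * R)) / p0))"
  define c2 where "c2 = (2 / p0 * (?E2 + ?E3 * R) + 2 / p0\<^sup>2 * (2 * R + ?m * (K * (2 * R)) / p0))"
  define c where "c = \<bar>c1\<bar> + \<bar>c2\<bar> + 1"
  define \<theta> where "\<theta> = min 1 (\<epsilon> / c)"
  have c: "c > 0" "c1 <= c" "c2 <= c" by (auto simp: c_def)
  have t: "0 < \<theta>" "\<theta> <= 1" "c * \<theta> <= \<epsilon>" using \<epsilon> c(1) by (auto simp: \<theta>_def min_def field_simps)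
  have ct: "c1 * \<theta> <= \<epsilon>" "c2 * \<theta> <= \<epsilon>"
    using t(3) mult_right_mono[OF c(2), of \<theta>] mult_right_mono[OF c(3), of \<theta>] t(1) by linarith+
  show thesis
  proof (rule that[OF t(1)])
    fix \<delta> :: real assume dp: "0 < \<delta>"
    define \<delta>1 where "\<delta>1 = min \<delta> (\<theta> / R)"
    have d1: "0 < \<delta>1" "\<delta>1 <= \<delta>" "\<delta>1 * R <= \<theta>" using dp t R1 by (auto simp: \<delta>1_def min_def field_simps)
    obtain \<rho> where \<rho>: "\<rho> > 0" "\<forall>l. \<forall>u\<in>cbox 0 1. \<forall>z\<in>cbox 0 1. \<delta>1 / 2 <= u $ l & u $ l <= 1 - \<delta>1 / 2 & \<delta>1 / 2 <= z $ l & z $ l <= 1 - \<delta>1 / 2 & (\<forall>i. \<bar>z $ i - u $ i\<bar> <= \<rho>)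
     --> \<bar>dd z l - dd u l\<bar> <= \<theta>" using dd_unif_cont[of "\<delta>1 / 2" \<theta>] d1 t by auto
    \<comment> \<open>\<open>g / sn\<close> dominates every left-hand side of the smallness
      conditions, so \<open>sn \<ge> g / e\<close> enforces all of them at once.\<close>
    define g where "g = 2 * ((2 * R + 1) / p0 + 1) + R + 2"
    define e where "e = Min {\<theta>, p0 / 2, \<delta>, \<delta>1 / 2, \<rho>}"
    have e: "e > 0" "e <= \<theta>" "e <= p0 / 2" "e <= \<delta>" "e <= \<delta>1 / 2" "e <= \<rho>"
      unfolding e_def using t p0 dp d1 \<rho>(1) by auto
    have gp: "g > 0" using R1 p0 by (auto simp: g_def intro!: add_pos_pos)
    show "\<exists>s0. \<forall>sn\<ge>s0. \<forall>a q. good R \<theta> \<delta> a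
      & (\<forall>l. q l 1 = 1) & (\<forall>l s. 0 <= s & s <= 1 --> 0 <= q l s & q l s <= 1
            & \<bar>Dsum sn a (at1 (q l s) l) - s * Dsum sn a ones\<bar> <= 1 / sn\<^sup>2)
      --> Dsum sn a ones > 0 & (\<forall>u\<in>cbox 0 1.
        \<bar>sn * (Dsum sn a (qvec q u) / Dsum sn a ones - D u / p0) - Cinf' a u\<bar> <= \<epsilon> &
        (\<forall>b. good R \<theta> \<delta> b --> \<bar>Dboot sn a q b u / Dsum sn a ones
            - Dsum sn a (qvec q u) * Dboot sn a q b ones / (Dsum sn a ones)\<^sup>2 - Cinf' b u\<bar> <= \<epsilon>))"
    proof (intro exI allI impI, elim conjE)
      fix sn a q
      assume sn: "sn >= g / e" and ga: "good R \<theta> \<delta> a" and q1: "\<forall>l. q l (1::real) = (1::real)"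
        and q: "\<forall>l s. 0 <= s & s <= 1 --> 0 <= q l s & q l s <= 1 & \<bar>Dsum sn a (at1 (q l s) l) - s * Dsum sn a ones\<bar> <= 1 / sn\<^sup>2"
      have snp: "sn > 0" using sn gp e(1) by (meson divide_pos_pos less_le_trans)
      have ge: "g / sn <= e" using sn snp e(1) by (simp add: field_simps)
      have "g / sn = 2 * ((2 * R + 1) / (p0 * sn)) + 2 * (1 / sn) + R / sn + 2 / sn"
        using snp p0 by (simp add: g_def field_simps)
      moreover have "0 <= (2 * R + 1) / (p0 * sn)" "0 < 1 / sn" "0 <= R / sn" "2 / sn = 2 * (1 / sn)" using R1 p0 snp by auto
      ultimately have all: "R / sn <= e" "2 / sn <= e" "(2 * R + 1) / (p0 * sn) <= e"
        "2 * ((2 * R + 1) / (p0 * sn)) + 2 / sn <= e" "(2 * R + 1) / (p0 * sn) + 1 / sn <= e"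
        using ge by linarith+
      interpret det_est D p0 dd K \<theta> R \<delta> \<delta>1 \<rho> sn ?m a q
        proof unfold_locales
        show "R / sn <= \<theta>" "R / sn <= p0 / 2" "2 / sn <= \<theta>" "(2 * R + 1) / (p0 * sn) <= \<theta>"
          "2 * ((2 * R + 1) / (p0 * sn)) + 2 / sn <= \<delta>" "(2 * R + 1) / (p0 * sn) + 1 / sn <= \<delta>1 / 2"
          "(2 * R + 1) / (p0 * sn) + 1 / sn <= \<rho>" using all e by linarith+
        show "\<bar>dd z l - dd u l\<bar> <= \<theta>" if "u \<in> cbox 0 1" "z \<in> cbox 0 1" "\<delta>1 / 2 <= u $ l" "u $ l <= 1 - \<delta>1 / 2"
          "\<delta>1 / 2 <= z $ l" "z $ l <= 1 - \<delta>1 / 2" "!!i. \<bar>z $ i - u $ i\<bar> <= \<rho>" for l u z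
          using \<rho>(2)[rule_format, OF that(1,2), of l] that(3-7) by blast
        show "\<bar>Dsum sn a (at1 (q l s) l) - s * Dsum sn a ones\<bar> <= 1 / sn\<^sup>2" "0 <= q l s" "q l s <= 1"
          if "0 <= s" "s <= 1" for l s using q[rule_format, of s l] that by blast+
      qed (use t(1,2) R1 snp d1 ga q1 in \<open>simp_all\<close>)
      show "Dsum sn a ones > 0 & (\<forall>u\<in>cbox 0 1.
        \<bar>sn * (Dsum sn a (qvec q u) / Dsum sn a ones - D u / p0) - Cinf' a u\<bar> <= \<epsilon> &
        (\<forall>b. good R \<theta> \<delta> b --> \<bar>Dboot sn a q b u / Dsum sn a ones
            - Dsum sn a (qvec q u) * Dboot sn a q b ones / (Dsum sn a ones)\<^sup>2 - Cinf' b u\<bar> <= \<epsilon>))"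
      proof (intro conjI ballI allI impI)
        fix u :: "real^'p" assume u: "u \<in> cbox 0 1"
        show "\<bar>sn * (Dsum sn a (qvec q u) / Dsum sn a ones - D u / p0) - Cinf' a u\<bar> <= \<epsilon>"
          by (rule order_trans[OF Cb_est[OF u] ct(1)[unfolded c1_def]])
        fix b assume b: "good R \<theta> \<delta> b"
        show "\<bar>Dboot sn a q b u / Dsum sn a ones
            - Dsum sn a (qvec q u) * Dboot sn a q b ones / (Dsum sn a ones)\<^sup>2 - Cinf' b u\<bar> <= \<epsilon>"
          by (rule order_trans[OF Ct_est[OF u b] ct(2)[unfolded c2_def]])
      qed (rule ph_pos)
    qed
  qed
qed

end

section \<open>Ranks and pseudo-observations\<close>

definition sub_idx :: "nat => (nat => 'z) => 'z set => nat set" where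
  "sub_idx n zs A = {i. i < n & zs i \<in> A}"

definition rk :: "nat set => (nat => real) => nat => nat" where
  "rk I y i = card {j\<in>I. y j < y i}"

lemma finite_sub_idx: "finite (sub_idx n zs A)" by (simp add: sub_idx_def)

lemma sum_if_card: "(\<Sum>i<n. if P i & zs i \<in> A then 1 else 0) = real (card {i\<in>sub_idx n zs A. P i})"
proof -
  have "(\<Sum>i<n. if P i & zs i \<in> A then 1 else 0) = (\<Sum>i\<in>{i\<in>{..<n}. P i & zs i \<in> A}. 1::real)"
    by (rule sum.inter_filter[symmetric]) simp
  also have "{i\<in>{..<n}. P i & zs i \<in> A} = {i\<in>sub_idx n zs A. P i}" by (auto simp: sub_idx_def)
  finally show ?thesis by simp
qed

lemma phat_card: "phat n zs A = real (card (sub_idx n zs A)) / real n"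
  using sum_if_card[of "%_. True" zs A n] unfolding phat_def by (simp add: indicator_def of_bool_def)

lemma Fn_card:
  assumes "0 < n"
  shows "Fn n xs zs k A t = real (card {j\<in>sub_idx n zs A. xs j $ k <= t}) / real (card (sub_idx n zs A))"
  using assms by (simp add: Fn_def phat_card sum_if_card[of "%j. xs j $ k <= t"])

text \<open>An observation is at or below the quantile of level \<open>u $ l\<close> iff every
  threshold strictly below it carries less than that share of the subsample. Just below the
  observation this share is its rank over the subsample size, \<open>rk\<close> counting strictly
  smaller values.\<close>

lemma sel_iff_rk:
  assumes n: "0 < n" and i: "i < n" and I: "sub_idx n zs A ~= {}"
  shows "sel n xs zs u A i \<longleftrightarrow> i \<in> sub_idx n zs A & (\<forall>l. real (rk (sub_idx n zs A) (%j. xs j $ l) i) < u $ l * real (card (sub_idx n zs A)))"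
proof -
  let ?I = "sub_idx n zs A"
  have fin: "finite ?I" by (rule finite_sub_idx)
  have N: "0 < real (card ?I)" using I fin by (simp add: card_gt_0_iff)
  have "ereal (xs i $ l) <= qinv (Fn n xs zs l A) (u $ l) \<longleftrightarrow> real (rk ?I (%j. xs j $ l) i) < u $ l * real (card ?I)" for l
  proof -
    have 1: "ereal (xs i $ l) <= qinv (Fn n xs zs l A) (u $ l) \<longleftrightarrow> (\<forall>t. u $ l <= Fn n xs zs l A t --> xs i $ l <= t)"
      unfolding qinv_def le_Inf_iff by auto
    have 2: "u $ l <= Fn n xs zs l A t \<longleftrightarrow> u $ l * real (card ?I) <= real (card {j\<in>?I. xs j $ l <= t})" for t
      using N by (simp add: Fn_card[OF n] field_simps)
    show ?thesis unfolding 1 2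
    proof
      assume a: "\<forall>t. u $ l * real (card ?I) <= real (card {j\<in>?I. xs j $ l <= t}) --> xs i $ l <= t"
      let ?L = "{j\<in>?I. xs j $ l < xs i $ l}"
      \<comment> \<open>The largest strictly smaller observation serves as threshold, or any smaller
        number if there is none.\<close>
      have "\<exists>t < xs i $ l. {j\<in>?I. xs j $ l <= t} = ?L"
      proof (cases "?L = {}")
        case True
        then have "{j\<in>?I. xs j $ l <= xs i $ l - 1} = ?L" by force
        then show ?thesis by (intro exI[of _ "xs i $ l - 1"]) simp
      next
        case False
        let ?t = "Max ((%j. xs j $ l) ` ?L)"
        have fL: "finite ((%j. xs j $ l) ` ?L)" using fin by simp
        have "?t < xs i $ l" using False fL by (subst Max_less_iff) auto
        moreover have "xs j $ l <= ?t" if "j \<in> ?L" for j using fL that by (intro Max_ge) auto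
        ultimately show ?thesis by (intro exI[of _ ?t]) auto
      qed
      then obtain t where t: "t < xs i $ l" "{j\<in>?I. xs j $ l <= t} = ?L" by blast
      then show "real (rk ?I (%j. xs j $ l) i) < u $ l * real (card ?I)" using a[rule_format, of t] by (force simp: rk_def)
    next
      assume a: "real (rk ?I (%j. xs j $ l) i) < u $ l * real (card ?I)"
      show "\<forall>t. u $ l * real (card ?I) <= real (card {j\<in>?I. xs j $ l <= t}) --> xs i $ l <= t"
      proof (intro allI impI)
        fix t assume b: "u $ l * real (card ?I) <= real (card {j\<in>?I. xs j $ l <= t})"
        show "xs i $ l <= t"
        proof (rule ccontr)
          assume c: "\<not> xs i $ l <= t"
          have "card {j\<in>?I. xs j $ l <= t} <= rk ?I (%j. xs j $ l) i" unfolding rk_def using fin c by (intro card_mono) auto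
          then show False using a b by linarith
        qed
      qed
    qed
  qed
  then show ?thesis using i by (auto simp: sel_def sub_idx_def)
qed

lemma rk_mono: "finite I ==> y i <= y j ==> rk I y i <= rk I y j"
  unfolding rk_def by (intro card_mono) auto

text \<open>Without ties the ranks are exactly the numbers below \<open>card I\<close>, so the
  number of ranks below a level is the ceiling of that level.\<close>

lemma card_rk_less:
  assumes fin: "finite I" and inj: "inj_on y I" and s: "0 <= s" "s <= 1"
  shows "\<bar>real (card {i\<in>I. real (rk I y i) < s * real (card I)}) - s * real (card I)\<bar> <= 1"
proof -
  have strict: "rk I y i < rk I y j" if "i \<in> I" "y i < y j" for i j
    unfolding rk_def using that fin by (intro psubset_card_mono) auto
  have injr: "inj_on (rk I y) I"
  proof (rule inj_onI)
    fix i j assume ij: "i \<in> I" "j \<in> I" "rk I y i = rk I y j"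
    have "y i = y j" using strict[of i j] strict[of j i] ij by (metis less_irrefl linorder_neqE)
    then show "i = j" using inj ij by (auto dest: inj_onD)
  qed
  have "rk I y ` I \<subseteq> {..<card I}"
  proof
    fix x assume "x \<in> rk I y ` I"
    then obtain i where i: "i \<in> I" "x = rk I y i" by blast
    have "card {j\<in>I. y j < y i} < card I" using i fin by (intro psubset_card_mono) auto
    then show "x \<in> {..<card I}" using i by (simp add: rk_def)
  qed
  then have im: "rk I y ` I = {..<card I}" using injr by (intro card_subset_eq) (auto simp: card_image)
  let ?c = "s * real (card I)"
  have c0: "0 <= ?c" "?c <= real (card I)" using s by (auto simp: mult_left_le_one_le)
  have "rk I y ` {i\<in>I. real (rk I y i) < ?c} = {k. k < card I & real k < ?c}"
    using im by (auto simp: image_iff)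
  then have "card {i\<in>I. real (rk I y i) < ?c} = card {k. k < card I & real k < ?c}"
    using card_image[OF inj_on_subset[OF injr, of "{i\<in>I. real (rk I y i) < ?c}"]] by auto
  also have "{k. k < card I & real k < ?c} = {..<nat \<lceil>?c\<rceil>}"
    using c0 by (auto simp: less_ceiling_iff zless_nat_eq_int_zless)
  finally have "real (card {i\<in>I. real (rk I y i) < ?c}) = of_int \<lceil>?c\<rceil>" using c0 by simp
  then show ?thesis by linarith
qed

text \<open>The sample quantile function of the values \<open>y\<close>. The inserted 0 covers
  levels at which no observation is selected. At level 1 the value 1 selects the same observations
  as the largest of them would, and it makes \<open>q l 1 = 1\<close> hold exactly.\<close>

definition qrk :: "nat set => (nat => real) => real => real" where
  "qrk I y s = (if 1 <= s then 1 else Max (insert 0 (y ` {i\<in>I. real (rk I y i) < s * real (card I)})))"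

lemma qrk_iff:
  assumes fin: "finite I" and y: "!!i. i \<in> I ==> 0 < y i & y i <= 1" and i: "i \<in> I" and s: "s <= 1"
  shows "real (rk I y i) < s * real (card I) \<longleftrightarrow> y i <= qrk I y s"
proof (cases "s = 1")
  case True
  have "card {j\<in>I. y j < y i} < card I" using i fin by (intro psubset_card_mono) auto
  then show ?thesis using True y[OF i] by (simp add: qrk_def rk_def)
next
  case False
  let ?S = "insert 0 (y ` {i\<in>I. real (rk I y i) < s * real (card I)})"
  have q: "qrk I y s = Max ?S" using False s by (simp add: qrk_def)
  have fS: "finite ?S" using fin by simp
  show ?thesis
  proof
    assume "real (rk I y i) < s * real (card I)"
    then show "y i <= qrk I y s" unfolding q using i fS by (intro Max_ge) auto
  next
    assume a: "y i <= qrk I y s"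
    have "Max ?S \<in> ?S" using fS by (intro Max_in) auto
    moreover have "Max ?S ~= 0" using a y[OF i] unfolding q by auto
    ultimately obtain j where j: "j \<in> I" "real (rk I y j) < s * real (card I)" "Max ?S = y j" by auto
    have "rk I y i <= rk I y j" using a j(3) fin unfolding q by (intro rk_mono) auto
    then show "real (rk I y i) < s * real (card I)" using j(2) by linarith
  qed
qed

lemma qrk_range:
  assumes fin: "finite I" and y: "!!i. i \<in> I ==> 0 < y i & y i <= 1"
  shows "0 <= qrk I y s" "qrk I y s <= 1"
  using fin y by (auto simp: qrk_def Max_ge_iff intro!: Max.boundedI)

section \<open>Pseudo-observations and the exact representation\<close>

definition emp_ind :: "(nat => 'z) => 'z set => (nat => real^'p) => real^'p => nat => real" where
  "emp_ind zs A U u i = (if (\<forall>l. U i $ l <= u $ l) & zs i \<in> A then 1 else 0)"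

text \<open>Weak order preservation together with the absence of ties among the \<open>U\<close>
  makes the ranks of \<open>xs\<close> and \<open>U\<close> agree; positivity makes the indicators
  vanish on the lower faces.\<close>

definition pseudo_obs :: "nat => (nat => real^'p) => (nat => 'z) => 'z set => (nat => real^'p) => bool" where
  "pseudo_obs n xs zs A U \<longleftrightarrow> (\<forall>i\<in>sub_idx n zs A. \<forall>l. 0 < U i $ l & U i $ l <= 1) &
     (\<forall>i\<in>sub_idx n zs A. \<forall>j\<in>sub_idx n zs A. \<forall>l. (xs j $ l <= xs i $ l --> U j $ l <= U i $ l) & (i ~= j --> U i $ l ~= U j $ l))"

context copula_fun begin

definition emp0 :: "nat => (nat => 'z) => 'z set => (nat => real^'p) => real^'p => real" where
  "emp0 n zs A U u = (\<Sum>i<n. emp_ind zs A U u i - D u) / sqrt (real n)"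

definition emp1 :: "nat => (nat => 'z) => 'z set => (nat => real^'p) => (nat => real) => real^'p => real" where
  "emp1 n zs A U y u = (\<Sum>i<n. (y i - wbar n y) * emp_ind zs A U u i) / sqrt (real n)"

lemma Dsum_emp0: "0 < n ==> Dsum (sqrt (real n)) (emp0 n zs A U) u = (\<Sum>i<n. emp_ind zs A U u i) / real n"
  by (simp add: Dsum_def emp0_def sum_subtractf field_simps)

lemma sample_representation:
  fixes xs U :: "nat => real^'p"
  assumes n: "0 < n" and po: "pseudo_obs n xs zs A U"
  obtains q where "!!l. q l 1 = 1" "!!l s. 0 <= s ==> s <= 1 ==> 0 <= q l s & q l s <= 1
            & \<bar>Dsum (sqrt (real n)) (emp0 n zs A U) (at1 (q l s) l) - s * Dsum (sqrt (real n)) (emp0 n zs A U) ones\<bar> <= 1 / (sqrt (real n))\<^sup>2"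
    "phat n zs A = Dsum (sqrt (real n)) (emp0 n zs A U) ones"
    "!!u. u \<in> cbox 0 1 ==> 0 < phat n zs A ==> Dbar n xs zs u A = Dsum (sqrt (real n)) (emp0 n zs A U) (qvec q u)"
    "!!u y. u \<in> cbox 0 1 ==> 0 < phat n zs A ==> Dstar n xs zs y u A = emp1 n zs A U y (qvec q u)"
proof -
  let ?I = "sub_idx n zs A"
  have fin: "finite ?I" by (rule finite_sub_idx)
  have Ur: "0 < U i $ l & U i $ l <= 1" if "i \<in> ?I" for i l using po that by (auto simp: pseudo_obs_def)
  have inj: "inj_on (%i. U i $ l) ?I" for l using po unfolding pseudo_obs_def inj_on_def by blast
  define q where "q l s = qrk ?I (%i. U i $ l) s" for l s
  have on: "Dsum (sqrt (real n)) (emp0 n zs A U) ones = real (card ?I) / real n"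
  proof -
    have "{i \<in> ?I. \<forall>l. U i $ l <= ones $ l} = ?I" using Ur by (auto simp: ones_nth)
    then show ?thesis unfolding Dsum_emp0[OF n] emp_ind_def sum_if_card by simp
  qed
  have ph: "phat n zs A = Dsum (sqrt (real n)) (emp0 n zs A U) ones" by (simp add: on phat_card)
  have rkeq: "rk ?I (%j. xs j $ l) i = rk ?I (%j. U j $ l) i" if i: "i \<in> ?I" for l i
  proof -
    have "(xs j $ l < xs i $ l) \<longleftrightarrow> (U j $ l < U i $ l)" if j: "j \<in> ?I" for j
    proof
      assume "xs j $ l < xs i $ l"
      then have "U j $ l <= U i $ l" "i ~= j" using po i j by (auto simp: pseudo_obs_def)
      then show "U j $ l < U i $ l" using po i j by (auto simp: pseudo_obs_def less_le)
    next
      assume "U j $ l < U i $ l"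
      then show "xs j $ l < xs i $ l" using po i j unfolding pseudo_obs_def by (meson linorder_not_le)
    qed
    then have "{j\<in>?I. xs j $ l < xs i $ l} = {j\<in>?I. U j $ l < U i $ l}" by auto
    then show ?thesis by (simp add: rk_def)
  qed
  have sel: "(if sel n xs zs u A i then 1 else 0) = emp_ind zs A U (qvec q u) i"
    if u: "u \<in> cbox 0 1" and p: "0 < phat n zs A" and i: "i < n" for u i
  proof -
    have I: "?I ~= {}" using p by (auto simp: phat_card)
    have "real (rk ?I (%j. xs j $ l) i) < u $ l * real (card ?I) \<longleftrightarrow> U i $ l <= qvec q u $ l" if "i \<in> ?I" for l
      using qrk_iff[OF fin, of "%i. U i $ l" i "u $ l"] Ur that u rkeq[OF that] by (simp add: q_def qvec_def cube_iff)
    then have "sel n xs zs u A i \<longleftrightarrow> i \<in> ?I & (\<forall>l. U i $ l <= qvec q u $ l)"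
      unfolding sel_iff_rk[OF n i I] by auto
    then show ?thesis using i by (auto simp: emp_ind_def sub_idx_def)
  qed
  show thesis
  proof (rule that[of q])
    show "q l 1 = 1" for l by (simp add: q_def qrk_def)
    fix l s assume s: "0 <= s" "s <= (1::real)"
    \<comment> \<open>The other coordinates of \<open>at1\<close> are 1 and impose no constraint, so
      the l-th empirical margin counts ranks and \<open>card_rk_less\<close> applies.\<close>
    have "{i \<in> ?I. \<forall>l'. U i $ l' <= at1 (q l s) l $ l'} = {i\<in>?I. real (rk ?I (%i. U i $ l) i) < s * real (card ?I)}"
      using qrk_iff[OF fin, of "%i. U i $ l" _ s] s Ur unfolding q_def by (auto simp: at1_nth)
    then have "Dsum (sqrt (real n)) (emp0 n zs A U) (at1 (q l s) l) - s * Dsum (sqrt (real n)) (emp0 n zs A U) ones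
      = (real (card {i\<in>?I. real (rk ?I (%i. U i $ l) i) < s * real (card ?I)}) - s * real (card ?I)) / real n"
      unfolding on unfolding Dsum_emp0[OF n] emp_ind_def sum_if_card by (simp add: diff_divide_distrib)
    moreover have "\<bar>...\<bar> <= 1 / real n" unfolding abs_divide using card_rk_less[OF fin inj s, of l] by (simp add: divide_right_mono)
    ultimately show "0 <= q l s & q l s <= 1 & \<bar>Dsum (sqrt (real n)) (emp0 n zs A U) (at1 (q l s) l) - s * Dsum (sqrt (real n)) (emp0 n zs A U) ones\<bar> <= 1 / (sqrt (real n))\<^sup>2"
      using qrk_range[OF fin, of "%i. U i $ l" s] Ur n by (simp add: q_def)
  next
    fix u :: "real^'p" assume u: "u \<in> cbox 0 1" and p: "0 < phat n zs A"
    show D1: "Dbar n xs zs u A = Dsum (sqrt (real n)) (emp0 n zs A U) (qvec q u)"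
      unfolding Dbar_def Dsum_emp0[OF n] by (intro arg_cong2[where f="(/)"] sum.cong) (auto simp: sel[OF u p])
    fix y
    have "(\<Sum>i<n. y i * (if sel n xs zs u A i then 1 else 0)) = (\<Sum>i<n. y i * emp_ind zs A U (qvec q u) i)"
      by (intro sum.cong refl arg_cong2[where f="(*)"] sel[OF u p]) auto
    moreover have "sqrt (real n) * wbar n y * ((\<Sum>i<n. emp_ind zs A U (qvec q u) i) / real n)
       = wbar n y * (\<Sum>i<n. emp_ind zs A U (qvec q u) i) / sqrt (real n)"
      using n by (simp add: field_simps)
    ultimately show "Dstar n xs zs y u A = emp1 n zs A U y (qvec q u)"
      unfolding Dstar_def D1 Dsum_emp0[OF n] emp1_def
      by (simp add: left_diff_distrib sum_subtractf sum_distrib_left diff_divide_distrib)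
  qed (rule ph)
qed

lemma sample_linearization:
  assumes R1: "1 <= R" and \<epsilon>: "0 < \<epsilon>"
  obtains \<theta> where "0 < \<theta>" "!!\<delta>. 0 < \<delta> ==> \<exists>n0. \<forall>n\<ge>n0. \<forall>(xs :: nat => real^'p) (zs :: nat => 'z) A U. pseudo_obs n xs zs A U & good R \<theta> \<delta> (emp0 n zs A U)
      --> (\<forall>u\<in>cbox 0 1. \<bar>sqrt (real n) * (Dbar n xs zs u A / phat n zs A - D u / p0) - Cinf' (emp0 n zs A U) u\<bar> <= \<epsilon> &
        (\<forall>y. good R \<theta> \<delta> (emp1 n zs A U y) --> \<bar>Ctilde n xs zs y u A - Cinf' (emp1 n zs A U y) u\<bar> <= \<epsilon>))"
proof -
  obtain \<theta> where t: "0 < \<theta>" and lin: "!!\<delta>. 0 < \<delta> ==> \<exists>s0. \<forall>sn\<ge>s0. \<forall>a q. good R \<theta> \<delta> a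
      & (\<forall>l. q l 1 = 1) & (\<forall>l s. 0 <= s & s <= 1 --> 0 <= q l s & q l s <= 1
            & \<bar>Dsum sn a (at1 (q l s) l) - s * Dsum sn a ones\<bar> <= 1 / sn\<^sup>2)
      --> Dsum sn a ones > 0 & (\<forall>u\<in>cbox 0 1.
        \<bar>sn * (Dsum sn a (qvec q u) / Dsum sn a ones - D u / p0) - Cinf' a u\<bar> <= \<epsilon> &
        (\<forall>b. good R \<theta> \<delta> b --> \<bar>Dboot sn a q b u / Dsum sn a ones
            - Dsum sn a (qvec q u) * Dboot sn a q b ones / (Dsum sn a ones)\<^sup>2 - Cinf' b u\<bar> <= \<epsilon>))"
  proof (rule empirical_linearization[OF R1 \<epsilon>], goal_cases)
    case (1 \<theta>)
    show ?case by (rule 1(1)[OF 1(2)]) (rule 1(3))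
  qed
  show thesis
  proof (rule that[OF t])
    fix \<delta> :: real assume "0 < \<delta>"
    from lin[OF this] obtain s0 where s0: "!!sn a q. sn >= s0 ==> good R \<theta> \<delta> a
      & (\<forall>l. q l 1 = 1) & (\<forall>l s. 0 <= s & s <= 1 --> 0 <= q l s & q l s <= 1
            & \<bar>Dsum sn a (at1 (q l s) l) - s * Dsum sn a ones\<bar> <= 1 / sn\<^sup>2)
      ==> Dsum sn a ones > 0 & (\<forall>u\<in>cbox 0 1.
        \<bar>sn * (Dsum sn a (qvec q u) / Dsum sn a ones - D u / p0) - Cinf' a u\<bar> <= \<epsilon> &
        (\<forall>b. good R \<theta> \<delta> b --> \<bar>Dboot sn a q b u / Dsum sn a ones
            - Dsum sn a (qvec q u) * Dboot sn a q b ones / (Dsum sn a ones)\<^sup>2 - Cinf' b u\<bar> <= \<epsilon>))"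
      by (elim exE) (rule that, drule spec, drule (1) mp, drule spec, drule spec, drule (1) mp, assumption)
    show "\<exists>n0. \<forall>n\<ge>n0. \<forall>(xs :: nat => real^'p) (zs :: nat => 'z) A U. pseudo_obs n xs zs A U & good R \<theta> \<delta> (emp0 n zs A U)
      --> (\<forall>u\<in>cbox 0 1. \<bar>sqrt (real n) * (Dbar n xs zs u A / phat n zs A - D u / p0) - Cinf' (emp0 n zs A U) u\<bar> <= \<epsilon> &
        (\<forall>y. good R \<theta> \<delta> (emp1 n zs A U y) --> \<bar>Ctilde n xs zs y u A - Cinf' (emp1 n zs A U y) u\<bar> <= \<epsilon>))"
    proof (intro exI allI impI, elim conjE)
      fix n :: nat and xs U :: "nat => real^'p" and zs :: "nat => 'z" and A
      \<comment> \<open>This starting index makes \<open>sqrt (real n)\<close> at least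
        \<open>s0\<close> and excludes the empty sample.\<close>
      assume nn: "max 1 (nat \<lceil>s0\<^sup>2\<rceil>) <= n" and po: "pseudo_obs n xs zs A U" and g: "good R \<theta> \<delta> (emp0 n zs A U)"
      have n: "0 < n" using nn by simp
      have "s0\<^sup>2 <= real n" using nn by linarith
      then have sn: "s0 <= sqrt (real n)" by (rule real_le_rsqrt)
      let ?sn = "sqrt (real n)" let ?a = "emp0 n zs A U"
      obtain q where q: "!!l. q l 1 = 1" "!!l s. 0 <= s ==> s <= 1 ==> 0 <= q l s & q l s <= 1
            & \<bar>Dsum ?sn ?a (at1 (q l s) l) - s * Dsum ?sn ?a ones\<bar> <= 1 / ?sn\<^sup>2"
        and ph: "phat n zs A = Dsum ?sn ?a ones"
        and Db: "!!u. u \<in> cbox 0 1 ==> 0 < phat n zs A ==> Dbar n xs zs u A = Dsum ?sn ?a (qvec q u)"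
        and Ds: "!!u y. u \<in> cbox 0 1 ==> 0 < phat n zs A ==> Dstar n xs zs y u A = emp1 n zs A U y (qvec q u)"
        by (rule sample_representation[OF n po]) (rule that, assumption+)
      have "good R \<theta> \<delta> ?a & (\<forall>l. q l 1 = 1) & (\<forall>l s. 0 <= s & s <= 1 --> 0 <= q l s & q l s <= 1
            & \<bar>Dsum ?sn ?a (at1 (q l s) l) - s * Dsum ?sn ?a ones\<bar> <= 1 / ?sn\<^sup>2)"
        using g q by auto
      note L = s0[OF sn this]
      have p: "0 < phat n zs A" using L ph by simp
      have dq: "dhat n xs zs u A l = dquot ?sn ?a q u l" if u: "u \<in> cbox 0 1" for u l
      proof -
        have "0 <= u $ l" "u $ l <= 1" using u by (auto simp: cube_iff)
        moreover have "0 <= 1 / ?sn" by simp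
        ultimately have "upd u l (min (u $ l + 1 / ?sn) 1) \<in> cbox 0 1" "upd u l (max (u $ l - 1 / ?sn) 0) \<in> cbox 0 1"
          by (intro upd_cube[OF u]; linarith)+
        then show ?thesis unfolding dhat_def dquot_def Let_def by (simp add: Db[OF _ p])
      qed
      have Dt: "Dtilde n xs zs y u A = Dboot ?sn ?a q (emp1 n zs A U y) u" if u: "u \<in> cbox 0 1" for u y
      proof -
        have "onek u l \<in> cbox 0 1" for l unfolding onek_at1 using u by (intro at1_cube) (auto simp: cube_iff)
        then show ?thesis unfolding Dtilde_def Dboot_def by (simp add: Ds[OF _ p] u ones_cube dq[OF u] ph)
      qed
      show "\<forall>u\<in>cbox 0 1. \<bar>sqrt (real n) * (Dbar n xs zs u A / phat n zs A - D u / p0) - Cinf' (emp0 n zs A U) u\<bar> <= \<epsilon> &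
        (\<forall>y. good R \<theta> \<delta> (emp1 n zs A U y) --> \<bar>Ctilde n xs zs y u A - Cinf' (emp1 n zs A U y) u\<bar> <= \<epsilon>)"
      proof
        fix u :: "real^'p" assume u: "u \<in> cbox 0 1"
        show "\<bar>sqrt (real n) * (Dbar n xs zs u A / phat n zs A - D u / p0) - Cinf' (emp0 n zs A U) u\<bar> <= \<epsilon> &
        (\<forall>y. good R \<theta> \<delta> (emp1 n zs A U y) --> \<bar>Ctilde n xs zs y u A - Cinf' (emp1 n zs A U y) u\<bar> <= \<epsilon>)"
          unfolding Ctilde_def Dt[OF u] Dt[OF ones_cube] Db[OF u p] ph using conjunct2[OF L, rule_format, OF u] by blast
      qed
    qed
  qed
qed

end

section \<open>Conditional margins and the probability integral transform\<close>

definition ufun :: "'a measure => ('a => real^'p) => ('a => 'z) => 'z set => real^'p => (real^'p) \<times> 'z => real" where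
  "ufun M X Z A u y = (if (\<forall>l. condF M X Z l (fst y $ l) A <= u $ l) & snd y \<in> A then 1 else 0)"

locale cond_margins = prob_space M for M :: "'a measure" +
  fixes X :: "'a => real^'p" and Z :: "'a => real^'q" and A :: "(real^'q) set"
  assumes XZ: "(%om. (X om, Z om)) \<in> borel_measurable M" and A[measurable]: "A \<in> sets borel"
    and pA_pos: "0 < pA M Z A" and F_cont: "!!l t. isCont (%s. condF M X Z l s A) t"
begin

abbreviation "p \<equiv> pA M Z A"
abbreviation "F l t \<equiv> condF M X Z l t A"

lemma nth_meas[measurable]: "(%x::real^'n. x $ l) \<in> borel_measurable borel"
  by (intro borel_measurable_continuous_onI continuous_intros)

lemma X_meas[measurable]: "X \<in> borel_measurable M"
  using measurable_compose[OF XZ borel_measurable_continuous_onI[of fst]] by (simp add: continuous_on_fst)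

lemma Z_meas[measurable]: "Z \<in> borel_measurable M"
  using measurable_compose[OF XZ borel_measurable_continuous_onI[of snd]] by (simp add: continuous_on_snd)

lemma F_meas[measurable]: "F l \<in> borel_measurable borel"
  using F_cont by (intro borel_measurable_continuous_onI continuous_at_imp_continuous_on) auto

lemma p1: "p <= 1" unfolding pA_def by simp

lemma G_eq: "measure M {om \<in> space M. X om $ l <= t & Z om \<in> A} = p * F l t"
  using pA_pos by (simp add: condF_def)

lemma F_mono: "s <= t ==> F l s <= F l t"
  unfolding condF_def using pA_pos by (intro divide_right_mono finite_measure_mono) auto

lemma F_ge0: "0 <= F l t" unfolding condF_def using pA_pos by simp

lemma F_le1: "F l t <= 1"
proof -
  have "measure M {om \<in> space M. X om $ l <= t & Z om \<in> A} <= p" unfolding pA_def by (intro finite_measure_mono) auto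
  then show ?thesis unfolding condF_def using pA_pos by simp
qed

text \<open>\<open>F l\<close> is the distribution function of the l-th coordinate under the measure
  conditioned on the event that Z lies in \<open>A\<close>.\<close>

lemma F_lim: "(F l \<longlongrightarrow> 1) at_top" "(F l \<longlongrightarrow> 0) at_bot"
proof -
  let ?B = "{om\<in>space M. Z om \<in> A}"
  have B: "?B \<in> sets M" "emeasure M ?B ~= 0" "emeasure M ?B ~= \<infinity>"
    using pA_pos by (auto simp: pA_def measure_def)
  let ?\<nu> = "distr (uniform_measure M ?B) borel (%om. X om $ l)"
  have pu: "prob_space (uniform_measure M ?B)" using B by (intro prob_space_uniform_measure)
  then interpret nu: real_distribution ?\<nu> by (simp add: real_distribution_def real_distribution_axioms_def prob_space.prob_space_distr)
  have "cdf ?\<nu> t = F l t" for t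
  proof -
    have "cdf ?\<nu> t = measure (uniform_measure M ?B) {om\<in>space M. X om $ l <= t}"
      unfolding cdf_def by (subst measure_distr) (auto intro!: arg_cong[where f="measure _"])
    also have "... = measure M (?B \<inter> {om\<in>space M. X om $ l <= t}) / measure M ?B"
      using B by (intro measure_uniform_measure) auto
    also have "?B \<inter> {om\<in>space M. X om $ l <= t} = {om \<in> space M. X om $ l <= t & Z om \<in> A}" by auto
    finally show ?thesis by (simp add: condF_def pA_def)
  qed
  then have "cdf ?\<nu> = F l" by auto
  then show "(F l \<longlongrightarrow> 1) at_top" "(F l \<longlongrightarrow> 0) at_bot" using nu.cdf_lim_at_top_prob nu.cdf_lim_at_bot by auto
qed

definition mg :: "'p => real => real" where
  "mg l s = measure M {om \<in> space M. F l (X om $ l) <= s & Z om \<in> A}"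

lemma mg_mono: "s <= t ==> mg l s <= mg l t"
  unfolding mg_def by (intro finite_measure_mono) auto

text \<open>The probability integral transform. By monotonicity and continuity the sublevel set of
  \<open>F l\<close> at \<open>s\<close> is a half-line that contains its endpoint, and
  \<open>F l\<close> takes the value \<open>s\<close> there.\<close>

lemma mg_open: "mg l s = p * s" if s: "0 < s" "s < 1"
proof -
  obtain a where a: "F l a < s" using order_tendstoD(2)[OF F_lim(2) s(1)] by (auto simp: eventually_at_bot_linorder)
  obtain b where b: "s < F l b" using order_tendstoD(1)[OF F_lim(1) s(2)] by (auto simp: eventually_at_top_linorder)
  have ab: "a <= b" using a b F_mono[of b a l] by linarith
  obtain t0 where t0: "F l t0 = s" using IVT[of "F l" a s b] a b ab F_cont by auto
  define T where "T = {t. F l t <= s}"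
  have bdd: "bdd_above T" unfolding bdd_above_def T_def
    using b F_mono[of b _ l] by (intro exI[of _ b]) (meson linorder_le_cases mem_Collect_eq not_le order_trans)
  have t0T: "t0 \<in> T" using t0 by (simp add: T_def)
  have "closed T" unfolding T_def using F_cont
    by (intro closed_Collect_le continuous_at_imp_continuous_on continuous_on_const ballI)
  then have "Sup T \<in> T" using t0T bdd by (intro closed_contains_Sup) auto
  moreover have "s <= F l (Sup T)" using F_mono[OF cSup_upper[OF t0T bdd], of l] t0 by simp
  ultimately have S: "F l (Sup T) = s" by (simp add: T_def)
  have "F l x <= s \<longleftrightarrow> x <= Sup T" for x
    using cSup_upper[OF _ bdd, of x] F_mono[of x "Sup T" l] S by (auto simp: T_def)
  then show ?thesis unfolding mg_def using G_eq[of l "Sup T"] S by simp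
qed

lemma mg_eq: "mg l s = p * max 0 (min 1 s)"
proof -
  have z: "mg l 0 = 0"
  proof (rule ccontr)
    assume "mg l 0 ~= 0"
    then have pos: "0 < mg l 0" by (simp add: mg_def zero_less_measure_iff)
    \<comment> \<open>Small enough that the mass at level 0 would exceed the mass
      \<open>p * s\<close> of a larger set.\<close>
    define s where "s = min (1/2) (mg l 0 / 2)"
    have s: "0 < s" "s < 1" using pos by (auto simp: s_def)
    have "mg l 0 <= p * s" using mg_mono[of 0 s l] mg_open[OF s, of l] s by simp
    also have "... <= 1 * s" using p1 s by (intro mult_right_mono) auto
    also have "... <= mg l 0 / 2" by (simp add: s_def)
    finally show False using pos by simp
  qed
  consider "s <= 0" | "0 < s" "s < 1" | "1 <= s" by linarith
  then show ?thesis
  proof cases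
    case 1
    then have "mg l s <= 0" using mg_mono[OF 1, of l] z by simp
    moreover have "0 <= mg l s" by (simp add: mg_def)
    ultimately show ?thesis using 1 by simp
  next
    case 3
    then have "{om \<in> space M. F l (X om $ l) <= s & Z om \<in> A} = {om \<in> space M. Z om \<in> A}"
      using order_trans[OF F_le1 3] by auto
    then show ?thesis using 3 by (simp add: mg_def pA_def)
  qed (simp add: mg_open)
qed

text \<open>\<open>mg l\<close> is Lipschitz by \<open>mg_eq\<close>, hence has no jumps. This is
  what excludes zeros and ties among the pseudo-observations.\<close>

lemma atom_null: "measure M {om \<in> space M. F l (X om $ l) = s & Z om \<in> A} = 0"
proof (rule ccontr)
  let ?m = "measure M {om \<in> space M. F l (X om $ l) = s & Z om \<in> A}"
  assume "?m ~= 0"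
  then have pos: "0 < ?m" by (simp add: zero_less_measure_iff)
  have "mg l (s - ?m / 2) + ?m <= mg l s"
    unfolding mg_def using pos by (subst finite_measure_Union[symmetric]) (auto intro!: finite_measure_mono)
  then have "?m <= p * (max 0 (min 1 s) - max 0 (min 1 (s - ?m / 2)))" by (simp add: mg_eq algebra_simps)
  also have "... <= 1 * (?m / 2)"
  proof (intro mult_mono p1)
    show "max 0 (min 1 s) - max 0 (min 1 (s - ?m / 2)) <= ?m / 2" "0 <= max 0 (min 1 s) - max 0 (min 1 (s - ?m / 2))"
      using pos by linarith+
  qed simp
  finally show False using pos by simp
qed

lemma ufun_meas[measurable]: "ufun M X Z A u \<in> borel_measurable (borel :: ((real^'p) \<times> (real^'q)) measure)"
proof -
  have [measurable]: "(fst :: (real^'p) \<times> (real^'q) => _) \<in> borel_measurable borel" "(snd :: (real^'p) \<times> (real^'q) => _) \<in> borel_measurable borel"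
    by (intro borel_measurable_continuous_onI continuous_intros)+
  show ?thesis unfolding ufun_def by measurable
qed

lemma expectation_if: "{om\<in>space M. Q om} \<in> sets M ==> expectation (%om. if Q om then 1 else (0::real)) = measure M {om\<in>space M. Q om}"
proof -
  assume a: "{om\<in>space M. Q om} \<in> sets M"
  have "expectation (%om. if Q om then 1 else (0::real)) = expectation (indicator {om\<in>space M. Q om})"
    by (intro Bochner_Integration.integral_cong) (auto simp: indicator_def)
  then show ?thesis using a by simp
qed

lemma Dfun_eq: "expectation (%om. ufun M X Z A u (X om, Z om)) = Dfun M X Z u A"
  unfolding ufun_def Dfun_def UA_def fst_conv snd_conv by (subst expectation_if) auto

lemma ufun_int: "integrable M (%om. ufun M X Z A u (X om, Z om))"
  by (rule integrable_const_bound[of _ 1]) (auto simp: ufun_def[of _ _ _ _ u "(_,_)"] intro!: measurable_compose[OF XZ ufun_meas])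

text \<open>Two orthant indicators can differ only if they differ in some coordinate, so the
  difference is at most the sum of the one-dimensional ones, whose means \<open>mg_eq\<close>
  supplies. Clamped arguments on the right make the bound sharp outside the cube as well, which
  yields \<open>ufun_clamp\<close>.\<close>

lemma ufun_lip_clamp: "expectation (%om. \<bar>ufun M X Z A u (X om, Z om) - ufun M X Z A v (X om, Z om)\<bar>) <= p * (\<Sum>l\<in>UNIV. \<bar>clamp01 u $ l - clamp01 v $ l\<bar>)"
proof -
  define h :: "'p => real => 'a => real" where "h l s om = (if F l (X om $ l) <= s & Z om \<in> A then 1 else 0)" for l s om
  have [measurable]: "h l s \<in> borel_measurable M" for l s unfolding h_def by measurable
  have hi: "integrable M (h l s)" for l s by (rule integrable_const_bound[of _ 1]) (auto simp: h_def)
  have Eh: "expectation (h l s) = p * max 0 (min 1 s)" for l s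
    using expectation_if[of "%om. F l (X om $ l) <= s & Z om \<in> A"] mg_eq[of l s] by (simp add: h_def[abs_def] mg_def)
  have hm: "h l s om <= h l t om" if "s <= t" for l s t om using that by (auto simp: h_def)
  have E1: "expectation (%om. \<bar>h l s om - h l t om\<bar>) = p * \<bar>max 0 (min 1 s) - max 0 (min 1 t)\<bar>" for l s t
  proof (cases "s <= t")
    case True
    then have "(%om. \<bar>h l s om - h l t om\<bar>) = (%om. h l t om - h l s om)" by (intro ext) (use hm[OF True, of l] in \<open>simp add: abs_of_nonpos\<close>)
    then show ?thesis using True pA_pos by (simp add: hi Eh abs_of_nonpos right_diff_distrib[symmetric])
  next
    case False
    then have ts: "t <= s" by simp
    have "(%om. \<bar>h l s om - h l t om\<bar>) = (%om. h l s om - h l t om)" by (intro ext) (use hm[OF ts, of l] in \<open>simp add: abs_of_nonneg\<close>)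
    then show ?thesis using ts pA_pos by (simp add: hi Eh abs_of_nonneg right_diff_distrib[symmetric])
  qed
  have pw: "\<bar>ufun M X Z A u (X om, Z om) - ufun M X Z A v (X om, Z om)\<bar> <= (\<Sum>l\<in>UNIV. \<bar>h l (u $ l) om - h l (v $ l) om\<bar>)" for om
  proof (cases "ufun M X Z A u (X om, Z om) = ufun M X Z A v (X om, Z om)")
    case False
    then obtain l where l: "\<bar>h l (u $ l) om - h l (v $ l) om\<bar> = 1" by (force simp: ufun_def h_def split: if_splits)
    have "\<bar>h l (u $ l) om - h l (v $ l) om\<bar> <= (\<Sum>l\<in>UNIV. \<bar>h l (u $ l) om - h l (v $ l) om\<bar>)" by (intro member_le_sum) auto
    then show ?thesis using l by (auto simp: ufun_def)
  qed (simp add: sum_nonneg)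
  have "expectation (%om. \<bar>ufun M X Z A u (X om, Z om) - ufun M X Z A v (X om, Z om)\<bar>) <= expectation (%om. \<Sum>l\<in>UNIV. \<bar>h l (u $ l) om - h l (v $ l) om\<bar>)"
    by (rule integral_mono) (auto intro!: ufun_int hi pw Bochner_Integration.integrable_sum)
  also have "... = (\<Sum>l\<in>UNIV. expectation (%om. \<bar>h l (u $ l) om - h l (v $ l) om\<bar>))" by (intro Bochner_Integration.integral_sum) (auto intro!: hi)
  also have "... = (\<Sum>l\<in>UNIV. p * \<bar>clamp01 u $ l - clamp01 v $ l\<bar>)" unfolding E1 by (simp add: clamp01_def)
  finally show ?thesis by (simp add: sum_distrib_left)
qed

lemma ufun_lip: "expectation (%om. \<bar>ufun M X Z A u (X om, Z om) - ufun M X Z A v (X om, Z om)\<bar>) <= p * (\<Sum>l\<in>UNIV. \<bar>u $ l - v $ l\<bar>)"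
proof (rule order_trans[OF ufun_lip_clamp])
  have "\<bar>clamp01 u $ l - clamp01 v $ l\<bar> <= \<bar>u $ l - v $ l\<bar>" for l by (simp add: clamp01_def)
  then show "p * (\<Sum>l\<in>UNIV. \<bar>clamp01 u $ l - clamp01 v $ l\<bar>) <= p * (\<Sum>l\<in>UNIV. \<bar>u $ l - v $ l\<bar>)"
    using pA_pos by (intro mult_left_mono sum_mono) auto
qed

lemma ufun_clamp: "AE om in M. ufun M X Z A (clamp01 u) (X om, Z om) = ufun M X Z A u (X om, Z om)"
proof -
  let ?d = "%om. \<bar>ufun M X Z A u (X om, Z om) - ufun M X Z A (clamp01 u) (X om, Z om)\<bar>"
  have "expectation ?d <= 0" using ufun_lip_clamp[of u "clamp01 u"] by (simp add: clamp01_id[OF clamp01_cube])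
  then have "expectation ?d = 0" by (intro antisym) auto
  then have "AE om in M. ?d om = 0" by (subst (asm) integral_nonneg_eq_0_iff_AE) (auto intro!: ufun_int)
  then show ?thesis by eventually_elim simp
qed

lemma unif_class_ufun: "unif_class (distr M borel (%om. (X om, Z om))) (ufun M X Z A) 1"
proof -
  interpret D: prob_space "distr M borel (%om. (X om, Z om))" by (rule prob_space_distr[OF XZ])
  show ?thesis
  proof
    show "D.expectation (%x. \<bar>ufun M X Z A u x - ufun M X Z A v x\<bar>) <= 1 * (\<Sum>i\<in>UNIV. \<bar>u $ i - v $ i\<bar>)" for u v
    proof -
      have "D.expectation (%x. \<bar>ufun M X Z A u x - ufun M X Z A v x\<bar>) <= p * (\<Sum>i\<in>UNIV. \<bar>u $ i - v $ i\<bar>)"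
        using ufun_lip[of u v] by (subst integral_distr[OF XZ]) auto
      also have "... <= 1 * (\<Sum>i\<in>UNIV. \<bar>u $ i - v $ i\<bar>)" using p1 by (intro mult_right_mono sum_nonneg) auto
      finally show ?thesis .
    qed
  qed (auto simp: ufun_def intro: order_trans)
qed

lemma ufun_1: "expectation (%om. ufun M X Z A (at1 s l) (X om, Z om)) = p * s" if "0 <= s" "s <= 1"
proof -
  have "(\<forall>k. F k (X om $ k) <= at1 s l $ k) \<longleftrightarrow> F l (X om $ l) <= s" for om
    using F_le1 by (auto simp: at1_nth)
  then show ?thesis unfolding Dfun_eq Dfun_def UA_def using mg_eq[of l s] that by (simp add: mg_def)
qed

text \<open>Difference quotients are bounded by 1 by the Lipschitz property, hence so are
  derivatives. Where no derivative exists, \<open>deriv\<close> is a choice from the empty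
  predicate; the bound names that same arbitrary real in order to cover it.\<close>

lemma copula_fun_Dfun:
  assumes cC: "condC M X Z A"
  shows "copula_fun (%u. Dfun M X Z u A) p (%u l. dD M X Z u A l) (max 1 \<bar>SOME d::real. False\<bar>)"
proof
  show lip: "\<bar>Dfun M X Z u A - Dfun M X Z v A\<bar> <= p * (\<Sum>i\<in>UNIV. \<bar>u $ i - v $ i\<bar>)" for u v
  proof -
    have "\<bar>Dfun M X Z u A - Dfun M X Z v A\<bar> = \<bar>expectation (%om. ufun M X Z A u (X om, Z om) - ufun M X Z A v (X om, Z om))\<bar>"
      by (simp add: ufun_int Dfun_eq)
    also have "... <= expectation (%om. \<bar>ufun M X Z A u (X om, Z om) - ufun M X Z A v (X om, Z om)\<bar>)" by (rule integral_abs_bound)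
    finally show ?thesis using ufun_lip[of u v] by linarith
  qed
  show "Dfun M X Z (at1 s l) A = p * s" if "0 <= s" "s <= 1" for s l using ufun_1[OF that] by (simp add: Dfun_eq)
  show "0 <= Dfun M X Z u A" for u by (simp add: Dfun_def)
  show "Dfun M X Z u A <= p" for u unfolding Dfun_def pA_def by (intro finite_measure_mono) auto
  show "((%s. Dfun M X Z (upd u l s) A) has_real_derivative dD M X Z u A l) (at (u $ l))" if "u \<in> cbox 0 1" "0 < u $ l" "u $ l < 1" for u l
    using cC that unfolding condC_def dD_def by (simp add: DERIV_deriv_iff_real_differentiable)
  show "continuous_on {u \<in> cbox 0 1. 0 < u $ l & u $ l < 1} (%u. dD M X Z u A l)" for l using cC by (simp add: condC_def)
  show "\<bar>dD M X Z u A l\<bar> <= max 1 \<bar>SOME d::real. False\<bar>" for u l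
  proof (cases "(%s. Dfun M X Z (upd u l s) A) differentiable (at (u $ l))")
    case True
    let ?g = "%s. Dfun M X Z (upd u l s) A"
    have "(?g has_real_derivative dD M X Z u A l) (at (u $ l))" using True by (simp add: dD_def DERIV_deriv_iff_real_differentiable)
    then have "((%h. (?g (u $ l + h) - ?g (u $ l)) / h) \<longlongrightarrow> dD M X Z u A l) (at 0)" by (simp add: DERIV_def)
    then have lim: "((%h. \<bar>(?g (u $ l + h) - ?g (u $ l)) / h\<bar>) \<longlongrightarrow> \<bar>dD M X Z u A l\<bar>) (at 0)" by (rule tendsto_rabs)
    have "\<bar>(?g (u $ l + h) - ?g (u $ l)) / h\<bar> <= 1" if "h ~= 0" for h
    proof -
      have "(\<Sum>i\<in>UNIV. \<bar>upd u l (u $ l + h) $ i - upd u l (u $ l) $ i\<bar>) = \<bar>h\<bar>"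
        by (subst sum.remove[of _ l]) (auto simp: upd_nth intro!: sum.neutral)
      then have "\<bar>?g (u $ l + h) - ?g (u $ l)\<bar> <= p * \<bar>h\<bar>" using lip[of "upd u l (u $ l + h)" "upd u l (u $ l)"] by simp
      also have "... <= 1 * \<bar>h\<bar>" using p1 by (intro mult_right_mono) auto
      finally show ?thesis using that by (simp add: abs_divide)
    qed
    then have "\<bar>dD M X Z u A l\<bar> <= 1" by (intro tendsto_upperbound[OF lim]) (auto simp: eventually_at_filter)
    then show ?thesis by simp
  next
    case False
    then have "!!D. \<not> ((%s. Dfun M X Z (upd u l s) A) has_real_derivative D) (at (u $ l))" by (auto simp: real_differentiable_def)
    then have "dD M X Z u A l = (SOME d. False)" by (simp add: dD_def deriv_def)
    then show ?thesis by simp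
  qed
qed (use pA_pos p1 in auto)

end

lemma ufun_prod:
  assumes "cond_margins M X Z A" "cond_margins M X Z A'"
  shows "integral\<^sup>L M (%om. ufun M X Z A u (X om, Z om) * ufun M X Z A' v (X om, Z om)) - Dfun M X Z u A * Dfun M X Z v A' = covB M X Z A u A' v"
proof -
  interpret a: cond_margins M X Z A by fact
  interpret b: cond_margins M X Z A' by fact
  have "(%om. ufun M X Z A u (X om, Z om) * ufun M X Z A' v (X om, Z om)) = (%om. if (\<forall>k. UA M X Z A om $ k <= u $ k) & (\<forall>k. UA M X Z A' om $ k <= v $ k)
                                & Z om \<in> A \<inter> A' then 1 else 0)" by (auto simp: ufun_def UA_def fun_eq_iff)
  moreover have "{om \<in> space M. (\<forall>k. UA M X Z A om $ k <= u $ k) & (\<forall>k. UA M X Z A' om $ k <= v $ k) & Z om \<in> A \<inter> A'} \<in> sets M"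
    unfolding UA_def by simp measurable
  ultimately show ?thesis unfolding covB_def by (simp only: a.expectation_if)
qed

section \<open>The sampling model\<close>

locale copula_boot = M: prob_space M for M :: "'a measure" +
  fixes X :: "'a => real^'p" and Z :: "'a => real^'q"
    and Xs :: "nat => 'a => real^'p" and Zs :: "nat => 'a => real^'q"
    and A :: "'m::finite => (real^'q) set"
    and W :: "nat => nat => nat => 'a => real"
    and Mb :: nat
  assumes cm: "!!k. cond_margins M X Z (A k)"
    and iid_indep: "M.indep_vars (%_. borel) (%i om. (Xs i om, Zs i om)) UNIV"
    and iid_dist: "!!i. distr M borel (%om. (Xs i om, Zs i om)) = distr M borel (%om. (X om, Z om))"
    and cC: "!!k. condC M X Z (A k)"
    and W_exch: "!!j. j \<in> {1..Mb} ==> exch_weights M (W j)"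
    and W_indep: "!!n. M.indep_vars (%_. PiM {..<n} (%_. borel))
          (%j om. restrict (%i. W j n i om) {..<n}) {1..Mb}"
    and W_sample_indep: "!!n. M.indep_set
          (sets (vimage_algebra (space M) (%om. %i. (Xs i om, Zs i om)) (PiM UNIV (%_. borel))))
          (sets (vimage_algebra (space M)
             (%om. restrict (%j. restrict (%i. W j n i om) {..<n}) {1..Mb})
             (PiM {1..Mb} (%_. PiM {..<n} (%_. borel)))))"
    and W_cond: "!!j. j \<in> {1..Mb} ==> condW M (W j)"
begin

definition Pxz :: "((real^'p) \<times> (real^'q)) measure" where "Pxz = distr M borel (%om. (X om, Z om))"

definition \<xi> :: "nat => 'a => (real^'p) \<times> (real^'q)" where "\<xi> i om = (Xs i om, Zs i om)"

lemma sets_Pxz: "sets Pxz = sets borel" by (simp add: Pxz_def)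

lemma xi_rv: "\<xi> i \<in> borel_measurable M"
  using iid_indep unfolding M.indep_vars_def \<xi>_def[abs_def] by auto

lemma sets_Pseq: "sets (PiM UNIV (%_::nat. Pxz)) = sets (PiM UNIV (%_::nat. borel))"
  by (intro sets_PiM_cong) (auto simp: sets_Pxz)

lemma xi_seq_meas: "(%om i. \<xi> i om) \<in> measurable M (PiM UNIV (%_::nat. Pxz))"
  using measurable_cong_sets[OF refl sets_Pseq, of M] by (auto intro!: measurable_PiM_single' xi_rv)

sublocale boot Pxz "%k. ufun M X Z (A k)" 1 M \<xi> W Mb
proof -
  interpret c: cond_margins M X Z "A undefined" by (rule cm)
  have "prob_space Pxz" unfolding Pxz_def by (rule M.prob_space_distr[OF c.XZ])
  then interpret D: prob_space Pxz .
  have fam: "unif_family Pxz (%k. ufun M X Z (A k)) 1"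
    by (intro unif_family.intro unif_family_axioms.intro D.prob_space_axioms) (rule cond_margins.unif_class_ufun[OF cm, folded Pxz_def])
  have xd: "distr M (PiM UNIV (%_::nat. Pxz)) (%om i. \<xi> i om) = PiM UNIV (%_::nat. Pxz)"
  proof -
    have "distr M (PiM UNIV (%_::nat. Pxz)) (%om i. \<xi> i om) = distr M (PiM UNIV (%_::nat. borel)) (%om. \<lambda>i\<in>UNIV. (Xs i om, Zs i om))"
      by (rule distr_cong) (auto simp: sets_Pseq \<xi>_def)
    also have "... = PiM UNIV (%i::nat. distr M borel (%om. (Xs i om, Zs i om)))"
      using iid_indep xi_rv by (subst M.indep_vars_iff_distr_eq_PiM[symmetric]) (auto simp: \<xi>_def[abs_def])
    finally show ?thesis unfolding iid_dist Pxz_def .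
  qed
  have wv: "(%om. restrict (%j. restrict (%i. W j n i om) {..<n}) {1..Mb}) \<in> measurable M (PiM {1..Mb} (%_. PiM {..<n} (%_. borel)))" for n
    by (rule measurable_restrict) (use W_indep[of n] in \<open>auto simp: M.indep_vars_def\<close>)
  have sv: "sets (vimage_algebra (space M) (%om i. \<xi> i om) (PiM UNIV (%_::nat. Pxz))) = sets (vimage_algebra (space M) (%om. %i. (Xs i om, Zs i om)) (PiM UNIV (%_. borel)))"
    unfolding \<xi>_def by (rule sets_vimage_algebra_cong[OF sets_Pseq])
  show "boot Pxz (%k. ufun M X Z (A k)) 1 M \<xi> W Mb"
    using M.prob_space_axioms fam xi_seq_meas xd W_indep W_exch W_cond
      M.distr_pair_of_indep_set[OF xi_seq_meas wv] W_sample_indep[folded sv]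
    by (intro boot.intro boot_axioms.intro) auto
qed

lemma cp: "copula_fun (%u. Dfun M X Z u (A k)) (pA M Z (A k)) (%u l. dD M X Z u (A k) l) (max 1 \<bar>SOME d::real. False\<bar>)"
  by (rule cond_margins.copula_fun_Dfun[OF cm cC])

lemma Cinf'_Cinf: "copula_fun.Cinf' (%u. Dfun M X Z u (A k)) (pA M Z (A k)) (%u l. dD M X Z u (A k) l) b u = Cinf M X Z b u (A k)"
  unfolding copula_fun.Cinf'_def[OF cp] Cinf_def ..

lemma XZ: "(%om. (X om, Z om)) \<in> borel_measurable M" by (rule cond_margins.XZ[OF cm])

lemma exp_f: "integral\<^sup>L Pxz (ufun M X Z (A k) u) = Dfun M X Z u (A k)"
  unfolding Pxz_def by (subst integral_distr[OF XZ]) (auto intro: cond_margins.ufun_meas[OF cm] simp: cond_margins.Dfun_eq[OF cm])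

text \<open>Projecting an argument to the cube changes the indicator only on a null set, so the
  process extended by \<open>clamp01\<close> has the required covariance at all arguments.\<close>

lemma covc_eq: "covc (k, u) (k', w') = covB M X Z (A k) u (A k') w'"
proof -
  note [measurable] = cond_margins.ufun_meas[OF cm] XZ
  have E: "integral\<^sup>L Pxz (%x. ufun M X Z (A k) (clamp01 u) x * ufun M X Z (A k') (clamp01 w') x) = integral\<^sup>L M (%om. ufun M X Z (A k) u (X om, Z om) * ufun M X Z (A k') w' (X om, Z om))"
    unfolding Pxz_def
  proof (subst integral_distr[OF XZ])
    show "(%x. ufun M X Z (A k) (clamp01 u) x * ufun M X Z (A k') (clamp01 w') x) \<in> borel_measurable borel"
      by (intro borel_measurable_times cond_margins.ufun_meas[OF cm])
    show "integral\<^sup>L M (%om. ufun M X Z (A k) (clamp01 u) (X om, Z om) * ufun M X Z (A k') (clamp01 w') (X om, Z om)) =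
      integral\<^sup>L M (%om. ufun M X Z (A k) u (X om, Z om) * ufun M X Z (A k') w' (X om, Z om))"
    proof (rule integral_cong_AE)
      show "AE om in M. ufun M X Z (A k) (clamp01 u) (X om, Z om) * ufun M X Z (A k') (clamp01 w') (X om, Z om) = ufun M X Z (A k) u (X om, Z om) * ufun M X Z (A k') w' (X om, Z om)"
        using cond_margins.ufun_clamp[OF cm, of k u] cond_margins.ufun_clamp[OF cm, of k' w'] by eventually_elim simp
    qed (auto intro!: borel_measurable_times measurable_compose[OF XZ cond_margins.ufun_meas[OF cm]])
  qed
  have D: "Dfun M X Z (clamp01 u) (A k) = Dfun M X Z u (A k)" for u k
    unfolding cond_margins.Dfun_eq[OF cm, symmetric]
    by (rule integral_cong_AE) (auto intro!: measurable_compose[OF XZ cond_margins.ufun_meas[OF cm]] cond_margins.ufun_clamp[OF cm])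
  show ?thesis unfolding covc_def cov_def fst_conv snd_conv exp_f D E by (rule ufun_prod[OF cm cm])
qed

definition Us :: "'a => 'm => nat => real^'p" where
  "Us om k i = (\<chi> l. condF M X Z l (Xs i om $ l) (A k))"

lemma ufun_emp: "ufun M X Z (A k) u (\<xi> i om) = emp_ind (%i. Zs i om) (A k) (Us om k) u i"
  by (simp add: ufun_def emp_ind_def \<xi>_def Us_def)

lemma alpha_0: "alpha n om 0 k = copula_fun.emp0 (%u. Dfun M X Z u (A k)) n (%i. Zs i om) (A k) (Us om k)"
  by (rule ext) (simp add: alpha_def v_def copula_fun.emp0_def[OF cp] exp_f ufun_emp)

lemma alpha_j: "0 < j ==> alpha n om j k = copula_fun.emp1 n (%i. Zs i om) (A k) (Us om k) (%i. W j n i om)"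
proof (rule ext)
  fix u :: "real^'p" assume j: "0 < j"
  have "(\<Sum>i<n. wcent n (%i. W j n i om) i * (emp_ind (%i. Zs i om) (A k) (Us om k) u i - Dfun M X Z u (A k)))
    = (\<Sum>i<n. wcent n (%i. W j n i om) i * emp_ind (%i. Zs i om) (A k) (Us om k) u i) - (\<Sum>i<n. wcent n (%i. W j n i om) i) * Dfun M X Z u (A k)"
    by (simp add: right_diff_distrib sum_subtractf sum_distrib_right)
  then show "alpha n om j k u = copula_fun.emp1 n (%i. Zs i om) (A k) (Us om k) (%i. W j n i om) u"
    using j unfolding alpha_def v_def copula_fun.emp1_def[OF cp] exp_f ufun_emp wcent_sum by (simp add: wcent_def)
qed

lemma AE_xi:
  assumes "AE om in M. R (X om, Z om)" "Measurable.pred borel R"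
  shows "AE om in M. R (\<xi> i om)"
proof -
  have "AE y in distr M borel (%om. (X om, Z om)). R y" using assms XZ by (subst AE_distr_iff) auto
  then show ?thesis unfolding iid_dist[of i, symmetric] using assms(2) xi_rv[of i] by (subst (asm) AE_distr_iff) (auto simp: \<xi>_def[abs_def])
qed

lemma U_atom: "AE om in M. \<not> (condF M X Z l (X om $ l) (A k) = s & Z om \<in> A k)"
proof -
  interpret c: cond_margins M X Z "A k" by (rule cm)
  have "{om \<in> space M. condF M X Z l (X om $ l) (A k) = s & Z om \<in> A k} \<in> null_sets M"
    using c.atom_null[of l s] by (auto simp: null_sets_def M.emeasure_eq_measure)
  from AE_not_in[OF this] show ?thesis using AE_space by eventually_elim auto
qed

definition uc :: "'m => 'p => (real^'p) \<times> (real^'q) => real" where "uc k l y = condF M X Z l (fst y $ l) (A k)"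

lemma uc_meas: "uc k l \<in> borel_measurable borel" "snd -` A k \<in> sets (borel :: ((real^'p) \<times> (real^'q)) measure)"
proof -
  interpret c: cond_margins M X Z "A k" by (rule cm)
  have [measurable]: "(fst :: (real^'p) \<times> (real^'q) => _) \<in> borel_measurable borel" and s: "(snd :: (real^'p) \<times> (real^'q) => _) \<in> borel_measurable borel"
    by (intro borel_measurable_continuous_onI continuous_intros)+
  show "uc k l \<in> borel_measurable borel" unfolding uc_def[abs_def] by measurable
  show "snd -` A k \<in> sets (borel :: ((real^'p) \<times> (real^'q)) measure)" using measurable_sets[OF s c.A] by simp
qed

lemma uc_pred: "Measurable.pred borel (%y::(real^'p) \<times> (real^'q). snd y \<in> A k)"
  using uc_meas(2)[of k] by (auto simp: pred_def vimage_def)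

text \<open>For a fixed value of one observation the other hits its transformed coordinate with
  probability zero by \<open>U_atom\<close>; independence and Fubini's theorem remove the
  conditioning.\<close>

lemma no_ties:
  assumes "i ~= j"
  shows "AE om in M. \<not> (uc k l (\<xi> i om) = uc k l (\<xi> j om) & Zs i om \<in> A k & Zs j om \<in> A k)"
proof -
  note [measurable] = uc_meas(1) uc_pred
  have "M.indep_var borel ((%x. x i) \<circ> (%om. restrict (%i. (Xs i om, Zs i om)) {i})) borel ((%x. x j) \<circ> (%om. restrict (%i. (Xs i om, Zs i om)) {j}))"
    by (rule M.indep_var_compose[OF M.indep_var_restrict[OF iid_indep]])
      (use assms in \<open>auto intro!: measurable_component_singleton\<close>)
  then have "M.indep_var borel (\<xi> i) borel (\<xi> j)" by (simp add: comp_def \<xi>_def[abs_def])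
  then have d: "distr M borel (\<xi> i) \<Otimes>\<^sub>M distr M borel (\<xi> j) = distr M (borel \<Otimes>\<^sub>M borel) (%om. (\<xi> i om, \<xi> j om))"
    by (auto simp: M.indep_var_distribution_eq)
  have dd: "distr M borel (\<xi> i) = Pxz" for i using iid_dist[of i] by (simp add: Pxz_def \<xi>_def[abs_def])
  interpret D: prob_space Pxz unfolding Pxz_def by (rule M.prob_space_distr[OF XZ])
  interpret pair_sigma_finite Pxz Pxz ..
  let ?R = "%x y. \<not> (uc k l x = uc k l y & snd x \<in> A k & snd y \<in> A k)"
  have R: "Measurable.pred (borel \<Otimes>\<^sub>M borel) (%z. ?R (fst z) (snd z))" by measurable
  have at: "AE y in Pxz. \<not> (uc k l y = s & snd y \<in> A k)" for s
    unfolding Pxz_def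
  proof (subst AE_distr_iff[OF XZ])
    have "Measurable.pred borel (%y::(real^'p) \<times> (real^'q). \<not> (uc k l y = s & snd y \<in> A k))" by measurable
    then show "{y \<in> space borel. \<not> (uc k l y = s & snd y \<in> A k)} \<in> sets borel" by (simp add: pred_def)
  qed (use U_atom[of l k s] in \<open>simp add: uc_def\<close>)
  have "AE y in Pxz. ?R x y" for x using at[of "uc k l x"] by eventually_elim auto
  moreover have "{z \<in> space (Pxz \<Otimes>\<^sub>M Pxz). ?R (fst z) (snd z)} \<in> sets (Pxz \<Otimes>\<^sub>M Pxz)"
  proof -
    have "sets (Pxz \<Otimes>\<^sub>M Pxz) = sets (borel \<Otimes>\<^sub>M borel)" "space (Pxz \<Otimes>\<^sub>M Pxz) = UNIV"
      by (auto intro!: sets_pair_measure_cong simp: sets_Pxz space_pair_measure Pxz_def)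
    then show ?thesis using R by (simp add: pred_def space_pair_measure)
  qed
  ultimately have "AE z in Pxz \<Otimes>\<^sub>M Pxz. ?R (fst z) (snd z)" by (intro AE_pair_measure) auto
  then have "AE z in distr M (borel \<Otimes>\<^sub>M borel) (%om. (\<xi> i om, \<xi> j om)). ?R (fst z) (snd z)" unfolding d[symmetric] dd .
  then show ?thesis
    using R by (subst (asm) AE_distr_iff[OF measurable_Pair[OF xi_rv xi_rv]]) (auto simp: \<xi>_def pred_def space_pair_measure)
qed

lemma AE_pseudo_obs: "AE om in M. \<forall>n k. pseudo_obs n (%i. Xs i om) (%i. Zs i om) (A k) (Us om k)"
proof -
  have "AE om in M. \<not> (uc k l (\<xi> i om) = 0 & snd (\<xi> i om) \<in> A k)" for k l i
  proof (rule AE_xi)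
    note [measurable] = uc_meas(1) uc_pred
    show "Measurable.pred borel (%y::(real^'p) \<times> (real^'q). \<not> (uc k l y = 0 & snd y \<in> A k))" by measurable
  qed (use U_atom[of l k 0] in \<open>simp add: uc_def\<close>)
  then have "AE om in M. \<forall>k l i. \<not> (uc k l (\<xi> i om) = 0 & snd (\<xi> i om) \<in> A k)"
    by (simp add: AE_all_countable AE_finite_all[OF finite_class.finite_UNIV, simplified])
  moreover have "AE om in M. \<forall>k l i j. i ~= j --> \<not> (uc k l (\<xi> i om) = uc k l (\<xi> j om) & Zs i om \<in> A k & Zs j om \<in> A k)"
    using no_ties by (simp add: AE_all_countable)
  ultimately show ?thesis
  proof eventually_elim
    case (elim om)
    have F: "0 <= condF M X Z l t (A k)" "condF M X Z l t (A k) <= 1" "s <= t ==> condF M X Z l s (A k) <= condF M X Z l t (A k)" for l s t k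
      using cond_margins.F_ge0[OF cm] cond_margins.F_le1[OF cm] cond_margins.F_mono[OF cm] by auto
    show ?case unfolding pseudo_obs_def
    proof (intro allI conjI ballI impI)
      fix n k i l assume i: "i \<in> sub_idx n (%i. Zs i om) (A k)"
      show "0 < Us om k i $ l" using elim(1)[rule_format, of k l i] F(1)[of l "Xs i om $ l" k] i
        by (auto simp: Us_def uc_def \<xi>_def sub_idx_def less_le)
      show "Us om k i $ l <= 1" using F(2) by (simp add: Us_def)
      fix j assume j: "j \<in> sub_idx n (%i. Zs i om) (A k)"
      show "Us om k j $ l <= Us om k i $ l" if "Xs j om $ l <= Xs i om $ l" using F(3)[OF that] by (simp add: Us_def)
      show "Us om k i $ l ~= Us om k j $ l" if "i ~= j" using elim(2)[rule_format, OF that, of k l] i j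
        by (auto simp: Us_def uc_def \<xi>_def sub_idx_def)
    qed
  qed
qed

end

section \<open>Approximation by functionals of grid values\<close>

lemma (in copula_fun) Cinf'_lip:
  assumes u: "u \<in> cbox 0 1" and ab: "!!x. x \<in> cbox 0 1 ==> \<bar>a x - b x\<bar> <= e"
  shows "\<bar>Cinf' a u - Cinf' b u\<bar> <= ((2 + real CARD('p) * (2 * K) / p0) / p0) * e"
proof -
  have e0: "0 <= e" using ab[OF u] by linarith
  have ul: "0 <= u $ l" "u $ l <= 1" for l using u by (auto simp: cube_iff)
  have on: "\<bar>a ones - b ones\<bar> <= e" by (rule ab[OF ones_cube])
  have bt: "\<bar>beta a l u - beta b l u\<bar> <= 2 * e" for l
  proof -
    have "\<bar>a (onek u l) - b (onek u l)\<bar> <= e" by (rule ab) (unfold onek_at1, rule at1_cube[OF ul])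
    moreover have "\<bar>u $ l * (a ones - b ones)\<bar> <= 1 * e" unfolding abs_mult using ul on by (intro mult_mono) auto
    moreover have "beta a l u - beta b l u = (a (onek u l) - b (onek u l)) - u $ l * (a ones - b ones)"
      by (simp add: beta_def algebra_simps)
    ultimately show ?thesis by linarith
  qed
  have "\<bar>(\<Sum>l\<in>UNIV. dd u l * beta a l u) - (\<Sum>l\<in>UNIV. dd u l * beta b l u)\<bar> = \<bar>\<Sum>l\<in>UNIV. dd u l * (beta a l u - beta b l u)\<bar>"
    by (simp add: sum_subtractf right_diff_distrib)
  also have "... <= (\<Sum>l\<in>(UNIV::'p set). K * (2 * e))"
    by (intro order_trans[OF sum_abs] sum_mono) (unfold abs_mult, intro mult_mono dd_bd bt, use K1 in auto)
  finally have S: "\<bar>(\<Sum>l\<in>UNIV. dd u l * beta a l u) / p0 - (\<Sum>l\<in>UNIV. dd u l * beta b l u) / p0\<bar> <= real CARD('p) * (2 * K) / p0 * e"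
    using p0 by (simp add: diff_divide_distrib[symmetric] divide_right_mono mult_ac)
  have "\<bar>D u / p0 * (a ones - b ones)\<bar> <= 1 * e"
    unfolding abs_mult using D_bd[of u] p0 on by (intro mult_mono) auto
  then have "\<bar>D u / p0 * a ones - D u / p0 * b ones\<bar> <= e" by (simp add: right_diff_distrib)
  then have "\<bar>(a u - (\<Sum>l\<in>UNIV. dd u l * beta a l u) / p0 - D u / p0 * a ones) - (b u - (\<Sum>l\<in>UNIV. dd u l * beta b l u) / p0 - D u / p0 * b ones)\<bar>
      <= (2 + real CARD('p) * (2 * K) / p0) * e" using S ab[OF u] unfolding distrib_right by linarith
  then show ?thesis unfolding Cinf'_beta diff_divide_distrib[symmetric] using p0 by (simp add: divide_right_mono)
qed

lemma (in prob_space) measure_nn_Markov: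
  assumes [measurable]: "g \<in> borel_measurable M" and g: "(\<integral>\<^sup>+om. g om \<partial>M) <= ennreal a" and b: "0 < b" and a: "0 <= a"
  shows "measure M {om\<in>space M. g om > ennreal b} <= a / b"
proof -
  let ?S = "{om\<in>space M. g om > ennreal b}"
  have "ennreal (b * measure M ?S) = (\<integral>\<^sup>+om. ennreal b * indicator ?S om \<partial>M)"
    using b by (simp add: ennreal_mult' emeasure_eq_measure nn_integral_cmult_indicator)
  also have "... <= (\<integral>\<^sup>+om. g om \<partial>M)" by (intro nn_integral_mono) (auto simp: indicator_def less_imp_le)
  also note g
  finally have "b * measure M ?S <= a" using a by simp
  then show ?thesis using b by (simp add: field_simps)
qed

context copula_boot begin

definition XX :: "nat => 'a => nat => 'm => real^'p => real" where
  "XX n om j k u = (if j = 0 then Cbar M X Z n (%i. Xs i om) (%i. Zs i om) u (A k)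
     else Ctilde n (%i. Xs i om) (%i. Zs i om) (%i. W j n i om) u (A k))"

definition CC :: "(real^'p => real) => 'm => real^'p => real" where "CC b k u = Cinf M X Z b u (A k)"

lemma CC_lip: obtains L where "0 <= L" "!!k a b u e. u \<in> cbox 0 1 ==> (!!x. x \<in> cbox 0 1 ==> \<bar>a x - b x\<bar> <= e) ==> \<bar>CC a k u - CC b k u\<bar> <= L * e"
proof -
  define Lk where "Lk k = (2 + real CARD('p) * (2 * max 1 \<bar>SOME d::real. False\<bar>) / pA M Z (A k)) / pA M Z (A k)" for k
  have pp: "0 < pA M Z (A k)" for k using cond_margins.pA_pos[OF cm] .
  have Lk: "0 <= Lk k" for k unfolding Lk_def using pp[of k] by (intro divide_nonneg_pos add_nonneg_nonneg) auto
  show thesis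
  proof (rule that[of "\<Sum>k\<in>UNIV. Lk k"])
    fix k a b u e assume u: "u \<in> cbox (0::real^'p) 1" and ab: "!!x. x \<in> cbox (0::real^'p) 1 ==> \<bar>a x - b x\<bar> <= (e::real)"
    have "\<bar>CC a k u - CC b k u\<bar> <= Lk k * e"
      unfolding CC_def Cinf'_Cinf[symmetric] Lk_def by (rule copula_fun.Cinf'_lip[OF cp u ab])
    also have "... <= (\<Sum>k\<in>UNIV. Lk k) * e"
      using Lk ab[OF u] by (intro mult_right_mono member_le_sum) auto
    finally show "\<bar>CC a k u - CC b k u\<bar> <= (\<Sum>k\<in>UNIV. Lk k) * e" .
  qed (intro sum_nonneg Lk)
qed

text \<open>Pseudo-observations are positive, so no indicator is on, and D vanishes on the lower
  faces because the l-th margin has no mass at 0.\<close>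

lemma alpha_zero:
  assumes po: "pseudo_obs n (%i. Xs i om) (%i. Zs i om) (A k) (Us om k)" and u: "u $ l = 0"
  shows "alpha n om j k u = 0"
proof -
  interpret c: cond_margins M X Z "A k" by (rule cm)
  have f0: "ufun M X Z (A k) u (\<xi> i om) = 0" if "i < n" for i
  proof (rule ccontr)
    assume "ufun M X Z (A k) u (\<xi> i om) ~= 0"
    then have "Us om k i $ l <= 0" "Zs i om \<in> A k" using u unfolding ufun_emp by (auto simp: emp_ind_def split: if_splits dest: spec[of _ l])
    moreover have "0 < Us om k i $ l" using po that \<open>Zs i om \<in> A k\<close> by (auto simp: pseudo_obs_def sub_idx_def)
    ultimately show False by linarith
  qed
  have "Dfun M X Z u (A k) <= c.mg l 0" unfolding Dfun_def c.mg_def UA_def using u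
    by (intro M.finite_measure_mono) (auto dest: spec[of _ l])
  then have "Dfun M X Z u (A k) = 0" unfolding c.mg_eq by (simp add: Dfun_def antisym)
  then show ?thesis by (simp add: alpha_def exp_f f0)
qed

lemma alpha_bd:
  assumes po: "pseudo_obs n (%i. Xs i om) (%i. Zs i om) (A k) (Us om k)" and u: "u \<in> cbox 0 1" and Q: "Q n 0 j k om <= ennreal R" "0 <= R"
  shows "\<bar>alpha n om j k u\<bar> <= R"
proof -
  have "ennreal \<bar>alpha n om j k u - alpha n om j k 0\<bar> <= Q n 0 j k om"
    using u by (intro Q_bound) (auto simp: cube_iff)
  then show ?thesis using alpha_zero[OF po, of 0] order_trans[OF _ Q(1)] Q(2) by fastforce
qed

lemma good_alpha:
  assumes po: "pseudo_obs n (%i. Xs i om) (%i. Zs i om) (A k) (Us om k)"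
    and Q0: "Q n 0 j k om <= ennreal R" "0 <= R" and Ql: "Q n l j k om <= ennreal \<theta>" "0 <= \<theta>" and tt: "\<theta> <= \<theta>'"
  shows "copula_fun.good R \<theta>' (1 / 2 ^ l) (alpha n om j k)"
  unfolding copula_fun.good_def[OF cp]
proof (intro ballI conjI impI)
  fix u :: "real^'p" assume u: "u \<in> cbox 0 1"
  show "\<bar>alpha n om j k u\<bar> <= R" by (rule alpha_bd[OF po u Q0])
  show "alpha n om j k u = 0" if "\<exists>l. u $ l = 0" using that alpha_zero[OF po] by blast
  fix w assume w: "w \<in> cbox 0 1" and d: "\<forall>i. \<bar>u $ i - w $ i\<bar> <= 1 / 2 ^ l"
  have "ennreal \<bar>alpha n om j k u - alpha n om j k w\<bar> <= ennreal \<theta>"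
    using d by (intro order_trans[OF Q_bound[OF u w] Ql(1)]) auto
  then show "\<bar>alpha n om j k u - alpha n om j k w\<bar> <= \<theta>'" using Ql(2) tt by simp
qed

text \<open>Constants are fixed in this order: the bound \<open>R\<close> from tightness, the
  modulus \<open>\<theta>\<close> from \<open>R\<close> and the target accuracy, the level
  \<open>l0\<close> from \<open>\<theta>\<close>, and the sample size last. Outside a small event
  all paths are then \<open>good\<close>, and the Lipschitz continuity of the limit functional lets
  them be replaced by their grid versions.\<close>

lemma process_approx:
  assumes \<epsilon>: "0 < \<epsilon>" and e: "0 < e"
  shows "\<exists>l0. \<forall>l\<ge>l0. \<forall>\<^sub>F n in sequentially. \<exists>E\<in>sets M. measure M E <= e & (\<forall>om\<in>space M - E. \<forall>j\<le>Mb. \<forall>k. \<forall>u\<in>cbox 0 1.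
    \<bar>XX n om j k u - CC (%x. alpha n om j k (dproj l x)) k u\<bar> <= \<epsilon>)"
proof -
  obtain L where L: "0 <= L" "!!k a b u e. u \<in> cbox 0 1 ==> (!!x. x \<in> cbox 0 1 ==> \<bar>a x - b x\<bar> <= e) ==> \<bar>CC a k u - CC b k u\<bar> <= L * e"
  proof (rule CC_lip, goal_cases)
    case (1 L)
    show ?case by (rule 1(1)[OF 1(2)]) (rule 1(3))
  qed
  define JK where "JK = {..Mb} \<times> (UNIV :: 'm set)"
  have fJK: "finite JK" and cJK: "0 < card JK" by (auto simp: JK_def card_gt_0_iff)
  \<comment> \<open>Each pair of slot and set carries two exceptional events, one for the bound and
    one for the modulus, of probability at most \<open>e1\<close> each.\<close>
  define e1 where "e1 = e / (2 * card JK)"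
  have e1: "0 < e1" using e cJK by (simp add: e1_def)
  obtain K0 where K0: "K0 >= 0" "\<forall>\<^sub>F n in sequentially. \<forall>j\<in>{..Mb}. \<forall>k. (\<integral>\<^sup>+om. Q n 0 j k om \<partial>M) <= ennreal K0" using Q0_bounded by blast
  define R where "R = max 1 (K0 / e1)"
  have R1: "1 <= R" by (simp add: R_def)
  have "K0 / e1 <= R" by (simp add: R_def)
  then have KR: "K0 / R <= e1" using R1 e1 by (simp add: field_simps)
  have "\<exists>\<theta>>0. \<forall>\<delta>>0. \<exists>n0. \<forall>n\<ge>n0. \<forall>(xs :: nat => real^'p) (zs :: nat => real^'q) Ak U. pseudo_obs n xs zs Ak U & copula_fun.good R \<theta> \<delta> (copula_fun.emp0 (%u. Dfun M X Z u (A k)) n zs Ak U)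
      --> (\<forall>u\<in>cbox 0 1. \<bar>sqrt (real n) * (Dbar n xs zs u Ak / phat n zs Ak - Dfun M X Z u (A k) / pA M Z (A k)) - CC (copula_fun.emp0 (%u. Dfun M X Z u (A k)) n zs Ak U) k u\<bar> <= \<epsilon> / 2 &
        (\<forall>y. copula_fun.good R \<theta> \<delta> (copula_fun.emp1 n zs Ak U y) --> \<bar>Ctilde n xs zs y u Ak - CC (copula_fun.emp1 n zs Ak U y) k u\<bar> <= \<epsilon> / 2))" for k
  proof -
    have e2: "0 < \<epsilon> / 2" using \<epsilon> by simp
    show ?thesis unfolding CC_def
      by (rule copula_fun.sample_linearization[OF cp R1 e2, of k, unfolded Cinf'_Cinf]) blast
  qed
  then obtain \<theta>' where t': "!!k. 0 < \<theta>' k" and lin: "!!k \<delta>. \<delta> > 0 ==> \<exists>n0. \<forall>n\<ge>n0. \<forall>(xs :: nat => real^'p) (zs :: nat => real^'q) Ak U. pseudo_obs n xs zs Ak U & copula_fun.good R (\<theta>' k) \<delta> (copula_fun.emp0 (%u. Dfun M X Z u (A k)) n zs Ak U)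
      --> (\<forall>u\<in>cbox 0 1. \<bar>sqrt (real n) * (Dbar n xs zs u Ak / phat n zs Ak - Dfun M X Z u (A k) / pA M Z (A k)) - CC (copula_fun.emp0 (%u. Dfun M X Z u (A k)) n zs Ak U) k u\<bar> <= \<epsilon> / 2 &
        (\<forall>y. copula_fun.good R (\<theta>' k) \<delta> (copula_fun.emp1 n zs Ak U y) --> \<bar>Ctilde n xs zs y u Ak - CC (copula_fun.emp1 n zs Ak U y) k u\<bar> <= \<epsilon> / 2))"
    by metis
  \<comment> \<open>Small enough for the linearisation of every set, and for \<open>L\<close> times
    the modulus to stay within \<open>\<epsilon> / 2\<close>.\<close>
  define \<theta> where "\<theta> = min (Min (range \<theta>')) (\<epsilon> / (2 * (L + 1)))"
  have "0 < Min (range \<theta>')" using t' by (subst Min_gr_iff) auto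
  then have t: "0 < \<theta>" using \<epsilon> L(1) by (auto simp: \<theta>_def)
  have tk: "\<theta> <= \<theta>' k" for k unfolding \<theta>_def by (intro min.coboundedI1 Min_le) auto
  have "\<theta> <= \<epsilon> / (2 * (L + 1))" by (simp add: \<theta>_def)
  then have "(L + 1) * \<theta> <= \<epsilon> / 2" using L(1) by (simp add: field_simps)
  then have Lt: "L * \<theta> <= \<epsilon> / 2" using t by (simp add: distrib_right)
  obtain l0 where l0: "\<forall>\<^sub>F n in sequentially. \<forall>j\<in>{..Mb}. \<forall>k. (\<integral>\<^sup>+om. Q n l0 j k om \<partial>M) <= ennreal (\<theta> * e1)"
    using Q_small[of "\<theta> * e1"] t e1 by auto
  obtain n0 where n0: "!!k n xs zs Ak U. n0 k <= n ==> pseudo_obs n (xs :: nat => real^'p) (zs :: nat => real^'q) Ak U & copula_fun.good R (\<theta>' k) (1 / 2 ^ l0) (copula_fun.emp0 (%u. Dfun M X Z u (A k)) n zs Ak U)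
      ==> (\<forall>u\<in>cbox 0 1. \<bar>sqrt (real n) * (Dbar n xs zs u Ak / phat n zs Ak - Dfun M X Z u (A k) / pA M Z (A k)) - CC (copula_fun.emp0 (%u. Dfun M X Z u (A k)) n zs Ak U) k u\<bar> <= \<epsilon> / 2 &
        (\<forall>y. copula_fun.good R (\<theta>' k) (1 / 2 ^ l0) (copula_fun.emp1 n zs Ak U y) --> \<bar>Ctilde n xs zs y u Ak - CC (copula_fun.emp1 n zs Ak U y) k u\<bar> <= \<epsilon> / 2))"
    using lin[of "1 / 2 ^ l0"] by (simp add: choice_iff) metis
  \<comment> \<open>One null set serves all sample sizes and all sets, so it can be added to the
    exceptional event at no cost.\<close>
  obtain E0 where E0: "E0 \<in> null_sets M" "!!om. om \<in> space M - E0 ==> \<forall>n k. pseudo_obs n (%i. Xs i om) (%i. Zs i om) (A k) (Us om k)"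
    using AE_E3[OF AE_pseudo_obs] by blast
  show ?thesis
  proof (intro exI[of _ l0] allI impI)
    fix l assume l: "l0 <= l"
    show "\<forall>\<^sub>F n in sequentially. \<exists>E\<in>sets M. measure M E <= e & (\<forall>om\<in>space M - E. \<forall>j\<le>Mb. \<forall>k. \<forall>u\<in>cbox 0 1.
      \<bar>XX n om j k u - CC (%x. alpha n om j k (dproj l x)) k u\<bar> <= \<epsilon>)"
      using K0(2) l0 eventually_ge_at_top[of "Max (range n0)"]
    proof eventually_elim
      case (elim n)
      have nk: "n0 k <= n" for k using elim(3) by (simp add: Max_le_iff)
      define E1 where "E1 = (%(j, k). {om\<in>space M. Q n 0 j k om > ennreal R} \<union> {om\<in>space M. Q n l0 j k om > ennreal \<theta>})"
      define E where "E = (\<Union>s\<in>JK. E1 s) \<union> E0"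
      have ms: "E1 s \<in> sets M & measure M (E1 s) <= 2 * e1" if sJ: "s \<in> JK" for s
      proof -
        obtain j k where s: "s = (j, k)" "j <= Mb" using sJ by (auto simp: JK_def)
        note [measurable] = Q_meas[OF s(2)]
        have "measure M {om\<in>space M. Q n 0 j k om > ennreal R} <= e1"
          using M.measure_nn_Markov[of "Q n 0 j k" K0 R] elim(1) s(2) R1 K0(1) KR by auto
        moreover have "measure M {om\<in>space M. Q n l0 j k om > ennreal \<theta>} <= e1"
          using M.measure_nn_Markov[of "Q n l0 j k" "\<theta> * e1" \<theta>] elim(2) s(2) t e1 by auto
        moreover have "measure M (E1 s) <= measure M {om\<in>space M. Q n 0 j k om > ennreal R} + measure M {om\<in>space M. Q n l0 j k om > ennreal \<theta>}"
          unfolding E1_def s prod.case by (intro measure_Un_le) auto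
        ultimately show ?thesis unfolding E1_def s by auto
      qed
      have UE: "(\<Union>s\<in>JK. E1 s) \<in> sets M" "E0 \<in> sets M" using ms E0(1) fJK by (blast intro: sets.finite_UN)+
      then have E: "E \<in> sets M" unfolding E_def by (rule sets.Un)
      have "measure M E <= measure M (\<Union>s\<in>JK. E1 s) + measure M E0"
        unfolding E_def by (rule measure_Un_le[OF UE])
      also have "... <= (\<Sum>s\<in>JK. measure M (E1 s)) + 0"
        using ms measure_eq_0_null_sets[OF E0(1)] by (intro add_mono measure_UNION_le[OF fJK]) auto
      also have "... <= (\<Sum>s\<in>JK. 2 * e1) + 0" using ms by (intro add_mono sum_mono) auto
      also have "... = e" using cJK by (simp add: e1_def)
      finally have mE: "measure M E <= e" .
      have "\<bar>XX n om j k u - CC (%x. alpha n om j k (dproj l x)) k u\<bar> <= \<epsilon>"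
        if w: "om \<in> space M - E" and j: "j <= Mb" and u: "u \<in> cbox 0 1" for om j k u
      proof -
        have po: "pseudo_obs n (%i. Xs i om) (%i. Zs i om) (A k) (Us om k)" using E0(2)[of om] w by (auto simp: E_def)
        have Qs: "Q n 0 j k om <= ennreal R" "Q n l0 j k om <= ennreal \<theta>" if "j <= Mb" for j
          using w that by (auto simp: E_def JK_def E1_def not_less)
        have g: "copula_fun.good R (\<theta>' k) (1 / 2 ^ l0) (alpha n om j k)" if "j <= Mb" for j
          by (rule good_alpha[OF po Qs(1)[OF that] _ Qs(2)[OF that]]) (use R1 t tk in auto)
        have b1: "\<bar>XX n om j k u - CC (alpha n om j k) k u\<bar> <= \<epsilon> / 2"
        proof -
          note main = n0[OF nk, of "%i. Xs i om" "%i. Zs i om" "A k" "Us om k" k, rule_format, OF conjI, OF po g[of 0, simplified, unfolded alpha_0] u]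
          show ?thesis
          proof (cases "j = 0")
            case True
            then show ?thesis using main by (simp add: XX_def Cbar_def copulaC_def alpha_0)
          next
            case False
            then have j0: "0 < j" by simp
            show ?thesis using conjunct2[OF main, rule_format, OF g[OF j, unfolded alpha_j[OF j0]]] False
              by (simp add: XX_def alpha_j[OF j0])
          qed
        qed
        have "\<bar>CC (alpha n om j k) k u - CC (%x. alpha n om j k (dproj l x)) k u\<bar> <= L * \<theta>"
        proof (rule L(2)[OF u])
          fix x :: "real^'p" assume x: "x \<in> cbox 0 1"
          have pc: "dproj l x \<in> cbox 0 1" using dproj_grid[OF x] dgrid_cube by blast
          have "(1::real) / 2 ^ l <= 1 / 2 ^ l0" using l by (simp add: frac_le)
          then have "\<bar>x $ i - dproj l x $ i\<bar> <= 1 / 2 ^ l0" for i using dproj_dist[of x i l] by (smt (verit))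
          then have "ennreal \<bar>alpha n om j k x - alpha n om j k (dproj l x)\<bar> <= ennreal \<theta>"
            by (intro order_trans[OF Q_bound[OF x pc] Qs(2)[OF j]])
          then show "\<bar>alpha n om j k x - alpha n om j k (dproj l x)\<bar> <= \<theta>" using t by simp
        qed
        then show ?thesis using b1 Lt by linarith
      qed
      then show ?case using E mE by blast
    qed
  qed
qed

end

section \<open>The main theorem\<close>

definition bdd_cube :: "(real^'p => real) => bool" where
  "bdd_cube g \<longleftrightarrow> (\<exists>b. \<forall>u\<in>cbox 0 1. \<bar>g u\<bar> <= b)"

lemma bdd_cubeI: "(!!u. u \<in> cbox 0 1 ==> \<bar>g u\<bar> <= b) ==> bdd_cube g" unfolding bdd_cube_def by blast

lemma bdd_cube_diff: "bdd_cube g ==> bdd_cube h ==> bdd_cube (%u. g u - h u)"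
  unfolding bdd_cube_def by (meson abs_triangle_ineq4 add_mono order_trans)

lemma bdd_cube_const: "bdd_cube (%_. c)" unfolding bdd_cube_def by auto

lemma bdd_cube_mult:
  assumes "bdd_cube g" "bdd_cube h" shows "bdd_cube (%u. g u * h u)"
proof -
  obtain a b where "!!u. u \<in> cbox 0 1 ==> \<bar>g u\<bar> <= a" "!!u. u \<in> cbox 0 1 ==> \<bar>h u\<bar> <= b"
    using assms unfolding bdd_cube_def by blast
  then have "\<bar>g u * h u\<bar> <= a * b" if "u \<in> cbox 0 1" for u
    unfolding abs_mult using that by (intro mult_mono) (auto intro: order_trans[OF abs_ge_zero])
  then show ?thesis by (rule bdd_cubeI)
qed

lemma bdd_cube_divide: "bdd_cube g ==> bdd_cube (%u. g u / c)"
  using bdd_cube_mult[OF _ bdd_cube_const, of g "inverse c"] by (simp add: divide_inverse)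

lemma bdd_cube_sum:
  assumes "finite S" "!!s. s \<in> S ==> bdd_cube (g s)" shows "bdd_cube (%u. \<Sum>s\<in>S. g s u)"
proof -
  obtain b where "!!s u. s \<in> S ==> u \<in> cbox 0 1 ==> \<bar>g s u\<bar> <= b s"
    using assms(2) unfolding bdd_cube_def by metis
  then have "\<bar>\<Sum>s\<in>S. g s u\<bar> <= (\<Sum>s\<in>S. b s)" if "u \<in> cbox 0 1" for u
    using that by (intro order_trans[OF sum_abs] sum_mono) auto
  then show ?thesis by (rule bdd_cubeI)
qed

lemma bdd_cube_comp: "bdd_cube g ==> (!!u. u \<in> cbox 0 1 ==> m u \<in> cbox 0 1) ==> bdd_cube (%u. g (m u))"
  unfolding bdd_cube_def by blast

lemmas bdd_cube_intros = bdd_cube_diff bdd_cube_const bdd_cube_mult bdd_cube_divide bdd_cube_sum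

lemma bdd_cube_Dbar: "bdd_cube (%u. Dbar n xs zs u A)"
  unfolding Dbar_def by (intro bdd_cube_intros) (auto intro: bdd_cubeI[of _ 1])

lemma bdd_cube_Dstar: "bdd_cube (%u. Dstar n xs zs w u A)"
  unfolding Dstar_def by (intro bdd_cube_intros bdd_cube_Dbar) (auto intro: bdd_cubeI[of _ 1])

text \<open>For fixed \<open>n\<close> the bandwidth is at least \<open>1 / sqrt (real n)\<close>,
  so the quotient is bounded. The bound grows with \<open>n\<close>, but only membership in the
  function space is at stake. For \<open>n = 0\<close> all quotients have the value 0.\<close>

lemma bdd_cube_dhat: "bdd_cube (%u. dhat n xs zs u A k)" for k :: "'p::finite"
proof -
  have Db: "\<bar>Dbar n xs zs u A\<bar> <= 1" for u
  proof -
    have "\<bar>\<Sum>i<n. if sel n xs zs u A i then 1 else 0\<bar> <= (\<Sum>i<n. 1::real)" by (intro order_trans[OF sum_abs] sum_mono) auto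
    then show ?thesis unfolding Dbar_def by (cases "n = 0") auto
  qed
  show ?thesis
  proof (rule bdd_cubeI[of _ "2 * sqrt (real n)"])
    fix u :: "real^'p" assume "u \<in> cbox 0 1"
    then have uk: "0 <= u $ k" "u $ k <= 1" by (auto simp: cube_iff)
    define x where "x = 1 / sqrt (real n)"
    define up where "up = min (u $ k + x) 1"
    define um where "um = max (u $ k - x) 0"
    show "\<bar>dhat n xs zs u A k\<bar> <= 2 * sqrt (real n)"
    proof (cases "n = 0")
      case False
      then have x: "0 < x" "x <= 1" by (auto simp: x_def)
      have g: "x <= up - um" unfolding up_def um_def using uk x by linarith
      have "\<bar>Dbar n xs zs (upd u k up) A - Dbar n xs zs (upd u k um) A\<bar> / \<bar>up - um\<bar> <= 2 / x"
        using Db[of "upd u k up"] Db[of "upd u k um"] g x by (intro frac_le) auto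
      then show ?thesis unfolding dhat_def Let_def x_def[symmetric] up_def[symmetric] um_def[symmetric] abs_divide by (simp add: x_def)
    qed (simp add: dhat_def Dbar_def)
  qed
qed

lemma bdd_cube_Ctilde: "bdd_cube (%u. Ctilde n xs zs w u A)" for xs :: "nat => real^'p"
proof -
  have nth: "bdd_cube (%u. u $ k)" for k :: 'p by (rule bdd_cubeI[of _ 1]) (simp add: cube_iff)
  have ok: "bdd_cube (%u. Dstar n xs zs w (onek u k) A)" for k
    by (rule bdd_cube_comp[OF bdd_cube_Dstar]) (unfold onek_at1, rule at1_cube, auto simp: cube_iff)
  show ?thesis unfolding Ctilde_def Dtilde_def
    by (intro bdd_cube_intros bdd_cube_Dstar bdd_cube_Dbar bdd_cube_dhat nth ok finite_class.finite_UNIV)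
qed

section \<open>Weak convergence of the joint process\<close>

context copula_boot begin

text \<open>Arguments beyond slot \<open>Mb\<close> are pinned to 0, so that a function on all
  naturals encodes exactly \<open>Mb + 1\<close> blocks of points of the cube.\<close>

definition Tset :: "(nat => 'm => real^'p) set" where
  "Tset = {t. \<forall>j k. (j <= Mb --> t j k \<in> cbox 0 1) & (Mb < j --> t j k = 0)}"

abbreviation "Iset \<equiv> {0..Mb} \<times> (UNIV :: 'm set)"

lemma TI: "Tset ~= {}" "Iset ~= {}"
proof -
  have "(%_ _. 0) \<in> Tset" by (auto simp: Tset_def cube_iff)
  then show "Tset ~= {}" by blast
qed auto

lemma linfI:
  assumes "!!j k. j <= Mb ==> bdd_cube (g j k)"
  shows "linf Tset Iset (%t (j, k). g j k (t j k))"
proof -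
  obtain b where b: "!!j k u. j <= Mb ==> u \<in> cbox 0 1 ==> \<bar>g j k u\<bar> <= b j k" using assms unfolding bdd_cube_def by metis
  show ?thesis unfolding linf_def
  proof (intro exI[of _ "\<Sum>(j, k)\<in>Iset. \<bar>b j k\<bar>"] ballI)
    fix t c assume t: "t \<in> Tset" and c: "c \<in> Iset"
    obtain j k where [simp]: "c = (j, k)" "j <= Mb" using c by auto
    have "\<bar>g j k (t j k)\<bar> <= \<bar>b j k\<bar>" using b[of j "t j k" k] t by (fastforce simp: Tset_def)
    also have "... <= (\<Sum>(j, k)\<in>Iset. \<bar>b j k\<bar>)" using c member_le_sum[of "(j, k)" Iset "%(j, k). \<bar>b j k\<bar>"] by auto
    finally show "\<bar>case c of (j, k) => g j k (t j k)\<bar> <= (\<Sum>(j, k)\<in>Iset. \<bar>b j k\<bar>)" by simp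
  qed
qed

lemma ldist_proc:
  assumes "!!j k u. j <= Mb ==> u \<in> cbox 0 1 ==> \<bar>g j k u - g' j k u\<bar> <= e"
  shows "ldist Tset Iset (%t (j, k). g j k (t j k)) (%t (j, k). g' j k (t j k)) <= e"
  using assms by (intro ldist_le TI) (auto simp: Tset_def)

lemma bdd_cube_XX: "bdd_cube (XX n om j k)"
proof -
  have "bdd_cube (%u. copulaC M X Z u (A k))"
    unfolding copulaC_def Dfun_def by (intro bdd_cube_divide bdd_cubeI[of _ 1]) simp
  then have "bdd_cube (%u. Cbar M X Z n (%i. Xs i om) (%i. Zs i om) u (A k))"
    unfolding Cbar_def by (intro bdd_cube_intros bdd_cube_Dbar)
  then show ?thesis using bdd_cube_Ctilde unfolding XX_def[abs_def] by (cases "j = 0") auto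
qed

lemma bdd_cube_CC:
  assumes "bdd_cube a" shows "bdd_cube (CC a k)"
proof -
  obtain b where b: "!!u. u \<in> cbox 0 1 ==> \<bar>a u - 0\<bar> <= b" using assms unfolding bdd_cube_def by auto
  obtain L where L: "!!u. u \<in> cbox 0 1 ==> \<bar>CC a k u - CC (%_. 0) k u\<bar> <= L * b"
  proof (rule CC_lip, goal_cases)
    case (1 L)
    show ?case by (rule 1(1)) (rule 1(3)[OF _ b])
  qed
  then show ?thesis by (intro bdd_cubeI[of _ "L * b"]) (simp add: CC_def Cinf_def)
qed

text \<open>The process rebuilt from its values on the grid of level \<open>l\<close>, a step
  function fed into the linear functional. It depends on finitely many coordinates, which makes
  Lipschitz functionals of it measurable.\<close>

definition Psi :: "nat => (nat \<times> 'm \<times> (real^'p) => real) => (nat => 'm => real^'p) => nat \<times> 'm => real" where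
  "Psi l x = (%t (j, k). CC (%u. x (j, k, dproj l u)) k (t j k))"

abbreviation "Fset l \<equiv> {..Mb} \<times> (UNIV :: 'm set) \<times> (dgrid l :: (real^'p) set)"

lemma finite_Fset: "finite (Fset l)" by (intro finite_cartesian_product finite_dgrid) auto

lemma linf_Psi: "linf Tset Iset (Psi l x)"
  unfolding Psi_def
proof (intro linfI bdd_cube_CC bdd_cubeI)
  fix j k and u :: "real^'p" assume "u \<in> cbox 0 1"
  then show "\<bar>x (j, k, dproj l u)\<bar> <= (\<Sum>d\<in>dgrid l. \<bar>x (j, k, d)\<bar>)"
    using member_le_sum[of "dproj l u" "dgrid l" "%d. \<bar>x (j, k, d)\<bar>"] finite_dgrid dproj_grid by auto
qed

definition Vn :: "nat => 'a => nat \<times> 'm \<times> (real^'p) => real" where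
  "Vn n om = (%(j, k, d). alpha n om j k d)"

lemma alpha_meas:
  assumes "j <= Mb" shows "(%om. alpha n om j k u) \<in> borel_measurable M"
  unfolding alpha_def using v_meas[OF assms] measurable_compose[OF xi_rv cond_margins.ufun_meas[OF cm]]
  by (intro borel_measurable_divide borel_measurable_sum borel_measurable_times borel_measurable_diff borel_measurable_const) auto

lemma Vn_tight:
  assumes e: "0 < e"
  shows "\<exists>R0. \<forall>R\<ge>R0. \<forall>\<^sub>F n in sequentially. \<forall>r\<in>Fset l. measure M {om\<in>space M. \<bar>Vn n om r\<bar> > R} <= e"
proof -
  obtain K0 where K0: "K0 >= 0" "\<forall>\<^sub>F n in sequentially. \<forall>j\<in>{..Mb}. \<forall>k. (\<integral>\<^sup>+om. Q n 0 j k om \<partial>M) <= ennreal K0" using Q0_bounded by blast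
  obtain E0 where E0: "E0 \<in> null_sets M" "!!om. om \<in> space M - E0 ==> \<forall>n k. pseudo_obs n (%i. Xs i om) (%i. Zs i om) (A k) (Us om k)"
    using AE_E3[OF AE_pseudo_obs] by blast
  show ?thesis
  proof (intro exI[of _ "max 1 (K0 / e)"] allI impI)
    fix R assume R: "max 1 (K0 / e) <= R"
    then have R0: "0 < R" "K0 / R <= e" using e by (auto simp: field_simps)
    show "\<forall>\<^sub>F n in sequentially. \<forall>r\<in>Fset l. measure M {om\<in>space M. \<bar>Vn n om r\<bar> > R} <= e"
      using K0(2)
    proof eventually_elim
      case (elim n)
      show ?case
      proof
        fix r assume r: "r \<in> Fset l"
        obtain j k d where [simp]: "r = (j, k, d)" and j: "j <= Mb" and d: "d \<in> cbox 0 1" using r dgrid_cube by (cases r) auto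
        note [measurable] = Q_meas[OF j]
        let ?S = "{om\<in>space M. Q n 0 j k om > ennreal R}"
        have S: "?S \<in> sets M" by measurable
        have "{om\<in>space M. \<bar>Vn n om r\<bar> > R} \<subseteq> ?S \<union> E0"
        proof (rule ccontr)
          assume "\<not> ?thesis"
          then obtain om where "om \<in> {om\<in>space M. \<bar>Vn n om r\<bar> > R}" "om \<notin> ?S \<union> E0" by blast
          then have w: "om \<in> space M - E0" "\<bar>alpha n om j k d\<bar> > R" "Q n 0 j k om <= ennreal R" by (auto simp: Vn_def not_less)
          show False using alpha_bd[OF E0(2)[OF w(1), rule_format] d w(3)] R0 w(2) by simp
        qed
        then have "measure M {om\<in>space M. \<bar>Vn n om r\<bar> > R} <= measure M (?S \<union> E0)"
          using S E0(1) by (intro M.finite_measure_mono) auto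
        also have "... <= measure M ?S + measure M E0" using S E0(1) by (intro measure_Un_le) auto
        also have "... <= K0 / R + 0"
          using M.measure_nn_Markov[of "Q n 0 j k" K0 R] elim j R0(1) K0(1) measure_eq_0_null_sets[OF E0(1)] by (intro add_mono) auto
        finally show "measure M {om\<in>space M. \<bar>Vn n om r\<bar> > R} <= e" using R0(2) by simp
      qed
    qed
  qed
qed

text \<open>\<open>h\<close> after \<open>Psi l\<close> is Lipschitz in the finitely many grid
  values, with constant \<open>Kh * L\<close>, so \<open>fidi_conv\<close> applies; on grid points
  \<open>covc\<close> and \<open>cov\<close> coincide.\<close>

lemma fidi_Psi:
  assumes h: "linf_BL Tset Iset Bd Kh h" and N: "prob_space N"
    and Bm: "!!j k u. B j k u \<in> borel_measurable N"
    and chf: "!!J F c. finite J ==> (!!j. finite (F j)) ==>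
       (\<integral>om. iexp (\<Sum>j\<in>J. \<Sum>s\<in>F j. c j s * B j (fst s) (snd s) om) \<partial>N) =
       complex_of_real (exp (- (\<Sum>j\<in>J. \<Sum>s\<in>F j. \<Sum>t\<in>F j. c j s * c j t * covc s t) / 2))"
  shows "(%n. \<integral>om. h (Psi l (Vn n om)) \<partial>M) \<longlonglongrightarrow> (\<integral>om. h (Psi l (%(j, k, d). B j k d om)) \<partial>N)"
    and "(%om. h (Psi l (Vn n om))) \<in> borel_measurable M"
    and "(%om. h (Psi l (%(j, k, d). B j k d om))) \<in> borel_measurable N"
proof -
  obtain L where L: "0 <= L" "!!k a b u e. u \<in> cbox 0 1 ==> (!!x. x \<in> cbox 0 1 ==> \<bar>a x - b x\<bar> <= e) ==> \<bar>CC a k u - CC b k u\<bar> <= L * e"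
  proof (rule CC_lip, goal_cases)
    case (1 L)
    show ?case by (rule 1(1)[OF 1(2)]) (rule 1(3))
  qed
  have hL: "0 <= Kh" "\<bar>h (Psi l x)\<bar> <= Bd" "\<bar>h (Psi l x) - h (Psi l y)\<bar> <= Kh * ldist Tset Iset (Psi l x) (Psi l y)" for x y
    using h linf_Psi unfolding linf_BL_def by blast+
  let ?V' = "%om (j, k, d). B j k d om"
  let ?G = "(UNIV :: 'm set) \<times> (dgrid l :: (real^'p) set)"
  have fG: "finite ?G" by (intro finite_cartesian_product finite_dgrid) auto
  have split: "(\<Sum>r\<in>Fset l. c r * (case r of (j, k, d) => g j k d)) = (\<Sum>j\<in>{..Mb}. \<Sum>s\<in>?G. c (j, s) * g j (fst s) (snd s))" for c g
    by (subst sum.cartesian_product) (auto intro!: sum.cong)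
  have cc: "cov s s' = covc s s'" if "s \<in> ?G" "s' \<in> ?G" for s s'
    using that by (auto simp: covc_def clamp01_id[OF dgrid_cube])
  have ch: "(%n. \<integral>om. iexp (\<Sum>r\<in>Fset l. c r * Vn n om r) \<partial>M) \<longlonglongrightarrow> (\<integral>om. iexp (\<Sum>r\<in>Fset l. c r * ?V' om r) \<partial>N)" for c
  proof -
    have "(%n. \<integral>om. iexp (\<Sum>j\<in>{..Mb}. \<Sum>s\<in>?G. c (j, s) * alpha n om j (fst s) (snd s)) \<partial>M) \<longlonglongrightarrow>
      complex_of_real (exp (- (\<Sum>j\<in>{..Mb}. \<Sum>s\<in>?G. \<Sum>t\<in>?G. c (j, s) * c (j, t) * cov s t) / 2))"
      by (rule fidi_char[of "{..Mb}" "%_. ?G" "%j s. c (j, s)"]) (auto intro: fG)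
    also have "(\<Sum>j\<in>{..Mb}. \<Sum>s\<in>?G. \<Sum>t\<in>?G. c (j, s) * c (j, t) * cov s t) = (\<Sum>j\<in>{..Mb}. \<Sum>s\<in>?G. \<Sum>t\<in>?G. c (j, s) * c (j, t) * covc s t)"
      by (intro sum.cong refl) (simp only: cc)
    finally show ?thesis unfolding Vn_def split chf[of "{..Mb}" "%_. ?G" "%j s. c (j, s)", OF finite_atMost fG] .
  qed
  have lip: "\<bar>h (Psi l x) - h (Psi l y)\<bar> <= (Kh * L) * e" if "!!r. r \<in> Fset l ==> \<bar>x r - y r\<bar> <= e" "0 <= e" for x y e
  proof -
    have "ldist Tset Iset (Psi l x) (Psi l y) <= L * e"
      unfolding Psi_def by (intro ldist_proc L(2) that(1)) (auto intro: dproj_grid)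
    then have "Kh * ldist Tset Iset (Psi l x) (Psi l y) <= Kh * (L * e)" using hL(1) by (rule mult_left_mono)
    then show ?thesis using hL(3)[of x y] by (simp add: mult.assoc)
  qed
  have Vm: "(%om. Vn n om r) \<in> borel_measurable M" if "r \<in> Fset l" for n r using that alpha_meas by (auto simp: Vn_def)
  have V'm: "(%om. ?V' om r) \<in> borel_measurable N" if "r \<in> Fset l" for r using Bm by (cases r) auto
  have KL: "0 <= Kh * L" using hL(1) L(1) by simp
  note fc = fidi_conv[of M N "Fset l" Vn ?V' "Kh * L" "%x. h (Psi l x)" Bd, OF M.prob_space_axioms N finite_Fset Vm V'm ch Vn_tight KL lip hL(2)]
  show "(%n. \<integral>om. h (Psi l (Vn n om)) \<partial>M) \<longlonglongrightarrow> (\<integral>om. h (Psi l (%(j, k, d). B j k d om)) \<partial>N)"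
    by (rule fc(1))
  show "(%om. h (Psi l (Vn n om))) \<in> borel_measurable M" by (rule fc(2))
  show "(%om. h (Psi l (%(j, k, d). B j k d om))) \<in> borel_measurable N" by (rule fc(3))
qed

lemma dproj_unif:
  assumes c: "continuous_on (cbox 0 1) (g :: real^'p => real)" and e: "0 < e"
  shows "\<forall>\<^sub>F l in sequentially. \<forall>u\<in>cbox 0 1. \<bar>g (dproj l u) - g u\<bar> <= e"
proof -
  have "uniformly_continuous_on (cbox 0 1) g" by (rule compact_uniformly_continuous[OF c compact_cbox])
  then obtain d where d: "d > 0" "!!u w. u \<in> cbox 0 1 ==> w \<in> cbox 0 1 ==> dist w u < d ==> dist (g w) (g u) < e"
    unfolding uniformly_continuous_on_def using e by blast
  have "(%l. real CARD('p) * (1 / 2) ^ l) \<longlonglongrightarrow> real CARD('p) * 0" by (intro tendsto_intros) auto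
  then have "\<forall>\<^sub>F l in sequentially. real CARD('p) * (1 / 2) ^ l < d" using d(1) by (intro order_tendstoD) auto
  then show ?thesis
  proof eventually_elim
    case (elim l)
    show ?case
    proof
      fix u :: "real^'p" assume u: "u \<in> cbox 0 1"
      have "dist (dproj l u) u <= (\<Sum>i\<in>UNIV. \<bar>(dproj l u - u) $ i\<bar>)" unfolding dist_norm by (rule norm_le_l1_cart)
      also have "... <= (\<Sum>i\<in>(UNIV::'p set). (1 / 2) ^ l)"
      proof (rule sum_mono)
        show "\<bar>(dproj l u - u) $ i\<bar> <= (1 / 2) ^ l" for i using dproj_dist[of u i l] by (simp add: power_one_over abs_le_iff)
      qed
      finally have "dist (dproj l u) u < d" using elim by simp
      then show "\<bar>g (dproj l u) - g u\<bar> <= e" using d(2)[OF u] dproj_grid[OF u] dgrid_cube by (fastforce simp: dist_real_def)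
    qed
  qed
qed

text \<open>Three comparisons: the processes with their grid versions outside a small event, the
  grid versions of both sides by finite-dimensional convergence, and the grid version of the limit
  with the limit by uniform continuity of its paths. The level is fixed before \<open>n\<close>
  tends to infinity.\<close>

lemma weak_conv:
  assumes N: "prob_space N"
    and Bm: "!!j k u. B j k u \<in> borel_measurable N"
    and Bc: "!!j k om. continuous_on (cbox 0 1) (%u. B j k u om)"
    and chf: "!!J F c. finite J ==> (!!j. finite (F j)) ==>
       (\<integral>om. iexp (\<Sum>j\<in>J. \<Sum>s\<in>F j. c j s * B j (fst s) (snd s) om) \<partial>N) =
       complex_of_real (exp (- (\<Sum>j\<in>J. \<Sum>s\<in>F j. \<Sum>t\<in>F j. c j s * c j t * covc s t) / 2))"
  shows "weak_conv_linf Tset Iset M (%n om t (j, k). XX n om j k (t j k)) N (%om t (j, k). CC (%u. B j k u om) k (t j k))"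
proof -
  interpret N: prob_space N by fact
  obtain L where L: "0 <= L" "!!k a b u e. u \<in> cbox 0 1 ==> (!!x. x \<in> cbox 0 1 ==> \<bar>a x - b x\<bar> <= e) ==> \<bar>CC a k u - CC b k u\<bar> <= L * e"
  proof (rule CC_lip, goal_cases)
    case (1 L)
    show ?case by (rule 1(1)[OF 1(2)]) (rule 1(3))
  qed
  let ?Xs = "%n om t (j, k). XX n om j k (t j k)" let ?G = "%om t (j, k). CC (%u. B j k u om) k (t j k)"
  let ?V' = "%om (j, k, d). B j k d om"
  have lX: "linf Tset Iset (?Xs n om)" for n om by (intro linfI bdd_cube_XX)
  have lG: "linf Tset Iset (?G om)" for om
  proof (intro linfI bdd_cube_CC)
    fix j k
    have "bounded ((%u. B j k u om) ` cbox 0 1)" using Bc compact_cbox by (intro compact_imp_bounded compact_continuous_image)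
    then show "bdd_cube (%u. B j k u om)" by (auto simp: bounded_iff bdd_cube_def)
  qed
  have lim: "(%l. h (Psi l (?V' om))) \<longlonglongrightarrow> h (?G om)" if h: "linf_BL Tset Iset Bd Kh h" for h Bd Kh om
  proof (rule LIMSEQ_I)
    fix r :: real assume r: "0 < r"
    have Kh: "0 <= Kh" using h by (simp add: linf_BL_def)
    define e where "e = r / (2 * (Kh * L + 1))"
    have KL: "0 <= Kh * L" using Kh L(1) by simp
    have e: "0 < e" using r KL by (simp add: e_def)
    have "(Kh * L + 1) * e = r / 2" using KL by (simp add: e_def field_simps)
    then have er: "Kh * (L * e) < r" using r e by (simp add: distrib_right mult.assoc)
    have "\<forall>\<^sub>F l in sequentially. \<forall>j\<in>{..Mb}. \<forall>k\<in>UNIV. \<forall>u\<in>cbox 0 1. \<bar>B j k (dproj l u) om - B j k u om\<bar> <= e"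
      by (intro eventually_ball_finite finite_class.finite_UNIV finite_atMost ballI dproj_unif[OF Bc e])
    then have "\<forall>\<^sub>F l in sequentially. norm (h (Psi l (?V' om)) - h (?G om)) < r"
    proof eventually_elim
      case (elim l)
      have "ldist Tset Iset (Psi l (?V' om)) (?G om) <= L * e" unfolding Psi_def prod.case
        using elim by (intro ldist_proc L(2)) auto
      then have "Kh * ldist Tset Iset (Psi l (?V' om)) (?G om) <= Kh * (L * e)" using Kh by (rule mult_left_mono)
      moreover have "\<bar>h (Psi l (?V' om)) - h (?G om)\<bar> <= Kh * ldist Tset Iset (Psi l (?V' om)) (?G om)"
        using h linf_Psi lG unfolding linf_BL_def by blast
      ultimately show ?case using er by simp
    qed
    then show "\<exists>n0. \<forall>l\<ge>n0. norm (h (Psi l (?V' om)) - h (?G om)) < r" by (simp add: eventually_sequentially)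
  qed
  show ?thesis
  proof (rule weak_conv_linf_of_BL[OF M.prob_space_axioms N TI lX lG])
    fix Bd Kh h assume h: "linf_BL Tset Iset Bd Kh h"
    note fidi = fidi_Psi[OF h N Bm chf]
    \<comment> \<open>The limit functional is a pointwise limit of functions of finitely many
      coordinates, which is the source of its measurability.\<close>
    show Gm: "(%om. h (?G om)) \<in> borel_measurable N" by (rule borel_measurable_LIMSEQ_real[OF lim[OF h] fidi(3)])
    have Kh: "0 <= Kh" and Bd: "0 <= Bd" and hB: "!!f. linf Tset Iset f ==> \<bar>h f\<bar> <= Bd"
      and hK: "!!f g. linf Tset Iset f ==> linf Tset Iset g ==> \<bar>h f - h g\<bar> <= Kh * ldist Tset Iset f g"
      using h unfolding linf_BL_def by blast+
    have Nlim: "(%l. \<integral>om. h (Psi l (?V' om)) \<partial>N) \<longlonglongrightarrow> (\<integral>om. h (?G om) \<partial>N)"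
    proof (rule integral_dominated_convergence[OF Gm fidi(3)])
      show "integrable N (%_. Bd)" by simp
      show "AE om in N. (%l. h (Psi l (?V' om))) \<longlonglongrightarrow> h (?G om)" using lim[OF h] by simp
      show "AE om in N. norm (h (Psi l (?V' om))) <= Bd" for l using hB[OF linf_Psi] by simp
    qed
    show "(%n. outer_exp M (%om. h (?Xs n om))) \<longlonglongrightarrow> (\<integral>om. h (?G om) \<partial>N)"
    proof (rule LIMSEQ_I)
      fix r :: real assume r: "0 < r"
      \<comment> \<open>Together \<open>e\<close> and \<open>e'\<close> keep the outer expectation
        error within \<open>r / 4\<close>; a functional bounded by \<open>Bd\<close> can lose
        \<open>2 * Bd\<close> on the exceptional event.\<close>
      define e where "e = r / (8 * (Kh + 1))"
      define e' where "e' = r / (16 * (Bd + 1))"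
      have e: "0 < e" "0 < e'" using r Kh Bd by (auto simp: e_def e'_def)
      have "(Kh + 1) * e = r / 8" "2 * (Bd + 1) * e' = r / 8" using Kh Bd by (auto simp: e_def e'_def field_simps)
      then have er: "Kh * e + 2 * Bd * e' <= r / 4" using e by (simp add: distrib_right distrib_left)
      obtain l0 where l0: "\<forall>l\<ge>l0. \<forall>\<^sub>F n in sequentially. \<exists>E\<in>sets M. measure M E <= e' & (\<forall>om\<in>space M - E. \<forall>j\<le>Mb. \<forall>k. \<forall>u\<in>cbox 0 1.
         \<bar>XX n om j k u - CC (%x. alpha n om j k (dproj l x)) k u\<bar> <= e)" using process_approx[OF e] by blast
      have "r / 4 > 0" using r by simp
      from LIMSEQ_D[OF Nlim this] obtain l1 where l1: "!!l. l >= l1 ==> norm ((\<integral>om. h (Psi l (?V' om)) \<partial>N) - (\<integral>om. h (?G om) \<partial>N)) < r / 4" by blast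
      define l where "l = max l0 l1"
      have A1: "\<forall>\<^sub>F n in sequentially. norm ((\<integral>om. h (Psi l (Vn n om)) \<partial>M) - (\<integral>om. h (Psi l (?V' om)) \<partial>N)) < r / 4"
        using LIMSEQ_D[OF fidi(1)[of l] \<open>r / 4 > 0\<close>] by (simp add: eventually_sequentially)
      have A2: "\<forall>\<^sub>F n in sequentially. \<exists>E\<in>sets M. measure M E <= e' & (\<forall>om\<in>space M - E. \<forall>j\<le>Mb. \<forall>k. \<forall>u\<in>cbox 0 1.
         \<bar>XX n om j k u - CC (%x. alpha n om j k (dproj l x)) k u\<bar> <= e)" using l0 by (simp add: l_def)
      have "\<forall>\<^sub>F n in sequentially. norm (outer_exp M (%om. h (?Xs n om)) - (\<integral>om. h (?G om) \<partial>N)) < r"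
        using A1 A2
      proof eventually_elim
        case (elim n)
        then obtain E where E: "E \<in> sets M" "measure M E <= e'" and Ew: "!!om j k u. om \<in> space M - E ==> j <= Mb ==> u \<in> cbox 0 1 ==>
          \<bar>XX n om j k u - CC (%x. alpha n om j k (dproj l x)) k u\<bar> <= e" by blast
        have "\<bar>outer_exp M (%om. h (?Xs n om)) - (\<integral>om. h (Psi l (Vn n om)) \<partial>M)\<bar> <= Kh * e + 2 * Bd * measure M E"
        proof (rule outer_exp_approx[OF M.prob_space_axioms fidi(2) _ E(1)])
          show "integrable M (%om. h (Psi l (Vn n om)))"
            by (rule M.integrable_const_bound[of _ Bd, OF _ fidi(2)]) (simp add: hB[OF linf_Psi])
          fix om assume w: "om \<in> space M"
          show "\<bar>h (?Xs n om) - h (Psi l (Vn n om))\<bar> <= Kh * e + 2 * Bd * indicator E om"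
          proof (cases "om \<in> E")
            case True
            have "0 <= Kh * e" using Kh e by simp
            then show ?thesis using hB[OF lX[of n om]] hB[OF linf_Psi[of l "Vn n om"]] True by simp
          next
            case False
            have "ldist Tset Iset (?Xs n om) (Psi l (Vn n om)) <= e"
              unfolding Psi_def Vn_def prod.case using w False by (intro ldist_proc Ew) auto
            then have "Kh * ldist Tset Iset (?Xs n om) (Psi l (Vn n om)) <= Kh * e" using Kh by (rule mult_left_mono)
            then show ?thesis using hK[OF lX[of n om] linf_Psi[of l "Vn n om"]] False by simp
          qed
        qed (use Bd in auto)
        also have "... <= Kh * e + 2 * Bd * e'" using E(2) Bd by (intro add_left_mono mult_left_mono) auto
        also note er
        finally have "\<bar>outer_exp M (%om. h (?Xs n om)) - (\<integral>om. h (Psi l (Vn n om)) \<partial>M)\<bar> <= r / 4" .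
        moreover have "norm ((\<integral>om. h (Psi l (?V' om)) \<partial>N) - (\<integral>om. h (?G om) \<partial>N)) < r / 4" by (rule l1) (simp add: l_def)
        ultimately show ?case using elim(1) r unfolding real_norm_def by linarith
      qed
      then show "\<exists>n0. \<forall>n\<ge>n0. norm (outer_exp M (%om. h (?Xs n om)) - (\<integral>om. h (?G om) \<partial>N)) < r" by (simp add: eventually_sequentially)
    qed
  qed
qed

end

theorem theorem6:
  fixes M :: "'a measure"
    and X :: "'a \<Rightarrow> real^'p" and Z :: "'a \<Rightarrow> real^'q"
    and Xs :: "nat \<Rightarrow> 'a \<Rightarrow> real^'p" and Zs :: "nat \<Rightarrow> 'a \<Rightarrow> real^'q"
    and A :: "'m::finite \<Rightarrow> (real^'q) set"
    and W :: "nat \<Rightarrow> nat \<Rightarrow> nat \<Rightarrow> 'a \<Rightarrow> real"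
    and Mb :: nat
  assumes P: "prob_space M"
    and XZ_rv: "(\<lambda>\<omega>. (X \<omega>, Z \<omega>)) \<in> borel_measurable M"
    and iid_indep: "prob_space.indep_vars M (\<lambda>_. borel) (\<lambda>i \<omega>. (Xs i \<omega>, Zs i \<omega>)) UNIV"
    and iid_dist: "\<And>i. distr M borel (\<lambda>\<omega>. (Xs i \<omega>, Zs i \<omega>)) = distr M borel (\<lambda>\<omega>. (X \<omega>, Z \<omega>))"
    and A_borel: "\<And>k. A k \<in> sets borel"
    and A_pos: "\<And>k. pA M Z (A k) > 0"
    and margins_cont: "\<And>k j t. isCont (\<lambda>s. condF M X Z j s (A k)) t"
    and condC: "\<And>k. condC M X Z (A k)"
    and Mb: "Mb \<ge> 2"
    and W_exch: "\<And>j. j \<in> {1..Mb} \<Longrightarrow> exch_weights M (W j)"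
    and W_same_law: "\<And>j n. j \<in> {1..Mb} \<Longrightarrow>
          distr M (PiM {..<n} (\<lambda>_. borel)) (\<lambda>\<omega>. restrict (\<lambda>i. W j n i \<omega>) {..<n})
        = distr M (PiM {..<n} (\<lambda>_. borel)) (\<lambda>\<omega>. restrict (\<lambda>i. W 1 n i \<omega>) {..<n})"
    and W_indep: "\<And>n. prob_space.indep_vars M (\<lambda>_. PiM {..<n} (\<lambda>_. borel))
          (\<lambda>j \<omega>. restrict (\<lambda>i. W j n i \<omega>) {..<n}) {1..Mb}"
    and W_sample_indep: "\<And>n. prob_space.indep_set M
          (sets (vimage_algebra (space M) (\<lambda>\<omega>. \<lambda>i. (Xs i \<omega>, Zs i \<omega>)) (PiM UNIV (\<lambda>_. borel))))
          (sets (vimage_algebra (space M)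
             (\<lambda>\<omega>. restrict (\<lambda>j. restrict (\<lambda>i. W j n i \<omega>) {..<n}) {1..Mb})
             (PiM {1..Mb} (\<lambda>_. PiM {..<n} (\<lambda>_. borel)))))"
    and condW: "\<And>j. j \<in> {1..Mb} \<Longrightarrow> condW M (W j)"
  shows "\<exists>(N :: real measure) (B :: nat \<Rightarrow> 'm \<Rightarrow> real^'p \<Rightarrow> real \<Rightarrow> real).
    prob_space N \<and>
    (\<forall>j\<le>Mb. gaussian_family N UNIV (\<lambda>(k, u) \<omega>. B j k u \<omega>)
               (\<lambda>(k, u) (k', v). covB M X Z (A k) u (A k') v)) \<and>
    prob_space.indep_vars N (\<lambda>_. PiM UNIV (\<lambda>_. borel)) (\<lambda>j \<omega>. \<lambda>(k, u). B j k u \<omega>) {0..Mb} \<and>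
    weak_conv_linf
      {t :: nat \<Rightarrow> 'm \<Rightarrow> real^'p. \<forall>j k. (j \<le> Mb \<longrightarrow> t j k \<in> cbox 0 1) \<and> (Mb < j \<longrightarrow> t j k = 0)}
      ({0..Mb} \<times> UNIV)
      M
      (\<lambda>n \<omega> t (j, k). if j = 0
          then Cbar M X Z n (\<lambda>i. Xs i \<omega>) (\<lambda>i. Zs i \<omega>) (t 0 k) (A k)
          else Ctilde n (\<lambda>i. Xs i \<omega>) (\<lambda>i. Zs i \<omega>) (\<lambda>i. W j n i \<omega>) (t j k) (A k))
      N
      (\<lambda>\<omega> t (j, k). Cinf M X Z (\<lambda>u. B j k u \<omega>) (t j k) (A k))"
proof -
  interpret M: prob_space M by fact
  have cm: "cond_margins M X Z (A k)" for k
    using P XZ_rv A_borel A_pos margins_cont by (intro cond_margins.intro cond_margins_axioms.intro)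
  interpret cb: copula_boot M X Z Xs Zs A W Mb
    by (intro copula_boot.intro copula_boot_axioms.intro P cm iid_indep iid_dist condC W_exch W_indep W_sample_indep condW)
  obtain N :: "real measure" and B :: "nat => 'm => real^'p => real => real" where N: "prob_space N"
    and Bm: "!!j k u. B j k u \<in> borel_measurable N"
    and Bc: "!!j k om. continuous_on (cbox 0 1) (%u. B j k u om)"
    and chf: "!!J F c. finite J ==> (!!j. finite (F j)) ==>
       (\<integral>om. iexp (\<Sum>j\<in>J. \<Sum>s\<in>F j. c j s * B j (fst s) (snd s) om) \<partial>N) =
       complex_of_real (exp (- (\<Sum>j\<in>J. \<Sum>s\<in>F j. \<Sum>t\<in>F j. c j s * c j t * cb.covc s t) / 2))"
    and ind: "prob_space.indep_vars N (%_. PiM UNIV (%_. borel)) (%j om. %(k, u). B j k u om) UNIV"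
  proof (rule cb.gaussian_copies, goal_cases)
    case (1 N B)
    show ?case by (rule 1(1)[OF 1(2-4) _ 1(6)]) (rule 1(5))
  qed
  interpret N: prob_space N by fact
  have gf: "gaussian_family N UNIV (%(k, u) om. B j k u om) (%(k, u) (k', v). covB M X Z (A k) u (A k') v)" for j
    unfolding gaussian_family_def
  proof (intro allI impI conjI)
    fix F and c :: "'m \<times> (real^'p) => real" assume F: "finite F & F \<subseteq> (UNIV :: ('m \<times> (real^'p)) set)"
    let ?Y = "%om. \<Sum>s\<in>F. c s * (case s of (k, u) => %om. B j k u om) om"
    have Y: "?Y = (%om. \<Sum>s\<in>F. c s * B j (fst s) (snd s) om)" by (intro ext sum.cong) (auto simp: case_prod_beta)
    show Ym: "?Y \<in> borel_measurable N" unfolding Y using Bm by measurable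
    fix \<theta> :: real
    have "char (distr N borel ?Y) \<theta> = (\<integral>om. iexp (\<theta> * ?Y om) \<partial>N)" unfolding char_def using Ym by (subst integral_distr) auto
    \<comment> \<open>A single slot with all coefficients scaled by \<open>\<theta>\<close>: the
      joint characteristic function of the copies contains that of every linear combination within
      one copy.\<close>
    also have "... = (\<integral>om. iexp (\<Sum>j\<in>{j}. \<Sum>s\<in>F. \<theta> * c s * B j (fst s) (snd s) om) \<partial>N)"
      by (simp add: sum_distrib_left mult.assoc case_prod_unfold)
    also have "... = complex_of_real (exp (- (\<Sum>s\<in>F. \<Sum>t\<in>F. (\<theta> * c s) * (\<theta> * c t) * cb.covc s t) / 2))"
      using chf[of "{j}" "%_. F" "%_ s. \<theta> * c s"] F by simp
    also have "(\<Sum>s\<in>F. \<Sum>t\<in>F. (\<theta> * c s) * (\<theta> * c t) * cb.covc s t) = \<theta>\<^sup>2 * (\<Sum>s\<in>F. \<Sum>t\<in>F. c s * c t * cb.covc s t)"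
      by (simp add: sum_distrib_left power2_eq_square mult_ac)
    also have "(\<Sum>s\<in>F. \<Sum>t\<in>F. c s * c t * cb.covc s t) = (\<Sum>s\<in>F. \<Sum>t\<in>F. c s * c t * (case s of (k, u) => %(k', v). covB M X Z (A k) u (A k') v) t)"
      by (intro sum.cong refl) (auto simp: cb.covc_eq)
    finally show "char (distr N borel ?Y) \<theta> = complex_of_real (exp (- (\<theta>\<^sup>2 * (\<Sum>s\<in>F. \<Sum>t\<in>F. c s * c t * (case s of (k, u) => %(k', v). covB M X Z (A k) u (A k') v) t)) / 2))" .
  qed
  have wc: "weak_conv_linf cb.Tset cb.Iset M (%n om t (j, k). cb.XX n om j k (t j k)) N (%om t (j, k). cb.CC (%u. B j k u om) k (t j k))"
    by (rule cb.weak_conv[OF N Bm Bc chf])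
  have X: "(%n om t (j, k). cb.XX n om j k (t j k)) = (%n om t (j, k). if j = 0
          then Cbar M X Z n (%i. Xs i om) (%i. Zs i om) (t 0 k) (A k)
          else Ctilde n (%i. Xs i om) (%i. Zs i om) (%i. W j n i om) (t j k) (A k))"
    by (auto simp: fun_eq_iff cb.XX_def)
  show ?thesis
    using wc unfolding X cb.CC_def cb.Tset_def
    by (intro exI[of _ N] exI[of _ B] conjI N allI impI gf N.indep_vars_subset[OF ind]) auto
qed

end
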